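(* Let $B$ be the unit ball in $\mathbb R^2$ centered at the origin. Let $(b_m,u_m)\in L_2(B)\times L_\infty(B)$ be a sequence such that each $b_m$ is a divergence-free vector field and $u_m$ is a distributional solution of $-\Delta u_m+b_m\cdot\nabla u_m=0$ in $B$. Assume that the $u_m$ are uniformly bounded in $B$ and that $$b_m\to b\ \text{ in } L_1(B),\qquad u_m\overset{\star}{\rightharpoonup}u\ \text{ in } L_\infty(B).$$ Then $u$ is a distributional solution of $-\Delta u+b\cdot\nabla u=0$ in $B$. Moreover, $u\in H^1_{\rm loc}(B)\cap C_{\rm loc}(B)$, and at the origin $u$ has the modulus of continuity $$\sup_{x\in B(0,r)}|u(x)-u(0)|\le\frac{C\left(1+\|b\|_{L_1(B)}\right)^{1/2}}{\sqrt{-\log r}}\,\|u\|_{L_\infty(B)}\qquad (0<r<1)$$ with a universal constant $C>0$.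
   Context: $B(0,r)$ is the ball of radius $r$ centered at the origin. For a vector field $b\in L_1(B)$ and $u\in L_\infty(B)$, $b$ is divergence-free and $u$ is a distributional solution of $-\Delta u+b\cdot\nabla u=0$ in $B$ if $$\int_B b\cdot\nabla v\,dx=0=\int_B(u\Delta v+u\,b\cdot\nabla v)\,dx\qquad\text{for all } v\in C_0^\infty(B).$$ $C_{\rm loc}(B)$ denotes continuous functions on $B$; $u\in C_{\rm loc}(B)$ means that $u$ has a continuous representative, which is the one used in the pointwise estimate. $\overset{\star}{\rightharpoonup}$ denotes weak-star convergence. *)

theory Defs
  imports "HOL-Analysis.Analysis" "HOL-Probability.Essential_Supremum"
begin

text \<open>
  Elements of the function spaces below are represented by total functions on the ambient
  Euclidean space. Only their restriction to the domain matters, and only up to null sets,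
  because every space, norm and integral refers to \<^term>\<open>lebesgue_on B\<close>.
\<close>

subsection \<open>Lebesgue spaces\<close>

definition L1_space :: "'a::euclidean_space set \<Rightarrow> ('a \<Rightarrow> 'b::euclidean_space) set" where
  "L1_space B = {f. integrable (lebesgue_on B) f}"

definition L1_norm :: "'a::euclidean_space set \<Rightarrow> ('a \<Rightarrow> 'b::euclidean_space) \<Rightarrow> real" where
  "L1_norm B f = (LINT x|lebesgue_on B. norm (f x))"

definition L1_converges ::
    "'a::euclidean_space set \<Rightarrow> (nat \<Rightarrow> 'a \<Rightarrow> 'b::euclidean_space) \<Rightarrow> ('a \<Rightarrow> 'b) \<Rightarrow> bool" where
  "L1_converges B bs b \<longleftrightarrow>
     (\<forall>m. bs m \<in> L1_space B) \<and> b \<in> L1_space B \<and>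
     (\<lambda>m. L1_norm B (\<lambda>x. bs m x - b x)) \<longlonglongrightarrow> 0"

definition L2_space :: "'a::euclidean_space set \<Rightarrow> ('a \<Rightarrow> 'b::euclidean_space) set" where
  "L2_space B = {f \<in> borel_measurable (lebesgue_on B).
     integrable (lebesgue_on B) (\<lambda>x. (norm (f x))\<^sup>2)}"

definition Linf_space :: "'a::euclidean_space set \<Rightarrow> ('a \<Rightarrow> real) set" where
  "Linf_space B = {u \<in> borel_measurable (lebesgue_on B).
     esssup (lebesgue_on B) (\<lambda>x. ereal \<bar>u x\<bar>) < \<infinity>}"

definition Linf_norm :: "'a::euclidean_space set \<Rightarrow> ('a \<Rightarrow> real) \<Rightarrow> real" where
  "Linf_norm B u = real_of_ereal (esssup (lebesgue_on B) (\<lambda>x. ereal \<bar>u x\<bar>))"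

text \<open>Weak-star convergence, with \<open>L\<^sub>\<infinity>\<close> regarded as the dual of \<open>L\<^sub>1\<close>.\<close>

definition Linf_weak_star_converges ::
    "'a::euclidean_space set \<Rightarrow> (nat \<Rightarrow> 'a \<Rightarrow> real) \<Rightarrow> ('a \<Rightarrow> real) \<Rightarrow> bool" where
  "Linf_weak_star_converges B us u \<longleftrightarrow>
     (\<forall>m. us m \<in> Linf_space B) \<and> u \<in> Linf_space B \<and>
     (\<forall>\<phi>\<in>L1_space B. (\<lambda>m. LINT x|lebesgue_on B. us m x * \<phi> x)
        \<longlonglongrightarrow> (LINT x|lebesgue_on B. u x * \<phi> x))"

subsection \<open>Test functions and classical differential operators\<close>

definition partial_deriv ::
    "'a::euclidean_space \<Rightarrow> ('a \<Rightarrow> real) \<Rightarrow> 'a \<Rightarrow> real" where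
  "partial_deriv i f x = frechet_derivative f (at x) i"

definition grad :: "('a::euclidean_space \<Rightarrow> real) \<Rightarrow> 'a \<Rightarrow> 'a" where
  "grad f x = (\<Sum>i\<in>Basis. partial_deriv i f x *\<^sub>R i)"

definition laplacian :: "('a::euclidean_space \<Rightarrow> real) \<Rightarrow> 'a \<Rightarrow> real" where
  "laplacian f x = (\<Sum>i\<in>Basis. partial_deriv i (partial_deriv i f) x)"

text \<open>
  \<open>C_k k f\<close>: \<open>f\<close> is \<open>k\<close> times continuously differentiable on the whole space. Differentiability
  is required explicitly since \<^const>\<open>frechet_derivative\<close> is unspecified without it.
\<close>

primrec C_k :: "nat \<Rightarrow> ('a::euclidean_space \<Rightarrow> real) \<Rightarrow> bool" where
  "C_k 0 f = continuous_on UNIV f"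
| "C_k (Suc k) f =
     ((\<forall>x. f differentiable (at x)) \<and> (\<forall>i\<in>Basis. C_k k (partial_deriv i f)))"

text \<open>\<open>C\<^sub>0\<^sup>\<infinity>(B)\<close>, its elements being extended by zero outside \<open>B\<close>.\<close>

definition test_functions :: "'a::euclidean_space set \<Rightarrow> ('a \<Rightarrow> real) set" where
  "test_functions B = {v. (\<forall>k. C_k k v) \<and>
     compact (closure {x. v x \<noteq> 0}) \<and> closure {x. v x \<noteq> 0} \<subseteq> B}"

subsection \<open>The drift-diffusion equation\<close>

definition divergence_free ::
    "'a::euclidean_space set \<Rightarrow> ('a \<Rightarrow> 'a) \<Rightarrow> bool" where
  "divergence_free B b \<longleftrightarrow> b \<in> L1_space B \<and>
     (\<forall>v\<in>test_functions B. (LINT x|lebesgue_on B. b x \<bullet> grad v x) = 0)"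

definition distributional_solution ::
    "'a::euclidean_space set \<Rightarrow> ('a \<Rightarrow> 'a) \<Rightarrow> ('a \<Rightarrow> real) \<Rightarrow> bool" where
  "distributional_solution B b u \<longleftrightarrow> b \<in> L1_space B \<and> u \<in> Linf_space B \<and>
     (\<forall>v\<in>test_functions B.
        (LINT x|lebesgue_on B. u x * laplacian v x + u x * (b x \<bullet> grad v x)) = 0)"

subsection \<open>Sobolev spaces and continuous representatives\<close>

definition H1_space :: "'a::euclidean_space set \<Rightarrow> ('a \<Rightarrow> real) set" where
  "H1_space D = {u \<in> L2_space D. \<exists>g::'a \<Rightarrow> 'a. g \<in> L2_space D \<and>
     (\<forall>\<phi>\<in>test_functions D. \<forall>i\<in>Basis.
        (LINT x|lebesgue_on D. u x * partial_deriv i \<phi> x) =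
        - (LINT x|lebesgue_on D. (g x \<bullet> i) * \<phi> x))}"

definition H1_loc :: "'a::euclidean_space set \<Rightarrow> ('a \<Rightarrow> real) set" where
  "H1_loc B = {u. \<forall>D. open D \<and> compact (closure D) \<and> closure D \<subseteq> B \<longrightarrow> u \<in> H1_space D}"

definition continuous_representative ::
    "'a::euclidean_space set \<Rightarrow> ('a \<Rightarrow> real) \<Rightarrow> ('a \<Rightarrow> real) \<Rightarrow> bool" where
  "continuous_representative B u w \<longleftrightarrow>
     continuous_on B w \<and> (AE x in lebesgue_on B. w x = u x)"

end

theory Submission
  imports Defs
begin

text \<open>
  Mollifying \<open>u\<^sub>m\<close> and \<open>b\<^sub>m\<close> gives smooth \<open>v\<close> and divergence-free \<open>\<beta>\<close> with
  \<open>\<Delta>v = div (v \<beta> + r)\<close>, where the commutator \<open>r\<close> is small in \<open>L\<^sub>2\<close> because \<open>b\<^sub>m \<in> L\<^sub>2\<close>.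
  As \<open>\<beta>\<close> is divergence-free, testing with \<open>v \<zeta>\<close> bounds \<open>\<integral>|\<nabla>v|\<^sup>2 \<zeta>\<close> by
  \<open>C \<integral>v\<^sup>2 (1 + |\<beta>|)\<close>, which involves only the \<open>L\<^sub>1\<close> norm of the drift; testing with
  \<open>((v - k)\<^sub>+)\<^sup>2\<close> on a square yields the maximum principle up to an error small in \<open>L\<^sub>2\<close>.
  By Fubini and Cauchy-Schwarz some concentric square has a boundary on which \<open>v\<close> oscillates
  by at most \<open>C (\<integral>|\<nabla>v|\<^sup>2 / log (R/r))\<^sup>1\<^sup>/\<^sup>2\<close> (Courant and Lebesgue), so the oscillation of the
  limit inside is bounded by the same quantity. The gradient bound makes \<open>v\<close> converge to \<open>u\<close>
  in \<open>L\<^sub>1\<close>, which replaces \<open>sup |u\<^sub>m|\<close> by \<open>\<parallel>u\<parallel>\<close> in the energy bound.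
\<close>

subsection \<open>Continuously differentiable functions\<close>

text \<open>Every estimate is therefore made on smooth functions, and its constants may contain only
  quantities that survive the limit. The scale at which the remainder \<open>r\<close> becomes small
  depends on \<open>m\<close>, so each \<open>m\<close> receives its own mollifier and one diagonal
  sequence carries all the arguments. Because of the remainder the maximum principle is not
  pointwise: the excess over the boundary values is bounded in \<open>L2\<close> by a root of the
  scale, which is enough since only a.e. bounds on the limit are wanted. The logarithm arises as
  follows. On a side of length \<open>2 * \<rho>\<close>, Cauchy-Schwarz costs the factor
  \<open>\<rho>\<close>; the energies of the sides, integrated over \<open>\<rho>\<close>, are
  bounded, so for some \<open>\<rho>\<close> the energy is at most a constant over
  \<open>\<rho> * ln (R / r)\<close> and the two factors cancel. In the plane the boundary of a
  square is a curve, which is what makes this work. Squares take the place of circles so that Fubini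
  in Cartesian coordinates suffices and paths along the boundary are segments. The root of
  \<open>1 + norm b\<close> in the modulus is the root of the energy.\<close>

definition has_grad :: "('a::euclidean_space \<Rightarrow> real) \<Rightarrow> ('a \<Rightarrow> 'a) \<Rightarrow> bool" where
  "has_grad f g \<longleftrightarrow> (\<forall>x. (f has_derivative (\<lambda>h. g x \<bullet> h)) (at x)) \<and> continuous_on UNIV g"

lemma has_grad_continuous: "has_grad f g \<Longrightarrow> continuous_on UNIV f"
  unfolding has_grad_def
  by (meson continuous_at_imp_continuous_on has_derivative_continuous)

lemma has_grad_continuous_grad: "has_grad f g \<Longrightarrow> continuous_on UNIV g"
  by (simp add: has_grad_def)

lemma has_grad_derivative: "has_grad f g \<Longrightarrow> (f has_derivative (\<lambda>h. g x \<bullet> h)) (at x)"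
  by (simp add: has_grad_def)

lemma has_grad_borel:
  assumes "has_grad f g"
  shows "f \<in> borel_measurable borel" "g \<in> borel_measurable borel"
  using assms has_grad_continuous has_grad_continuous_grad borel_measurable_continuous_onI by blast+

lemma has_grad_mult:
  assumes "has_grad f g" "has_grad f' g'"
  shows "has_grad (\<lambda>x. f x * f' x) (\<lambda>x. f x *\<^sub>R g' x + f' x *\<^sub>R g x)"
proof -
  have "((\<lambda>x. f x * f' x) has_derivative (\<lambda>h. (f x *\<^sub>R g' x + f' x *\<^sub>R g x) \<bullet> h)) (at x)" for x
    by (rule has_derivative_eq_rhs[OF has_derivative_mult[OF has_grad_derivative[OF assms(1)] has_grad_derivative[OF assms(2)]]])
       (auto simp: inner_add_left algebra_simps)
  moreover have "continuous_on UNIV (\<lambda>x. f x *\<^sub>R g' x + f' x *\<^sub>R g x)"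
    using assms by (intro continuous_intros has_grad_continuous has_grad_continuous_grad)
  ultimately show ?thesis by (simp add: has_grad_def)
qed

lemma has_grad_compose:
  assumes "has_grad f g" "\<And>t. (p has_real_derivative p' t) (at t)" "continuous_on UNIV p'"
  shows "has_grad (\<lambda>x. p (f x)) (\<lambda>x. p' (f x) *\<^sub>R g x)"
proof -
  have "((\<lambda>x. p (f x)) has_derivative (\<lambda>h. (p' (f x) *\<^sub>R g x) \<bullet> h)) (at x)" for x
    by (rule has_derivative_eq_rhs[OF has_derivative_compose[OF has_grad_derivative[OF assms(1)]
          assms(2)[unfolded has_field_derivative_def]]]) auto
  moreover have "continuous_on UNIV (\<lambda>x. p' (f x) *\<^sub>R g x)"
    using assms(1,3) by (intro continuous_intros continuous_on_compose2[OF assms(3)] has_grad_continuous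
        has_grad_continuous_grad) auto
  ultimately show ?thesis by (simp add: has_grad_def)
qed

lemma has_grad_const: "has_grad (\<lambda>x. c) (\<lambda>x. 0)"
  by (simp add: has_grad_def)

lemma has_grad_inner: "has_grad (\<lambda>x. x \<bullet> i) (\<lambda>x. i)"
  by (auto simp: has_grad_def inner_commute intro!: derivative_eq_intros)

lemma has_grad_add:
  assumes "has_grad f g" "has_grad f' g'"
  shows "has_grad (\<lambda>x. f x + f' x) (\<lambda>x. g x + g' x)"
  using assms by (auto simp: has_grad_def inner_add_left intro!: derivative_intros continuous_intros)

lemma has_grad_cmult:
  assumes "has_grad f g"
  shows "has_grad (\<lambda>x. c * f x) (\<lambda>x. c *\<^sub>R g x)"
  using has_grad_mult[OF has_grad_const[of c] assms] by simp

lemma has_grad_eq_zero: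
  assumes "has_grad f g" "open U" "\<And>x. x \<in> U \<Longrightarrow> f x = 0" "x \<in> U"
  shows "g x = 0"
proof -
  have "(f has_derivative (\<lambda>h. 0)) (at x)"
    by (rule has_derivative_transform_within_open[where f="\<lambda>x. 0" and s=U]) (use assms in auto)
  with has_grad_derivative[OF assms(1), of x] have "(\<lambda>h. g x \<bullet> h) = (\<lambda>h. 0)"
    by (rule has_derivative_unique)
  then show ?thesis by (metis inner_eq_zero_iff)
qed

text \<open>The sets \<open>Q\<close> and \<open>- K\<close> are open and cover the space, and on
  their overlap \<open>f\<close> and hence its gradient vanish, so the two local formulas glue. This
  turns truncations of \<open>v\<close> inside a square into admissible test functions.\<close>

lemma has_grad_restrict:
  assumes "has_grad f g" "open Q" "closed K" "K \<subseteq> Q" "\<And>x. x \<in> Q - K \<Longrightarrow> f x = 0"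
  shows "has_grad (\<lambda>x. if x \<in> Q then f x else 0) (\<lambda>x. if x \<in> Q then g x else 0)"
proof -
  have U: "open (- K)" using assms by auto
  have g0: "g x = 0" if "x \<in> Q - K" for x
    by (rule has_grad_eq_zero[OF assms(1), of "Q - K"]) (use assms that in auto)
  have "((\<lambda>x. if x \<in> Q then f x else 0) has_derivative (\<lambda>h. (if x \<in> Q then g x else 0) \<bullet> h)) (at x)" for x
  proof (cases "x \<in> Q")
    case True
    show ?thesis
      by (rule has_derivative_transform_within_open[where f=f and s=Q])
         (use True assms(2) has_grad_derivative[OF assms(1)] in auto)
  next
    case False
    show ?thesis
      by (rule has_derivative_transform_within_open[where f="\<lambda>x. 0" and s="-K"])
         (use False U assms in auto)
  qed
  moreover have "continuous_on UNIV (\<lambda>x. if x \<in> Q then g x else 0)"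
  proof -
    have "continuous_on (Q \<union> - K) (\<lambda>x. if x \<in> Q then g x else 0)"
    proof (rule continuous_on_open_Un)
      show "continuous_on Q (\<lambda>x. if x \<in> Q then g x else 0)"
        by (rule continuous_on_eq[where f=g])
           (use has_grad_continuous_grad[OF assms(1)] continuous_on_subset in auto)
      show "continuous_on (- K) (\<lambda>x. if x \<in> Q then g x else 0)"
        by (rule continuous_on_eq[where f="\<lambda>x. 0"]) (use g0 in auto)
    qed (use assms U in auto)
    moreover have "Q \<union> - K = UNIV" using assms by auto
    ultimately show ?thesis by simp
  qed
  ultimately show ?thesis by (simp add: has_grad_def)
qed

text \<open>The derivative is linear, hence determined by the partial derivatives; these are
  continuous by the base case of \<open>C_k\<close> or because they are differentiable. Bridge from
  the iterated partial derivatives of test functions to \<open>has_grad\<close>.\<close>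

lemma has_grad_C_k:
  assumes "C_k (Suc k) f"
  shows "has_grad f (grad f)"
proof -
  have d: "f differentiable (at x)" for x using assms by simp
  have c: "continuous_on UNIV (partial_deriv i f)" if "i \<in> Basis" for i
    using assms that
  proof (induction k)
    case 0 then show ?case by simp
  next
    case (Suc k)
    then have "C_k (Suc k) (partial_deriv i f)" by simp
    then have "\<forall>x. partial_deriv i f differentiable (at x)" by simp
    then show ?case
      by (simp add: continuous_at_imp_continuous_on differentiable_imp_continuous_within)
  qed
  have "frechet_derivative f (at x) h = grad f x \<bullet> h" for x h
  proof -
    have bl: "linear (frechet_derivative f (at x))"
      using d linear_frechet_derivative by blast
    have "frechet_derivative f (at x) h = frechet_derivative f (at x) (\<Sum>i\<in>Basis. (h \<bullet> i) *\<^sub>R i)"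
      by (simp add: euclidean_representation)
    also have "\<dots> = (\<Sum>i\<in>Basis. (h \<bullet> i) * frechet_derivative f (at x) i)"
      using bl by (simp add: linear_sum linear_cmul)
    also have "\<dots> = grad f x \<bullet> h"
      by (simp add: grad_def partial_deriv_def inner_sum_left inner_commute[of h] mult.commute)
    finally show ?thesis .
  qed
  then have "(\<lambda>h. grad f x \<bullet> h) = frechet_derivative f (at x)" for x by (metis ext)
  then have "(f has_derivative (\<lambda>h. grad f x \<bullet> h)) (at x)" for x
    using d frechet_derivative_works[of f "at x"] by simp
  moreover have "continuous_on UNIV (grad f)"
    unfolding grad_def by (intro continuous_intros c)
  ultimately show ?thesis by (simp add: has_grad_def)
qed

lemma partial_deriv_has_grad:
  assumes "has_grad f g"
  shows "partial_deriv i f x = g x \<bullet> i"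
  unfolding partial_deriv_def using frechet_derivative_at[OF has_grad_derivative[OF assms], of x] by metis

lemma has_grad_reflect:
  assumes "has_grad f g"
  shows "has_grad (\<lambda>y. f (x - y)) (\<lambda>y. - g (x - y))"
  unfolding has_grad_def
proof (intro conjI allI)
  show "((\<lambda>y. f (x - y)) has_derivative (\<lambda>h. - g (x - y) \<bullet> h)) (at y)" for y
    by (rule has_derivative_eq_rhs[OF has_derivative_compose[where g=f and f="\<lambda>y. x - y" and f'="\<lambda>h. - h"]])
       (auto intro!: derivative_eq_intros has_grad_derivative[OF assms] simp: inner_diff_right)
  show "continuous_on UNIV (\<lambda>y. - g (x - y))"
    by (auto intro!: continuous_intros continuous_on_compose2[OF has_grad_continuous_grad[OF assms]])
qed

lemma has_grad_grad: "has_grad f g \<Longrightarrow> grad f = g"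
  by (simp add: fun_eq_iff grad_def partial_deriv_has_grad euclidean_representation)

text \<open>Compact support is encoded from here on as vanishing where \<open>r < norm x\<close>,
  which avoids closures of supports in the later estimates.\<close>

lemma integrable_continuous_bounded_support:
  fixes f :: "'a::euclidean_space \<Rightarrow> 'b::euclidean_space"
  assumes "continuous_on UNIV f" "\<And>x. r < norm x \<Longrightarrow> f x = 0"
  shows "integrable lborel f"
proof -
  have "integrable lborel (\<lambda>x. indicator (cball 0 r) x *\<^sub>R f x)"
    by (rule borel_integrable_compact[OF compact_cball continuous_on_subset[OF assms(1)]]) simp
  moreover have "(\<lambda>x. indicator (cball 0 r) x *\<^sub>R f x) = f"
    using assms by (auto simp: indicator_def fun_eq_iff not_le)
  ultimately show ?thesis by simp
qed

lemma bounded_continuous_bounded_support: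
  fixes f :: "'a::euclidean_space \<Rightarrow> 'b::real_normed_vector"
  assumes "continuous_on UNIV f" "\<And>x. r < norm x \<Longrightarrow> f x = 0"
  obtains B where "B \<ge> 0" "\<And>x. norm (f x) \<le> B"
proof -
  have "compact (f ` cball 0 r)"
    by (intro compact_continuous_image continuous_on_subset[OF assms(1)]) auto
  then obtain B where B: "\<And>y. y \<in> f ` cball 0 r \<Longrightarrow> norm y \<le> B"
    using compact_imp_bounded bounded_iff by metis
  have "norm (f x) \<le> max B 0" for x
  proof (cases "norm x \<le> r")
    case True then show ?thesis using B[of "f x"] by auto
  next
    case False then show ?thesis using assms(2)[of x] by auto
  qed
  then show ?thesis using that[of "max B 0"] by auto
qed

lemma has_grad_zero_outside:
  fixes f :: "'a::euclidean_space \<Rightarrow> real"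
  assumes "has_grad f g" "\<And>x. r < norm x \<Longrightarrow> f x = 0" "r < norm x"
  shows "g x = 0"
proof (rule has_grad_eq_zero[OF assms(1), of "- cball 0 r"])
qed (use assms in auto)

lemma lborel_integral_translate:
  fixes f :: "'a::euclidean_space \<Rightarrow> 'b::euclidean_space"
  assumes "f \<in> borel_measurable borel"
  shows "(\<integral>x. f (c + x) \<partial>lborel) = (\<integral>x. f x \<partial>lborel)"
    and "integrable lborel f \<Longrightarrow> integrable lborel (\<lambda>x. f (c + x))"
proof -
  have "(\<integral>x. f x \<partial>distr lborel borel ((+) c)) = (\<integral>x. f (c + x) \<partial>lborel)"
    by (rule integral_distr) (use assms in auto)
  then show "(\<integral>x. f (c + x) \<partial>lborel) = (\<integral>x. f x \<partial>lborel)"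
    by (simp add: lborel_distr_plus)
  show "integrable lborel (\<lambda>x. f (c + x))" if "integrable lborel f"
    using integrable_distr_eq[of "(+) c" lborel borel f] assms that by (simp add: lborel_distr_plus)
qed

lemma nn_integral_lborel_translate:
  fixes f :: "'a::euclidean_space \<Rightarrow> ennreal"
  assumes "f \<in> borel_measurable borel"
  shows "(\<integral>\<^sup>+x. f (c + x) \<partial>lborel) = (\<integral>\<^sup>+x. f x \<partial>lborel)"
  using nn_integral_distr[of "(+) c" lborel borel f] assms by (simp add: lborel_distr_plus)

text \<open>The directional derivative is a limit of difference quotients, and each quotient has
  integral zero by translation invariance of \<open>lborel\<close>. Dominated convergence applies
  because \<open>f\<close> is Lipschitz with bounded support.\<close>

lemma integral_grad_zero:
  fixes f :: "'a::euclidean_space \<Rightarrow> real"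
  assumes fg: "has_grad f g" and f0: "\<And>x. r < norm x \<Longrightarrow> f x = 0"
  shows "(\<integral>x. g x \<bullet> e \<partial>lborel) = 0"
proof -
  have g0: "g x = 0" if "r < norm x" for x
    by (rule has_grad_zero_outside[OF fg f0 that])
  obtain B where B: "B \<ge> 0" "\<And>x. norm (g x) \<le> B"
    using bounded_continuous_bounded_support[OF has_grad_continuous_grad[OF fg] g0] by blast
  define s where "s n x = real (Suc n) * (f (inverse (real (Suc n)) *\<^sub>R e + x) - f x)" for n x
  have [measurable]: "f \<in> borel_measurable borel" "g \<in> borel_measurable borel"
    using has_grad_borel[OF fg] by auto
  have fi: "integrable lborel f"
    by (rule integrable_continuous_bounded_support[OF has_grad_continuous[OF fg] f0])
  have s0: "(\<integral>x. s n x \<partial>lborel) = 0" for n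
    unfolding s_def
    using fi lborel_integral_translate[of f "inverse (real (Suc n)) *\<^sub>R e"] by simp
  have lim: "(\<lambda>n. s n x) \<longlonglongrightarrow> g x \<bullet> e" for x
  proof -
    have "((\<lambda>t. f (x + t *\<^sub>R e)) has_derivative (\<lambda>t. g x \<bullet> (t *\<^sub>R e))) (at 0)"
      by (rule has_derivative_eq_rhs[OF has_derivative_compose[where g=f and f="\<lambda>t. x + t *\<^sub>R e"]])
         (auto intro!: derivative_eq_intros has_grad_derivative[OF fg])
    then have "((\<lambda>t. f (x + t *\<^sub>R e)) has_real_derivative (g x \<bullet> e)) (at 0)"
      by (simp add: has_field_derivative_def mult.commute[of _ "g x \<bullet> e"] cong: if_cong)
    then have "((\<lambda>t. (f (x + t *\<^sub>R e) - f x) / t) \<longlongrightarrow> g x \<bullet> e) (at 0)"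
      by (simp add: DERIV_def)
    moreover have "filterlim (\<lambda>n. inverse (real (Suc n))) (at 0) sequentially"
      using LIMSEQ_inverse_real_of_nat by (simp add: filterlim_at del: of_nat_Suc)
    ultimately have "(\<lambda>n. (f (x + inverse (real (Suc n)) *\<^sub>R e) - f x) / inverse (real (Suc n))) \<longlonglongrightarrow> g x \<bullet> e"
      by (rule filterlim_compose)
    then show ?thesis
      unfolding s_def by (simp add: divide_inverse mult.commute add.commute)
  qed
  \<comment> \<open>Translating by \<open>inverse (real (Suc n)) *\<^sub>R e\<close> moves the
    support by at most \<open>norm e\<close>, hence the larger ball.\<close>
  define w where "w x = B * norm e * indicator (cball 0 (r + norm e)) x" for x :: 'a
  have bd: "norm (s n x) \<le> w x" for n x
  proof -
    define h where "h = inverse (real (Suc n)) *\<^sub>R e"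
    have hn: "norm h = inverse (real (Suc n)) * norm e" by (simp add: h_def)
    have hle: "norm h \<le> norm e" unfolding hn
      by (intro mult_left_le_one_le) (auto simp: inverse_le_1_iff)
    show ?thesis
    proof (cases "norm x \<le> r + norm e")
      case True
      have "norm (f (h + x) - f x) \<le> B * norm ((h + x) - x)"
      proof (rule differentiable_bound[where S=UNIV and f'="\<lambda>x h. g x \<bullet> h"])
        fix y show "(f has_derivative (\<lambda>h. g y \<bullet> h)) (at y within UNIV)"
          using has_grad_derivative[OF fg] by auto
        show "onorm (\<lambda>h. g y \<bullet> h) \<le> B"
        proof (rule onorm_bound)
          fix x show "norm (g y \<bullet> x) \<le> B * norm x"
            using Cauchy_Schwarz_ineq2[of "g y" x] mult_right_mono[OF B(2)[of y] norm_ge_zero[of x]]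
            by (simp only: real_norm_def)
        qed (rule B(1))
      qed auto
      then have "real (Suc n) * norm (f (h + x) - f x) \<le> real (Suc n) * (B * norm h)"
        by (intro mult_left_mono) auto
      also have "\<dots> = B * norm e" unfolding hn by simp
      finally show ?thesis using True
        unfolding s_def w_def h_def[symmetric] by (simp add: abs_mult)
    next
      case False
      have "norm x \<le> norm (h + x) + norm h" by (metis add_diff_cancel_left' norm_triangle_ineq4 add.commute)
      then have "r < norm (h + x)" "r < norm x" using False hle norm_ge_zero[of e] by linarith+
      then have "f (h + x) = 0" "f x = 0" using f0 by auto
      then show ?thesis using B(1) unfolding s_def w_def h_def[symmetric] by simp
    qed
  qed
  have wi: "integrable lborel w"
    unfolding w_def
    by (rule integrable_mult_right) (use emeasure_bounded_finite[of "cball 0 (r + norm e)"] in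
      \<open>auto simp: integrable_indicator_iff\<close>)
  have "(\<lambda>n. \<integral>x. s n x \<partial>lborel) \<longlonglongrightarrow> (\<integral>x. g x \<bullet> e \<partial>lborel)"
    by (rule integral_dominated_convergence[OF _ _ wi]) (use lim bd in \<open>auto simp: s_def\<close>)
  then show ?thesis unfolding s0 by (simp add: LIMSEQ_const_iff)
qed

text \<open>The product of \<open>f\<close> and \<open>p\<close> has bounded support as soon as
  \<open>p\<close> has, so \<open>f\<close> may be any C1 function, for instance a
  coordinate.\<close>

lemma grad_integral_by_parts:
  fixes f :: "'a::euclidean_space \<Rightarrow> real"
  assumes fg: "has_grad f g" and pq: "has_grad p q" and p0: "\<And>x. r < norm x \<Longrightarrow> p x = 0"
  shows "(\<integral>x. (g x \<bullet> e) * p x \<partial>lborel) = - (\<integral>x. f x * (q x \<bullet> e) \<partial>lborel)"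
proof -
  note fc = has_grad_continuous[OF fg] has_grad_continuous_grad[OF fg]
    has_grad_continuous[OF pq] has_grad_continuous_grad[OF pq]
  have "(\<integral>x. (f x *\<^sub>R q x + p x *\<^sub>R g x) \<bullet> e \<partial>lborel) = 0"
    by (rule integral_grad_zero[OF has_grad_mult[OF fg pq], where r=r]) (use p0 in auto)
  moreover have "integrable lborel (\<lambda>x. (g x \<bullet> e) * p x)"
    by (rule integrable_continuous_bounded_support[where r=r]) (use p0 fc in \<open>auto intro!: continuous_intros\<close>)
  moreover have "integrable lborel (\<lambda>x. f x * (q x \<bullet> e))"
    by (rule integrable_continuous_bounded_support[where r=r])
      (use has_grad_zero_outside[OF pq p0] fc in \<open>auto intro!: continuous_intros\<close>)
  ultimately show ?thesis
    by (simp add: inner_add_left mult.commute)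
qed

subsection \<open>Smooth bump functions\<close>

lemma C_k_Suc_D: "C_k (Suc k) f \<Longrightarrow> C_k k f"
proof (induction k arbitrary: f)
  case 0 then show ?case
    by (simp add: continuous_at_imp_continuous_on differentiable_imp_continuous_within)
next
  case (Suc k)
  have "C_k k (partial_deriv i f)" if "i \<in> Basis" for i
    using Suc.IH[of "partial_deriv i f"] Suc.prems that by simp
  then show ?case using Suc.prems by simp
qed

lemma C_k_const: "C_k k (\<lambda>x::'a::euclidean_space. c)"
proof (induction k arbitrary: c)
  case 0 then show ?case by simp
next
  case (Suc k)
  have "partial_deriv i (\<lambda>x::'a. c) = (\<lambda>x. 0)" for i
    by (simp add: fun_eq_iff partial_deriv_has_grad[OF has_grad_const])
  then show ?case using Suc by simp
qed

lemma C_k_add: "C_k k f \<Longrightarrow> C_k k g \<Longrightarrow> C_k k (\<lambda>x. f x + g x)"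
proof (induction k arbitrary: f g)
  case 0 then show ?case by (simp add: continuous_intros)
next
  case (Suc k)
  have "partial_deriv i (\<lambda>x. f x + g x) = (\<lambda>x. partial_deriv i f x + partial_deriv i g x)" for i
    by (simp add: fun_eq_iff inner_add_left partial_deriv_has_grad[OF has_grad_add[OF has_grad_C_k[OF Suc.prems(1)] has_grad_C_k[OF Suc.prems(2)]]]
      partial_deriv_has_grad[OF has_grad_C_k[OF Suc.prems(1)]] partial_deriv_has_grad[OF has_grad_C_k[OF Suc.prems(2)]])
  then show ?case using Suc by auto
qed

lemma C_k_mult: "C_k k f \<Longrightarrow> C_k k g \<Longrightarrow> C_k k (\<lambda>x. f x * g x)"
proof (induction k arbitrary: f g)
  case 0 then show ?case by (simp add: continuous_intros)
next
  case (Suc k)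
  have "partial_deriv i (\<lambda>x. f x * g x) = (\<lambda>x. f x * partial_deriv i g x + g x * partial_deriv i f x)" for i
    by (simp add: fun_eq_iff inner_add_left partial_deriv_has_grad[OF has_grad_mult[OF has_grad_C_k[OF Suc.prems(1)] has_grad_C_k[OF Suc.prems(2)]]]
      partial_deriv_has_grad[OF has_grad_C_k[OF Suc.prems(1)]] partial_deriv_has_grad[OF has_grad_C_k[OF Suc.prems(2)]])
  moreover have "C_k k (\<lambda>x. f x * partial_deriv i g x + g x * partial_deriv i f x)" if "i \<in> Basis" for i
    using Suc.prems that C_k_Suc_D[OF Suc.prems(1)] C_k_Suc_D[OF Suc.prems(2)]
    by (intro C_k_add Suc.IH) auto
  moreover have "(\<lambda>x. f x * g x) differentiable (at x)" for x
    using Suc.prems by (auto intro!: differentiable_mult)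
  ultimately show ?case by auto
qed

lemma C_k_inner: "C_k k (\<lambda>x::'a::euclidean_space. x \<bullet> i)"
proof (cases k)
  case (Suc k)
  have "partial_deriv j (\<lambda>x::'a. x \<bullet> i) = (\<lambda>x. i \<bullet> j)" for j
    by (simp add: fun_eq_iff partial_deriv_has_grad[OF has_grad_inner])
  moreover have "(\<lambda>x::'a. x \<bullet> i) differentiable (at x)" for x
    using has_grad_derivative[OF has_grad_inner] differentiable_def by blast
  ultimately show ?thesis using Suc C_k_const by auto
qed (auto intro!: continuous_intros)

lemma C_k_reflect:
  "C_k k f \<Longrightarrow> C_k k (\<lambda>y. f (x - y))"
proof (induction k arbitrary: f)
  case 0 then show ?case
    by (auto intro!: continuous_intros continuous_on_compose2[of UNIV f])
next
  case (Suc k)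
  note fg = has_grad_C_k[OF Suc.prems]
  note hg = has_grad_reflect[OF fg, of x]
  have "partial_deriv i (\<lambda>y. f (x - y)) = (\<lambda>y. (-1) * partial_deriv i f (x - y))" for i
    by (simp add: fun_eq_iff partial_deriv_has_grad[OF hg] partial_deriv_has_grad[OF fg])
  moreover have "C_k k (\<lambda>y. (-1) * partial_deriv i f (x - y))" if "i \<in> Basis" for i
    using that Suc.prems by (intro C_k_mult C_k_const Suc.IH) auto
  moreover have "(\<lambda>y. f (x - y)) differentiable (at y)" for y
    using has_grad_derivative[OF hg] differentiable_def by blast
  ultimately show ?case by auto
qed

text \<open>The functions \<open>t\<^sup>-\<^sup>j exp (-1/t)\<close>, extended by zero, are closed under taking
  derivatives up to linear combinations.\<close>

definition flat_exp :: "nat \<Rightarrow> real \<Rightarrow> real" where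
  "flat_exp j t = (if t \<le> 0 then 0 else exp (- inverse t) / t ^ j)"

text \<open>The substitution t = 1/x turns the limit from the right into the decay of
  \<open>x ^ j / exp x\<close> at infinity; on the left the function is zero.\<close>

lemma flat_exp_lim: "(flat_exp j \<longlongrightarrow> 0) (at 0)"
proof -
  have l: "((\<lambda>t::real. exp (- inverse t) / t ^ j) \<longlongrightarrow> 0) (at_right 0)"
  proof (subst filterlim_at_right_to_top)
    show "((\<lambda>x. exp (- inverse (inverse x)) / inverse x ^ j) \<longlongrightarrow> (0::real)) at_top"
      using tendsto_power_div_exp_0[of j] by (simp only: exp_minus power_inverse divide_inverse inverse_inverse_eq mult.commute)
  qed
  have "(flat_exp j \<longlongrightarrow> 0) (at_right 0)"
    by (rule Lim_transform_eventually[OF l])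
      (auto simp: flat_exp_def eventually_at_filter)
  moreover have "(flat_exp j \<longlongrightarrow> 0) (at_left 0)"
    by (rule tendsto_eventually) (auto simp: flat_exp_def eventually_at_filter)
  ultimately show ?thesis by (simp add: filterlim_at_split)
qed

text \<open>At 0 the difference quotient of \<open>flat_exp j\<close> is
  \<open>flat_exp (Suc j)\<close>, so the previous limit gives derivative zero there; for positive
  \<open>t\<close> it is the product rule.\<close>

lemma flat_exp_deriv:
  "(flat_exp j has_real_derivative (flat_exp (j + 2) t - real j * flat_exp (j + 1) t)) (at t)"
proof -
  consider "t < 0" | "t = 0" | "t > 0" by linarith
  then show ?thesis
  proof cases
    case 1
    have "((\<lambda>t. 0) has_real_derivative 0) (at t)" by simp
    then have "(flat_exp j has_real_derivative 0) (at t)"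
      by (rule DERIV_cong_ev[THEN iffD1, rotated 3, OF _ refl _ refl])
         (use 1 in \<open>auto simp: flat_exp_def intro!: eventually_mono[OF eventually_nhds_in_open[of "{..<0}"]]\<close>)
    then show ?thesis using 1 by (simp add: flat_exp_def)
  next
    case 2
    have "((\<lambda>h. (flat_exp j (0 + h) - flat_exp j 0) / h) \<longlongrightarrow> 0) (at 0)"
    proof (rule Lim_transform_eventually[OF flat_exp_lim[of "Suc j"]])
      show "\<forall>\<^sub>F x in at 0. flat_exp (Suc j) x = (flat_exp j (0 + x) - flat_exp j 0) / x"
        by (auto simp: flat_exp_def field_simps eventually_at_filter)
    qed
    then have "(flat_exp j has_real_derivative 0) (at 0)" by (simp add: DERIV_def)
    then show ?thesis using 2 by (simp add: flat_exp_def)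
  next
    case 3
    have "((\<lambda>t. exp (- inverse t) * inverse t ^ j) has_real_derivative
        (flat_exp (j + 2) t - real j * flat_exp (j + 1) t)) (at t)"
      using 3
      apply (auto intro!: derivative_eq_intros simp: flat_exp_def)
      apply (cases j)
      apply (auto simp: field_simps power2_eq_square)
      done
    then show ?thesis
      by (rule DERIV_cong_ev[THEN iffD1, rotated 3, OF _ refl _ refl])
         (use 3 in \<open>auto simp: flat_exp_def field_simps intro!: eventually_mono[OF eventually_nhds_in_open[of "{0<..}"]]\<close>)
  qed
qed

lemma continuous_on_flat_exp: "continuous_on UNIV (flat_exp j)"
  using flat_exp_deriv DERIV_isCont by (blast intro: continuous_at_imp_continuous_on)

text \<open>Differentiation raises the exponent, so the induction over \<open>k\<close> has to run
  for all \<open>j\<close> at once.\<close>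

lemma C_k_flat_exp:
  assumes "\<And>k. C_k k q"
  shows "C_k k (\<lambda>x. flat_exp j (q x))"
proof (induction k arbitrary: j)
  case 0
  have "continuous_on UNIV q" using assms[of 0] by simp
  then show ?case by (auto intro: continuous_on_compose2[OF continuous_on_flat_exp])
next
  case (Suc k)
  have hg: "has_grad (\<lambda>x. flat_exp j (q x))
     (\<lambda>x. (flat_exp (j + 2) (q x) - real j * flat_exp (j + 1) (q x)) *\<^sub>R grad q x)"
    by (rule has_grad_compose[OF has_grad_C_k[OF assms] flat_exp_deriv])
       (intro continuous_intros continuous_on_flat_exp)
  have "partial_deriv i (\<lambda>x. flat_exp j (q x)) =
      (\<lambda>x. (flat_exp (j + 2) (q x) + (- real j) * flat_exp (j + 1) (q x)) * partial_deriv i q x)" for i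
    by (simp add: fun_eq_iff partial_deriv_has_grad[OF hg] partial_deriv_has_grad[OF has_grad_C_k[OF assms]])
  moreover have "C_k k (\<lambda>x. (flat_exp (j + 2) (q x) + (- real j) * flat_exp (j + 1) (q x)) * partial_deriv i q x)"
    if "i \<in> Basis" for i
    using assms[of "Suc k"] that by (intro C_k_mult C_k_add C_k_const Suc.IH) auto
  moreover have "(\<lambda>x. flat_exp j (q x)) differentiable (at x)" for x
    using has_grad_derivative[OF hg] differentiable_def by blast
  ultimately show ?case by auto
qed

text \<open>A mollifier of scale \<open>e\<close>. It is a predicate and not a fixed kernel rescaled
  by \<open>e\<close>: the estimates hold for every kernel with these properties, and existence at
  each scale is enough.\<close>

definition bump :: "real \<Rightarrow> ('a::euclidean_space \<Rightarrow> real) \<Rightarrow> bool" where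
  "bump e p \<longleftrightarrow> 0 < e \<and> (\<forall>k. C_k k p) \<and> (\<forall>x. 0 \<le> p x) \<and> (\<forall>x. e \<le> norm x \<longrightarrow> p x = 0) \<and>
     integral\<^sup>L lborel p = 1"

lemma C_k_sum: "finite A \<Longrightarrow> (\<And>i. i \<in> A \<Longrightarrow> C_k k (f i)) \<Longrightarrow> C_k k (\<lambda>x. \<Sum>i\<in>A. f i x)"
  by (induction rule: finite_induct) (auto intro: C_k_const C_k_add)

lemma ex_bump:
  assumes "e > 0"
  shows "\<exists>p :: 'a::euclidean_space \<Rightarrow> real. bump e p"
proof -
  \<comment> \<open>The standard bump \<open>exp (-1 / (e^2 - |x|^2))\<close>; its argument is
    written as a polynomial in the coordinates so that the closure rules for \<open>C_k\<close>
    apply.\<close>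
  define f :: "'a \<Rightarrow> real" where "f x = flat_exp 0 (e\<^sup>2 + (-1) * (\<Sum>i\<in>Basis. (x \<bullet> i) * (x \<bullet> i)))" for x
  have f_eq: "f x = flat_exp 0 (e\<^sup>2 - (norm x)\<^sup>2)" for x
    unfolding f_def by (simp add: power2_norm_eq_inner euclidean_inner[of x x])
  have fC: "C_k k f" for k
    unfolding f_def by (intro C_k_flat_exp C_k_add C_k_const C_k_mult C_k_sum C_k_inner) auto
  have f0: "f x = 0" if "e \<le> norm x" for x
    using that assms power_mono[of e "norm x" 2] by (simp add: f_eq flat_exp_def)
  have fpos: "f x > 0" if "norm x < e" for x
    using that assms power_strict_mono[of "norm x" e 2] by (simp add: f_eq flat_exp_def)
  have fnn: "f x \<ge> 0" for x by (simp add: f_eq flat_exp_def)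
  have fc: "continuous_on UNIV f" using fC[of 0] by simp
  have fi: "integrable lborel f"
    by (rule integrable_continuous_bounded_support[OF fc, of e]) (use f0 in auto)
  have "integral\<^sup>L lborel f \<noteq> 0"
  proof
    assume "integral\<^sup>L lborel f = 0"
    then have "AE x in lborel. f x = 0"
      using integral_nonneg_eq_0_iff_AE[OF fi] fnn by simp
    then have "AE x in lborel. x \<notin> ball (0::'a) e"
      by eventually_elim (use fpos in force)
    then have "emeasure lborel (ball (0::'a) e) = 0"
      by (subst (asm) AE_iff_measurable[OF _ refl]) (auto simp: ball_def)
    then show False
      using assms open_not_negligible[of "ball (0::'a) e"] negligible_iff_null_sets null_sets_completionI by fastforce
  qed
  then have c: "integral\<^sup>L lborel f > 0"
    using Bochner_Integration.integral_nonneg[of lborel f] fnn by (simp add: less_le)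
  have "bump e (\<lambda>x. inverse (integral\<^sup>L lborel f) * f x)"
    unfolding bump_def using assms c f0 fnn C_k_mult[OF C_k_const fC] by auto
  then show ?thesis by blast
qed

lemma bump_has_grad: "bump e p \<Longrightarrow> has_grad p (grad p)"
  unfolding bump_def using has_grad_C_k by blast

lemma bump_partial_has_grad: "bump e p \<Longrightarrow> i \<in> Basis \<Longrightarrow> has_grad (partial_deriv i p) (grad (partial_deriv i p))"
  unfolding bump_def using has_grad_C_k[of 0 "partial_deriv i p"]
  by (metis C_k.simps(2) has_grad_C_k)

text \<open>The kernel centred at \<open>x\<close> may be inserted into the distributional equation
  as long as its support, of radius \<open>e\<close>, stays inside the unit ball. This is the origin
  of the boundary layer in \<open>approx_solution\<close>.\<close>

lemma bump_test_function:
  assumes "bump e p" "norm x + e < 1"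
  shows "(\<lambda>y. p (x - y)) \<in> test_functions (ball 0 1)"
proof -
  have "{y. p (x - y) \<noteq> 0} \<subseteq> cball x e"
    using assms by (force simp: bump_def dist_norm)
  then have s: "closure {y. p (x - y) \<noteq> 0} \<subseteq> cball x e" by (simp add: closure_minimal)
  moreover have "cball x e \<subseteq> ball 0 1"
    using assms norm_triangle_ineq2 by (auto simp: subset_iff dist_norm) (smt (verit) norm_minus_commute norm_triangle_sub)
  moreover have "compact (closure {y. p (x - y) \<noteq> 0})"
    using s by (meson compact_cball compact_closure bounded_subset bounded_cball closed_closure compact_eq_bounded_closed)
  moreover have "\<forall>k. C_k k (\<lambda>y. p (x - y))"
    using assms C_k_reflect by (auto simp: bump_def)
  ultimately show ?thesis unfolding test_functions_def by auto
qed

subsection \<open>Mollification\<close>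

lemma lborel_distr_reflect: "distr lborel borel (\<lambda>y. x - y) = (lborel :: 'a::euclidean_space measure)"
  using lborel_affine[of "-1" x] by (simp add: density_1)

lemma nn_integral_lborel_reflect:
  fixes f :: "'a::euclidean_space \<Rightarrow> ennreal"
  assumes "f \<in> borel_measurable borel"
  shows "(\<integral>\<^sup>+y. f (x - y) \<partial>lborel) = (\<integral>\<^sup>+y. f y \<partial>lborel)"
  using nn_integral_distr[of "\<lambda>y. x - y" lborel borel f] assms by (simp add: lborel_distr_reflect)

lemma lborel_integral_reflect:
  fixes f :: "'a::euclidean_space \<Rightarrow> 'b::euclidean_space"
  assumes "f \<in> borel_measurable borel"
  shows "(\<integral>y. f (x - y) \<partial>lborel) = (\<integral>y. f y \<partial>lborel)"
  using integral_distr[of "\<lambda>y. x - y" lborel borel f] assms by (simp add: lborel_distr_reflect)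

lemma integrable_bounded_scaleR:
  fixes f :: "'a \<Rightarrow> real" and h :: "'a \<Rightarrow> 'b::euclidean_space"
  assumes "integrable M f" "h \<in> borel_measurable M" "\<And>x. norm (h x) \<le> C"
  shows "integrable M (\<lambda>x. f x *\<^sub>R h x)"
proof (rule Bochner_Integration.integrable_bound)
  show "integrable M (\<lambda>x. C * f x)" using assms by simp
  show "(\<lambda>x. f x *\<^sub>R h x) \<in> borel_measurable M" using assms by auto
  show "AE x in M. norm (f x *\<^sub>R h x) \<le> norm (C * f x)"
  proof (rule AE_I2)
    fix x
    have "0 \<le> C" using assms(3)[of x] norm_ge_zero order_trans by blast
    then show "norm (f x *\<^sub>R h x) \<le> norm (C * f x)"
      using mult_left_mono[OF assms(3)[of x], of "\<bar>f x\<bar>"] by (simp add: abs_mult mult.commute)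
  qed
qed

lemma integrable_scaleR_bounded:
  fixes f :: "'a \<Rightarrow> 'b::euclidean_space" and h :: "'a \<Rightarrow> real"
  assumes "integrable M f" "h \<in> borel_measurable M" "\<And>x. \<bar>h x\<bar> \<le> C"
  shows "integrable M (\<lambda>x. h x *\<^sub>R f x)"
proof (rule Bochner_Integration.integrable_bound)
  show "integrable M (\<lambda>x. C *\<^sub>R f x)" using assms by simp
  show "(\<lambda>x. h x *\<^sub>R f x) \<in> borel_measurable M" using assms by auto
  show "AE x in M. norm (h x *\<^sub>R f x) \<le> norm (C *\<^sub>R f x)"
    by (rule AE_I2, simp, rule mult_right_mono) (use assms(3) in \<open>auto intro: order_trans[OF _ abs_ge_self]\<close>)
qed

lemma uniformly_continuous_bounded_support:
  fixes f :: "'a::euclidean_space \<Rightarrow> 'b::real_normed_vector"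
  assumes "continuous_on UNIV f" "\<And>x. r < norm x \<Longrightarrow> f x = 0" "\<eta> > 0"
  obtains d where "d > 0" "\<And>x y. norm (x - y) < d \<Longrightarrow> norm (f x - f y) < \<eta>"
proof -
  have "uniformly_continuous_on (cball 0 (r + 1)) f"
    by (intro compact_uniformly_continuous continuous_on_subset[OF assms(1)]) auto
  then obtain d where d: "d > 0" "\<And>x y. x \<in> cball 0 (r + 1) \<Longrightarrow> y \<in> cball 0 (r + 1) \<Longrightarrow>
      dist x y < d \<Longrightarrow> dist (f x) (f y) < \<eta>"
    unfolding uniformly_continuous_on_def using assms(3) by metis
  \<comment> \<open>At distance below 1, either both points lie in the ball of radius
    \<open>r + 1\<close>, or both lie outside the ball of radius \<open>r\<close>, where
    \<open>f\<close> is zero.\<close>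
  have "norm (f x - f y) < \<eta>" if "norm (x - y) < min d 1" for x y
  proof (cases "x \<in> cball 0 (r + 1) \<and> y \<in> cball 0 (r + 1)")
    case True then show ?thesis using d(2)[of x y] that by (simp add: dist_norm)
  next
    case False
    have "\<bar>norm x - norm y\<bar> < 1" using norm_triangle_ineq3[of x y] that by linarith
    then have "r < norm x" "r < norm y" using False by auto
    then show ?thesis using assms by simp
  qed
  then show ?thesis using that[of "min d 1"] d by auto
qed

lemma has_grad_linearization_bound:
  assumes "has_grad p q" "\<And>z. z \<in> closed_segment a b \<Longrightarrow> norm (q z - q a) \<le> \<eta>"
  shows "\<bar>p b - p a - q a \<bullet> (b - a)\<bar> \<le> \<eta> * norm (b - a)"
proof -
  have e0: "\<eta> \<ge> 0" using assms(2)[of a] by auto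
  have "norm (p b - p a - q a \<bullet> (b - a)) \<le> norm (b - a) * \<eta>"
  proof (rule differentiable_bound_linearization[where S="closed_segment a b" and f'="\<lambda>x h. q x \<bullet> h"])
    show "a + t *\<^sub>R (b - a) \<in> closed_segment a b" if "t \<in> {0..1}" for t
      using that by (auto simp: in_segment algebra_simps intro!: exI[of _ t])
    show "(p has_derivative (\<bullet>) (q x)) (at x within closed_segment a b)" for x
      using has_grad_derivative[OF assms(1), of x] has_derivative_at_withinI by blast
    show "onorm ((\<bullet>) (q x) - (\<bullet>) (q a)) \<le> \<eta>" if "x \<in> closed_segment a b" for x
    proof (rule onorm_bound)
      fix h show "norm (((\<bullet>) (q x) - (\<bullet>) (q a)) h) \<le> \<eta> * norm h"
        using Cauchy_Schwarz_ineq2[of "q x - q a" h] mult_right_mono[OF assms(2)[OF that] norm_ge_zero[of h]]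
        by (simp add: inner_diff_left)
    qed (rule e0)
  qed auto
  then show ?thesis by (simp add: mult.commute)
qed

definition mollify :: "('a::euclidean_space \<Rightarrow> real) \<Rightarrow> ('a \<Rightarrow> 'b::euclidean_space) \<Rightarrow> 'a \<Rightarrow> 'b" where
  "mollify p f x = (\<integral>y. p (x - y) *\<^sub>R f y \<partial>lborel)"

text \<open>The moving factor is the kernel \<open>q\<close>, allowed to be vector valued since
  gradients of bumps will be inserted. Its uniform continuity against the fixed mass of
  \<open>f\<close> gives continuity.\<close>

lemma continuous_convolution:
  fixes q :: "'a::euclidean_space \<Rightarrow> 'b::euclidean_space" and f :: "'a \<Rightarrow> real"
  assumes f: "integrable lborel f" and q: "continuous_on UNIV q" "\<And>x. r < norm x \<Longrightarrow> q x = 0"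
  shows "continuous_on UNIV (\<lambda>x. \<integral>y. f y *\<^sub>R q (x - y) \<partial>lborel)"
    and "integrable lborel (\<lambda>y. f y *\<^sub>R q (x - y))"
proof -
  obtain B where B: "B \<ge> 0" "\<And>x. norm (q x) \<le> B"
    using bounded_continuous_bounded_support[OF q] by blast
  have [measurable]: "q \<in> borel_measurable borel" using q borel_measurable_continuous_onI by blast
  show int: "integrable lborel (\<lambda>y. f y *\<^sub>R q (x - y))" for x
    by (rule integrable_bounded_scaleR[OF f]) (use B in auto)
  define L where "L = (\<integral>y. \<bar>f y\<bar> \<partial>lborel)"
  have L0: "L \<ge> 0" unfolding L_def by simp
  show "continuous_on UNIV (\<lambda>x. \<integral>y. f y *\<^sub>R q (x - y) \<partial>lborel)"
    unfolding continuous_on_iff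
  proof (intro ballI allI impI)
    fix x :: 'a and e :: real assume e: "e > 0"
    \<comment> \<open>\<open>L + 1\<close> instead of \<open>L\<close>, because the
      \<open>L1\<close> norm of \<open>f\<close> may be zero.\<close>
    define \<eta> where "\<eta> = e / (L + 1)"
    have eta: "\<eta> > 0" "L * \<eta> < e" using e L0 by (auto simp: \<eta>_def field_simps)
    obtain d where d: "d > 0" "\<And>x y. norm (x - y) < d \<Longrightarrow> norm (q x - q y) < \<eta>"
      using uniformly_continuous_bounded_support[OF q eta(1)] by blast
    have "dist (\<integral>y. f y *\<^sub>R q (x' - y) \<partial>lborel) (\<integral>y. f y *\<^sub>R q (x - y) \<partial>lborel) < e"
      if "dist x' x < d" for x'
    proof -
      have "norm ((\<integral>y. f y *\<^sub>R q (x' - y) \<partial>lborel) - (\<integral>y. f y *\<^sub>R q (x - y) \<partial>lborel)) =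
         norm (\<integral>y. f y *\<^sub>R (q (x' - y) - q (x - y)) \<partial>lborel)"
        using int[of x] int[of x'] by (simp add: scaleR_diff_right)
      also have "\<dots> \<le> (\<integral>y. \<bar>f y\<bar> * \<eta> \<partial>lborel)"
      proof (rule Bochner_Integration.integral_norm_bound_integral)
        show "integrable lborel (\<lambda>y. f y *\<^sub>R (q (x' - y) - q (x - y)))"
          using int[of x] int[of x'] by (simp add: scaleR_diff_right)
        show "integrable lborel (\<lambda>y. \<bar>f y\<bar> * \<eta>)" using f by simp
        fix y
        have "norm (q (x' - y) - q (x - y)) \<le> \<eta>"
          using d(2)[of "x' - y" "x - y"] that by (simp add: dist_norm)
        then show "norm (f y *\<^sub>R (q (x' - y) - q (x - y))) \<le> \<bar>f y\<bar> * \<eta>"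
          by (simp add: mult_left_mono)
      qed
      also have "\<dots> = L * \<eta>" by (simp add: L_def)
      finally show ?thesis using eta by (simp add: dist_norm)
    qed
    then show "\<exists>d>0. \<forall>x'\<in>UNIV. dist x' x < d \<longrightarrow>
       dist (\<integral>y. f y *\<^sub>R q (x' - y) \<partial>lborel) (\<integral>y. f y *\<^sub>R q (x - y) \<partial>lborel) < e"
      using d(1) by blast
  qed
qed

text \<open>Linearize the kernel: along a segment \<open>p\<close> differs from its first-order
  expansion by at most the oscillation of \<open>q\<close> times the length, uniformly in the base
  point. Integration against \<open>f\<close> preserves this rate.\<close>

lemma has_grad_mollify:
  fixes f :: "'a::euclidean_space \<Rightarrow> real"
  assumes f: "integrable lborel f" and pq: "has_grad p q" and p0: "\<And>x. r < norm x \<Longrightarrow> p x = 0"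
  shows "has_grad (mollify p f) (\<lambda>x. \<integral>y. f y *\<^sub>R q (x - y) \<partial>lborel)"
proof -
  have q0: "q x = 0" if "r < norm x" for x by (rule has_grad_zero_outside[OF pq p0 that])
  note qc = has_grad_continuous_grad[OF pq]
  have cq1: "continuous_on UNIV (\<lambda>x. \<integral>y. f y *\<^sub>R q (x - y) \<partial>lborel)"
    by (rule continuous_convolution(1)[OF f qc]) (rule q0)
  have cq2: "integrable lborel (\<lambda>y. f y *\<^sub>R q (x - y))" for x
    by (rule continuous_convolution(2)[OF f qc]) (rule q0)
  have intp: "integrable lborel (\<lambda>y. f y * p (x - y))" for x
  proof -
    have "integrable lborel (\<lambda>y. f y *\<^sub>R p (x - y))"
      by (rule continuous_convolution(2)[OF f has_grad_continuous[OF pq]]) (rule p0)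
    then show ?thesis by simp
  qed
  define L where "L = (\<integral>y. \<bar>f y\<bar> \<partial>lborel)"
  have L0: "L \<ge> 0" unfolding L_def by simp
  have "(mollify p f has_derivative (\<lambda>h. (\<integral>y. f y *\<^sub>R q (x - y) \<partial>lborel) \<bullet> h)) (at x)" for x
    unfolding has_derivative_at_alt
  proof (intro conjI allI impI)
    show "bounded_linear (\<lambda>h. (\<integral>y. f y *\<^sub>R q (x - y) \<partial>lborel) \<bullet> h)"
      by (rule bounded_linear_inner_right)
  next
    fix e :: real assume e: "e > 0"
    define \<eta> where "\<eta> = e / (L + 1)"
    have eta: "\<eta> > 0" "L * \<eta> \<le> e" using e L0 by (auto simp: \<eta>_def field_simps)
    obtain d where d: "d > 0" "\<And>x y. norm (x - y) < d \<Longrightarrow> norm (q x - q y) < \<eta>"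
      using uniformly_continuous_bounded_support[OF qc q0 eta(1)] by blast
    have "norm (mollify p f x' - mollify p f x - (\<integral>y. f y *\<^sub>R q (x - y) \<partial>lborel) \<bullet> (x' - x)) \<le> e * norm (x' - x)"
      if x': "norm (x' - x) < d" for x'
    proof -
      have iq: "integrable lborel (\<lambda>y. f y * (q (x - y) \<bullet> (x' - x)))"
        using integrable_inner_left[of "x' - x" lborel, OF cq2[of x]] by simp
      have eq: "mollify p f x' - mollify p f x - (\<integral>y. f y *\<^sub>R q (x - y) \<partial>lborel) \<bullet> (x' - x)
        = (\<integral>y. f y * (p (x' - y) - p (x - y) - q (x - y) \<bullet> (x' - x)) \<partial>lborel)"
        using intp[of x] intp[of x'] cq2[of x] iq
        by (simp add: mollify_def right_diff_distrib mult.commute[of _ "f _"] flip: integral_inner_left)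
      have "norm (\<integral>y. f y * (p (x' - y) - p (x - y) - q (x - y) \<bullet> (x' - x)) \<partial>lborel)
         \<le> (\<integral>y. \<bar>f y\<bar> * (\<eta> * norm (x' - x)) \<partial>lborel)"
      proof (rule Bochner_Integration.integral_norm_bound_integral)
        show "integrable lborel (\<lambda>y. f y * (p (x' - y) - p (x - y) - q (x - y) \<bullet> (x' - x)))"
          using intp[of x] intp[of x'] iq by (simp add: right_diff_distrib)
        show "integrable lborel (\<lambda>y. \<bar>f y\<bar> * (\<eta> * norm (x' - x)))" using f by simp
        fix y
        have "\<bar>p (x' - y) - p (x - y) - q (x - y) \<bullet> ((x' - y) - (x - y))\<bar> \<le> \<eta> * norm ((x' - y) - (x - y))"
        proof (rule has_grad_linearization_bound[OF pq])
          fix z assume "z \<in> closed_segment (x - y) (x' - y)"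
          then have "norm (z - (x - y)) \<le> norm ((x' - y) - (x - y))"
            using segment_bound1 by blast
          then show "norm (q z - q (x - y)) \<le> \<eta>"
            using d(2)[of z "x - y"] x' by simp
        qed
        then show "norm (f y * (p (x' - y) - p (x - y) - q (x - y) \<bullet> (x' - x))) \<le> \<bar>f y\<bar> * (\<eta> * norm (x' - x))"
          by (simp add: abs_mult mult_left_mono)
      qed
      also have "\<dots> = (L * \<eta>) * norm (x' - x)" by (simp add: L_def)
      also have "\<dots> \<le> e * norm (x' - x)" using eta by (intro mult_right_mono) auto
      finally show ?thesis using eq by simp
    qed
    then show "\<exists>d>0. \<forall>y. norm (y - x) < d \<longrightarrow>
      norm (mollify p f y - mollify p f x - (\<integral>y. f y *\<^sub>R q (x - y) \<partial>lborel) \<bullet> (y - x)) \<le> e * norm (y - x)"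
      using d(1) by blast
  qed
  then show ?thesis using cq1 by (simp add: has_grad_def)
qed

lemma bumpD:
  assumes "bump e p"
  shows "0 < e" "0 \<le> p x" "e \<le> norm x \<Longrightarrow> p x = 0" "integral\<^sup>L lborel p = 1" "C_k k p" "continuous_on UNIV p"
    "p \<in> borel_measurable borel"
proof -
  show c: "continuous_on UNIV p" using assms has_grad_continuous bump_has_grad by blast
  then show "p \<in> borel_measurable borel" by (rule borel_measurable_continuous_onI)
qed (use assms in \<open>auto simp: bump_def\<close>)

lemma bump_integral_reflect:
  assumes "bump e p"
  shows "integrable lborel (\<lambda>y. p (x - y))" "(\<integral>y. p (x - y) \<partial>lborel) = 1"
    "(\<integral>\<^sup>+y. ennreal (p (x - y)) \<partial>lborel) = 1" "(\<integral>\<^sup>+z. ennreal (p z) \<partial>lborel) = 1"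
proof -
  note b = bumpD[OF assms]
  have i: "integrable lborel p"
    by (rule integrable_continuous_bounded_support[OF b(6), of e]) (use b(3) in auto)
  show n: "(\<integral>\<^sup>+z. ennreal (p z) \<partial>lborel) = 1"
    using nn_integral_eq_integral[OF i] b(2,4) by simp
  show "(\<integral>\<^sup>+y. ennreal (p (x - y)) \<partial>lborel) = 1"
    using nn_integral_lborel_reflect[of "\<lambda>z. ennreal (p z)" x] b(7) n by simp
  show "(\<integral>y. p (x - y) \<partial>lborel) = 1"
    using lborel_integral_reflect[of p x] b by simp
  show "integrable lborel (\<lambda>y. p (x - y))"
    using integrable_distr_eq[of "\<lambda>y. x - y" lborel borel p] b(7) i by (simp add: lborel_distr_reflect)
qed

lemma bump_bounded:
  assumes "bump e p" obtains B where "B \<ge> 0" "\<And>x. \<bar>p x\<bar> \<le> B"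
  using bounded_continuous_bounded_support[OF bumpD(6)[OF assms], of e] bumpD(3)[OF assms] by (auto simp: less_imp_le)

lemma integrable_mollify:
  fixes f :: "'a::euclidean_space \<Rightarrow> 'b::euclidean_space"
  assumes "bump e p" "integrable lborel f"
  shows "integrable lborel (\<lambda>y. p (x - y) *\<^sub>R f y)"
proof -
  obtain B where "\<And>x. \<bar>p x\<bar> \<le> B" using bump_bounded[OF assms(1)] by blast
  moreover have [measurable]: "p \<in> borel_measurable borel" using bumpD[OF assms(1)] by simp
  ultimately show ?thesis by (intro integrable_scaleR_bounded[OF assms(2)]) auto
qed

lemma mollify_bound:
  fixes f :: "'a::euclidean_space \<Rightarrow> real"
  assumes "bump e p" "integrable lborel f" "\<And>x. \<bar>f x\<bar> \<le> M"
  shows "\<bar>mollify p f x\<bar> \<le> M"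
proof -
  have "norm (\<integral>y. p (x - y) *\<^sub>R f y \<partial>lborel) \<le> (\<integral>y. p (x - y) * M \<partial>lborel)"
  proof (rule Bochner_Integration.integral_norm_bound_integral)
    show "integrable lborel (\<lambda>y. p (x - y) * M)" using bump_integral_reflect[OF assms(1)] by simp
    show "norm (p (x - y) *\<^sub>R f y) \<le> p (x - y) * M" for y
      using bumpD(2)[OF assms(1)] assms(3)[of y] by (simp add: abs_mult mult_left_mono)
  qed (rule integrable_mollify[OF assms(1,2)])
  then show ?thesis using bump_integral_reflect[OF assms(1)] by (simp add: mollify_def)
qed

lemma mollify_inner:
  fixes f :: "'a::euclidean_space \<Rightarrow> 'b::euclidean_space"
  assumes "bump e p" "integrable lborel f"
  shows "mollify p f x \<bullet> i = mollify p (\<lambda>y. f y \<bullet> i) x"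
  using integral_inner_left[of i lborel, OF integrable_mollify[OF assms, of x]] by (simp add: mollify_def)

lemma norm_add_sq_le: "(norm (a + b))\<^sup>2 \<le> 2 * (norm a)\<^sup>2 + 2 * (norm (b::'a::real_normed_vector))\<^sup>2"
proof -
  have "(norm (a + b))\<^sup>2 \<le> (norm a + norm b)\<^sup>2" by (intro power_mono norm_triangle_ineq) simp
  also have "\<dots> \<le> 2 * (norm a)\<^sup>2 + 2 * (norm b)\<^sup>2"
    using sum_squares_bound[of "norm a" "norm b"] by (simp add: power2_sum)
  finally show ?thesis .
qed

lemma norm_add3_sq_le: "(norm (a + b + c))\<^sup>2 \<le> 4 * (norm a)\<^sup>2 + 4 * (norm b)\<^sup>2 + 2 * (norm (c::'a::real_normed_vector))\<^sup>2"
  using norm_add_sq_le[of "a + b" c] norm_add_sq_le[of a b] by linarith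

text \<open>Truncation in position and in value at once: the first factor fades out between
  \<open>norm x = N\<close> and \<open>norm x = N + 1\<close>, the second projects \<open>y\<close>
  radially onto the ball of radius \<open>N\<close>. Joint continuity preserves both continuous
  functions and a.e. convergence.\<close>

definition trunc :: "nat \<Rightarrow> 'a::euclidean_space \<Rightarrow> 'b::euclidean_space \<Rightarrow> 'b" where
  "trunc N x y = (max 0 (min 1 (real N + 1 - norm x)) * (real N / max (real N) (norm y))) *\<^sub>R y"

lemma trunc_factor:
  assumes "N \<ge> 1"
  shows "0 \<le> max 0 (min 1 (real N + 1 - norm x)) * (real N / max (real N) (norm y))"
    and "max 0 (min 1 (real N + 1 - norm x)) * (real N / max (real N) (norm y)) \<le> 1"
proof -
  show "0 \<le> max 0 (min 1 (real N + 1 - norm x)) * (real N / max (real N) (norm y))"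
    by (intro mult_nonneg_nonneg divide_nonneg_nonneg) auto
  show "max 0 (min 1 (real N + 1 - norm x)) * (real N / max (real N) (norm y)) \<le> 1"
    by (rule mult_le_one) (use assms in \<open>auto simp: divide_simps\<close>)
qed

lemma trunc_bounds:
  assumes "N \<ge> 1"
  shows "norm (y - trunc N x y) \<le> norm y" "norm (trunc N x y) \<le> real N"
    "real N + 1 < norm x \<Longrightarrow> trunc N x y = 0"
    "norm x \<le> real N \<Longrightarrow> norm y \<le> real N \<Longrightarrow> trunc N x y = y"
proof -
  define c where "c = max 0 (min 1 (real N + 1 - norm x)) * (real N / max (real N) (norm y))"
  have c: "0 \<le> c" "c \<le> 1" using trunc_factor[OF assms] by (auto simp: c_def)
  have "y - trunc N x y = (1 - c) *\<^sub>R y" by (simp add: trunc_def c_def algebra_simps)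
  then show "norm (y - trunc N x y) \<le> norm y" using c by (simp add: mult_left_le_one_le)
  have "norm (trunc N x y) = max 0 (min 1 (real N + 1 - norm x)) * (real N / max (real N) (norm y) * norm y)"
    by (simp add: trunc_def abs_mult)
  also have "\<dots> \<le> 1 * (real N / max (real N) (norm y) * norm y)"
    by (intro mult_right_mono) auto
  also have "\<dots> \<le> real N" using assms by (auto simp: divide_simps max_def)
  finally show "norm (trunc N x y) \<le> real N" .
  show "real N + 1 < norm x \<Longrightarrow> trunc N x y = 0" by (simp add: trunc_def)
  show "norm x \<le> real N \<Longrightarrow> norm y \<le> real N \<Longrightarrow> trunc N x y = y" using assms by (simp add: trunc_def)
qed

lemma continuous_on_trunc:
  assumes "N \<ge> 1" "continuous_on S f" "continuous_on S g"
  shows "continuous_on S (\<lambda>x. trunc N (f x) (g x))"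
proof -
  have "max (real N) (norm (g x)) \<noteq> 0" for x using assms(1) by auto
  then show ?thesis unfolding trunc_def
    by (intro continuous_intros assms) auto
qed

text \<open>Two dominated convergences. Truncating \<open>f\<close> costs little, the square of
  \<open>f\<close> being the dominating function. Moreover \<open>f\<close> is an a.e. limit of
  continuous functions; once truncated these are uniformly bounded with a common bounded support, so
  they converge in \<open>L2\<close> to the truncated \<open>f\<close>.\<close>

lemma L2_approx_continuous:
  fixes f :: "'a::euclidean_space \<Rightarrow> 'b::euclidean_space"
  assumes [measurable]: "f \<in> borel_measurable borel"
    and fin: "(\<integral>\<^sup>+x. ennreal ((norm (f x))\<^sup>2) \<partial>lborel) < \<infinity>" and \<delta>: "\<delta> > 0"
  obtains G R where "continuous_on UNIV G" "\<And>x. R < norm x \<Longrightarrow> G x = 0"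
    "(\<integral>\<^sup>+x. ennreal ((norm (f x - G x))\<^sup>2) \<partial>lborel) \<le> ennreal \<delta>"
proof -
  have "continuous_on UNIV (\<lambda>p::'a\<times>'b. trunc (Suc N) (fst p) (snd p))" for N
    by (rule continuous_on_trunc) (auto intro!: continuous_intros)
  then have T[measurable]: "(\<lambda>p::'a\<times>'b. trunc (Suc N) (fst p) (snd p)) \<in> borel_measurable borel" for N
    by (rule borel_measurable_continuous_onI)
  have Tm[measurable]: "(\<lambda>x. trunc (Suc N) x (h x)) \<in> borel_measurable borel"
    if [measurable]: "h \<in> borel_measurable borel" for N and h :: "'a \<Rightarrow> 'b"
    using measurable_compose[OF _ T[of N], of "\<lambda>x. (x, h x)" borel] by simp
  have "(\<lambda>N. \<integral>\<^sup>+x. ennreal ((norm (f x - trunc (Suc N) x (f x)))\<^sup>2) \<partial>lborel) \<longlonglongrightarrow> (\<integral>\<^sup>+x. 0 \<partial>(lborel::'a measure))"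
  proof (rule nn_integral_dominated_convergence[where w="\<lambda>x. ennreal ((norm (f x))\<^sup>2)"])
    show "AE x in lborel. ennreal ((norm (f x - trunc (Suc N) x (f x)))\<^sup>2) \<le> ennreal ((norm (f x))\<^sup>2)" for N
      by (intro AE_I2 ennreal_leI power_mono trunc_bounds(1)) auto
    show "AE x in lborel. (\<lambda>i. ennreal ((norm (f x - trunc (Suc i) x (f x)))\<^sup>2)) \<longlonglongrightarrow> 0"
    proof (rule AE_I2)
      fix x
      obtain N0 :: nat where N0: "max (norm x) (norm (f x)) \<le> real N0" using real_arch_simple by blast
      show "(\<lambda>i. ennreal ((norm (f x - trunc (Suc i) x (f x)))\<^sup>2)) \<longlonglongrightarrow> 0"
        by (rule tendsto_eventually, rule eventually_sequentiallyI[of N0])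
           (use N0 in \<open>auto simp: trunc_bounds(4)\<close>)
    qed
  qed (use fin in auto)
  then have "\<forall>\<^sub>F N in sequentially. (\<integral>\<^sup>+x. ennreal ((norm (f x - trunc (Suc N) x (f x)))\<^sup>2) \<partial>lborel) < ennreal (\<delta> / 4)"
    using \<delta> by (intro order_tendstoD(2)) auto
  then obtain N where N: "(\<integral>\<^sup>+x. ennreal ((norm (f x - trunc (Suc N) x (f x)))\<^sup>2) \<partial>lborel) < ennreal (\<delta> / 4)"
    by (meson eventually_sequentially order_refl)
  \<comment> \<open>This notion of measurability provides the continuous functions converging to
    \<open>f\<close> off a negligible set.\<close>
  have "f measurable_on UNIV"
    by (rule lebesgue_measurable_imp_measurable_on) (auto intro: measurable_completion)
  then obtain Z g where Z: "negligible Z" and g: "\<And>n. continuous_on UNIV (g n)"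
    and gl: "\<And>x. x \<notin> Z \<Longrightarrow> (\<lambda>n. g n x) \<longlonglongrightarrow> f x"
    unfolding measurable_on_def by auto
  have [measurable]: "g n \<in> borel_measurable borel" for n using g borel_measurable_continuous_onI by blast
  have Z0: "AE x in lborel. x \<notin> Z"
    using Z AE_not_in[of Z lebesgue] by (simp add: negligible_iff_null_sets AE_completion_iff)
  have "(\<lambda>n. \<integral>\<^sup>+x. ennreal ((norm (trunc (Suc N) x (f x) - trunc (Suc N) x (g n x)))\<^sup>2) \<partial>lborel)
      \<longlonglongrightarrow> (\<integral>\<^sup>+x. 0 \<partial>(lborel::'a measure))"
  proof (rule nn_integral_dominated_convergence[where w="\<lambda>x. ennreal ((2 * real (Suc N))\<^sup>2) * indicator (cball 0 (real (Suc N) + 1)) x"])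
    fix n
    show "AE x in lborel. ennreal ((norm (trunc (Suc N) x (f x) - trunc (Suc N) x (g n x)))\<^sup>2)
      \<le> ennreal ((2 * real (Suc N))\<^sup>2) * indicator (cball 0 (real (Suc N) + 1)) x"
    proof (rule AE_I2)
      fix x
      show "ennreal ((norm (trunc (Suc N) x (f x) - trunc (Suc N) x (g n x)))\<^sup>2)
        \<le> ennreal ((2 * real (Suc N))\<^sup>2) * indicator (cball 0 (real (Suc N) + 1)) x"
      proof (cases "norm x \<le> real (Suc N) + 1")
        case True
        have "norm (trunc (Suc N) x (f x) - trunc (Suc N) x (g n x)) \<le> 2 * real (Suc N)"
          using trunc_bounds(2)[of "Suc N" x "f x"] trunc_bounds(2)[of "Suc N" x "g n x"]
            norm_triangle_ineq4[of "trunc (Suc N) x (f x)" "trunc (Suc N) x (g n x)"] by simp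
        then have "(norm (trunc (Suc N) x (f x) - trunc (Suc N) x (g n x)))\<^sup>2 \<le> (2 * real (Suc N))\<^sup>2"
          by (rule power_mono) simp
        then show ?thesis using True by (auto intro!: ennreal_leI simp del: of_nat_Suc)
      next
        case False then show ?thesis by (simp add: trunc_bounds(3))
      qed
    qed
  next
    show "AE x in lborel. (\<lambda>n. ennreal ((norm (trunc (Suc N) x (f x) - trunc (Suc N) x (g n x)))\<^sup>2)) \<longlonglongrightarrow> 0"
      using Z0
    proof eventually_elim
      fix x assume "x \<notin> Z"
      have "continuous_on UNIV (\<lambda>y::'b. trunc (Suc N) x y)"
        by (rule continuous_on_trunc) (auto intro!: continuous_intros)
      then have "(\<lambda>n. trunc (Suc N) x (g n x)) \<longlonglongrightarrow> trunc (Suc N) x (f x)"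
        by (rule continuous_on_tendsto_compose[OF _ gl[OF \<open>x \<notin> Z\<close>]]) auto
      then have "(\<lambda>n. (norm (trunc (Suc N) x (f x) - trunc (Suc N) x (g n x)))\<^sup>2) \<longlonglongrightarrow> (norm (trunc (Suc N) x (f x) - trunc (Suc N) x (f x)))\<^sup>2"
        by (intro tendsto_intros)
      then show "(\<lambda>n. ennreal ((norm (trunc (Suc N) x (f x) - trunc (Suc N) x (g n x)))\<^sup>2)) \<longlonglongrightarrow> 0"
        using tendsto_ennrealI by fastforce
    qed
  next
    show "(\<integral>\<^sup>+x. ennreal ((2 * real (Suc N))\<^sup>2) * indicator (cball 0 (real (Suc N) + 1)) (x::'a) \<partial>lborel) < \<infinity>"
      using emeasure_lborel_cball_finite[of "0::'a" "real (Suc N) + 1"]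
      by (subst nn_integral_cmult_indicator) (auto simp: ennreal_mult_less_top simp del: of_nat_Suc)
  next
    show "(\<lambda>x. ennreal ((2 * real (Suc N))\<^sup>2) * indicator (cball 0 (real (Suc N) + 1)) (x::'a)) \<in> borel_measurable lborel"
      by (rule borel_measurable_times_ennreal[OF _ borel_measurable_indicator]) simp_all
  qed auto
  then have "\<forall>\<^sub>F n in sequentially. (\<integral>\<^sup>+x. ennreal ((norm (trunc (Suc N) x (f x) - trunc (Suc N) x (g n x)))\<^sup>2) \<partial>lborel) < ennreal (\<delta> / 4)"
    using \<delta> by (intro order_tendstoD(2)) auto
  then obtain n where n: "(\<integral>\<^sup>+x. ennreal ((norm (trunc (Suc N) x (f x) - trunc (Suc N) x (g n x)))\<^sup>2) \<partial>lborel) < ennreal (\<delta> / 4)"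
    by (meson eventually_sequentially order_refl)
  show thesis
  proof (rule that)
    show "continuous_on UNIV (\<lambda>x. trunc (Suc N) x (g n x))"
      by (rule continuous_on_trunc) (auto intro!: g continuous_intros)
    show "trunc (Suc N) x (g n x) = 0" if "real (Suc N) + 1 < norm x" for x
      by (rule trunc_bounds(3)) (use that in auto)
    have "(\<integral>\<^sup>+x. ennreal ((norm (f x - trunc (Suc N) x (g n x)))\<^sup>2) \<partial>lborel)
      \<le> (\<integral>\<^sup>+x. 2 * ennreal ((norm (f x - trunc (Suc N) x (f x)))\<^sup>2) +
            2 * ennreal ((norm (trunc (Suc N) x (f x) - trunc (Suc N) x (g n x)))\<^sup>2) \<partial>lborel)"
    proof (rule nn_integral_mono)
      fix x
      show "ennreal ((norm (f x - trunc (Suc N) x (g n x)))\<^sup>2) \<le> 2 * ennreal ((norm (f x - trunc (Suc N) x (f x)))\<^sup>2) +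
            2 * ennreal ((norm (trunc (Suc N) x (f x) - trunc (Suc N) x (g n x)))\<^sup>2)"
        using norm_add_sq_le[of "f x - trunc (Suc N) x (f x)" "trunc (Suc N) x (f x) - trunc (Suc N) x (g n x)"]
        by (simp add: ennreal_leI flip: ennreal_mult' ennreal_plus ennreal_numeral)
    qed
    also have "\<dots> = 2 * (\<integral>\<^sup>+x. ennreal ((norm (f x - trunc (Suc N) x (f x)))\<^sup>2) \<partial>lborel) +
        2 * (\<integral>\<^sup>+x. ennreal ((norm (trunc (Suc N) x (f x) - trunc (Suc N) x (g n x)))\<^sup>2) \<partial>lborel)"
      by (simp add: nn_integral_add nn_integral_cmult)
    also have "\<dots> \<le> 2 * ennreal (\<delta> / 4) + 2 * ennreal (\<delta> / 4)"
      using N n by (intro add_mono mult_left_mono) auto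
    also have "\<dots> = ennreal \<delta>"
      using \<delta> by (simp flip: ennreal_mult' ennreal_plus ennreal_numeral)
    finally show "(\<integral>\<^sup>+x. ennreal ((norm (f x - trunc (Suc N) x (g n x)))\<^sup>2) \<partial>lborel) \<le> ennreal \<delta>" .
  qed
qed

text \<open>Quadratic oscillation of \<open>f\<close> around \<open>x\<close> as seen by the kernel.
  It dominates both the mollification error and the commutator, so one convergence result serves for
  both.\<close>

definition osc_fun :: "('a::euclidean_space \<Rightarrow> real) \<Rightarrow> ('a \<Rightarrow> 'b::euclidean_space) \<Rightarrow> 'a \<Rightarrow> ennreal" where
  "osc_fun p f x = (\<integral>\<^sup>+y. ennreal (p (x - y) * (norm (f y - f x))\<^sup>2) \<partial>lborel)"

lemma osc_fun_measurable [measurable]: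
  fixes f :: "'a::euclidean_space \<Rightarrow> 'b::euclidean_space"
  assumes [measurable]: "p \<in> borel_measurable borel" "f \<in> borel_measurable borel"
  shows "osc_fun p f \<in> borel_measurable borel"
  unfolding osc_fun_def by measurable

lemma nn_integral_bump_swap:
  fixes h :: "'a::euclidean_space \<Rightarrow> ennreal"
  assumes b: "bump e p" and [measurable]: "h \<in> borel_measurable borel"
  shows "(\<integral>\<^sup>+x. \<integral>\<^sup>+y. ennreal (p (x - y)) * h y \<partial>lborel \<partial>lborel) = (\<integral>\<^sup>+y. h y \<partial>lborel)"
proof -
  have [measurable]: "p \<in> borel_measurable borel" using bumpD[OF b] by simp
  have "(\<integral>\<^sup>+x. \<integral>\<^sup>+y. ennreal (p (x - y)) * h y \<partial>lborel \<partial>lborel) =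
     (\<integral>\<^sup>+y. \<integral>\<^sup>+x. ennreal (p (x - y)) * h y \<partial>lborel \<partial>lborel)"
    by (rule lborel_pair.Fubini'[symmetric]) measurable
  also have "\<dots> = (\<integral>\<^sup>+y. h y \<partial>lborel)"
  proof (rule nn_integral_cong)
    fix y
    have "(\<integral>\<^sup>+x. ennreal (p (x - y)) \<partial>lborel) = 1"
      using nn_integral_lborel_translate[of "\<lambda>x. ennreal (p x)" "- y"] bump_integral_reflect(4)[OF b] by simp
    then show "(\<integral>\<^sup>+x. ennreal (p (x - y)) * h y \<partial>lborel) = h y"
      by (simp add: nn_integral_multc)
  qed
  finally show ?thesis .
qed

text \<open>Replace \<open>f\<close> by a uniformly continuous \<open>G\<close> close to it in
  \<open>L2\<close>: averaging does not enlarge the \<open>L2\<close> error, and \<open>G\<close>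
  oscillates little at small scales. The threshold \<open>e0\<close> is valid for all kernels, so a
  single kernel can later serve the solution and the drift.\<close>

lemma osc_fun_tendsto:
  fixes f :: "'a::euclidean_space \<Rightarrow> 'b::euclidean_space"
  assumes [measurable]: "f \<in> borel_measurable borel" "A \<in> sets borel"
    and fin: "(\<integral>\<^sup>+x. ennreal ((norm (f x))\<^sup>2) \<partial>lborel) < \<infinity>" and A: "emeasure lborel A < \<infinity>" and \<delta>: "\<delta> > 0"
  obtains e0 where "e0 > 0" "\<And>e p. bump e p \<Longrightarrow> e \<le> e0 \<Longrightarrow>
    (\<integral>\<^sup>+x\<in>A. osc_fun p f x \<partial>lborel) \<le> ennreal \<delta>"
proof -
  obtain G R where G: "continuous_on UNIV G" "\<And>x. R < norm x \<Longrightarrow> G x = 0"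
    and fG: "(\<integral>\<^sup>+x. ennreal ((norm (f x - G x))\<^sup>2) \<partial>lborel) \<le> ennreal (\<delta> / 16)"
    using L2_approx_continuous[OF assms(1) fin, of "\<delta> / 16"] \<delta> by auto
  have [measurable]: "G \<in> borel_measurable borel" using G borel_measurable_continuous_onI by blast
  define a where "a = measure lborel A"
  have a0: "a \<ge> 0" "emeasure lborel A = ennreal a" using A by (auto simp: a_def emeasure_eq_ennreal_measure)
  \<comment> \<open>Chosen so that the oscillation of \<open>G\<close>, which contributes
    \<open>2 * \<omega>\<^sup>2\<close> times the measure of \<open>A\<close>, stays below
    \<open>\<delta> / 2\<close>; the two approximation errors contribute
    \<open>4 * (\<delta> / 16)\<close> each.\<close>
  define \<omega> where "\<omega> = sqrt (\<delta> / (4 * (a + 1)))"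
  have om: "\<omega> > 0" "2 * (a * \<omega>\<^sup>2) \<le> \<delta> / 2"
    using \<delta> a0 by (auto simp: \<omega>_def field_simps)
  obtain d where d: "d > 0" "\<And>x y. norm (x - y) < d \<Longrightarrow> norm (G x - G y) < \<omega>"
    using uniformly_continuous_bounded_support[OF G om(1)] by blast
  show thesis
  proof (rule that[OF d(1)])
    fix e and p :: "'a \<Rightarrow> real" assume b: "bump e p" and e: "e \<le> d"
    have [measurable]: "p \<in> borel_measurable borel" using bumpD[OF b] by simp
    define h where "h x = ennreal ((norm (f x - G x))\<^sup>2)" for x
    have [measurable]: "h \<in> borel_measurable borel" unfolding h_def by measurable
    have pt: "ennreal (p (x - y) * (norm (f y - f x))\<^sup>2) \<le>
        4 * (ennreal (p (x - y)) * h y) + 4 * (ennreal (p (x - y)) * h x) + ennreal (2 * \<omega>\<^sup>2) * ennreal (p (x - y))" for x y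
    proof (cases "norm (x - y) < e")
      case False then show ?thesis using bumpD(3)[OF b, of "x - y"] by simp
    next
      case True
      have "(norm (f y - f x))\<^sup>2 \<le> 4 * (norm (f y - G y))\<^sup>2 + 4 * (norm (f x - G x))\<^sup>2 + 2 * (norm (G y - G x))\<^sup>2"
        using norm_add3_sq_le[of "f y - G y" "- (f x - G x)" "G y - G x"] by (simp add: norm_minus_commute)
      moreover have "(norm (G y - G x))\<^sup>2 \<le> \<omega>\<^sup>2"
        using d(2)[of y x] True e by (intro power_mono) (auto simp: norm_minus_commute)
      ultimately have "p (x - y) * (norm (f y - f x))\<^sup>2 \<le> p (x - y) * (4 * (norm (f y - G y))\<^sup>2 + 4 * (norm (f x - G x))\<^sup>2 + 2 * \<omega>\<^sup>2)"
        using bumpD(2)[OF b] by (intro mult_left_mono) linarith+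
      also have "\<dots> = 4 * (p (x - y) * (norm (f y - G y))\<^sup>2) + 4 * (p (x - y) * (norm (f x - G x))\<^sup>2) + (2 * \<omega>\<^sup>2) * p (x - y)"
        by (simp add: algebra_simps)
      finally show ?thesis unfolding h_def using bumpD(2)[OF b]
        by (simp add: ennreal_leI flip: ennreal_mult' ennreal_plus ennreal_numeral ennreal_mult)
    qed
    have 1: "osc_fun p f x \<le> 4 * (\<integral>\<^sup>+y. ennreal (p (x - y)) * h y \<partial>lborel) + (4 * h x + ennreal (2 * \<omega>\<^sup>2))" for x
    proof -
      have "osc_fun p f x \<le> (\<integral>\<^sup>+y. 4 * (ennreal (p (x - y)) * h y) + 4 * (ennreal (p (x - y)) * h x) + ennreal (2 * \<omega>\<^sup>2) * ennreal (p (x - y)) \<partial>lborel)"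
        unfolding osc_fun_def by (intro nn_integral_mono pt)
      also have "\<dots> = 4 * (\<integral>\<^sup>+y. ennreal (p (x - y)) * h y \<partial>lborel) + 4 * ((\<integral>\<^sup>+y. ennreal (p (x - y)) \<partial>lborel) * h x)
          + ennreal (2 * \<omega>\<^sup>2) * (\<integral>\<^sup>+y. ennreal (p (x - y)) \<partial>lborel)"
        by (simp add: nn_integral_add nn_integral_cmult nn_integral_multc)
      finally show ?thesis using bump_integral_reflect(3)[OF b] by (simp add: add.assoc)
    qed
    have "(\<integral>\<^sup>+x\<in>A. osc_fun p f x \<partial>lborel) \<le>
      (\<integral>\<^sup>+x. 4 * (\<integral>\<^sup>+y. ennreal (p (x - y)) * h y \<partial>lborel) + (4 * h x + ennreal (2 * \<omega>\<^sup>2) * indicator A x) \<partial>lborel)"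
      using 1 by (intro nn_integral_mono) (auto simp: indicator_def)
    also have "\<dots> = 4 * (\<integral>\<^sup>+x. \<integral>\<^sup>+y. ennreal (p (x - y)) * h y \<partial>lborel \<partial>lborel) +
       (4 * (\<integral>\<^sup>+x. h x \<partial>lborel) + ennreal (2 * \<omega>\<^sup>2) * emeasure lborel A)"
      by (simp add: nn_integral_add nn_integral_cmult nn_integral_cmult_indicator)
    also have "\<dots> = 4 * (\<integral>\<^sup>+x. h x \<partial>lborel) + (4 * (\<integral>\<^sup>+x. h x \<partial>lborel) + ennreal (2 * (a * \<omega>\<^sup>2)))"
      using a0 by (subst nn_integral_bump_swap[OF b]) (auto simp flip: ennreal_mult' simp: ac_simps)
    also have "\<dots> \<le> 4 * ennreal (\<delta> / 16) + (4 * ennreal (\<delta> / 16) + ennreal (\<delta> / 2))"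
      using fG om(2) unfolding h_def by (intro add_mono mult_left_mono ennreal_leI) auto
    also have "\<dots> = ennreal \<delta>"
      using \<delta> by (simp flip: ennreal_mult' ennreal_plus ennreal_numeral)
    finally show "(\<integral>\<^sup>+x\<in>A. osc_fun p f x \<partial>lborel) \<le> ennreal \<delta>" .
  qed
qed

text \<open>Cauchy-Schwarz with \<open>p\<close> split into two square roots; the square of one of
  them integrates to one. A bounded weight \<open>h\<close> costs only the square of its
  bound.\<close>

lemma weighted_osc_bound:
  fixes f :: "'a::euclidean_space \<Rightarrow> 'b::euclidean_space"
  assumes b: "bump e p" and [measurable]: "f \<in> borel_measurable borel" "h \<in> borel_measurable borel"
    and f: "integrable lborel f" and h: "\<And>y. \<bar>h y\<bar> \<le> C"
  shows "integrable lborel (\<lambda>y. (p (x - y) * h y) *\<^sub>R (f y - f x))"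
    and "ennreal ((norm (\<integral>y. (p (x - y) * h y) *\<^sub>R (f y - f x) \<partial>lborel))\<^sup>2) \<le> ennreal (C\<^sup>2) * osc_fun p f x"
proof -
  have [measurable]: "p \<in> borel_measurable borel" using bumpD[OF b] by simp
  have C0: "0 \<le> C" using h[of 0] by linarith
  have "integrable lborel (\<lambda>y. h y *\<^sub>R (p (x - y) *\<^sub>R f y - p (x - y) *\<^sub>R f x))"
    by (rule integrable_scaleR_bounded[OF _ _ h])
       (use integrable_mollify[OF b f] bump_integral_reflect(1)[OF b] in auto)
  then show i: "integrable lborel (\<lambda>y. (p (x - y) * h y) *\<^sub>R (f y - f x))"
    by (simp add: scaleR_diff_right mult.commute)
  have "ennreal (norm (\<integral>y. (p (x - y) * h y) *\<^sub>R (f y - f x) \<partial>lborel)) \<le>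
      (\<integral>\<^sup>+y. ennreal (norm ((p (x - y) * h y) *\<^sub>R (f y - f x))) \<partial>lborel)"
    by (rule integral_norm_bound_ennreal[OF i])
  also have "\<dots> \<le> (\<integral>\<^sup>+y. ennreal C * (ennreal (sqrt (p (x - y))) * ennreal (sqrt (p (x - y)) * norm (f y - f x))) \<partial>lborel)"
  proof (rule nn_integral_mono)
    fix y
    have p0: "0 \<le> p (x - y)" by (rule bumpD(2)[OF b])
    have "norm ((p (x - y) * h y) *\<^sub>R (f y - f x)) \<le> C * (p (x - y) * norm (f y - f x))"
      using mult_right_mono[OF h[of y], of "p (x - y) * norm (f y - f x)"] p0 by (simp add: abs_mult ac_simps)
    also have "\<dots> = C * (sqrt (p (x - y)) * (sqrt (p (x - y)) * norm (f y - f x)))"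
      using p0 by (simp flip: mult.assoc)
    finally show "ennreal (norm ((p (x - y) * h y) *\<^sub>R (f y - f x))) \<le>
       ennreal C * (ennreal (sqrt (p (x - y))) * ennreal (sqrt (p (x - y)) * norm (f y - f x)))"
      using C0 p0 by (simp add: ennreal_leI flip: ennreal_mult)
  qed
  also have "\<dots> = ennreal C * (\<integral>\<^sup>+y. ennreal (sqrt (p (x - y))) * ennreal (sqrt (p (x - y)) * norm (f y - f x)) \<partial>lborel)"
    by (rule nn_integral_cmult) measurable
  finally have 1: "(ennreal (norm (\<integral>y. (p (x - y) * h y) *\<^sub>R (f y - f x) \<partial>lborel)))\<^sup>2 \<le>
     (ennreal C * (\<integral>\<^sup>+y. ennreal (sqrt (p (x - y))) * ennreal (sqrt (p (x - y)) * norm (f y - f x)) \<partial>lborel))\<^sup>2"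
    by (rule power_mono) simp
  have "(\<integral>\<^sup>+y. ennreal (sqrt (p (x - y))) * ennreal (sqrt (p (x - y)) * norm (f y - f x)) \<partial>lborel)\<^sup>2 \<le>
     (\<integral>\<^sup>+y. (ennreal (sqrt (p (x - y))))\<^sup>2 \<partial>lborel) * (\<integral>\<^sup>+y. (ennreal (sqrt (p (x - y)) * norm (f y - f x)))\<^sup>2 \<partial>lborel)"
    by (rule Cauchy_Schwarz_nn_integral) measurable
  also have "\<dots> = osc_fun p f x"
    using bumpD(2)[OF b] bump_integral_reflect(3)[OF b, of x]
    by (simp add: osc_fun_def ennreal_power power_mult_distrib)
  finally have 2: "(\<integral>\<^sup>+y. ennreal (sqrt (p (x - y))) * ennreal (sqrt (p (x - y)) * norm (f y - f x)) \<partial>lborel)\<^sup>2 \<le> osc_fun p f x" .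
  have "(ennreal C * (\<integral>\<^sup>+y. ennreal (sqrt (p (x - y))) * ennreal (sqrt (p (x - y)) * norm (f y - f x)) \<partial>lborel))\<^sup>2 \<le>
    ennreal (C\<^sup>2) * osc_fun p f x"
    using mult_left_mono[OF 2, of "ennreal (C\<^sup>2)"] C0 by (simp add: power_mult_distrib ennreal_power)
  with 1 show "ennreal ((norm (\<integral>y. (p (x - y) * h y) *\<^sub>R (f y - f x) \<partial>lborel))\<^sup>2) \<le> ennreal (C\<^sup>2) * osc_fun p f x"
    by (simp add: ennreal_power order_trans)
qed

lemma mollify_diff_bound:
  fixes f :: "'a::euclidean_space \<Rightarrow> 'b::euclidean_space"
  assumes b: "bump e p" and [measurable]: "f \<in> borel_measurable borel" and f: "integrable lborel f"
  shows "ennreal ((norm (mollify p f x - f x))\<^sup>2) \<le> osc_fun p f x"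
proof -
  have "(\<integral>y. (p (x - y) * 1) *\<^sub>R (f y - f x) \<partial>lborel) = mollify p f x - f x"
    using bump_integral_reflect(1,2)[OF b, of x] integrable_mollify[OF b f, of x]
    by (simp add: scaleR_diff_right mollify_def)
  then show ?thesis using weighted_osc_bound(2)[OF b assms(2) _ f, of "\<lambda>_. 1" 1 x] by simp
qed

text \<open>The factor \<open>u y - mollify p u x\<close> has weighted mean zero, so \<open>f y\<close> may be replaced
  by \<open>f y - f x\<close>.\<close>

lemma mollify_commutator_bound:
  fixes f :: "'a::euclidean_space \<Rightarrow> 'b::euclidean_space"
  assumes b: "bump e p" and [measurable]: "f \<in> borel_measurable borel" "u \<in> borel_measurable borel"
    and f: "integrable lborel f" and u: "integrable lborel u" "\<And>y. \<bar>u y\<bar> \<le> M"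
  shows "ennreal ((norm (mollify p (\<lambda>y. u y *\<^sub>R f y) x - mollify p u x *\<^sub>R mollify p f x))\<^sup>2) \<le> ennreal (4 * M\<^sup>2) * osc_fun p f x"
proof -
  define v where "v = mollify p u x"
  have v: "\<bar>v\<bar> \<le> M" unfolding v_def by (rule mollify_bound[OF b u])
  have uf: "integrable lborel (\<lambda>y. u y *\<^sub>R f y)" by (rule integrable_scaleR_bounded[OF f _ u(2)]) measurable
  have "(\<integral>y. (p (x - y) * (u y - v)) *\<^sub>R (f y - f x) \<partial>lborel) =
     (\<integral>y. (p (x - y) *\<^sub>R (u y *\<^sub>R f y) - v *\<^sub>R (p (x - y) *\<^sub>R f y)) - ((p (x - y) * u y - v * p (x - y)) *\<^sub>R f x) \<partial>lborel)"
    by (intro Bochner_Integration.integral_cong) (auto simp: algebra_simps)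
  also have "\<dots> = mollify p (\<lambda>y. u y *\<^sub>R f y) x - v *\<^sub>R mollify p f x"
  proof -
    have "integrable lborel (\<lambda>y. p (x - y) * u y)" "(\<integral>y. p (x - y) * u y \<partial>lborel) = v"
      using integrable_mollify[OF b u(1), of x] by (simp_all add: v_def mollify_def)
    then show ?thesis
      using bump_integral_reflect(1,2)[OF b, of x] integrable_mollify[OF b f, of x] integrable_mollify[OF b uf, of x]
      by (simp add: mollify_def del: scaleR_scaleR)
  qed
  finally have eq: "(\<integral>y. (p (x - y) * (u y - v)) *\<^sub>R (f y - f x) \<partial>lborel) = mollify p (\<lambda>y. u y *\<^sub>R f y) x - v *\<^sub>R mollify p f x" .
  \<comment> \<open>Both \<open>u\<close> and its average are bounded by \<open>M\<close>; squaring
    the weight bound gives the factor \<open>4 * M\<^sup>2\<close>.\<close>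
  have d: "\<bar>u y - v\<bar> \<le> 2 * M" for y using u(2)[of y] v by linarith
  have "ennreal ((norm (\<integral>y. (p (x - y) * (u y - v)) *\<^sub>R (f y - f x) \<partial>lborel))\<^sup>2) \<le> ennreal ((2 * M)\<^sup>2) * osc_fun p f x"
    by (rule weighted_osc_bound(2)[OF b _ _ f d]) measurable
  from this[unfolded eq] show ?thesis by (simp add: power_mult_distrib v_def)
qed

subsection \<open>Smooth approximate solutions\<close>

text \<open>The two signs produced by the reflection cancel.\<close>

lemma laplacian_reflect:
  assumes "C_k (Suc (Suc 0)) p"
  shows "laplacian (\<lambda>y. p (x - y)) y = laplacian p (x - y)"
proof -
  have "partial_deriv i (partial_deriv i (\<lambda>y. p (x - y))) y = partial_deriv i (partial_deriv i p) (x - y)"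
    if i: "i \<in> Basis" for i
  proof -
    have p: "has_grad p (grad p)" by (rule has_grad_C_k[OF assms])
    have q: "has_grad (partial_deriv i p) (grad (partial_deriv i p))"
      using assms i by (intro has_grad_C_k[of 0]) simp
    have "partial_deriv i (\<lambda>y. p (x - y)) = (\<lambda>y. (-1) * partial_deriv i p (x - y))"
      by (simp add: fun_eq_iff partial_deriv_has_grad[OF has_grad_reflect[OF p]] partial_deriv_has_grad[OF p])
    then show ?thesis
      by (simp only: partial_deriv_has_grad[OF has_grad_cmult[OF has_grad_reflect[OF q]]] partial_deriv_has_grad[OF q]) simp
  qed
  then show ?thesis by (simp add: laplacian_def)
qed

lemma L2_imp_integrable_bounded_support:
  fixes f :: "'a::euclidean_space \<Rightarrow> 'b::euclidean_space"
  assumes [measurable]: "f \<in> borel_measurable borel" and s: "\<And>x. r < norm x \<Longrightarrow> f x = 0"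
    and fin: "(\<integral>\<^sup>+x. ennreal ((norm (f x))\<^sup>2) \<partial>lborel) < \<infinity>"
  shows "integrable lborel f"
proof (rule integrableI_bounded)
  have "(\<integral>\<^sup>+x. ennreal (norm (f x)) \<partial>lborel) \<le> (\<integral>\<^sup>+x. ennreal ((norm (f x))\<^sup>2) + indicator (cball 0 r) x \<partial>lborel)"
  proof (rule nn_integral_mono)
    fix x
    show "ennreal (norm (f x)) \<le> ennreal ((norm (f x))\<^sup>2) + indicator (cball 0 r) x"
    proof (cases "norm x \<le> r")
      case True
      have "norm (f x) \<le> (norm (f x))\<^sup>2 + 1"
      proof -
        have "0 \<le> norm (f x)" "2 * norm (f x) \<le> (norm (f x))\<^sup>2 + 1"
          using sum_squares_bound[of "norm (f x)" 1] by simp_all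
        then show ?thesis by linarith
      qed
      then have "ennreal (norm (f x)) \<le> ennreal ((norm (f x))\<^sup>2 + 1)" by (rule ennreal_leI)
      then show ?thesis using True by simp
    qed (simp add: s)
  qed
  also have "\<dots> = (\<integral>\<^sup>+x. ennreal ((norm (f x))\<^sup>2) \<partial>lborel) + emeasure lborel (cball (0::'a) r)"
    by (subst nn_integral_add) (auto intro!: borel_measurable_indicator)
  also have "\<dots> < \<infinity>" using fin emeasure_lborel_cball_finite[of "0::'a" r] by simp
  finally show "(\<integral>\<^sup>+x. ennreal (norm (f x)) \<partial>lborel) < \<infinity>" .
qed measurable

lemma bounded_imp_L2_bounded_support:
  fixes f :: "'a::euclidean_space \<Rightarrow> real"
  assumes "\<And>x. r < norm x \<Longrightarrow> f x = 0" "\<And>x. \<bar>f x\<bar> \<le> M"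
  shows "(\<integral>\<^sup>+x. ennreal ((norm (f x))\<^sup>2) \<partial>lborel) < \<infinity>"
proof -
  have "(\<integral>\<^sup>+x. ennreal ((norm (f x))\<^sup>2) \<partial>lborel) \<le> (\<integral>\<^sup>+x. ennreal (M\<^sup>2) * indicator (cball 0 r) (x::'a) \<partial>lborel)"
  proof (rule nn_integral_mono)
    fix x
    have "(f x)\<^sup>2 \<le> M\<^sup>2" using assms(2)[of x] by (intro power2_le_iff_abs_le[THEN iffD2]) auto
    then show "ennreal ((norm (f x))\<^sup>2) \<le> ennreal (M\<^sup>2) * indicator (cball 0 r) x"
      using assms(1)[of x] by (auto simp: indicator_def not_le)
  qed
  also have "\<dots> = ennreal (M\<^sup>2) * emeasure lborel (cball (0::'a) r)"
    by (simp add: nn_integral_cmult_indicator)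
  also have "\<dots> < \<infinity>" using emeasure_lborel_cball_finite[of "0::'a" r] by (simp add: ennreal_mult_less_top)
  finally show ?thesis .
qed

text \<open>Here \<open>\<beta>\<close> is the mollified drift and \<open>r\<close> the commutator of mollification with the
  product of solution and drift. The equation holds away from the boundary layer of width \<open>\<delta>\<close>
  that is lost in mollifying.\<close>

definition approx_solution ::
  "real \<Rightarrow> ('a::euclidean_space \<Rightarrow> real) \<Rightarrow> ('a \<Rightarrow> 'a) \<Rightarrow> ('a \<Rightarrow> 'a) \<Rightarrow> ('a \<Rightarrow> 'a) \<Rightarrow> bool" where
  "approx_solution \<delta> v g \<beta> r \<longleftrightarrow> has_grad v g \<and> continuous_on UNIV \<beta> \<and> continuous_on UNIV r \<and>
     (\<forall>\<psi> \<gamma>. has_grad \<psi> \<gamma> \<longrightarrow> (\<forall>x. 1 - \<delta> < norm x \<longrightarrow> \<psi> x = 0) \<longrightarrow>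
        (\<integral>x. g x \<bullet> \<gamma> x \<partial>lborel) = (\<integral>x. (v x *\<^sub>R \<beta> x + r x) \<bullet> \<gamma> x \<partial>lborel) \<and>
        (\<integral>x. \<beta> x \<bullet> \<gamma> x \<partial>lborel) = 0) \<and>
     (\<integral>\<^sup>+x\<in>ball 0 1. ennreal ((norm (r x))\<^sup>2) \<partial>lborel) \<le> ennreal \<delta>"

text \<open>Integration by parts of a mollified field against a test function brings in
  \<open>\<integral> F y \<bullet> grad p (x - y) dy\<close>, the divergence of the mollified field.\<close>

lemma mollify_field_parts:
  fixes F :: "'a::euclidean_space \<Rightarrow> 'a"
  assumes b: "bump e p" and F: "integrable lborel F" and \<psi>: "has_grad \<psi> \<gamma>" "\<And>x. s < norm x \<Longrightarrow> \<psi> x = 0"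
  shows "continuous_on UNIV (mollify p F)"
    and "(\<integral>x. mollify p F x \<bullet> \<gamma> x \<partial>lborel) = - (\<integral>x. (\<integral>y. F y \<bullet> grad p (x - y) \<partial>lborel) * \<psi> x \<partial>lborel)"
proof -
  have pg: "has_grad p (grad p)" by (rule bump_has_grad[OF b])
  have p0: "p x = 0" if "e < norm x" for x using bumpD(3)[OF b] that by simp
  have gp0: "grad p x = 0" if "e < norm x" for x by (rule has_grad_zero_outside[OF pg p0 that])
  define H where "H i x = (\<integral>y. (F y \<bullet> i) *\<^sub>R grad p (x - y) \<partial>lborel)" for i x
  have Fi: "integrable lborel (\<lambda>y. F y \<bullet> i)" for i using F by simp
  have hg: "has_grad (\<lambda>x. mollify p F x \<bullet> i) (H i)" for i
    unfolding mollify_inner[OF b F] H_def by (rule has_grad_mollify[OF Fi pg]) (rule p0)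
  have Hi: "integrable lborel (\<lambda>y. (F y \<bullet> i) *\<^sub>R grad p (x - y))" for i x
    by (rule continuous_convolution(2)[OF Fi has_grad_continuous_grad[OF pg]]) (rule gp0)
  have "continuous_on UNIV (\<lambda>x. \<Sum>i\<in>Basis. (mollify p F x \<bullet> i) *\<^sub>R i)"
    by (intro continuous_intros has_grad_continuous[OF hg])
  then show c: "continuous_on UNIV (mollify p F)" by (simp add: euclidean_representation)
  have \<gamma>0: "\<gamma> x = 0" if "s < norm x" for x by (rule has_grad_zero_outside[OF \<psi> that])
  have i1: "integrable lborel (\<lambda>x. (mollify p F x \<bullet> i) * (\<gamma> x \<bullet> i))" for i
    by (rule integrable_continuous_bounded_support[where r=s])
      (use \<gamma>0 in \<open>auto intro!: continuous_intros c has_grad_continuous_grad[OF \<psi>(1)]\<close>)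
  have i2: "integrable lborel (\<lambda>x. (H i x \<bullet> i) * \<psi> x)" for i
    by (rule integrable_continuous_bounded_support[where r=s])
      (use \<psi>(2) in \<open>auto intro!: continuous_intros has_grad_continuous_grad[OF hg] has_grad_continuous[OF \<psi>(1)]\<close>)
  have div: "(\<Sum>i\<in>Basis. H i x \<bullet> i) = (\<integral>y. F y \<bullet> grad p (x - y) \<partial>lborel)" for x
  proof -
    have "(\<Sum>i\<in>Basis. H i x \<bullet> i) = (\<Sum>i\<in>Basis. \<integral>y. ((F y \<bullet> i) *\<^sub>R grad p (x - y)) \<bullet> i \<partial>lborel)"
      unfolding H_def by (intro sum.cong refl integral_inner_left[symmetric] Hi)
    also have "\<dots> = (\<integral>y. (\<Sum>i\<in>Basis. ((F y \<bullet> i) *\<^sub>R grad p (x - y)) \<bullet> i) \<partial>lborel)"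
      by (rule Bochner_Integration.integral_sum[symmetric]) (intro integrable_inner_left Hi)
    also have "\<dots> = (\<integral>y. F y \<bullet> grad p (x - y) \<partial>lborel)"
      by (subst euclidean_inner) simp
    finally show ?thesis .
  qed
  have "(\<integral>x. mollify p F x \<bullet> \<gamma> x \<partial>lborel) = (\<Sum>i\<in>Basis. \<integral>x. (mollify p F x \<bullet> i) * (\<gamma> x \<bullet> i) \<partial>lborel)"
    using i1 by (subst euclidean_inner) simp
  also have "\<dots> = (\<Sum>i\<in>Basis. - (\<integral>x. (H i x \<bullet> i) * \<psi> x \<partial>lborel))"
    using grad_integral_by_parts[OF hg \<psi>(1), of s] \<psi>(2) by simp
  also have "\<dots> = - (\<integral>x. (\<Sum>i\<in>Basis. H i x \<bullet> i) * \<psi> x \<partial>lborel)"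
    using i2 by (simp add: sum_negf sum_distrib_right)
  finally show "(\<integral>x. mollify p F x \<bullet> \<gamma> x \<partial>lborel) = - (\<integral>x. (\<integral>y. F y \<bullet> grad p (x - y) \<partial>lborel) * \<psi> x \<partial>lborel)"
    unfolding div .
qed

text \<open>Each component of the gradient is a convolution of \<open>u\<close> with a partial
  derivative of the kernel and can be differentiated once more. The second derivatives fall on the
  kernel again and add up to its Laplacian, the form in which the distributional equation
  enters.\<close>

lemma mollify_gradient_parts:
  fixes u :: "'a::euclidean_space \<Rightarrow> real"
  assumes b: "bump e p" and u: "integrable lborel u" and \<psi>: "has_grad \<psi> \<gamma>" "\<And>x. s < norm x \<Longrightarrow> \<psi> x = 0"
  shows "(\<integral>x. (\<integral>y. u y *\<^sub>R grad p (x - y) \<partial>lborel) \<bullet> \<gamma> x \<partial>lborel) =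
    - (\<integral>x. (\<integral>y. u y * laplacian p (x - y) \<partial>lborel) * \<psi> x \<partial>lborel)"
proof -
  have pg: "has_grad p (grad p)" by (rule bump_has_grad[OF b])
  have p0: "p x = 0" if "e < norm x" for x using bumpD(3)[OF b] that by simp
  have gp0: "grad p x = 0" if "e < norm x" for x by (rule has_grad_zero_outside[OF pg p0 that])
  define g where "g x = (\<integral>y. u y *\<^sub>R grad p (x - y) \<partial>lborel)" for x
  define H where "H i x = (\<integral>y. u y *\<^sub>R grad (partial_deriv i p) (x - y) \<partial>lborel)" for i x
  have qg: "has_grad (partial_deriv i p) (grad (partial_deriv i p))" if "i \<in> Basis" for i
    by (rule bump_partial_has_grad[OF b that])
  have q0: "partial_deriv i p x = 0" if "e < norm x" for x i
    using gp0[OF that] partial_deriv_has_grad[OF pg, of i x] by simp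
  have gq0: "grad (partial_deriv i p) x = 0" if "i \<in> Basis" "e < norm x" for x i
    by (rule has_grad_zero_outside[OF qg[OF that(1)] q0 that(2)])
  have gi: "integrable lborel (\<lambda>y. u y *\<^sub>R grad p (x - y))" for x
    by (rule continuous_convolution(2)[OF u has_grad_continuous_grad[OF pg]]) (rule gp0)
  have Hi: "integrable lborel (\<lambda>y. u y *\<^sub>R grad (partial_deriv i p) (x - y))" if "i \<in> Basis" for i x
    by (rule continuous_convolution(2)[OF u has_grad_continuous_grad[OF qg[OF that]]]) (rule gq0[OF that])
  have gc: "continuous_on UNIV g" unfolding g_def
    by (rule continuous_convolution(1)[OF u has_grad_continuous_grad[OF pg]]) (rule gp0)
  have g_eq: "g x \<bullet> i = mollify (partial_deriv i p) u x" for x i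
  proof -
    have "g x \<bullet> i = (\<integral>y. (u y *\<^sub>R grad p (x - y)) \<bullet> i \<partial>lborel)"
      unfolding g_def by (rule integral_inner_left[symmetric]) (rule gi)
    then show ?thesis by (simp add: mollify_def partial_deriv_has_grad[OF pg] mult.commute)
  qed
  have hg: "has_grad (\<lambda>x. g x \<bullet> i) (H i)" if "i \<in> Basis" for i
    unfolding g_eq H_def by (rule has_grad_mollify[OF u qg[OF that]]) (rule q0)
  have \<gamma>0: "\<gamma> x = 0" if "s < norm x" for x by (rule has_grad_zero_outside[OF \<psi> that])
  have i1: "integrable lborel (\<lambda>x. (g x \<bullet> i) * (\<gamma> x \<bullet> i))" for i
    by (rule integrable_continuous_bounded_support[where r=s])
      (use \<gamma>0 in \<open>auto intro!: continuous_intros gc has_grad_continuous_grad[OF \<psi>(1)]\<close>)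
  have i2: "integrable lborel (\<lambda>x. (H i x \<bullet> i) * \<psi> x)" if "i \<in> Basis" for i
    by (rule integrable_continuous_bounded_support[where r=s])
      (use \<psi>(2) in \<open>auto intro!: continuous_intros has_grad_continuous_grad[OF hg[OF that]] has_grad_continuous[OF \<psi>(1)]\<close>)
  have lap: "(\<Sum>i\<in>Basis. H i x \<bullet> i) = (\<integral>y. u y * laplacian p (x - y) \<partial>lborel)" for x
  proof -
    have "(\<Sum>i\<in>Basis. H i x \<bullet> i) = (\<Sum>i\<in>Basis. \<integral>y. (u y *\<^sub>R grad (partial_deriv i p) (x - y)) \<bullet> i \<partial>lborel)"
      unfolding H_def by (intro sum.cong refl integral_inner_left[symmetric] Hi)
    also have "\<dots> = (\<integral>y. (\<Sum>i\<in>Basis. (u y *\<^sub>R grad (partial_deriv i p) (x - y)) \<bullet> i) \<partial>lborel)"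
      by (rule Bochner_Integration.integral_sum[symmetric]) (intro integrable_inner_left Hi)
    also have "\<dots> = (\<integral>y. u y * laplacian p (x - y) \<partial>lborel)"
      using partial_deriv_has_grad[OF qg] by (simp add: laplacian_def sum_distrib_left)
    finally show ?thesis .
  qed
  have "(\<integral>x. g x \<bullet> \<gamma> x \<partial>lborel) = (\<Sum>i\<in>Basis. \<integral>x. (g x \<bullet> i) * (\<gamma> x \<bullet> i) \<partial>lborel)"
    using i1 by (subst euclidean_inner) simp
  also have "\<dots> = (\<Sum>i\<in>Basis. - (\<integral>x. (H i x \<bullet> i) * \<psi> x \<partial>lborel))"
    using grad_integral_by_parts[OF hg \<psi>(1), of _ s] \<psi>(2) by simp
  also have "\<dots> = - (\<integral>x. (\<Sum>i\<in>Basis. H i x \<bullet> i) * \<psi> x \<partial>lborel)"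
    using i2 by (simp add: sum_negf sum_distrib_right)
  finally show ?thesis unfolding lap g_def .
qed

text \<open>Solution, drift and their product are mollified with one kernel. At distance more than
  the kernel scale from the unit sphere the shifted kernel is a test function, so there the
  distributional equation becomes a pointwise identity between convolutions.\<close>

lemma ex_approx_solution:
  fixes u :: "'a::euclidean_space \<Rightarrow> real" and b :: "'a \<Rightarrow> 'a"
  assumes [measurable]: "u \<in> borel_measurable borel" "b \<in> borel_measurable borel"
    and u0: "\<And>x. 1 < norm x \<Longrightarrow> u x = 0" and uM: "\<And>x. \<bar>u x\<bar> \<le> M"
    and b0: "\<And>x. 1 < norm x \<Longrightarrow> b x = 0" and b2: "(\<integral>\<^sup>+x. ennreal ((norm (b x))\<^sup>2) \<partial>lborel) < \<infinity>"
    and div: "\<And>w. w \<in> test_functions (ball 0 1) \<Longrightarrow> (\<integral>x. b x \<bullet> grad w x \<partial>lborel) = 0"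
    and eq: "\<And>w. w \<in> test_functions (ball 0 1) \<Longrightarrow> (\<integral>x. u x * laplacian w x + u x * (b x \<bullet> grad w x) \<partial>lborel) = 0"
    and \<delta>: "0 < \<delta>"
  obtains v g \<beta> r where "approx_solution \<delta> v g \<beta> r" "\<And>x. \<bar>v x\<bar> \<le> M"
    "(\<integral>\<^sup>+x\<in>ball 0 1. ennreal ((norm (\<beta> x - b x))\<^sup>2) \<partial>lborel) \<le> ennreal \<delta>"
    "(\<integral>\<^sup>+x\<in>ball 0 1. ennreal ((norm (v x - u x))\<^sup>2) \<partial>lborel) \<le> ennreal \<delta>"
proof -
  have u2: "(\<integral>\<^sup>+x. ennreal ((norm (u x))\<^sup>2) \<partial>lborel) < \<infinity>"
    by (rule bounded_imp_L2_bounded_support[OF u0 uM])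
  have ui: "integrable lborel u" by (rule L2_imp_integrable_bounded_support[OF _ u0 u2]) measurable
  have bi: "integrable lborel b" by (rule L2_imp_integrable_bounded_support[OF _ b0 b2]) measurable
  have ubi: "integrable lborel (\<lambda>y. u y *\<^sub>R b y)" by (rule integrable_scaleR_bounded[OF bi _ uM]) measurable
  \<comment> \<open>The commutator bound carries the factor \<open>4 * M\<^sup>2\<close>; the added
    1 keeps the denominator positive and also gives \<open>\<delta>1 \<le> \<delta>\<close>.\<close>
  define \<delta>1 where "\<delta>1 = \<delta> / (4 * M\<^sup>2 + 1)"
  have c0: "4 * M\<^sup>2 + 1 > 0" by (simp add: add_nonneg_pos)
  have d1: "\<delta>1 > 0" "4 * M\<^sup>2 * \<delta>1 \<le> \<delta>" "\<delta>1 \<le> \<delta>"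
  proof -
    show "\<delta>1 > 0" unfolding \<delta>1_def using \<delta> c0 by (rule divide_pos_pos)
    have "(4 * M\<^sup>2 + 1) * \<delta>1 = \<delta>" unfolding \<delta>1_def using c0 by simp
    then show "4 * M\<^sup>2 * \<delta>1 \<le> \<delta>" "\<delta>1 \<le> \<delta>" using \<open>\<delta>1 > 0\<close> by (simp_all add: distrib_right) (smt (verit) mult_nonneg_nonneg zero_le_power2)
  qed
  have fin: "emeasure lborel (ball (0::'a) 1) < \<infinity>" by (rule emeasure_lborel_ball_finite)
  obtain e1 where e1: "e1 > 0" "\<And>e p. bump e p \<Longrightarrow> e \<le> e1 \<Longrightarrow>
      (\<integral>\<^sup>+x\<in>ball 0 1. osc_fun p b x \<partial>lborel) \<le> ennreal \<delta>1"
    using osc_fun_tendsto[of b "ball 0 1", OF _ _ b2 fin d1(1)] by auto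
  obtain e2 where e2: "e2 > 0" "\<And>e p. bump e p \<Longrightarrow> e \<le> e2 \<Longrightarrow>
      (\<integral>\<^sup>+x\<in>ball 0 1. osc_fun p u x \<partial>lborel) \<le> ennreal \<delta>"
    using osc_fun_tendsto[of u "ball 0 1", OF _ _ u2 fin \<delta>] by auto
  \<comment> \<open>The last entry gives \<open>e < \<delta>\<close>, so that kernels centred at
    points with \<open>norm x \<le> 1 - \<delta>\<close> are supported inside the ball.\<close>
  define e where "e = min (min e1 e2) (\<delta> / 2)"
  have e: "e > 0" "e \<le> e1" "e \<le> e2" "e < \<delta>" using e1 e2 \<delta> by (auto simp: e_def)
  obtain p :: "'a \<Rightarrow> real" where b: "bump e p" using ex_bump[OF e(1)] by blast
  have [measurable]: "p \<in> borel_measurable borel" using bumpD[OF b] by simp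
  have pg: "has_grad p (grad p)" by (rule bump_has_grad[OF b])
  have p0: "p x = 0" if "e < norm x" for x using bumpD(3)[OF b] that by simp
  have gp0: "grad p x = 0" if "e < norm x" for x by (rule has_grad_zero_outside[OF pg p0 that])
  define v where "v = mollify p u"
  define g where "g x = (\<integral>y. u y *\<^sub>R grad p (x - y) \<partial>lborel)" for x
  define \<beta> where "\<beta> = mollify p b"
  define F where "F = mollify p (\<lambda>y. u y *\<^sub>R b y)"
  \<comment> \<open>With this choice the flux \<open>v x *\<^sub>R \<beta> x + r x\<close> is
    exactly the mollified product.\<close>
  define r where "r x = F x - v x *\<^sub>R \<beta> x" for x
  have vg: "has_grad v g" unfolding v_def g_def by (rule has_grad_mollify[OF ui pg]) (rule p0)
  have \<beta>c: "continuous_on UNIV \<beta>" unfolding \<beta>_def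
    by (rule mollify_field_parts(1)[OF b bi has_grad_const[of 0], of 0]) simp
  have Fc: "continuous_on UNIV F" unfolding F_def
    by (rule mollify_field_parts(1)[OF b ubi has_grad_const[of 0], of 0]) simp
  have rc: "continuous_on UNIV r" unfolding r_def
    by (intro continuous_intros Fc \<beta>c has_grad_continuous[OF vg])
  have weak: "(\<integral>x. g x \<bullet> \<gamma> x \<partial>lborel) = (\<integral>x. (v x *\<^sub>R \<beta> x + r x) \<bullet> \<gamma> x \<partial>lborel) \<and> (\<integral>x. \<beta> x \<bullet> \<gamma> x \<partial>lborel) = 0"
    if \<psi>: "has_grad \<psi> \<gamma>" "\<forall>x. 1 - \<delta> < norm x \<longrightarrow> \<psi> x = 0" for \<psi> \<gamma>
  proof -
    have t: "(\<lambda>y. p (x - y)) \<in> test_functions (ball 0 1)" if "norm x \<le> 1 - \<delta>" for x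
      using that e by (intro bump_test_function[OF b]) linarith
    have gr: "grad (\<lambda>y. p (x - y)) = (\<lambda>y. - grad p (x - y))" for x
      by (rule has_grad_grad[OF has_grad_reflect[OF pg]])
    have 1: "(\<integral>y. b y \<bullet> grad p (x - y) \<partial>lborel) = 0" if "norm x \<le> 1 - \<delta>" for x
      using div[OF t[OF that]] by (simp add: gr)
    have 2: "(\<integral>y. u y * laplacian p (x - y) \<partial>lborel) = (\<integral>y. (u y *\<^sub>R b y) \<bullet> grad p (x - y) \<partial>lborel)" if "norm x \<le> 1 - \<delta>" for x
    proof -
      obtain B where B: "B \<ge> 0" "\<And>x. norm (grad p x) \<le> B"
        using bounded_continuous_bounded_support[OF has_grad_continuous_grad[OF pg] gp0] by blast
      have [measurable]: "grad p \<in> borel_measurable borel" using has_grad_borel[OF pg] by simp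
      have i1: "integrable lborel (\<lambda>y. (u y *\<^sub>R b y) \<bullet> grad p (x - y))"
      proof (rule Bochner_Integration.integrable_bound)
        show "integrable lborel (\<lambda>y. B * norm (u y *\<^sub>R b y))" using integrable_norm[OF ubi] by simp
        show "AE y in lborel. norm ((u y *\<^sub>R b y) \<bullet> grad p (x - y)) \<le> norm (B * norm (u y *\<^sub>R b y))"
        proof (rule AE_I2)
          fix y
          have "norm ((u y *\<^sub>R b y) \<bullet> grad p (x - y)) \<le> norm (u y *\<^sub>R b y) * norm (grad p (x - y))"
            using Cauchy_Schwarz_ineq2 by (simp only: real_norm_def)
          also have "\<dots> \<le> norm (u y *\<^sub>R b y) * B" by (intro mult_left_mono B) auto
          finally show "norm ((u y *\<^sub>R b y) \<bullet> grad p (x - y)) \<le> norm (B * norm (u y *\<^sub>R b y))"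
            using B by (simp add: mult.commute)
        qed
      qed measurable
      have i2: "integrable lborel (\<lambda>y. u y * laplacian p (x - y))"
      proof -
        have "integrable lborel (\<lambda>y. u y * partial_deriv i (partial_deriv i p) (x - y))" if "i \<in> Basis" for i
        proof -
          have qg: "has_grad (partial_deriv i p) (grad (partial_deriv i p))" by (rule bump_partial_has_grad[OF b that])
          have q0: "partial_deriv i p x = 0" if "e < norm x" for x
            using gp0[OF that] partial_deriv_has_grad[OF pg, of i x] by simp
          have "integrable lborel (\<lambda>y. u y *\<^sub>R grad (partial_deriv i p) (x - y))"
            by (rule continuous_convolution(2)[OF ui has_grad_continuous_grad[OF qg]])
               (rule has_grad_zero_outside[OF qg q0])
          then have "integrable lborel (\<lambda>y. (u y *\<^sub>R grad (partial_deriv i p) (x - y)) \<bullet> i)"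
            by (rule integrable_inner_left)
          then show ?thesis by (simp add: partial_deriv_has_grad[OF qg])
        qed
        then show ?thesis by (simp add: laplacian_def sum_distrib_left)
      qed
      \<comment> \<open>Reflecting the kernel flips the sign of its gradient but not of its
        Laplacian, so the sum in the weak equation appears here as a difference.\<close>
      have "(\<integral>y. u y * laplacian p (x - y) - (u y *\<^sub>R b y) \<bullet> grad p (x - y) \<partial>lborel) = 0"
        using eq[OF t[OF that]] by (simp add: gr laplacian_reflect[OF bumpD(5)[OF b]])
      then show ?thesis using i1 i2 by simp
    qed
    have s: "\<psi> x = 0" if "1 - \<delta> < norm x" for x using \<psi>(2) that by blast
    have "(\<integral>x. g x \<bullet> \<gamma> x \<partial>lborel) = - (\<integral>x. (\<integral>y. u y * laplacian p (x - y) \<partial>lborel) * \<psi> x \<partial>lborel)"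
      unfolding g_def by (rule mollify_gradient_parts[OF b ui \<psi>(1)]) (rule s)
    also have "\<dots> = - (\<integral>x. (\<integral>y. (u y *\<^sub>R b y) \<bullet> grad p (x - y) \<partial>lborel) * \<psi> x \<partial>lborel)"
    proof -
      have "(\<integral>y. u y * laplacian p (x - y) \<partial>lborel) * \<psi> x = (\<integral>y. (u y *\<^sub>R b y) \<bullet> grad p (x - y) \<partial>lborel) * \<psi> x" for x
        using 2[of x] s[of x] by (cases "norm x \<le> 1 - \<delta>") (simp_all only: not_le mult_zero_right)
      then show ?thesis by (simp only:)
    qed
    also have "- (\<integral>x. (\<integral>y. (u y *\<^sub>R b y) \<bullet> grad p (x - y) \<partial>lborel) * \<psi> x \<partial>lborel) = (\<integral>x. F x \<bullet> \<gamma> x \<partial>lborel)"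
      unfolding F_def by (rule mollify_field_parts(2)[OF b ubi \<psi>(1), symmetric]) (rule s)
    finally have A: "(\<integral>x. g x \<bullet> \<gamma> x \<partial>lborel) = (\<integral>x. (v x *\<^sub>R \<beta> x + r x) \<bullet> \<gamma> x \<partial>lborel)"
      by (simp add: r_def)
    have "(\<integral>x. \<beta> x \<bullet> \<gamma> x \<partial>lborel) = - (\<integral>x. (\<integral>y. b y \<bullet> grad p (x - y) \<partial>lborel) * \<psi> x \<partial>lborel)"
      unfolding \<beta>_def by (rule mollify_field_parts(2)[OF b bi \<psi>(1)]) (rule s)
    also have "\<dots> = 0"
    proof -
      have "(\<integral>y. b y \<bullet> grad p (x - y) \<partial>lborel) * \<psi> x = 0" for x
        using 1[of x] s[of x] by (cases "norm x \<le> 1 - \<delta>") (simp_all only: not_le mult_zero_right mult_zero_left)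
      then show ?thesis by (simp only: Bochner_Integration.integral_zero minus_zero)
    qed
    finally show ?thesis using A by simp
  qed
  have "(\<integral>\<^sup>+x\<in>ball 0 1. ennreal ((norm (r x))\<^sup>2) \<partial>lborel) \<le> (\<integral>\<^sup>+x\<in>ball 0 1. ennreal (4 * M\<^sup>2) * osc_fun p b x \<partial>lborel)"
    unfolding r_def F_def v_def \<beta>_def
    by (intro nn_integral_mono mult_right_mono mollify_commutator_bound[OF b _ _ bi ui uM]) auto
  also have "\<dots> = ennreal (4 * M\<^sup>2) * (\<integral>\<^sup>+x\<in>ball 0 1. osc_fun p b x \<partial>lborel)"
  proof -
    have "(\<lambda>x. osc_fun p b x * indicator (ball 0 1) x) \<in> borel_measurable lborel"
      by (rule borel_measurable_times_ennreal[OF _ borel_measurable_indicator]) simp_all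
    from nn_integral_cmult[OF this] show ?thesis by (simp add: mult.assoc)
  qed
  also have "\<dots> \<le> ennreal (4 * M\<^sup>2) * ennreal \<delta>1"
    by (intro mult_left_mono e1(2)[OF b e(2)]) auto
  also have "\<dots> \<le> ennreal \<delta>" using d1 by (simp add: ennreal_leI flip: ennreal_mult)
  finally have R: "(\<integral>\<^sup>+x\<in>ball 0 1. ennreal ((norm (r x))\<^sup>2) \<partial>lborel) \<le> ennreal \<delta>" .
  show thesis
  proof (rule that[of v g \<beta> r])
    show "approx_solution \<delta> v g \<beta> r"
      unfolding approx_solution_def using vg \<beta>c rc weak R by blast
    show "\<bar>v x\<bar> \<le> M" for x unfolding v_def by (rule mollify_bound[OF b ui uM])
    have "(\<integral>\<^sup>+x\<in>ball 0 1. ennreal ((norm (\<beta> x - b x))\<^sup>2) \<partial>lborel) \<le> (\<integral>\<^sup>+x\<in>ball 0 1. osc_fun p b x \<partial>lborel)"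
      unfolding \<beta>_def by (intro nn_integral_mono mult_right_mono mollify_diff_bound[OF b _ bi]) auto
    also have "\<dots> \<le> ennreal \<delta>"
      using e1(2)[OF b e(2)] d1(3) by (meson ennreal_leI order_trans)
    finally show "(\<integral>\<^sup>+x\<in>ball 0 1. ennreal ((norm (\<beta> x - b x))\<^sup>2) \<partial>lborel) \<le> ennreal \<delta>" .
    have "(\<integral>\<^sup>+x\<in>ball 0 1. ennreal ((norm (v x - u x))\<^sup>2) \<partial>lborel) \<le> (\<integral>\<^sup>+x\<in>ball 0 1. osc_fun p u x \<partial>lborel)"
      unfolding v_def by (intro nn_integral_mono mult_right_mono mollify_diff_bound[OF b _ ui]) auto
    also have "\<dots> \<le> ennreal \<delta>" by (rule e2(2)[OF b e(3)])
    finally show "(\<integral>\<^sup>+x\<in>ball 0 1. ennreal ((norm (v x - u x))\<^sup>2) \<partial>lborel) \<le> ennreal \<delta>" .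
  qed
qed

subsection \<open>Energy estimate and approximate maximum principle\<close>

text \<open>An exponent of at least 2 removes the kink: at \<open>k\<close> the difference quotient
  is bounded by \<open>\<bar>h\<bar> ^ (n + 1)\<close>.\<close>

lemma DERIV_pos_part_power:
  "((\<lambda>t::real. max 0 (t - k) ^ (n + 2)) has_real_derivative (real (n + 2) * max 0 (t - k) ^ (n + 1))) (at t)"
proof -
  consider "t < k" | "t = k" | "t > k" by linarith
  then show ?thesis
  proof cases
    case 1
    have "((\<lambda>t::real. 0) has_real_derivative 0) (at t)" by simp
    then have "((\<lambda>t. max 0 (t - k) ^ (n + 2)) has_real_derivative 0) (at t)"
      by (rule has_field_derivative_transform_within_open[where S="{..<k}"]) (use 1 in auto)
    then show ?thesis using 1 by simp
  next
    case 2
    have "((\<lambda>h. (max 0 (k + h - k) ^ (n + 2) - max 0 (k - k) ^ (n + 2)) / h) \<longlongrightarrow> 0) (at (0::real))"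
    proof (rule Lim_null_comparison)
      show "\<forall>\<^sub>F h in at (0::real). norm ((max 0 (k + h - k) ^ (n + 2) - max 0 (k - k) ^ (n + 2)) / h) \<le> \<bar>h\<bar> ^ (n + 1)"
      proof (intro always_eventually allI)
        fix h :: real
        show "norm ((max 0 (k + h - k) ^ (n + 2) - max 0 (k - k) ^ (n + 2)) / h) \<le> \<bar>h\<bar> ^ (n + 1)"
          by (cases "h \<le> 0") (auto simp: max_def abs_mult mult_nonpos_nonneg)
      qed
      have "((\<lambda>h::real. \<bar>h\<bar> ^ (n + 1)) \<longlongrightarrow> \<bar>0\<bar> ^ (n + 1)) (at 0)" by (intro tendsto_intros)
      then show "((\<lambda>h::real. \<bar>h\<bar> ^ (n + 1)) \<longlongrightarrow> 0) (at 0)" by simp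
    qed
    then have "((\<lambda>t. max 0 (t - k) ^ (n + 2)) has_real_derivative 0) (at k)" by (simp add: DERIV_def)
    then show ?thesis using 2 by simp
  next
    case 3
    have "((\<lambda>t. (t - k) ^ (n + 2)) has_real_derivative (real (n + 2) * (t - k) ^ (n + 1))) (at t)"
    proof -
      have "((\<lambda>t. t - k) has_real_derivative 1) (at t)" by (auto intro!: derivative_eq_intros)
      from DERIV_power[OF this, of "n + 2"] show ?thesis by simp
    qed
    then have "((\<lambda>t. max 0 (t - k) ^ (n + 2)) has_real_derivative (real (n + 2) * (t - k) ^ (n + 1))) (at t)"
      by (rule has_field_derivative_transform_within_open[where S="{k<..}"]) (use 3 in auto)
    then show ?thesis using 3 by simp
  qed
qed

lemma DERIV_pos_part_square:
  "((\<lambda>t::real. (max 0 (t - k))\<^sup>2) has_real_derivative (2 * max 0 (t - k))) (at t)"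
  using DERIV_pos_part_power[of k 0 t] by (simp add: power2_eq_square)

lemma DERIV_pos_part_cube:
  "((\<lambda>t::real. (max 0 (t - k)) ^ 3) has_real_derivative (3 * (max 0 (t - k))\<^sup>2)) (at t)"
  using DERIV_pos_part_power[of k 1 t] by (simp add: eval_nat_numeral)

text \<open>The square of this function is C1, and on the unit ball its gradient is bounded by 4
  times the function itself. The cross term of the energy estimate can thus be absorbed into the
  weighted gradient term.\<close>

definition cutoff :: "real \<Rightarrow> 'a::euclidean_space \<Rightarrow> real" where
  "cutoff s x = max 0 (s\<^sup>2 - (norm x)\<^sup>2)"

lemma has_grad_cutoff_sq:
  "has_grad (\<lambda>x::'a::euclidean_space. (cutoff s x)\<^sup>2) (\<lambda>x. (- 4 * cutoff s x) *\<^sub>R x)"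
proof -
  have "has_grad (\<lambda>x::'a. - (x \<bullet> x)) (\<lambda>x. - 2 *\<^sub>R x)"
    unfolding has_grad_def by (auto intro!: derivative_eq_intros continuous_intros simp: inner_commute)
  then have "has_grad (\<lambda>x::'a. (max 0 (- (x \<bullet> x) - - s\<^sup>2))\<^sup>2) (\<lambda>x. (2 * max 0 (- (x \<bullet> x) - - s\<^sup>2)) *\<^sub>R (- 2 *\<^sub>R x))"
    by (rule has_grad_compose[OF _ DERIV_pos_part_square]) (intro continuous_intros)
  then show ?thesis by (simp add: cutoff_def power2_norm_eq_inner)
qed

lemma cutoff_zero: "0 \<le> s \<Longrightarrow> s < norm x \<Longrightarrow> cutoff s x = 0"
  using power_strict_mono[of s "norm x" 2] by (simp add: cutoff_def)

lemma continuous_on_cutoff: "continuous_on UNIV (cutoff s)"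
  unfolding cutoff_def by (intro continuous_intros)

lemma energy_integrand_bound:
  fixes g \<beta> r z :: "'a::euclidean_space"
  assumes h: "0 \<le> h" "h \<le> 1" and z: "norm z \<le> 4 * h"
  shows "(1/2) * v\<^sup>2 * (\<beta> \<bullet> z) + r \<bullet> (v *\<^sub>R z + h\<^sup>2 *\<^sub>R g) - v * (g \<bullet> z) - h\<^sup>2 * (norm g)\<^sup>2
     \<le> 18 * (v\<^sup>2 * (1 + norm \<beta>)) + 3 * (norm r)\<^sup>2 - (1/2) * (h\<^sup>2 * (norm g)\<^sup>2)"
proof -
  have 1: "(1/2) * v\<^sup>2 * (\<beta> \<bullet> z) \<le> 2 * (v\<^sup>2 * norm \<beta>)"
  proof -
    have "\<beta> \<bullet> z \<le> norm \<beta> * norm z" by (rule norm_cauchy_schwarz)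
    also have "\<dots> \<le> norm \<beta> * 4" using z h by (intro mult_left_mono) auto
    finally have "v\<^sup>2 * (\<beta> \<bullet> z) \<le> v\<^sup>2 * (norm \<beta> * 4)" by (intro mult_left_mono) auto
    then show ?thesis by simp
  qed
  have vz: "\<bar>v\<bar> * norm z \<le> \<bar>v\<bar> * (4 * h)" using z by (intro mult_left_mono) auto
  have 2: "r \<bullet> (v *\<^sub>R z) \<le> 2 * (norm r)\<^sup>2 + 2 * v\<^sup>2"
  proof -
    have "r \<bullet> (v *\<^sub>R z) \<le> norm r * (\<bar>v\<bar> * norm z)" using norm_cauchy_schwarz[of r "v *\<^sub>R z"] by simp
    also have "\<dots> \<le> norm r * (\<bar>v\<bar> * 4)" using z h by (intro mult_left_mono) auto
    also have "\<dots> \<le> 2 * (norm r)\<^sup>2 + 2 * v\<^sup>2" using sum_squares_bound[of "norm r" "\<bar>v\<bar>"] by simp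
    finally show ?thesis .
  qed
  have 3: "r \<bullet> (h\<^sup>2 *\<^sub>R g) \<le> (norm r)\<^sup>2 + (1/4) * (h\<^sup>2 * (norm g)\<^sup>2)"
  proof -
    have "r \<bullet> (h\<^sup>2 *\<^sub>R g) \<le> h\<^sup>2 * (norm r * norm g)"
      using norm_cauchy_schwarz[of r "h\<^sup>2 *\<^sub>R g"] by (simp add: ac_simps)
    also have "\<dots> \<le> h\<^sup>2 * ((norm r)\<^sup>2 + (1/4) * (norm g)\<^sup>2)"
      using sum_squares_bound[of "norm r" "norm g / 2"] by (intro mult_left_mono) (auto simp: power_divide)
    also have "\<dots> \<le> (norm r)\<^sup>2 + (1/4) * (h\<^sup>2 * (norm g)\<^sup>2)"
    proof -
      have "h\<^sup>2 * (norm r)\<^sup>2 \<le> 1 * (norm r)\<^sup>2" using h by (intro mult_right_mono power_le_one) auto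
      then show ?thesis by (simp add: distrib_left)
    qed
    finally show ?thesis .
  qed
  have 4: "- (v * (g \<bullet> z)) \<le> 16 * v\<^sup>2 + (1/4) * (h\<^sup>2 * (norm g)\<^sup>2)"
  proof -
    have "- (v * (g \<bullet> z)) \<le> \<bar>v\<bar> * \<bar>g \<bullet> z\<bar>" by (metis abs_ge_minus_self abs_mult)
    also have "\<dots> \<le> \<bar>v\<bar> * (norm g * norm z)" by (intro mult_left_mono Cauchy_Schwarz_ineq2) auto
    also have "\<dots> \<le> norm g * (\<bar>v\<bar> * (4 * h))" using mult_left_mono[OF vz norm_ge_zero[of g]] by (simp add: ac_simps)
    also have "\<dots> \<le> 16 * v\<^sup>2 + (1/4) * (h\<^sup>2 * (norm g)\<^sup>2)"
      using sum_squares_bound[of "4 * \<bar>v\<bar>" "h * norm g / 2"] by (simp add: power_mult_distrib power_divide ac_simps)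
    finally show ?thesis .
  qed
  have "r \<bullet> (v *\<^sub>R z + h\<^sup>2 *\<^sub>R g) = r \<bullet> (v *\<^sub>R z) + r \<bullet> (h\<^sup>2 *\<^sub>R g)" by (simp add: inner_add_right)
  moreover have "18 * (v\<^sup>2 * (1 + norm \<beta>)) = 18 * v\<^sup>2 + 18 * (v\<^sup>2 * norm \<beta>)" by (simp add: algebra_simps)
  moreover have "0 \<le> v\<^sup>2 * norm \<beta>" by simp
  ultimately show ?thesis using 1 2 3 4 by linarith
qed

lemma nn_integral_indicator_eq_integral:
  fixes f :: "'a::euclidean_space \<Rightarrow> real"
  assumes "continuous_on UNIV f" "\<And>x. 0 \<le> f x" "compact K"
  shows "integrable lborel (\<lambda>x. indicator K x * f x)"
    and "(\<integral>\<^sup>+x\<in>K. ennreal (f x) \<partial>lborel) = ennreal (\<integral>x. indicator K x * f x \<partial>lborel)"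
proof -
  show i: "integrable lborel (\<lambda>x. indicator K x * f x)"
    using borel_integrable_compact[OF assms(3) continuous_on_subset[OF assms(1)]] by simp
  have "(\<integral>\<^sup>+x\<in>K. ennreal (f x) \<partial>lborel) = (\<integral>\<^sup>+x. ennreal (indicator K x * f x) \<partial>lborel)"
    by (intro nn_integral_cong) (auto simp: indicator_def)
  also have "\<dots> = ennreal (\<integral>x. indicator K x * f x \<partial>lborel)"
    by (rule nn_integral_eq_integral[OF i]) (use assms in auto)
  finally show "(\<integral>\<^sup>+x\<in>K. ennreal (f x) \<partial>lborel) = ennreal (\<integral>x. indicator K x * f x \<partial>lborel)" .
qed

text \<open>Testing with \<open>v\<close> times the squared cutoff leaves a drift term that contains
  \<open>g\<close>. Subtracting half of the divergence identity for \<open>v\<^sup>2\<close> times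
  the squared cutoff cancels it: only half of \<open>v\<^sup>2 * (\<beta> \<bullet> z)\<close>
  remains, where \<open>z\<close> is bounded. The constants 36 and 6 are twice those of the
  pointwise bound, since half of the gradient term survives there.\<close>

lemma energy_estimate:
  assumes ap: "approx_solution \<delta> v g \<beta> r" and s: "0 < s" "s \<le> 1 - \<delta>" "0 < \<delta>"
  shows "(\<integral>x. (cutoff s x)\<^sup>2 * (norm (g x))\<^sup>2 \<partial>lborel) \<le>
     36 * (\<integral>x. indicator (cball 0 s) x * ((v x)\<^sup>2 * (1 + norm (\<beta> x))) \<partial>lborel) + 6 * \<delta>"
proof -
  have vg: "has_grad v g" and \<beta>c: "continuous_on UNIV \<beta>" and rc: "continuous_on UNIV r"
    and R: "(\<integral>\<^sup>+x\<in>ball 0 1. ennreal ((norm (r x))\<^sup>2) \<partial>lborel) \<le> ennreal \<delta>"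
    using ap by (auto simp: approx_solution_def)
  note vc = has_grad_continuous[OF vg] and gc = has_grad_continuous_grad[OF vg]
  define z :: "'a \<Rightarrow> 'a" where "z x = (- 4 * cutoff s x) *\<^sub>R x" for x
  have zeta: "has_grad (\<lambda>x. (cutoff s x)\<^sup>2) z" unfolding z_def by (rule has_grad_cutoff_sq)
  have zc: "continuous_on UNIV z" by (rule has_grad_continuous_grad[OF zeta])
  note cc = continuous_on_cutoff[of s]
  define \<gamma> where "\<gamma> x = v x *\<^sub>R z x + (cutoff s x)\<^sup>2 *\<^sub>R g x" for x
  have \<psi>: "has_grad (\<lambda>x. v x * (cutoff s x)\<^sup>2) \<gamma>" unfolding \<gamma>_def by (rule has_grad_mult[OF vg zeta])
  have \<psi>2: "has_grad (\<lambda>x. v x * (v x * (cutoff s x)\<^sup>2)) (\<lambda>x. v x *\<^sub>R \<gamma> x + (v x * (cutoff s x)\<^sup>2) *\<^sub>R g x)"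
    by (rule has_grad_mult[OF vg \<psi>])
  have c0: "cutoff s x = 0" if "1 - \<delta> < norm x" for x :: 'a
    by (rule cutoff_zero) (use s that in auto)
  have cs0: "cutoff s x = 0" "z x = 0" if "s < norm x" for x :: 'a
    using cutoff_zero[of s x] s that by (auto simp: z_def)
  have \<gamma>c: "continuous_on UNIV \<gamma>" by (rule has_grad_continuous_grad[OF \<psi>])
  have \<gamma>0: "\<gamma> x = 0" if "s < norm x" for x using cs0[OF that] by (simp add: \<gamma>_def)
  have w1: "(\<integral>x. g x \<bullet> \<gamma> x \<partial>lborel) = (\<integral>x. (v x *\<^sub>R \<beta> x + r x) \<bullet> \<gamma> x \<partial>lborel)"
    using ap[unfolded approx_solution_def] \<psi> c0 by auto
  have w2: "(\<integral>x. \<beta> x \<bullet> (v x *\<^sub>R \<gamma> x + (v x * (cutoff s x)\<^sup>2) *\<^sub>R g x) \<partial>lborel) = 0"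
    using ap[unfolded approx_solution_def] \<psi>2 c0 by auto
  have i1: "integrable lborel (\<lambda>x. g x \<bullet> \<gamma> x)"
    by (rule integrable_continuous_bounded_support[where r=s]) (use \<gamma>0 in \<open>auto intro!: continuous_intros gc \<gamma>c\<close>)
  have i2: "integrable lborel (\<lambda>x. (v x *\<^sub>R \<beta> x + r x) \<bullet> \<gamma> x)"
    by (rule integrable_continuous_bounded_support[where r=s]) (use \<gamma>0 in \<open>auto intro!: continuous_intros vc rc \<beta>c \<gamma>c\<close>)
  have i3: "integrable lborel (\<lambda>x. \<beta> x \<bullet> (v x *\<^sub>R \<gamma> x + (v x * (cutoff s x)\<^sup>2) *\<^sub>R g x))"
    by (rule integrable_continuous_bounded_support[where r=s]) (use \<gamma>0 cs0 in \<open>auto intro!: continuous_intros vc \<beta>c \<gamma>c gc cc\<close>)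
  have i4: "integrable lborel (\<lambda>x. (cutoff s x)\<^sup>2 * (norm (g x))\<^sup>2)"
    by (rule integrable_continuous_bounded_support[where r=s]) (use cs0 in \<open>auto intro!: continuous_intros gc cc\<close>)
  have i5: "integrable lborel (\<lambda>x. indicator (cball 0 s) x * ((v x)\<^sup>2 * (1 + norm (\<beta> x))))"
    by (rule nn_integral_indicator_eq_integral) (auto intro!: continuous_intros vc \<beta>c)
  have i6: "integrable lborel (\<lambda>x. indicator (cball 0 s) x * (norm (r x))\<^sup>2)"
    by (rule nn_integral_indicator_eq_integral) (auto intro!: continuous_intros rc)
  have pt: "((v x *\<^sub>R \<beta> x + r x) \<bullet> \<gamma> x - g x \<bullet> \<gamma> x) - (1/2) * (\<beta> x \<bullet> (v x *\<^sub>R \<gamma> x + (v x * (cutoff s x)\<^sup>2) *\<^sub>R g x))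
     \<le> 18 * (indicator (cball 0 s) x * ((v x)\<^sup>2 * (1 + norm (\<beta> x)))) + 3 * (indicator (cball 0 s) x * (norm (r x))\<^sup>2)
        - (1/2) * ((cutoff s x)\<^sup>2 * (norm (g x))\<^sup>2)" for x
  proof (cases "norm x \<le> s")
    case False then show ?thesis using cs0[of x] by (simp add: \<gamma>_def)
  next
    case True
    have n: "norm x \<le> 1" using True s by linarith
    have "cutoff s x \<le> s\<^sup>2" by (simp add: cutoff_def)
    also have "\<dots> \<le> 1" using s by (intro power_le_one) auto
    finally have c1: "cutoff s x \<le> 1" .
    have c2: "0 \<le> cutoff s x" by (simp add: cutoff_def)
    have "norm (z x) = 4 * cutoff s x * norm x" using c2 by (simp add: z_def)
    also have "\<dots> \<le> 4 * cutoff s x" using c2 n by (intro mult_left_le) auto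
    finally have zn: "norm (z x) \<le> 4 * cutoff s x" .
    have "((v x *\<^sub>R \<beta> x + r x) \<bullet> \<gamma> x - g x \<bullet> \<gamma> x) - (1/2) * (\<beta> x \<bullet> (v x *\<^sub>R \<gamma> x + (v x * (cutoff s x)\<^sup>2) *\<^sub>R g x))
      = (1/2) * (v x)\<^sup>2 * (\<beta> x \<bullet> z x) + r x \<bullet> (v x *\<^sub>R z x + (cutoff s x)\<^sup>2 *\<^sub>R g x) - v x * (g x \<bullet> z x)
         - (cutoff s x)\<^sup>2 * (norm (g x))\<^sup>2"
      by (simp add: \<gamma>_def inner_add_left inner_add_right power2_norm_eq_inner) (simp add: algebra_simps power2_eq_square add_divide_distrib)
    with energy_integrand_bound[OF c2 c1 zn, of "v x" "\<beta> x" "r x" "g x"] True show ?thesis by simp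
  qed
  have "0 = (\<integral>x. ((v x *\<^sub>R \<beta> x + r x) \<bullet> \<gamma> x - g x \<bullet> \<gamma> x) - (1/2) * (\<beta> x \<bullet> (v x *\<^sub>R \<gamma> x + (v x * (cutoff s x)\<^sup>2) *\<^sub>R g x)) \<partial>lborel)"
    using w1 w2 i1 i2 i3 by simp
  also have "\<dots> \<le> (\<integral>x. 18 * (indicator (cball 0 s) x * ((v x)\<^sup>2 * (1 + norm (\<beta> x)))) + 3 * (indicator (cball 0 s) x * (norm (r x))\<^sup>2)
        - (1/2) * ((cutoff s x)\<^sup>2 * (norm (g x))\<^sup>2) \<partial>lborel)"
    by (rule integral_mono) (use i1 i2 i3 i4 i5 i6 pt in auto)
  also have "\<dots> = 18 * (\<integral>x. indicator (cball 0 s) x * ((v x)\<^sup>2 * (1 + norm (\<beta> x))) \<partial>lborel) + 3 * (\<integral>x. indicator (cball 0 s) x * (norm (r x))\<^sup>2 \<partial>lborel)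
        - (1/2) * (\<integral>x. (cutoff s x)\<^sup>2 * (norm (g x))\<^sup>2 \<partial>lborel)"
    using i4 i5 i6 by simp
  finally have main: "(\<integral>x. (cutoff s x)\<^sup>2 * (norm (g x))\<^sup>2 \<partial>lborel) \<le>
     36 * (\<integral>x. indicator (cball 0 s) x * ((v x)\<^sup>2 * (1 + norm (\<beta> x))) \<partial>lborel) + 6 * (\<integral>x. indicator (cball 0 s) x * (norm (r x))\<^sup>2 \<partial>lborel)"
    by linarith
  have "ennreal (\<integral>x. indicator (cball 0 s) x * (norm (r x))\<^sup>2 \<partial>lborel) = (\<integral>\<^sup>+x\<in>cball 0 s. ennreal ((norm (r x))\<^sup>2) \<partial>lborel)"
    by (rule nn_integral_indicator_eq_integral(2)[symmetric]) (auto intro!: continuous_intros rc)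
  also have "\<dots> \<le> (\<integral>\<^sup>+x\<in>ball 0 1. ennreal ((norm (r x))\<^sup>2) \<partial>lborel)"
    using s by (intro nn_integral_mono) (auto simp: indicator_def)
  finally have "ennreal (\<integral>x. indicator (cball 0 s) x * (norm (r x))\<^sup>2 \<partial>lborel) \<le> ennreal \<delta>"
    using R by (rule order_trans)
  then have "(\<integral>x. indicator (cball 0 s) x * (norm (r x))\<^sup>2 \<partial>lborel) \<le> \<delta>" using s(3) by (simp add: ennreal_le_iff)
  with main show ?thesis by linarith
qed

text \<open>The weak equation is linear in solution and remainder for a fixed drift. Lower bounds
  are obtained by applying the maximum principle to \<open>- v\<close>.\<close>

lemma approx_solution_uminus:
  assumes "approx_solution \<delta> v g \<beta> r"
  shows "approx_solution \<delta> (\<lambda>x. - v x) (\<lambda>x. - g x) \<beta> (\<lambda>x. - r x)"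
proof -
  have "has_grad (\<lambda>x. - v x) (\<lambda>x. - g x)"
    using has_grad_cmult[of v g "-1"] assms by (simp add: approx_solution_def)
  moreover have "(- v x *\<^sub>R \<beta> x + - r x) \<bullet> y = - ((v x *\<^sub>R \<beta> x + r x) \<bullet> y)" for x y
    by (simp add: inner_diff_left inner_add_left)
  ultimately show ?thesis
    using assms unfolding approx_solution_def
    by (simp only: inner_minus_left Bochner_Integration.integral_minus neg_equal_iff_equal norm_minus_cancel)
       (auto intro!: continuous_intros)
qed

text \<open>Testing with \<open>((v - k)\<^sub>+)\<^sup>2\<close> kills the drift term, which becomes the integral of
  \<open>\<beta>\<close> against a gradient.\<close>

lemma approx_maximum_principle:
  fixes v :: "'a::euclidean_space \<Rightarrow> real"
  assumes ap: "approx_solution \<delta> v g \<beta> r" and \<delta>: "0 < \<delta>" and Q: "open Q" "Q \<subseteq> cball 0 (1 - \<delta>)"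
    and k: "\<And>x. x \<in> frontier Q \<Longrightarrow> v x < k" and L: "\<And>x. v x - k \<le> L" "0 \<le> L"
  shows "(\<integral>\<^sup>+x\<in>Q. ennreal ((max 0 (v x - k))\<^sup>2) \<partial>lborel) \<le>
     ennreal (L * sqrt \<delta> * (measure lborel (cball (0::'a) 1) + 1))"
proof -
  have vg: "has_grad v g" and \<beta>c: "continuous_on UNIV \<beta>" and rc: "continuous_on UNIV r"
    and R: "(\<integral>\<^sup>+x\<in>ball 0 1. ennreal ((norm (r x))\<^sup>2) \<partial>lborel) \<le> ennreal \<delta>"
    using ap by (auto simp: approx_solution_def)
  note vc = has_grad_continuous[OF vg] and gc = has_grad_continuous_grad[OF vg]
  \<comment> \<open>The strict inequality on the frontier keeps the set where
    \<open>k \<le> v x\<close> off it: this closed set lies inside the open \<open>Q\<close>, as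
    gluing with zero requires.\<close>
  define K where "K = closure Q \<inter> {x. k \<le> v x}"
  have Kc: "closed K" unfolding K_def
    by (intro closed_Int closed_closure closed_Collect_le continuous_intros vc)
  have KQ: "K \<subseteq> Q" using k Q(1) by (force simp: K_def frontier_def interior_open)
  have hG: "has_grad (\<lambda>x. (max 0 (v x - k))\<^sup>2) (\<lambda>x. (2 * max 0 (v x - k)) *\<^sub>R g x)"
    by (rule has_grad_compose[OF vg DERIV_pos_part_square]) (intro continuous_intros)
  have hC: "has_grad (\<lambda>x. (max 0 (v x - k))^3) (\<lambda>x. (3 * (max 0 (v x - k))\<^sup>2) *\<^sub>R g x)"
    by (rule has_grad_compose[OF vg DERIV_pos_part_cube]) (intro continuous_intros)
  \<comment> \<open>A primitive of \<open>t * (2 * max 0 (t - k))\<close>, found by writing t as (t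
    - k) + k. Hence \<open>v\<close> times the gradient of the test function is again a gradient of
    a function supported in \<open>Q\<close>.\<close>
  have hH: "has_grad (\<lambda>x. (2/3) * (max 0 (v x - k))^3 + k * (max 0 (v x - k))\<^sup>2) (\<lambda>x. v x *\<^sub>R ((2 * max 0 (v x - k)) *\<^sub>R g x))"
  proof -
    have "(2/3) *\<^sub>R ((3 * (max 0 (v x - k))\<^sup>2) *\<^sub>R g x) + k *\<^sub>R ((2 * max 0 (v x - k)) *\<^sub>R g x) = v x *\<^sub>R ((2 * max 0 (v x - k)) *\<^sub>R g x)" for x
      by (cases "v x \<le> k") (auto simp: max_def power2_eq_square algebra_simps simp flip: scaleR_add_left scaleR_left_diff_distrib)
    then show ?thesis using has_grad_add[OF has_grad_cmult[OF hC, of "2/3"] has_grad_cmult[OF hG, of k]] by simp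
  qed
  have z: "v x \<le> k" if "x \<in> Q - K" for x
    using that closure_subset[of Q] by (auto simp: K_def)
  define \<psi> where "\<psi> x = (if x \<in> Q then (max 0 (v x - k))\<^sup>2 else 0)" for x
  define \<gamma> where "\<gamma> x = (if x \<in> Q then (2 * max 0 (v x - k)) *\<^sub>R g x else 0)" for x
  have \<psi>: "has_grad \<psi> \<gamma>" unfolding \<psi>_def \<gamma>_def
    by (rule has_grad_restrict[OF hG Q(1) Kc KQ]) (use z in auto)
  have "has_grad (\<lambda>x. if x \<in> Q then (2/3) * (max 0 (v x - k))^3 + k * (max 0 (v x - k))\<^sup>2 else 0)
     (\<lambda>x. if x \<in> Q then v x *\<^sub>R ((2 * max 0 (v x - k)) *\<^sub>R g x) else 0)"
    by (rule has_grad_restrict[OF hH Q(1) Kc KQ]) (use z in auto)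
  moreover have "(\<lambda>x. if x \<in> Q then v x *\<^sub>R ((2 * max 0 (v x - k)) *\<^sub>R g x) else 0) = (\<lambda>x. v x *\<^sub>R \<gamma> x)"
    by (auto simp: \<gamma>_def)
  ultimately have \<chi>: "has_grad (\<lambda>x. if x \<in> Q then (2/3) * (max 0 (v x - k))^3 + k * (max 0 (v x - k))\<^sup>2 else 0) (\<lambda>x. v x *\<^sub>R \<gamma> x)"
    by simp
  have Q0: "x \<notin> Q" if "1 - \<delta> < norm x" for x using Q(2) that by auto
  \<comment> \<open>This is the truncation of \<open>v\<close> itself, extended by zero; its
    continuity is read off from its square, for which the gluing has been carried out.\<close>
  define A where "A x = sqrt (\<psi> x)" for x
  have A_eq: "A x = (if x \<in> Q then max 0 (v x - k) else 0)" for x by (simp add: A_def \<psi>_def)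
  have Ac: "continuous_on UNIV A" unfolding A_def by (intro continuous_intros has_grad_continuous[OF \<psi>])
  have A0: "0 \<le> A x" "A x \<le> L" for x using L by (auto simp: A_eq)
  have AQ: "A x = 0" if "1 < norm x" for x using Q0[of x] \<delta> that by (simp add: A_eq)
  have \<gamma>A: "\<gamma> x = (2 * A x) *\<^sub>R g x" for x by (simp add: \<gamma>_def A_eq)
  have \<psi>A: "\<psi> x = (A x)\<^sup>2" for x by (simp add: \<psi>_def A_eq)
  have w1: "(\<integral>x. g x \<bullet> \<gamma> x \<partial>lborel) = (\<integral>x. (v x *\<^sub>R \<beta> x + r x) \<bullet> \<gamma> x \<partial>lborel)"
    using ap[unfolded approx_solution_def] \<psi> Q0 by (auto simp: \<psi>_def)
  have w2: "(\<integral>x. \<beta> x \<bullet> (v x *\<^sub>R \<gamma> x) \<partial>lborel) = 0"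
  proof -
    have "(\<integral>x. \<beta> x \<bullet> \<gamma>' x \<partial>lborel) = 0"
      if "has_grad \<psi>' \<gamma>'" "\<forall>x. 1 - \<delta> < norm x \<longrightarrow> \<psi>' x = 0" for \<psi>' \<gamma>'
      using ap that unfolding approx_solution_def by blast
    from this[OF \<chi>] show ?thesis using Q0 by simp
  qed
  have i1: "integrable lborel (\<lambda>x. A x * (norm (g x))\<^sup>2)"
    by (rule integrable_continuous_bounded_support[where r=1]) (use AQ in \<open>auto intro!: continuous_intros gc Ac\<close>)
  have i2: "integrable lborel (\<lambda>x. A x * (norm (r x))\<^sup>2)"
    by (rule integrable_continuous_bounded_support[where r=1]) (use AQ in \<open>auto intro!: continuous_intros rc Ac\<close>)
  have i3: "integrable lborel (\<lambda>x. r x \<bullet> \<gamma> x)"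
    by (rule integrable_continuous_bounded_support[where r=1]) (use AQ in \<open>auto simp: \<gamma>A intro!: continuous_intros rc gc Ac\<close>)
  have i4: "integrable lborel (\<lambda>x. \<beta> x \<bullet> (v x *\<^sub>R \<gamma> x))"
    by (rule integrable_continuous_bounded_support[where r=1]) (use AQ in \<open>auto simp: \<gamma>A intro!: continuous_intros \<beta>c vc gc Ac\<close>)
  have i5: "integrable lborel A"
    by (rule integrable_continuous_bounded_support[where r=1, OF Ac]) (use AQ in auto)
  have i6: "integrable lborel \<psi>"
    by (rule integrable_continuous_bounded_support[where r=1, OF has_grad_continuous[OF \<psi>]]) (use AQ \<psi>A in auto)
  \<comment> \<open>Once the drift is gone only the remainder stands on the right. Young's
    inequality splits it, and half of the left-hand side absorbs the gradient part.\<close>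
  have "2 * (\<integral>x. A x * (norm (g x))\<^sup>2 \<partial>lborel) = (\<integral>x. g x \<bullet> \<gamma> x \<partial>lborel)"
    by (simp add: \<gamma>A power2_norm_eq_inner mult.assoc)
  also have "\<dots> = (\<integral>x. r x \<bullet> \<gamma> x \<partial>lborel) + (\<integral>x. \<beta> x \<bullet> (v x *\<^sub>R \<gamma> x) \<partial>lborel)"
    unfolding w1 using i3 i4 by (simp add: inner_add_left)
  also have "\<dots> = (\<integral>x. r x \<bullet> \<gamma> x \<partial>lborel)" using w2 by simp
  also have "\<dots> \<le> (\<integral>x. A x * (norm (g x))\<^sup>2 + A x * (norm (r x))\<^sup>2 \<partial>lborel)"
  proof (rule integral_mono)
    fix x
    have "2 * (r x \<bullet> g x) \<le> (norm (g x))\<^sup>2 + (norm (r x))\<^sup>2"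
      using norm_cauchy_schwarz[of "r x" "g x"] sum_squares_bound[of "norm (r x)" "norm (g x)"] by simp
    from mult_left_mono[OF this A0(1)[of x]]
    show "r x \<bullet> \<gamma> x \<le> A x * (norm (g x))\<^sup>2 + A x * (norm (r x))\<^sup>2" by (simp add: \<gamma>A distrib_left ac_simps)
  qed (use i1 i2 i3 in auto)
  also have "\<dots> = (\<integral>x. A x * (norm (g x))\<^sup>2 \<partial>lborel) + (\<integral>x. A x * (norm (r x))\<^sup>2 \<partial>lborel)" using i1 i2 by simp
  finally have Ag: "(\<integral>x. A x * (norm (g x))\<^sup>2 \<partial>lborel) \<le> (\<integral>x. A x * (norm (r x))\<^sup>2 \<partial>lborel)" by linarith
  have "ennreal (\<integral>x. A x * (norm (r x))\<^sup>2 \<partial>lborel) = (\<integral>\<^sup>+x. ennreal (A x * (norm (r x))\<^sup>2) \<partial>lborel)"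
    by (rule nn_integral_eq_integral[OF i2, symmetric]) (use A0 in auto)
  also have "\<dots> \<le> (\<integral>\<^sup>+x. ennreal L * (ennreal ((norm (r x))\<^sup>2) * indicator (ball 0 1) x) \<partial>lborel)"
  proof (rule nn_integral_mono)
    fix x
    show "ennreal (A x * (norm (r x))\<^sup>2) \<le> ennreal L * (ennreal ((norm (r x))\<^sup>2) * indicator (ball 0 1) x)"
    proof (cases "norm x < 1")
      case True
      then show ?thesis using A0[of x] L(2) by (auto simp: mult_right_mono ennreal_leI simp flip: ennreal_mult)
    next
      case False then show ?thesis using Q0[of x] \<delta> by (simp add: A_eq)
    qed
  qed
  also have "\<dots> = ennreal L * (\<integral>\<^sup>+x\<in>ball 0 1. ennreal ((norm (r x))\<^sup>2) \<partial>lborel)"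
  proof -
    have [measurable]: "r \<in> borel_measurable borel" using rc by (rule borel_measurable_continuous_onI)
    have "(\<lambda>x. ennreal ((norm (r x))\<^sup>2) * indicator (ball 0 1) x) \<in> borel_measurable lborel"
      by (rule borel_measurable_times_ennreal[OF _ borel_measurable_indicator]) simp_all
    then show ?thesis by (rule nn_integral_cmult)
  qed
  also have "\<dots> \<le> ennreal L * ennreal \<delta>" using R by (intro mult_left_mono) auto
  finally have "ennreal (\<integral>x. A x * (norm (r x))\<^sup>2 \<partial>lborel) \<le> ennreal (L * \<delta>)" using L \<delta> by (simp add: ennreal_mult)
  then have Ar: "(\<integral>x. A x * (norm (r x))\<^sup>2 \<partial>lborel) \<le> L * \<delta>" using L \<delta> by (simp add: ennreal_le_iff)
  define V where "V = measure lborel (cball (0::'a) 1)"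
  have iV: "integrable lborel (\<lambda>x. L * indicator (cball (0::'a) 1) x)"
    using emeasure_lborel_cball_finite[of "0::'a" 1] by (intro integrable_mult_right) (auto simp: integrable_indicator_iff)
  have "(\<integral>x. A x \<partial>lborel) \<le> (\<integral>x. L * indicator (cball (0::'a) 1) x \<partial>lborel)"
  proof (rule integral_mono[OF i5 iV])
    fix x show "A x \<le> L * indicator (cball 0 1) x" using A0[of x] AQ[of x] by (auto simp: indicator_def)
  qed
  also have "\<dots> = L * V" by (simp add: V_def)
  finally have AV: "(\<integral>x. A x \<partial>lborel) \<le> L * V" .
  obtain i :: 'a where i: "i \<in> Basis" using nonempty_Basis by blast
  \<comment> \<open>The weight that balances Young's inequality: the integral of \<open>A\<close> is
    merely bounded, while that of \<open>A\<close> times the squared gradient is at most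
    \<open>L * \<delta>\<close>.\<close>
  define \<tau> where "\<tau> = sqrt \<delta>"
  have \<tau>: "\<tau> > 0" "\<delta> / \<tau> = \<tau>" using \<delta> by (auto simp: \<tau>_def real_div_sqrt)
  have ig: "integrable lborel (\<lambda>x. \<tau> * A x + (1 / \<tau>) * (A x * (norm (g x))\<^sup>2))" using i1 i5 by auto
  \<comment> \<open>A Poincare inequality: the coordinate \<open>x \<bullet> i\<close> has
    derivative one in direction \<open>i\<close> and is bounded by one on the support, so
    integration by parts trades \<open>\<psi>\<close> for its gradient.\<close>
  have "(\<integral>x. \<psi> x \<partial>lborel) = (\<integral>x. (i \<bullet> i) * \<psi> x \<partial>lborel)" using i by simp
  also have "\<dots> = - (\<integral>x. (x \<bullet> i) * (\<gamma> x \<bullet> i) \<partial>lborel)"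
    by (rule grad_integral_by_parts[OF has_grad_inner \<psi>, where r=1]) (use AQ \<psi>A in auto)
  also have "\<dots> = (\<integral>x. - ((x \<bullet> i) * (\<gamma> x \<bullet> i)) \<partial>lborel)" by simp
  also have "\<dots> \<le> (\<integral>x. \<tau> * A x + (1 / \<tau>) * (A x * (norm (g x))\<^sup>2) \<partial>lborel)"
  proof (rule integral_mono[OF _ ig])
    show "integrable lborel (\<lambda>x. - ((x \<bullet> i) * (\<gamma> x \<bullet> i)))"
      by (rule integrable_continuous_bounded_support[where r=1]) (use AQ in \<open>auto simp: \<gamma>A intro!: continuous_intros gc Ac\<close>)
    fix x :: 'a
    show "- ((x \<bullet> i) * (\<gamma> x \<bullet> i)) \<le> \<tau> * A x + (1 / \<tau>) * (A x * (norm (g x))\<^sup>2)"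
    proof (cases "norm x \<le> 1")
      case False then show ?thesis using AQ[of x] by (simp add: \<gamma>A)
    next
      case True
      have "- ((x \<bullet> i) * (\<gamma> x \<bullet> i)) \<le> \<bar>x \<bullet> i\<bar> * \<bar>\<gamma> x \<bullet> i\<bar>" by (metis abs_ge_minus_self abs_mult)
      also have "\<dots> \<le> 1 * norm (\<gamma> x)"
        using True Basis_le_norm[OF i, of x] Basis_le_norm[OF i, of "\<gamma> x"] by (intro mult_mono) auto
      also have "\<dots> = A x * (2 * norm (g x))" using A0[of x] by (simp add: \<gamma>A)
      also have "\<dots> \<le> A x * (\<tau> + (1 / \<tau>) * (norm (g x))\<^sup>2)"
      proof (intro mult_left_mono A0)
        have "2 * (sqrt \<tau> * (norm (g x) / sqrt \<tau>)) \<le> (sqrt \<tau>)\<^sup>2 + (norm (g x) / sqrt \<tau>)\<^sup>2"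
          using sum_squares_bound[of "sqrt \<tau>" "norm (g x) / sqrt \<tau>"] by (simp only: mult.assoc)
        moreover have "sqrt \<tau> * (norm (g x) / sqrt \<tau>) = norm (g x)" using \<tau> by simp
        ultimately show "2 * norm (g x) \<le> \<tau> + (1 / \<tau>) * (norm (g x))\<^sup>2" using \<tau> by (simp add: power_divide)
      qed
      finally show ?thesis by (simp add: algebra_simps)
    qed
  qed
  also have "\<dots> = \<tau> * (\<integral>x. A x \<partial>lborel) + (1 / \<tau>) * (\<integral>x. A x * (norm (g x))\<^sup>2 \<partial>lborel)" using i1 i5 by simp
  also have "\<dots> \<le> \<tau> * (L * V) + (1 / \<tau>) * (L * \<delta>)"
    using \<tau> AV Ag Ar by (intro add_mono mult_left_mono) auto
  also have "\<dots> = L * \<tau> * (V + 1)" using \<tau> by (simp add: algebra_simps) (metis (no_types, lifting) mult.commute times_divide_eq_right)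
  finally have fin: "(\<integral>x. \<psi> x \<partial>lborel) \<le> L * \<tau> * (V + 1)" .
  have "(\<integral>\<^sup>+x\<in>Q. ennreal ((max 0 (v x - k))\<^sup>2) \<partial>lborel) = (\<integral>\<^sup>+x. ennreal (\<psi> x) \<partial>lborel)"
    by (intro nn_integral_cong) (auto simp: \<psi>_def)
  also have "\<dots> = ennreal (\<integral>x. \<psi> x \<partial>lborel)"
    by (rule nn_integral_eq_integral[OF i6]) (simp add: \<psi>_def)
  also have "\<dots> \<le> ennreal (L * \<tau> * (V + 1))" by (rule ennreal_leI[OF fin])
  finally show ?thesis by (simp add: \<tau>_def V_def)
qed

subsection \<open>Oscillation on the boundaries of concentric squares\<close>

text \<open>The fundamental theorem of calculus on a segment, in terms of the nonnegative integral
  so that Tonelli and Cauchy-Schwarz can be applied to the result directly.\<close>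

lemma has_grad_line_bound:
  assumes vg: "has_grad v g" and ab: "a \<le> b"
  shows "ennreal \<bar>v (c + b *\<^sub>R e) - v (c + a *\<^sub>R e)\<bar> \<le> (\<integral>\<^sup>+t\<in>{a..b}. ennreal (norm e * norm (g (c + t *\<^sub>R e))) \<partial>lborel)"
proof -
  have gc: "continuous_on UNIV (\<lambda>t. g (c + t *\<^sub>R e) \<bullet> e)"
    by (intro continuous_intros continuous_on_compose2[OF has_grad_continuous_grad[OF vg]]) auto
  have d: "DERIV (\<lambda>t. v (c + t *\<^sub>R e)) t :> g (c + t *\<^sub>R e) \<bullet> e" for t
  proof -
    have "((\<lambda>t. v (c + t *\<^sub>R e)) has_derivative (\<lambda>h. g (c + t *\<^sub>R e) \<bullet> (h *\<^sub>R e))) (at t)"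
      by (rule has_derivative_compose[where g=v and f="\<lambda>t. c + t *\<^sub>R e", OF _ has_grad_derivative[OF vg]])
         (auto intro!: derivative_eq_intros)
    then show ?thesis by (simp add: has_field_derivative_def mult.commute[of _ "g _ \<bullet> e"] cong: if_cong)
  qed
  have hb: "has_bochner_integral lborel (\<lambda>t. (g (c + t *\<^sub>R e) \<bullet> e) * indicator {a..b} t) (v (c + b *\<^sub>R e) - v (c + a *\<^sub>R e))"
    by (rule has_bochner_integral_FTC_Icc_real[OF ab d])
       (use gc in \<open>auto simp: continuous_on_eq_continuous_at\<close>)
  have "ennreal (norm (v (c + b *\<^sub>R e) - v (c + a *\<^sub>R e))) \<le> (\<integral>\<^sup>+t. ennreal (norm ((g (c + t *\<^sub>R e) \<bullet> e) * indicator {a..b} t)) \<partial>lborel)"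
    using has_bochner_integral_norm_bound[OF hb] .
  also have "\<dots> \<le> (\<integral>\<^sup>+t\<in>{a..b}. ennreal (norm e * norm (g (c + t *\<^sub>R e))) \<partial>lborel)"
  proof (rule nn_integral_mono)
    fix t
    have "\<bar>g (c + t *\<^sub>R e) \<bullet> e\<bar> \<le> norm e * norm (g (c + t *\<^sub>R e))"
      using Cauchy_Schwarz_ineq2[of "g (c + t *\<^sub>R e)" e] by (simp add: mult.commute)
    then show "ennreal (norm ((g (c + t *\<^sub>R e) \<bullet> e) * indicator {a..b} t)) \<le> ennreal (norm e * norm (g (c + t *\<^sub>R e))) * indicator {a..b} t"
      by (auto simp: indicator_def ennreal_leI)
  qed
  finally show ?thesis by simp
qed

lemma ennreal_le_of_sq_le:
  assumes "x\<^sup>2 \<le> ennreal (a\<^sup>2)" "0 \<le> a"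
  shows "x \<le> ennreal a"
proof (cases x)
  case (real y)
  then have "ennreal (y\<^sup>2) \<le> ennreal (a\<^sup>2)" using assms by (simp add: ennreal_power)
  then have "y\<^sup>2 \<le> a\<^sup>2" by (simp add: ennreal_le_iff)
  then show ?thesis using real assms(2) by (auto intro!: ennreal_leI power2_le_imp_le)
next
  case top then show ?thesis using assms by (simp add: power2_eq_square top_unique)
qed

definition unit_e1 :: "real^2" where "unit_e1 = axis 1 1"
definition unit_e2 :: "real^2" where "unit_e2 = axis 2 1"

lemma unit_e_component [simp]:
  "unit_e1 $ 1 = 1" "unit_e1 $ 2 = 0" "unit_e2 $ 1 = 0" "unit_e2 $ 2 = 1"
  "norm unit_e1 = 1" "norm unit_e2 = 1"
  by (simp_all add: unit_e1_def unit_e2_def norm_axis_1) (simp_all add: axis_def)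

text \<open>Since \<open>real^2\<close> is not a product type, Lebesgue measure is first identified
  with the image of the product measure under \<open>T\<close>, by its values on boxes. The two
  orders of integration serve the vertical and the horizontal sides of squares.\<close>

lemma nn_integral_real2:
  fixes f :: "real^2 \<Rightarrow> ennreal"
  assumes [measurable]: "f \<in> borel_measurable borel"
  shows "(\<integral>\<^sup>+x. f x \<partial>lborel) = (\<integral>\<^sup>+s. \<integral>\<^sup>+t. f (s *\<^sub>R unit_e1 + t *\<^sub>R unit_e2) \<partial>lborel \<partial>lborel)"
    and "(\<integral>\<^sup>+x. f x \<partial>lborel) = (\<integral>\<^sup>+s. \<integral>\<^sup>+t. f (s *\<^sub>R unit_e2 + t *\<^sub>R unit_e1) \<partial>lborel \<partial>lborel)"
proof -
  define T :: "real \<times> real \<Rightarrow> real^2" where "T p = fst p *\<^sub>R unit_e1 + snd p *\<^sub>R unit_e2" for p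
  have "continuous_on UNIV T" unfolding T_def by (intro continuous_intros)
  then have [measurable]: "T \<in> borel_measurable borel" by (rule borel_measurable_continuous_onI)
  have "distr lborel borel T = lborel"
  proof (rule lborel_eqI[symmetric])
    fix l u :: "real^2"
    assume lu: "\<And>b. b \<in> Basis \<Longrightarrow> l \<bullet> b \<le> u \<bullet> b"
    have le: "l $ 1 \<le> u $ 1" "l $ 2 \<le> u $ 2"
      using lu[of "axis 1 1"] lu[of "axis 2 1"] by (auto simp: inner_axis axis_in_Basis_iff)
    have "T -` box l u = box (l $ 1) (u $ 1) \<times> box (l $ 2) (u $ 2)"
      by (auto simp: T_def mem_box_cart forall_2 box_real)
    then have "emeasure (distr lborel borel T) (box l u) = emeasure (lborel \<Otimes>\<^sub>M lborel) (box (l $ 1) (u $ 1) \<times> box (l $ 2) (u $ 2))"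
      by (subst emeasure_distr) (auto simp: lborel_prod)
    also have "\<dots> = emeasure lborel (box (l $ 1) (u $ 1)) * emeasure lborel (box (l $ 2) (u $ 2))"
      by (rule lborel.emeasure_pair_measure_Times) auto
    also have "\<dots> = ennreal ((u $ 1 - l $ 1) * (u $ 2 - l $ 2))"
      using le by (simp add: box_real ennreal_mult)
    also have "(u $ 1 - l $ 1) * (u $ 2 - l $ 2) = (\<Prod>b\<in>Basis. (u - l) \<bullet> b)"
      by (simp add: Basis_vec_def UNIV_2 axis_eq_axis inner_axis)
    finally show "emeasure (distr lborel borel T) (box l u) = (\<Prod>b\<in>Basis. (u - l) \<bullet> b)" .
  qed auto
  then have "(\<integral>\<^sup>+x. f x \<partial>lborel) = (\<integral>\<^sup>+x. f x \<partial>distr lborel borel T)" by simp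
  also have "\<dots> = (\<integral>\<^sup>+p. f (T p) \<partial>lborel)" by (rule nn_integral_distr) auto
  also have "\<dots> = (\<integral>\<^sup>+p. f (T p) \<partial>(lborel \<Otimes>\<^sub>M lborel))" by (simp add: lborel_prod)
  finally have e: "(\<integral>\<^sup>+x. f x \<partial>lborel) = (\<integral>\<^sup>+p. f (T p) \<partial>(lborel \<Otimes>\<^sub>M lborel))" .
  have m: "(\<lambda>p. f (T p)) \<in> borel_measurable (lborel \<Otimes>\<^sub>M lborel)" by (simp add: lborel_prod)
  have "(\<integral>\<^sup>+p. f (T p) \<partial>(lborel \<Otimes>\<^sub>M lborel)) = (\<integral>\<^sup>+a. \<integral>\<^sup>+b. f (T (a, b)) \<partial>lborel \<partial>lborel)"
    by (rule lborel.nn_integral_fst[OF m, symmetric])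
  then show 1: "(\<integral>\<^sup>+x. f x \<partial>lborel) = (\<integral>\<^sup>+s. \<integral>\<^sup>+t. f (s *\<^sub>R unit_e1 + t *\<^sub>R unit_e2) \<partial>lborel \<partial>lborel)"
    using e by (simp add: T_def)
  have "(\<integral>\<^sup>+s. \<integral>\<^sup>+t. f (s *\<^sub>R unit_e1 + t *\<^sub>R unit_e2) \<partial>lborel \<partial>lborel) = (\<integral>\<^sup>+t. \<integral>\<^sup>+s. f (s *\<^sub>R unit_e1 + t *\<^sub>R unit_e2) \<partial>lborel \<partial>lborel)"
    using lborel_pair.Fubini'[of "\<lambda>s t. f (s *\<^sub>R unit_e1 + t *\<^sub>R unit_e2)"] m by (simp add: T_def case_prod_beta')
  then show "(\<integral>\<^sup>+x. f x \<partial>lborel) = (\<integral>\<^sup>+s. \<integral>\<^sup>+t. f (s *\<^sub>R unit_e2 + t *\<^sub>R unit_e1) \<partial>lborel \<partial>lborel)"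
    using 1 by (simp add: add.commute)
qed

text \<open>The maximum norm: its spheres are boundaries of squares with sides parallel to the
  axes.\<close>

definition sq_norm :: "real^2 \<Rightarrow> real" where "sq_norm x = max \<bar>x $ 1\<bar> \<bar>x $ 2\<bar>"

lemma continuous_on_sq_norm [continuous_intros]: "continuous_on S f \<Longrightarrow> continuous_on S (\<lambda>x. sq_norm (f x))"
  unfolding sq_norm_def by (intro continuous_intros)

lemma sq_norm_le_norm: "sq_norm x \<le> norm x"
  by (simp add: sq_norm_def component_le_norm_cart)

lemma norm_le_sq_norm: "norm x \<le> 2 * sq_norm x"
proof -
  have "norm x \<le> (\<Sum>i\<in>UNIV. \<bar>x $ i\<bar>)" by (rule norm_le_l1_cart)
  also have "\<dots> \<le> 2 * sq_norm x" by (simp add: sq_norm_def sum_2)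
  finally show ?thesis .
qed

lemma norm_sq_le_sq_norm: "(norm x)\<^sup>2 \<le> 2 * (sq_norm x)\<^sup>2"
proof -
  have "(norm x)\<^sup>2 = \<bar>x $ 1\<bar>\<^sup>2 + \<bar>x $ 2\<bar>\<^sup>2"
    by (simp add: power2_norm_eq_inner inner_vec_def sum_2) (simp add: power2_eq_square)
  also have "\<dots> \<le> (sq_norm x)\<^sup>2 + (sq_norm x)\<^sup>2"
    unfolding sq_norm_def by (intro add_mono power_mono) auto
  finally show ?thesis by simp
qed

text \<open>The sign \<open>\<sigma>\<close> and the order of \<open>e\<close> and \<open>f\<close>
  select one of the four sides at distance \<open>\<rho>\<close> from the centre \<open>c\<close>.
  Each side is prolonged to the fixed length \<open>2 * R\<close>, so that the slices are slices of
  one and the same square and Fubini applies.\<close>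

lemma slice_energy:
  fixes g :: "real^2 \<Rightarrow> real^2"
  assumes gc: "continuous_on UNIV g" and ef: "(e, f) = (unit_e1, unit_e2) \<or> (e, f) = (unit_e2, unit_e1)" and \<sigma>: "\<sigma> = 1 \<or> \<sigma> = - 1"
    and r: "0 \<le> r"
  shows "(\<integral>\<^sup>+\<rho>\<in>{r..R}. (\<integral>\<^sup>+t\<in>{-R..R}. ennreal ((norm (g (c + (\<sigma> * \<rho>) *\<^sub>R e + t *\<^sub>R f)))\<^sup>2) \<partial>lborel) \<partial>lborel) \<le>
     (\<integral>\<^sup>+x\<in>{x. sq_norm (x - c) \<le> R}. ennreal ((norm (g x))\<^sup>2) \<partial>lborel)" (is "?L \<le> ?R")
    and "(\<lambda>\<rho>. \<integral>\<^sup>+t\<in>{-R..R}. ennreal ((norm (g (c + (\<sigma> * \<rho>) *\<^sub>R e + t *\<^sub>R f)))\<^sup>2) \<partial>lborel) \<in> borel_measurable borel"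
proof -
  have [measurable]: "g \<in> borel_measurable borel" using gc by (rule borel_measurable_continuous_onI)
  have sq: "sq_norm (s *\<^sub>R e + t *\<^sub>R f) \<le> R \<longleftrightarrow> \<bar>s\<bar> \<le> R \<and> \<bar>t\<bar> \<le> R" for s t
    using ef by (auto simp: sq_norm_def)
  have "closed {x. sq_norm x \<le> R}" by (intro closed_Collect_le continuous_intros)
  then have Cm: "{x. sq_norm x \<le> R} \<in> sets borel" by simp
  have Cm': "{x. sq_norm (x - c) \<le> R} \<in> sets borel"
    by (rule borel_closed) (intro closed_Collect_le continuous_intros)
  define h where "h x = ennreal ((norm (g (c + x)))\<^sup>2) * indicator {x. sq_norm x \<le> R} x" for x
  have hm[measurable]: "h \<in> borel_measurable borel" unfolding h_def
    by (rule borel_measurable_times_ennreal[OF _ borel_measurable_indicator[OF Cm]]) measurable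
  define w where "w s = (\<integral>\<^sup>+t. h (s *\<^sub>R e + t *\<^sub>R f) \<partial>lborel)" for s
  have wm[measurable]: "w \<in> borel_measurable borel" unfolding w_def by measurable
  show "(\<lambda>\<rho>. \<integral>\<^sup>+t\<in>{-R..R}. ennreal ((norm (g (c + (\<sigma> * \<rho>) *\<^sub>R e + t *\<^sub>R f)))\<^sup>2) \<partial>lborel) \<in> borel_measurable borel"
    by measurable
  have "?R = (\<integral>\<^sup>+x. ennreal ((norm (g (c + x)))\<^sup>2) * indicator {x. sq_norm (x - c) \<le> R} (c + x) \<partial>lborel)"
  proof (rule nn_integral_lborel_translate[symmetric])
    show "(\<lambda>x. ennreal ((norm (g x))\<^sup>2) * indicator {x. sq_norm (x - c) \<le> R} x) \<in> borel_measurable borel"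
      by (rule borel_measurable_times_ennreal[OF _ borel_measurable_indicator[OF Cm']]) measurable
  qed
  also have "\<dots> = (\<integral>\<^sup>+x. h x \<partial>lborel)" unfolding h_def by (intro nn_integral_cong) (auto simp: indicator_def)
  also have "\<dots> = (\<integral>\<^sup>+s. w s \<partial>lborel)"
    unfolding w_def using ef nn_integral_real2[OF hm] by auto
  also have "\<dots> = (\<integral>\<^sup>+\<rho>. w (\<sigma> * \<rho>) \<partial>lborel)"
    using \<sigma> nn_integral_lborel_reflect[OF wm, of 0] by auto
  finally have R: "?R = (\<integral>\<^sup>+\<rho>. w (\<sigma> * \<rho>) \<partial>lborel)" .
  show "?L \<le> ?R" unfolding R
  proof (rule nn_integral_mono)
    fix \<rho>
    show "(\<integral>\<^sup>+t\<in>{-R..R}. ennreal ((norm (g (c + (\<sigma> * \<rho>) *\<^sub>R e + t *\<^sub>R f)))\<^sup>2) \<partial>lborel) * indicator {r..R} \<rho> \<le> w (\<sigma> * \<rho>)"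
    proof (cases "\<rho> \<in> {r..R}")
      case True
      have "\<bar>\<sigma> * \<rho>\<bar> \<le> R" using True \<sigma> r by auto
      then have "w (\<sigma> * \<rho>) = (\<integral>\<^sup>+t\<in>{-R..R}. ennreal ((norm (g (c + (\<sigma> * \<rho>) *\<^sub>R e + t *\<^sub>R f)))\<^sup>2) \<partial>lborel)"
        unfolding w_def h_def by (intro nn_integral_cong) (auto simp: indicator_def sq add.assoc)
      then show ?thesis using True by simp
    next
      case False
      then show ?thesis by (auto simp: indicator_def)
    qed
  qed
qed

text \<open>Integrated over \<open>\<rho>\<close>, the four sides carry energy at most
  \<open>4 * K\<close>, so their energy cannot exceed \<open>A / \<rho>\<close> for all
  \<open>\<rho>\<close> in \<open>{r..R}\<close>. At a good \<open>\<rho>\<close>, Cauchy-Schwarz on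
  a side of length \<open>2 * \<rho>\<close> bounds the oscillation along it by an expression from
  which \<open>\<rho>\<close> has cancelled.\<close>

lemma courant_lebesgue:
  fixes v :: "real^2 \<Rightarrow> real"
  assumes vg: "has_grad v g" and r: "0 < r" "r < R" and K: "0 < K"
    and E: "(\<integral>\<^sup>+x\<in>{x. sq_norm (x - c) \<le> R}. ennreal ((norm (g x))\<^sup>2) \<partial>lborel) \<le> ennreal K"
  obtains \<rho> where "r \<le> \<rho>" "\<rho> \<le> R"
    "\<And>x y. sq_norm (x - c) = \<rho> \<Longrightarrow> sq_norm (y - c) = \<rho> \<Longrightarrow> \<bar>v x - v y\<bar> \<le> 16 * sqrt (K / ln (R / r))"
proof -
  have gc: "continuous_on UNIV g" by (rule has_grad_continuous_grad[OF vg])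
  have gm[measurable]: "g \<in> borel_measurable borel" using gc by (rule borel_measurable_continuous_onI)
  define W where "W e f \<sigma> \<rho> = (\<integral>\<^sup>+t\<in>{-R..R}. ennreal ((norm (g (c + (\<sigma> * \<rho>) *\<^sub>R e + t *\<^sub>R f)))\<^sup>2) \<partial>lborel)" for e f \<sigma> \<rho>
  have Wm[measurable]: "W e f \<sigma> \<in> borel_measurable borel" for e f \<sigma>
    unfolding W_def by measurable
  have WK: "(\<integral>\<^sup>+\<rho>\<in>{r..R}. W e f \<sigma> \<rho> \<partial>lborel) \<le> ennreal K"
    if "(e, f) = (unit_e1, unit_e2) \<or> (e, f) = (unit_e2, unit_e1)" "\<sigma> = 1 \<or> \<sigma> = - 1" for e f \<sigma>
    using order_trans[OF slice_energy(1)[OF gc that] E] r unfolding W_def by simp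
  define S where "S \<rho> = W unit_e1 unit_e2 1 \<rho> + W unit_e1 unit_e2 (-1) \<rho> + W unit_e2 unit_e1 1 \<rho> + W unit_e2 unit_e1 (-1) \<rho>" for \<rho>
  define l where "l = ln (R / r)"
  have l: "l > 0" "l = ln R - ln r" using r by (auto simp: l_def ln_div)
  \<comment> \<open>Twice what the sides can afford on average: \<open>A / \<rho>\<close> integrates
    to \<open>8 * K\<close> over \<open>{r..R}\<close>, against at most
    \<open>4 * K\<close>.\<close>
  define A where "A = 8 * K / l"
  have A: "A > 0" "A * l = 8 * K" using K l by (auto simp: A_def)
  have "\<exists>\<rho>\<in>{r..R}. S \<rho> \<le> ennreal (A / \<rho>)"
  proof (rule ccontr)
    assume "\<not> ?thesis"
    then have big: "ennreal (A / \<rho>) \<le> S \<rho>" if "\<rho> \<in> {r..R}" for \<rho> using that by (meson linear)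
    have "ennreal (A * ln R - A * ln r) = (\<integral>\<^sup>+\<rho>. ennreal (A / \<rho>) * indicator {r..R} \<rho> \<partial>lborel)"
      by (rule nn_integral_FTC_Icc[where F="\<lambda>x. A * ln x", symmetric])
         (use r A in \<open>auto intro!: derivative_eq_intros simp: field_simps\<close>)
    also have "\<dots> \<le> (\<integral>\<^sup>+\<rho>\<in>{r..R}. S \<rho> \<partial>lborel)"
      by (intro nn_integral_mono) (use big in \<open>auto simp: indicator_def\<close>)
    also have "\<dots> = (\<integral>\<^sup>+\<rho>\<in>{r..R}. W unit_e1 unit_e2 1 \<rho> \<partial>lborel) + (\<integral>\<^sup>+\<rho>\<in>{r..R}. W unit_e1 unit_e2 (-1) \<rho> \<partial>lborel) +
       (\<integral>\<^sup>+\<rho>\<in>{r..R}. W unit_e2 unit_e1 1 \<rho> \<partial>lborel) + (\<integral>\<^sup>+\<rho>\<in>{r..R}. W unit_e2 unit_e1 (-1) \<rho> \<partial>lborel)"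
      unfolding S_def by (simp add: distrib_right nn_integral_add)
    also have "\<dots> \<le> ennreal K + ennreal K + ennreal K + ennreal K" by (intro add_mono WK) auto
    also have "\<dots> = ennreal (4 * K)" using K by (simp flip: ennreal_plus)
    finally have "ennreal (A * ln R - A * ln r) \<le> ennreal (4 * K)" .
    moreover have "A * ln R - A * ln r = 8 * K" using A l by (simp add: right_diff_distrib)
    ultimately show False using K by (simp add: ennreal_le_iff)
  qed
  then obtain \<rho> where \<rho>: "\<rho> \<in> {r..R}" and S\<rho>: "S \<rho> \<le> ennreal (A / \<rho>)" by blast
  have \<rho>0: "\<rho> > 0" using \<rho> r by auto
  define q where "q = sqrt (2 * A)"
  have q: "q \<ge> 0" "q\<^sup>2 = 2 * A" using A by (auto simp: q_def)
  have W\<rho>: "W e f \<sigma> \<rho> \<le> ennreal (A / \<rho>)"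
    if "(e, f) = (unit_e1, unit_e2) \<or> (e, f) = (unit_e2, unit_e1)" "\<sigma> = 1 \<or> \<sigma> = - 1" for e f \<sigma>
  proof -
    have "W e f \<sigma> \<rho> \<le> S \<rho>" using that unfolding S_def by (auto simp: add_increasing add_increasing2)
    then show ?thesis using S\<rho> by (rule order_trans)
  qed
  have side1: "\<bar>v (c + (\<sigma> * \<rho>) *\<^sub>R e + b *\<^sub>R f) - v (c + (\<sigma> * \<rho>) *\<^sub>R e + a *\<^sub>R f)\<bar> \<le> q"
    if ef: "(e, f) = (unit_e1, unit_e2) \<or> (e, f) = (unit_e2, unit_e1)" "\<sigma> = 1 \<or> \<sigma> = - 1" and ab: "- \<rho> \<le> a" "a \<le> b" "b \<le> \<rho>" for e f \<sigma> a b
  proof -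
    have nf: "norm f = 1" using ef by auto
    have "ennreal \<bar>v (c + (\<sigma> * \<rho>) *\<^sub>R e + b *\<^sub>R f) - v (c + (\<sigma> * \<rho>) *\<^sub>R e + a *\<^sub>R f)\<bar> \<le>
      (\<integral>\<^sup>+t\<in>{a..b}. ennreal (norm f * norm (g (c + (\<sigma> * \<rho>) *\<^sub>R e + t *\<^sub>R f))) \<partial>lborel)"
      by (rule has_grad_line_bound[OF vg ab(2)])
    also have "\<dots> \<le> (\<integral>\<^sup>+t. indicator {-\<rho>..\<rho>} t * (ennreal (norm (g (c + (\<sigma> * \<rho>) *\<^sub>R e + t *\<^sub>R f))) * indicator {-R..R} t) \<partial>lborel)"
      by (intro nn_integral_mono) (use ab \<rho> in \<open>auto simp: indicator_def nf\<close>)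
    finally have 1: "ennreal \<bar>v (c + (\<sigma> * \<rho>) *\<^sub>R e + b *\<^sub>R f) - v (c + (\<sigma> * \<rho>) *\<^sub>R e + a *\<^sub>R f)\<bar> \<le>
      (\<integral>\<^sup>+t. indicator {-\<rho>..\<rho>} t * (ennreal (norm (g (c + (\<sigma> * \<rho>) *\<^sub>R e + t *\<^sub>R f))) * indicator {-R..R} t) \<partial>lborel)" (is "_ \<le> ?I") .
    have "?I\<^sup>2 \<le> (\<integral>\<^sup>+t. (indicator {-\<rho>..\<rho>} t)\<^sup>2 \<partial>lborel) *
       (\<integral>\<^sup>+t. (ennreal (norm (g (c + (\<sigma> * \<rho>) *\<^sub>R e + t *\<^sub>R f))) * indicator {-R..R} t)\<^sup>2 \<partial>lborel)"
      by (rule Cauchy_Schwarz_nn_integral) measurable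
    also have "(\<integral>\<^sup>+t. (indicator {-\<rho>..\<rho>} t)\<^sup>2 \<partial>lborel) = (\<integral>\<^sup>+t. indicator {-\<rho>..\<rho>} t \<partial>lborel)"
      by (intro nn_integral_cong) (auto simp: indicator_def)
    also have "\<dots> = ennreal (2 * \<rho>)" using \<rho>0 by simp
    also have "(\<integral>\<^sup>+t. (ennreal (norm (g (c + (\<sigma> * \<rho>) *\<^sub>R e + t *\<^sub>R f))) * indicator {-R..R} t)\<^sup>2 \<partial>lborel) = W e f \<sigma> \<rho>"
      unfolding W_def by (intro nn_integral_cong) (auto simp: indicator_def ennreal_power)
    also have "ennreal (2 * \<rho>) * W e f \<sigma> \<rho> \<le> ennreal (2 * \<rho>) * ennreal (A / \<rho>)"
      by (intro mult_left_mono W\<rho> ef) auto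
    also have "\<dots> = ennreal (q\<^sup>2)" using \<rho>0 A q by (simp flip: ennreal_mult)
    finally have "?I \<le> ennreal q" by (rule ennreal_le_of_sq_le) (rule q(1))
    with 1 have "ennreal \<bar>v (c + (\<sigma> * \<rho>) *\<^sub>R e + b *\<^sub>R f) - v (c + (\<sigma> * \<rho>) *\<^sub>R e + a *\<^sub>R f)\<bar> \<le> ennreal q" by (rule order_trans)
    then show ?thesis using q(1) by (simp add: ennreal_le_iff)
  qed
  have side: "\<bar>v (c + (\<sigma> * \<rho>) *\<^sub>R e + a *\<^sub>R f) - v (c + (\<sigma> * \<rho>) *\<^sub>R e + b *\<^sub>R f)\<bar> \<le> q"
    if ef: "(e, f) = (unit_e1, unit_e2) \<or> (e, f) = (unit_e2, unit_e1)" "\<sigma> = 1 \<or> \<sigma> = - 1" and ab: "\<bar>a\<bar> \<le> \<rho>" "\<bar>b\<bar> \<le> \<rho>" for e f \<sigma> a b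
    using side1[OF ef, of a b] side1[OF ef, of b a] ab by (cases "a \<le> b") (auto simp: abs_minus_commute abs_le_iff)
  \<comment> \<open>Every boundary point reaches this corner along at most two sides, so two
    boundary points differ in value by at most \<open>4 * q\<close>, where
    \<open>q = 4 * sqrt (K / l)\<close>.\<close>
  define C where "C = c + \<rho> *\<^sub>R unit_e1 + \<rho> *\<^sub>R unit_e2"
  have corner: "\<bar>v x - v C\<bar> \<le> 2 * q" if x: "sq_norm (x - c) = \<rho>" for x
  proof -
    define a where "a = (x - c) $ 1"
    define b where "b = (x - c) $ 2"
    have xe: "x = c + a *\<^sub>R unit_e1 + b *\<^sub>R unit_e2"
      by (simp add: vec_eq_iff forall_2 a_def b_def)
    have ab: "\<bar>a\<bar> \<le> \<rho>" "\<bar>b\<bar> \<le> \<rho>" "\<bar>a\<bar> = \<rho> \<or> \<bar>b\<bar> = \<rho>"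
      using x by (auto simp: sq_norm_def a_def b_def max_def split: if_splits)
    consider "a = \<rho>" | "a = - \<rho>" | "b = \<rho>" | "b = - \<rho>" using ab(3) by linarith
    then show ?thesis
    proof cases
      case 1
      then show ?thesis using side[of unit_e1 unit_e2 1 b \<rho>] ab \<rho>0 q(1) by (simp add: xe C_def)
    next
      case 2
      then show ?thesis
        using side[of unit_e1 unit_e2 "-1" b \<rho>] side[of unit_e2 unit_e1 1 "-\<rho>" \<rho>] ab \<rho>0
        by (simp add: xe C_def algebra_simps)
    next
      case 3
      then show ?thesis using side[of unit_e2 unit_e1 1 a \<rho>] ab \<rho>0 q(1) by (simp add: xe C_def algebra_simps)
    next
      case 4
      then show ?thesis
        using side[of unit_e2 unit_e1 "-1" a \<rho>] side[of unit_e1 unit_e2 1 "-\<rho>" \<rho>] ab \<rho>0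
        by (simp add: xe C_def algebra_simps)
    qed
  qed
  have "4 * q = 16 * sqrt (K / ln (R / r))"
  proof -
    have "2 * A = 4\<^sup>2 * (K / l)" by (simp add: A_def)
    then have "q = 4 * sqrt (K / l)" unfolding q_def by (simp only: real_sqrt_mult real_sqrt_abs)
    then show ?thesis by (simp add: l_def)
  qed
  then have "\<bar>v x - v y\<bar> \<le> 16 * sqrt (K / ln (R / r))" if "sq_norm (x - c) = \<rho>" "sq_norm (y - c) = \<rho>" for x y
    using corner[OF that(1)] corner[OF that(2)] by linarith
  then show thesis using that[of \<rho>] \<rho> by auto
qed

subsection \<open>Compactness\<close>

text \<open>The increment is bounded by the integral of the gradient along the segment; exchanging
  the integrals, each intermediate translate stays in the ball enlarged by \<open>d\<close>.\<close>

lemma nn_integral_translate_diff: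
  fixes v :: "'a::euclidean_space \<Rightarrow> real"
  assumes vg: "has_grad v g" and h: "norm h \<le> d"
  shows "(\<integral>\<^sup>+x\<in>cball 0 s. ennreal \<bar>v (x + h) - v x\<bar> \<partial>lborel) \<le> ennreal d * (\<integral>\<^sup>+x\<in>cball 0 (s + d). ennreal (norm (g x)) \<partial>lborel)"
proof -
  have gm[measurable]: "g \<in> borel_measurable borel" using has_grad_borel[OF vg] by simp
  define G where "G x = ennreal (norm (g x)) * indicator (cball 0 (s + d)) x" for x
  have Gm[measurable]: "G \<in> borel_measurable borel" unfolding G_def
    by (rule borel_measurable_times_ennreal[OF _ borel_measurable_indicator]) simp_all
  have "(\<integral>\<^sup>+x\<in>cball 0 s. ennreal \<bar>v (x + h) - v x\<bar> \<partial>lborel) \<le>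
     (\<integral>\<^sup>+x. \<integral>\<^sup>+t. ennreal (norm h) * (indicator {0..1} t * G (x + t *\<^sub>R h)) \<partial>lborel \<partial>lborel)"
  proof (rule nn_integral_mono)
    fix x
    show "ennreal \<bar>v (x + h) - v x\<bar> * indicator (cball 0 s) x \<le> (\<integral>\<^sup>+t. ennreal (norm h) * (indicator {0..1} t * G (x + t *\<^sub>R h)) \<partial>lborel)"
    proof (cases "norm x \<le> s")
      case True
      have "ennreal \<bar>v (x + h) - v x\<bar> \<le> (\<integral>\<^sup>+t\<in>{0..1}. ennreal (norm h * norm (g (x + t *\<^sub>R h))) \<partial>lborel)"
        using has_grad_line_bound[OF vg, of 0 1 x h] by simp
      also have "\<dots> \<le> (\<integral>\<^sup>+t. ennreal (norm h) * (indicator {0..1} t * G (x + t *\<^sub>R h)) \<partial>lborel)"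
      proof (rule nn_integral_mono)
        fix t :: real
        show "ennreal (norm h * norm (g (x + t *\<^sub>R h))) * indicator {0..1} t \<le> ennreal (norm h) * (indicator {0..1} t * G (x + t *\<^sub>R h))"
        proof (cases "t \<in> {0..1}")
          case t: True
          have "norm (x + t *\<^sub>R h) \<le> norm x + t * norm h" using norm_triangle_ineq[of x "t *\<^sub>R h"] t by simp
          also have "\<dots> \<le> s + d" using True h t mult_left_le_one_le[of "norm h" t] by (intro add_mono) auto
          finally show ?thesis using t by (simp add: G_def ennreal_mult)
        qed simp
      qed
      finally show ?thesis using True by simp
    qed simp
  qed
  also have "\<dots> = (\<integral>\<^sup>+t. \<integral>\<^sup>+x. ennreal (norm h) * (indicator {0..1} t * G (x + t *\<^sub>R h)) \<partial>lborel \<partial>lborel)"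
    by (rule lborel_pair.Fubini'[symmetric]) measurable
  also have "\<dots> = (\<integral>\<^sup>+t. ennreal (norm h) * (\<integral>\<^sup>+x. G x \<partial>lborel) * indicator {0..1::real} t \<partial>lborel)"
  proof (rule nn_integral_cong)
    fix t :: real
    have "(\<integral>\<^sup>+x. G (x + t *\<^sub>R h) \<partial>lborel) = (\<integral>\<^sup>+x. G x \<partial>lborel)"
      using nn_integral_lborel_translate[OF Gm, of "t *\<^sub>R h"] by (simp add: add.commute)
    then show "(\<integral>\<^sup>+x. ennreal (norm h) * (indicator {0..1} t * G (x + t *\<^sub>R h)) \<partial>lborel) = ennreal (norm h) * (\<integral>\<^sup>+x. G x \<partial>lborel) * indicator {0..1} t"
      by (simp add: nn_integral_cmult ac_simps)
  qed
  also have "\<dots> = ennreal (norm h) * (\<integral>\<^sup>+x. G x \<partial>lborel)"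
    by (subst nn_integral_cmult_indicator) auto
  also have "\<dots> \<le> ennreal d * (\<integral>\<^sup>+x. G x \<partial>lborel)"
    using h by (intro mult_right_mono ennreal_leI) auto
  finally show ?thesis unfolding G_def .
qed

text \<open>The error is an average of increments by vectors shorter than \<open>e\<close>. The rate
  depends on \<open>v\<close> only through its gradient, which makes it uniform along a sequence
  with bounded energy.\<close>

lemma mollify_L1_rate:
  fixes v :: "'a::euclidean_space \<Rightarrow> real"
  assumes vg: "has_grad v g" and b: "bump e p"
  shows "(\<integral>\<^sup>+x\<in>cball 0 s. ennreal \<bar>(\<integral>y. p (x - y) * v y \<partial>lborel) - v x\<bar> \<partial>lborel) \<le>
     ennreal e * (\<integral>\<^sup>+x\<in>cball 0 (s + e). ennreal (norm (g x)) \<partial>lborel)"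
proof -
  have vc: "continuous_on UNIV v" by (rule has_grad_continuous[OF vg])
  have vm[measurable]: "v \<in> borel_measurable borel" using has_grad_borel[OF vg] by simp
  have pm[measurable]: "p \<in> borel_measurable borel" using bumpD[OF b] by simp
  define B where "B = ennreal e * (\<integral>\<^sup>+x\<in>cball 0 (s + e). ennreal (norm (g x)) \<partial>lborel)"
  have "(\<integral>\<^sup>+x\<in>cball 0 s. ennreal \<bar>(\<integral>y. p (x - y) * v y \<partial>lborel) - v x\<bar> \<partial>lborel) \<le>
     (\<integral>\<^sup>+x. \<integral>\<^sup>+h. ennreal (p (- h)) * (ennreal \<bar>v (x + h) - v x\<bar> * indicator (cball 0 s) x) \<partial>lborel \<partial>lborel)"
  proof (rule nn_integral_mono)
    fix x
    have i: "integrable lborel (\<lambda>y. p (x - y) * v y)"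
    proof (rule integrable_continuous_bounded_support[where r="norm x + e"])
      show "continuous_on UNIV (\<lambda>y. p (x - y) * v y)"
        by (intro continuous_intros vc continuous_on_compose2[OF bumpD(6)[OF b]]) auto
      fix y :: 'a assume "norm x + e < norm y"
      then have "e \<le> norm (x - y)" using norm_triangle_ineq2[of y x] by (simp add: norm_minus_commute)
      then show "p (x - y) * v y = 0" using bumpD(3)[OF b] by simp
    qed
    have "(\<integral>y. p (x - y) * v y \<partial>lborel) - v x = (\<integral>y. p (x - y) * (v y - v x) \<partial>lborel)"
      using i bump_integral_reflect(1,2)[OF b, of x] by (simp add: right_diff_distrib)
    also have "ennreal \<bar>\<dots>\<bar> \<le> (\<integral>\<^sup>+y. ennreal (norm (p (x - y) * (v y - v x))) \<partial>lborel)"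
      using integral_norm_bound_ennreal[of lborel "\<lambda>y. p (x - y) * (v y - v x)"] i bump_integral_reflect(1)[OF b, of x]
      by (simp add: right_diff_distrib)
    also have "\<dots> = (\<integral>\<^sup>+h. ennreal (norm (p (x - (x + h)) * (v (x + h) - v x))) \<partial>lborel)"
      by (rule nn_integral_lborel_translate[symmetric]) measurable
    also have "\<dots> = (\<integral>\<^sup>+h. ennreal (p (- h)) * ennreal \<bar>v (x + h) - v x\<bar> \<partial>lborel)"
      using bumpD(2)[OF b] by (intro nn_integral_cong) (simp add: abs_mult ennreal_mult)
    finally show "ennreal \<bar>(\<integral>y. p (x - y) * v y \<partial>lborel) - v x\<bar> * indicator (cball 0 s) x \<le>
        (\<integral>\<^sup>+h. ennreal (p (- h)) * (ennreal \<bar>v (x + h) - v x\<bar> * indicator (cball 0 s) x) \<partial>lborel)"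
      by (cases "x \<in> cball 0 s") auto
  qed
  also have "\<dots> = (\<integral>\<^sup>+h. \<integral>\<^sup>+x. ennreal (p (- h)) * (ennreal \<bar>v (x + h) - v x\<bar> * indicator (cball 0 s) x) \<partial>lborel \<partial>lborel)"
  proof (rule lborel_pair.Fubini'[symmetric])
    have "(\<lambda>q. (indicator (cball (0::'a) s) (fst q) :: ennreal)) \<in> borel_measurable (lborel \<Otimes>\<^sub>M (lborel :: 'a measure))"
      by (rule measurable_compose[OF measurable_fst borel_measurable_indicator]) simp
    then show "(\<lambda>(x, h). ennreal (p (- h)) * (ennreal \<bar>v (x + h) - v x\<bar> * indicator (cball 0 s) x)) \<in> borel_measurable (lborel \<Otimes>\<^sub>M lborel)"
      unfolding case_prod_beta' by measurable
  qed
  also have "\<dots> \<le> (\<integral>\<^sup>+h. ennreal (p (- h)) * B \<partial>lborel)"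
  proof (rule nn_integral_mono)
    fix h :: 'a
    have "(\<lambda>x. ennreal \<bar>v (x + h) - v x\<bar> * indicator (cball 0 s) x) \<in> borel_measurable lborel"
      by (rule borel_measurable_times_ennreal[OF _ borel_measurable_indicator]) simp_all
    then have "(\<integral>\<^sup>+x. ennreal (p (- h)) * (ennreal \<bar>v (x + h) - v x\<bar> * indicator (cball 0 s) x) \<partial>lborel) =
       ennreal (p (- h)) * (\<integral>\<^sup>+x\<in>cball 0 s. ennreal \<bar>v (x + h) - v x\<bar> \<partial>lborel)"
      by (rule nn_integral_cmult)
    also have "\<dots> \<le> ennreal (p (- h)) * B"
    proof (cases "norm h < e")
      case True
      then show ?thesis unfolding B_def by (intro mult_left_mono nn_integral_translate_diff[OF vg]) auto
    next
      case False
      then show ?thesis using bumpD(3)[OF b, of "- h"] by simp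
    qed
    finally show "(\<integral>\<^sup>+x. ennreal (p (- h)) * (ennreal \<bar>v (x + h) - v x\<bar> * indicator (cball 0 s) x) \<partial>lborel) \<le> ennreal (p (- h)) * B" .
  qed
  also have "\<dots> = (\<integral>\<^sup>+h. ennreal (p (0 - h)) \<partial>lborel) * B" by (simp add: nn_integral_multc)
  also have "\<dots> = B" using bump_integral_reflect(3)[OF b, of 0] by simp
  finally show ?thesis unfolding B_def .
qed

text \<open>Dyadic convex combinations of the tail from index \<open>n\<close> on. Closure under
  midpoints is what the parallelogram law asks for, and rule induction carries norm bounds and
  limits of integrals over to the combinations.\<close>

inductive_set midpoints :: "(nat \<Rightarrow> 'a \<Rightarrow> 'b::real_vector) \<Rightarrow> nat \<Rightarrow> ('a \<Rightarrow> 'b) set" for G n where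
  base: "n \<le> k \<Longrightarrow> G k \<in> midpoints G n"
| avg: "f \<in> midpoints G n \<Longrightarrow> g \<in> midpoints G n \<Longrightarrow> (\<lambda>x. (1/2) *\<^sub>R (f x + g x)) \<in> midpoints G n"

lemma midpoints_antimono:
  assumes "n \<le> m" shows "midpoints G m \<subseteq> midpoints G n"
proof
  fix f assume "f \<in> midpoints G m"
  then show "f \<in> midpoints G n"
    by induction (use assms in \<open>auto intro: midpoints.intros\<close>)
qed

lemma parallelogram_half:
  "(norm ((1/2) *\<^sub>R (a + b)))\<^sup>2 + (norm ((1/2) *\<^sub>R (a - b)))\<^sup>2 = (1/2) * (norm a)\<^sup>2 + (1/2) * (norm (b::'a::real_inner))\<^sup>2"
  unfolding power2_norm_eq_inner by (simp add: inner_add_left inner_add_right inner_diff_left inner_diff_right inner_commute field_simps)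

text \<open>A bounded sequence in \<open>L\<^sup>2\<close> has convex combinations of its tails that converge
  strongly: almost minimal elements of the tails are Cauchy by the parallelogram law.\<close>

lemma L2_bounded_weak_limit:
  fixes G :: "nat \<Rightarrow> 'a \<Rightarrow> 'b::euclidean_space"
  assumes fin: "finite_measure M" and Gm: "\<And>n. G n \<in> borel_measurable M" and K: "0 \<le> K"
    and GK: "\<And>n. (\<integral>\<^sup>+x. ennreal ((norm (G n x))\<^sup>2) \<partial>M) \<le> ennreal K"
  obtains H where "H \<in> borel_measurable M" "(\<integral>\<^sup>+x. ennreal ((norm (H x))\<^sup>2) \<partial>M) \<le> ennreal K"
    "\<And>\<phi> C l. \<phi> \<in> borel_measurable M \<Longrightarrow> (\<And>x. norm (\<phi> x) \<le> C) \<Longrightarrow>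
       (\<lambda>n. \<integral>x. G n x \<bullet> \<phi> x \<partial>M) \<longlonglongrightarrow> l \<Longrightarrow> (\<integral>x. H x \<bullet> \<phi> x \<partial>M) = l"
proof -
  interpret finite_measure M by (rule fin)
  define good where "good f \<longleftrightarrow> f \<in> borel_measurable M \<and> integrable M (\<lambda>x. (norm (f x))\<^sup>2)" for f :: "'a \<Rightarrow> 'b"
  define N where "N f = (\<integral>x. (norm (f x))\<^sup>2 \<partial>M)" for f :: "'a \<Rightarrow> 'b"
  have N0: "0 \<le> N f" for f unfolding N_def by simp
  have good_half: "good (\<lambda>x. (1/2) *\<^sub>R (f x + g x))" "good (\<lambda>x. (1/2) *\<^sub>R (f x - g x))"
      "N (\<lambda>x. (1/2) *\<^sub>R (f x + g x)) + N (\<lambda>x. (1/2) *\<^sub>R (f x - g x)) = (1/2) * N f + (1/2) * N g"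
    if "good f" "good g" for f g
  proof -
    have [measurable]: "f \<in> borel_measurable M" "g \<in> borel_measurable M" using that by (auto simp: good_def)
    have i: "integrable M (\<lambda>x. (1/2) * (norm (f x))\<^sup>2 + (1/2) * (norm (g x))\<^sup>2)" using that by (auto simp: good_def)
    have i1: "integrable M (\<lambda>x. (norm ((1/2) *\<^sub>R (f x + g x)))\<^sup>2)"
      by (rule Bochner_Integration.integrable_bound[OF i], measurable)
         (intro AE_I2, use parallelogram_half[of "f _" "g _"] in \<open>smt (verit) real_norm_def zero_le_power2\<close>)
    have i2: "integrable M (\<lambda>x. (norm ((1/2) *\<^sub>R (f x - g x)))\<^sup>2)"
      by (rule Bochner_Integration.integrable_bound[OF i], measurable)
         (intro AE_I2, use parallelogram_half[of "f _" "g _"] in \<open>smt (verit) real_norm_def zero_le_power2\<close>)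
    show "good (\<lambda>x. (1/2) *\<^sub>R (f x + g x))" unfolding good_def by (intro conjI i1) measurable
    show "good (\<lambda>x. (1/2) *\<^sub>R (f x - g x))" unfolding good_def by (intro conjI i2) measurable
    have "N (\<lambda>x. (1/2) *\<^sub>R (f x + g x)) + N (\<lambda>x. (1/2) *\<^sub>R (f x - g x)) =
       (\<integral>x. (norm ((1/2) *\<^sub>R (f x + g x)))\<^sup>2 + (norm ((1/2) *\<^sub>R (f x - g x)))\<^sup>2 \<partial>M)"
      unfolding N_def by (rule Bochner_Integration.integral_add[OF i1 i2, symmetric])
    also have "\<dots> = (1/2) * N f + (1/2) * N g"
      unfolding parallelogram_half N_def using that by (simp add: good_def)
    finally show "N (\<lambda>x. (1/2) *\<^sub>R (f x + g x)) + N (\<lambda>x. (1/2) *\<^sub>R (f x - g x)) = (1/2) * N f + (1/2) * N g" .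
  qed
  have Gg: "good (G k)" "N (G k) \<le> K" for k
  proof -
    have i: "integrable M (\<lambda>x. (norm (G k x))\<^sup>2)"
      by (rule integrableI_bounded) (use Gm GK[of k] in \<open>auto simp: less_top[symmetric] top_unique\<close>)
    then show "good (G k)" using Gm by (simp add: good_def)
    have "ennreal (N (G k)) \<le> ennreal K"
      unfolding N_def using GK[of k] nn_integral_eq_integral[OF i] by simp
    then show "N (G k) \<le> K" using K by (simp add: ennreal_le_iff)
  qed
  have mg: "good f \<and> N f \<le> K" if "f \<in> midpoints G n" for f n
    using that
  proof induction
    case (avg f g)
    then show ?case using good_half[of f g] N0[of "\<lambda>x. (1/2) *\<^sub>R (f x - g x)"] by auto
  qed (use Gg in auto)
  \<comment> \<open>On a finite measure space a small \<open>N\<close> forces a small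
    \<open>L1\<close> norm, because \<open>norm (f x) \<le> t + (norm (f x))\<^sup>2 / t\<close>.
    The \<open>L1\<close> norm then gives access to a.e. convergent subsequences.\<close>
  have L1: "integrable M f" "t > 0 \<Longrightarrow> (\<integral>x. norm (f x) \<partial>M) \<le> t * measure M (space M) + N f / t" if "good f" for f t
  proof -
    have [measurable]: "f \<in> borel_measurable M" using that by (auto simp: good_def)
    have b: "norm (f x) \<le> t + (norm (f x))\<^sup>2 / t" if "t > 0" for x t
    proof -
      have "0 \<le> (norm (f x) - t)\<^sup>2 + t * norm (f x)" using that by simp
      then have "norm (f x) * t \<le> t\<^sup>2 + (norm (f x))\<^sup>2" by (simp add: power2_diff ac_simps)
      then show ?thesis using that by (simp add: field_simps power2_eq_square)
    qed
    have i: "integrable M (\<lambda>x. t + (norm (f x))\<^sup>2 / t)" for t using that by (auto simp: good_def)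
    show "integrable M f"
    proof (rule Bochner_Integration.integrable_bound[OF i[of 1]])
      show "AE x in M. norm (f x) \<le> norm (1 + (norm (f x))\<^sup>2 / 1)"
      proof (rule AE_I2)
        fix x show "norm (f x) \<le> norm (1 + (norm (f x))\<^sup>2 / 1)" using b[of 1 x] by simp
      qed
    qed measurable
    then have fi: "integrable M (\<lambda>x. norm (f x))" by simp
    assume t: "t > 0"
    have "(\<integral>x. norm (f x) \<partial>M) \<le> (\<integral>x. t + (norm (f x))\<^sup>2 / t \<partial>M)"
      by (rule integral_mono[OF fi i]) (use b[OF t] in auto)
    also have "\<dots> = t * measure M (space M) + N f / t"
      using that by (simp add: good_def N_def)
    finally show "(\<integral>x. norm (f x) \<partial>M) \<le> t * measure M (space M) + N f / t" .
  qed
  \<comment> \<open>Least energy in the tail. It increases because tails shrink, and it is bounded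
    by \<open>K\<close>; its convergence is what makes almost minimizers Cauchy.\<close>
  define d where "d n = Inf (N ` midpoints G n)" for n
  have ne: "N ` midpoints G n \<noteq> {}" for n using midpoints.base[of n n G] by auto
  have bdd: "bdd_below (N ` midpoints G n)" for n by (rule bdd_belowI2[where m=0]) (rule N0)
  have dle: "d n \<le> N f" if "f \<in> midpoints G n" for n f
    unfolding d_def using that bdd by (auto intro: cInf_lower)
  have dinc: "incseq d"
    unfolding incseq_def d_def using midpoints_antimono by (blast intro: cInf_superset_mono[OF ne bdd] image_mono)
  have dK: "d n \<le> K" for n using dle[of "G n" n] midpoints.base[of n n G] Gg(2)[of n] by (meson order_refl order_trans)
  obtain D where D: "d \<longlonglongrightarrow> D" using incseq_convergent[OF dinc] dK by metis
  have dD: "d n \<le> D" for n using incseq_le[OF dinc D] .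
  have "\<exists>f\<in>midpoints G n. N f < d n + 1 / real (Suc n)" for n
  proof -
    have "Inf (N ` midpoints G n) < d n + 1 / real (Suc n)" unfolding d_def by simp
    then show ?thesis using cInf_lessD[OF ne] by blast
  qed
  then obtain h where h: "\<And>n. h n \<in> midpoints G n" "\<And>n. N (h n) < d n + 1 / real (Suc n)" by metis
  have hg: "good (h n)" "N (h n) \<le> K" for n using mg[OF h(1)] by auto
  have [measurable]: "h n \<in> borel_measurable M" for n using hg by (auto simp: good_def)
  \<comment> \<open>The midpoint of \<open>h n\<close> and \<open>h m\<close> belongs to the tail
    from \<open>n\<close>, so its energy is at least \<open>d n\<close>, while both functions nearly
    attain their infima. The parallelogram identity then leaves little room for their
    difference.\<close>
  have half: "N (\<lambda>x. (1/2) *\<^sub>R (h n x - h m x)) \<le> (1/2) * (D - d n) + 1 / real (Suc n)" if "n \<le> m" for n m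
  proof -
    have "h m \<in> midpoints G n" using h(1)[of m] midpoints_antimono[OF that] by blast
    then have "d n \<le> N (\<lambda>x. (1/2) *\<^sub>R (h n x + h m x))" by (intro dle midpoints.avg h(1))
    moreover have "1 / real (Suc m) \<le> 1 / real (Suc n)" using that by (simp add: frac_le)
    moreover have "Q \<le> (1/2) * (D - d n) + a"
      if "d n \<le> P" "a' \<le> a" "P + Q = (1/2) * N (h n) + (1/2) * N (h m)" "N (h n) < d n + a" "N (h m) < d m + a'"
      for P Q a a' :: real
      using that dD[of m] by argo
    ultimately show ?thesis
      using good_half(3)[OF hg(1) hg(1), of n m] h(2)[of n] h(2)[of m] by blast
  qed
  have good_diff: "good (\<lambda>x. h n x - h m x)" "N (\<lambda>x. h n x - h m x) = 4 * N (\<lambda>x. (1/2) *\<^sub>R (h n x - h m x))" for n m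
  proof -
    have e: "(norm (h n x - h m x))\<^sup>2 = 4 * (norm ((1/2) *\<^sub>R (h n x - h m x)))\<^sup>2" for x
      by (simp add: power_mult_distrib power_divide)
    show "good (\<lambda>x. h n x - h m x)"
      using good_half(2)[OF hg(1) hg(1), of n m] unfolding good_def e by simp
    show "N (\<lambda>x. h n x - h m x) = 4 * N (\<lambda>x. (1/2) *\<^sub>R (h n x - h m x))"
      unfolding N_def e by simp
  qed
  have cauchy: "\<exists>n0. \<forall>n\<ge>n0. \<forall>m\<ge>n0. (\<integral>x. norm (h n x - h m x) \<partial>M) < e" if e: "e > 0" for e
  proof -
    define t where "t = (e / 2) / (measure M (space M) + 1)"
    have t: "t > 0" "t * measure M (space M) < e / 2 + e / 4"
    proof -
      have m0: "measure M (space M) + 1 > 0" by (simp add: add_nonneg_pos)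
      then show t0: "t > 0" using e by (simp add: t_def)
      have "t * (measure M (space M) + 1) = e / 2" unfolding t_def by (rule nonzero_eq_divide_eq[THEN iffD1, OF _ refl]) (use m0 in simp)
      then show "t * measure M (space M) < e / 2 + e / 4" using t0 e by (simp add: distrib_left)
    qed
    have "(\<lambda>n. 4 * ((1/2) * (D - d n) + 1 / real (Suc n)) / t) \<longlonglongrightarrow> 4 * ((1/2) * (D - D) + 0) / t"
      using t by (intro tendsto_intros D LIMSEQ_inverse_real_of_nat[unfolded inverse_eq_divide]) auto
    then have "(\<lambda>n. 4 * ((1/2) * (D - d n) + 1 / real (Suc n)) / t) \<longlonglongrightarrow> 0" by simp
    then have "\<forall>\<^sub>F n in sequentially. 4 * ((1/2) * (D - d n) + 1 / real (Suc n)) / t < e / 4"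
      using e by (intro order_tendstoD(2)) auto
    then obtain n0 where n0: "\<And>n. n \<ge> n0 \<Longrightarrow> 4 * ((1/2) * (D - d n) + 1 / real (Suc n)) / t < e / 4"
      by (auto simp: eventually_sequentially)
    have le: "(\<integral>x. norm (h n x - h m x) \<partial>M) < e" if "n0 \<le> n" "n \<le> m" for n m
    proof -
      have "(\<integral>x. norm (h n x - h m x) \<partial>M) \<le> t * measure M (space M) + N (\<lambda>x. h n x - h m x) / t"
        by (rule L1(2)[OF good_diff(1) t(1)])
      also have "N (\<lambda>x. h n x - h m x) / t \<le> 4 * ((1/2) * (D - d n) + 1 / real (Suc n)) / t"
        unfolding good_diff(2) using half[OF that(2)] t(1) by (intro divide_right_mono mult_left_mono) auto
      also have "\<dots> < e / 4" by (rule n0[OF that(1)])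
      finally show ?thesis using t(2) by simp
    qed
    have "(\<integral>x. norm (h n x - h m x) \<partial>M) < e" if "n0 \<le> n" "n0 \<le> m" for n m
      using le[of n m] le[of m n] that by (cases "n \<le> m") (auto simp: norm_minus_commute)
    then show ?thesis by blast
  qed
  \<comment> \<open>An \<open>L1\<close> Cauchy sequence has an a.e. Cauchy subsequence, whose
    pointwise limit is the candidate \<open>H\<close>.\<close>
  obtain r where r: "strict_mono r" "AE x in M. Cauchy (\<lambda>i. h (r i) x)"
    using cauchy_L1_AE_cauchy_subseq[of M h] L1(1)[OF hg(1)] cauchy by blast
  define H where "H x = lim (\<lambda>i. h (r i) x)" for x
  have Hm[measurable]: "H \<in> borel_measurable M" unfolding H_def by measurable
  have lim: "AE x in M. (\<lambda>i. h (r i) x) \<longlonglongrightarrow> H x"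
    using r(2) by eventually_elim (simp add: H_def Cauchy_convergent_iff convergent_LIMSEQ_iff)
  \<comment> \<open>Fatou's lemma along the subsequence for an expression \<open>F\<close> in the
    function: used once for the energy bound and once for the \<open>L1\<close> distance between
    \<open>h n\<close> and the limit.\<close>
  have fatou: "(\<integral>\<^sup>+x. ennreal (F H x) \<partial>M) \<le> ennreal c"
    if F: "\<And>f. f \<in> borel_measurable M \<Longrightarrow> F f \<in> borel_measurable M"
      and c: "\<forall>\<^sub>F i in sequentially. (\<integral>\<^sup>+x. ennreal (F (h (r i)) x) \<partial>M) \<le> ennreal c"
      and cont: "AE x in M. (\<lambda>i. F (h (r i)) x) \<longlonglongrightarrow> F H x" for F :: "('a \<Rightarrow> 'b) \<Rightarrow> 'a \<Rightarrow> real" and c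
  proof -
    have "(\<integral>\<^sup>+x. ennreal (F H x) \<partial>M) = (\<integral>\<^sup>+x. liminf (\<lambda>i. ennreal (F (h (r i)) x)) \<partial>M)"
      by (rule nn_integral_cong_AE, use cont in eventually_elim)
         (auto intro!: lim_imp_Liminf[symmetric] tendsto_ennrealI)
    also have "\<dots> \<le> liminf (\<lambda>i. \<integral>\<^sup>+x. ennreal (F (h (r i)) x) \<partial>M)"
    proof (rule nn_integral_liminf)
      fix i
      have [measurable]: "F (h (r i)) \<in> borel_measurable M" by (rule F) measurable
      show "(\<lambda>x. ennreal (F (h (r i)) x)) \<in> borel_measurable M" by measurable
    qed
    also have "\<dots> \<le> limsup (\<lambda>i. \<integral>\<^sup>+x. ennreal (F (h (r i)) x) \<partial>M)" by (rule Liminf_le_Limsup) simp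
    also have "\<dots> \<le> ennreal c" by (rule Limsup_bounded[OF c])
    finally show ?thesis .
  qed
  show thesis
  proof (rule that[OF Hm])
    show "(\<integral>\<^sup>+x. ennreal ((norm (H x))\<^sup>2) \<partial>M) \<le> ennreal K"
    proof (rule fatou[of "\<lambda>f x. (norm (f x))\<^sup>2"])
      have "(\<integral>\<^sup>+x. ennreal ((norm (h (r i) x))\<^sup>2) \<partial>M) \<le> ennreal K" for i
        using hg[of "r i"] nn_integral_eq_integral[of M "\<lambda>x. (norm (h (r i) x))\<^sup>2"] by (simp add: good_def N_def ennreal_leI)
      then show "\<forall>\<^sub>F i in sequentially. (\<integral>\<^sup>+x. ennreal ((norm (h (r i) x))\<^sup>2) \<partial>M) \<le> ennreal K" by simp
      show "AE x in M. (\<lambda>i. (norm (h (r i) x))\<^sup>2) \<longlonglongrightarrow> (norm (H x))\<^sup>2"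
        using lim by eventually_elim (intro tendsto_intros)
    qed measurable
    have "integrable M (\<lambda>x. (norm (H x))\<^sup>2)"
      by (rule integrableI_bounded)
         (use \<open>(\<integral>\<^sup>+x. ennreal ((norm (H x))\<^sup>2) \<partial>M) \<le> ennreal K\<close> in \<open>auto simp: less_top[symmetric] top_unique\<close>)
    then have HI: "integrable M H" by (intro L1(1)) (simp add: good_def)
    fix \<phi> C l assume \<phi>m[measurable]: "\<phi> \<in> borel_measurable M" and \<phi>C: "\<And>x. norm (\<phi> x) \<le> C"
      and Gl: "(\<lambda>n. \<integral>x. G n x \<bullet> \<phi> x \<partial>M) \<longlonglongrightarrow> l"
    obtain x0 :: 'a where True by simp
    have C0: "0 \<le> C" using \<phi>C[of x0] norm_ge_zero order_trans by blast
    have pi: "integrable M (\<lambda>x. f x \<bullet> \<phi> x)" "\<bar>\<integral>x. f x \<bullet> \<phi> x \<partial>M\<bar> \<le> C * (\<integral>x. norm (f x) \<partial>M)" if "integrable M f" for f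
    proof -
      have [measurable]: "f \<in> borel_measurable M" using that by auto
      have b: "norm (f x \<bullet> \<phi> x) \<le> C * norm (f x)" for x
        using Cauchy_Schwarz_ineq2[of "f x" "\<phi> x"] mult_left_mono[OF \<phi>C[of x] norm_ge_zero[of "f x"]] by (simp add: mult.commute)
      have i: "integrable M (\<lambda>x. C * norm (f x))" using that by simp
      show i2: "integrable M (\<lambda>x. f x \<bullet> \<phi> x)"
      proof (rule Bochner_Integration.integrable_bound[OF i])
        show "AE x in M. norm (f x \<bullet> \<phi> x) \<le> norm (C * norm (f x))"
        proof (rule AE_I2)
          fix x show "norm (f x \<bullet> \<phi> x) \<le> norm (C * norm (f x))" using b[of x] C0 by simp
        qed
      qed measurable
      have "norm (\<integral>x. f x \<bullet> \<phi> x \<partial>M) \<le> (\<integral>x. norm (f x \<bullet> \<phi> x) \<partial>M)" by (rule integral_norm_bound)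
      also have "\<dots> \<le> (\<integral>x. C * norm (f x) \<partial>M)" by (rule integral_mono) (use i i2 b in auto)
      finally show "\<bar>\<integral>x. f x \<bullet> \<phi> x \<partial>M\<bar> \<le> C * (\<integral>x. norm (f x) \<partial>M)" by simp
    qed
    \<comment> \<open>Being within \<open>e\<close> of \<open>l\<close> is a convex condition, so it
      passes from the tail to all its midpoints.\<close>
    have close: "\<bar>(\<integral>x. f x \<bullet> \<phi> x \<partial>M) - l\<bar> \<le> e"
      if "f \<in> midpoints G n" "\<And>k. n \<le> k \<Longrightarrow> \<bar>(\<integral>x. G k x \<bullet> \<phi> x \<partial>M) - l\<bar> \<le> e" for f n e
      using that(1)
    proof induction
      case (base k) then show ?case using that(2) by auto
    next
      case (avg f g)
      have fi: "integrable M f" "integrable M g" using L1(1) mg avg by auto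
      have "(\<integral>x. ((1/2) *\<^sub>R (f x + g x)) \<bullet> \<phi> x \<partial>M) = (1/2) * (\<integral>x. f x \<bullet> \<phi> x \<partial>M) + (1/2) * (\<integral>x. g x \<bullet> \<phi> x \<partial>M)"
        using pi(1)[OF fi(1)] pi(1)[OF fi(2)] by (simp add: inner_add_left)
      then show ?case using avg.IH unfolding abs_le_iff by linarith
    qed
    show "(\<integral>x. H x \<bullet> \<phi> x \<partial>M) = l"
    proof -
      have "\<bar>(\<integral>x. H x \<bullet> \<phi> x \<partial>M) - l\<bar> \<le> 0 + e" if e: "e > 0" for e
      proof -
        define \<eta> where "\<eta> = (e / 2) / (C + 1)"
        have C1: "C + 1 > 0" using C0 by simp
        have eta: "\<eta> > 0" "C * \<eta> \<le> e / 2"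
        proof -
          show t0: "\<eta> > 0" using e C1 by (simp add: \<eta>_def)
          have "\<eta> * (C + 1) = e / 2" unfolding \<eta>_def by (rule nonzero_eq_divide_eq[THEN iffD1, OF _ refl]) (use C1 in simp)
          then show "C * \<eta> \<le> e / 2" using t0 by (simp add: distrib_left mult.commute)
        qed
        obtain n0 where n0: "\<And>n m. n \<ge> n0 \<Longrightarrow> m \<ge> n0 \<Longrightarrow> (\<integral>x. norm (h n x - h m x) \<partial>M) < \<eta>"
          using cauchy[OF eta(1)] by blast
        have "\<forall>\<^sub>F n in sequentially. \<bar>(\<integral>x. G n x \<bullet> \<phi> x \<partial>M) - l\<bar> < e / 2"
          using tendstoD[OF Gl, of "e / 2"] e by (simp add: dist_real_def)
        then obtain n1 where n1: "\<And>k. n1 \<le> k \<Longrightarrow> \<bar>(\<integral>x. G k x \<bullet> \<phi> x \<partial>M) - l\<bar> < e / 2"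
          by (auto simp: eventually_sequentially)
        define n where "n = max n0 n1"
        have 1: "\<bar>(\<integral>x. h n x \<bullet> \<phi> x \<partial>M) - l\<bar> \<le> e / 2"
          by (rule close[OF h(1)]) (use n1 in \<open>auto simp: n_def less_imp_le\<close>)
        have "(\<integral>\<^sup>+x. ennreal (norm (h n x - H x)) \<partial>M) \<le> ennreal \<eta>"
        proof (rule fatou[of "\<lambda>f x. norm (h n x - f x)"])
          have "(\<integral>\<^sup>+x. ennreal (norm (h n x - h (r i) x)) \<partial>M) \<le> ennreal \<eta>" if "i \<ge> n0" for i
          proof -
            have "r i \<ge> n0" using that seq_suble[OF r(1), of i] by linarith
            then have "(\<integral>x. norm (h n x - h (r i) x) \<partial>M) \<le> \<eta>" using n0[of n "r i"] by (simp add: n_def)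
            then show ?thesis
              using nn_integral_eq_integral[of M "\<lambda>x. norm (h n x - h (r i) x)"] L1(1)[OF good_diff(1)] by (simp add: ennreal_leI)
          qed
          then show "\<forall>\<^sub>F i in sequentially. (\<integral>\<^sup>+x. ennreal (norm (h n x - h (r i) x)) \<partial>M) \<le> ennreal \<eta>"
            by (auto simp: eventually_sequentially)
          show "AE x in M. (\<lambda>i. norm (h n x - h (r i) x)) \<longlonglongrightarrow> norm (h n x - H x)"
            using lim by eventually_elim (intro tendsto_intros)
        qed measurable
        moreover have hH: "integrable M (\<lambda>x. h n x - H x)" using HI L1(1)[OF hg(1)] by simp
        ultimately have "(\<integral>x. norm (h n x - H x) \<partial>M) \<le> \<eta>"
          using nn_integral_eq_integral[of M "\<lambda>x. norm (h n x - H x)"] eta(1) by (simp add: ennreal_le_iff)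
        then have "C * (\<integral>x. norm (h n x - H x) \<partial>M) \<le> C * \<eta>" using C0 by (rule mult_left_mono)
        then have "\<bar>\<integral>x. (h n x - H x) \<bullet> \<phi> x \<partial>M\<bar> \<le> e / 2" using pi(2)[OF hH] eta(2) by linarith
        moreover have "(\<integral>x. (h n x - H x) \<bullet> \<phi> x \<partial>M) = (\<integral>x. h n x \<bullet> \<phi> x \<partial>M) - (\<integral>x. H x \<bullet> \<phi> x \<partial>M)"
          using pi(1)[OF HI] pi(1)[OF L1(1)[OF hg(1)], of n] by (simp add: inner_diff_left)
        ultimately show ?thesis using 1 by linarith
      qed
      then have "\<bar>(\<integral>x. H x \<bullet> \<phi> x \<partial>M) - l\<bar> \<le> 0" by (rule field_le_epsilon)
      then show ?thesis by simp
    qed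
  qed
qed

lemma ennreal_tendsto_0I:
  fixes f :: "'a \<Rightarrow> ennreal"
  assumes "\<And>\<eta>. \<eta> > 0 \<Longrightarrow> \<forall>\<^sub>F x in F. f x \<le> ennreal \<eta>"
  shows "(f \<longlongrightarrow> 0) F"
proof (rule order_tendstoI)
  fix a :: ennreal assume a: "0 < a"
  obtain \<eta> where \<eta>: "\<eta> > 0" "ennreal \<eta> < a"
  proof (cases a)
    case (real y)
    then have "y > 0" using a by (simp add: ennreal_less_zero_iff)
    then show thesis using that[of "y / 2"] real by (simp add: ennreal_less_iff)
  next
    case top then show thesis using that[of 1] by simp
  qed
  from assms[OF \<eta>(1)] show "\<forall>\<^sub>F x in F. f x < a"
    by eventually_elim (use \<eta>(2) in \<open>auto intro: le_less_trans\<close>)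
qed auto

lemma ennreal_tendsto_0D:
  fixes f :: "'a \<Rightarrow> ennreal"
  assumes "(f \<longlongrightarrow> 0) F" "\<eta> > 0"
  shows "\<forall>\<^sub>F x in F. f x \<le> ennreal \<eta>"
  using order_tendstoD(2)[OF assms(1), of "ennreal \<eta>"] assms(2) by (auto elim!: eventually_mono)

lemma nn_integral_sq_bound:
  fixes f :: "'a::euclidean_space \<Rightarrow> ennreal"
  assumes [measurable]: "f \<in> borel_measurable borel" and A: "A \<in> sets borel"
  shows "(\<integral>\<^sup>+x\<in>A. f x \<partial>lborel)\<^sup>2 \<le> emeasure lborel A * (\<integral>\<^sup>+x\<in>A. (f x)\<^sup>2 \<partial>lborel)"
proof -
  have Im[measurable]: "indicator A \<in> borel_measurable (lborel :: 'a measure)"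
    by (rule borel_measurable_indicator) (use A in simp)
  have "(\<integral>\<^sup>+x\<in>A. f x \<partial>lborel) = (\<integral>\<^sup>+x. indicator A x * (f x * indicator A x) \<partial>lborel)"
    by (intro nn_integral_cong) (auto simp: indicator_def)
  also have "\<dots>\<^sup>2 \<le> (\<integral>\<^sup>+x. (indicator A x)\<^sup>2 \<partial>lborel) * (\<integral>\<^sup>+x. (f x * indicator A x)\<^sup>2 \<partial>lborel)"
    by (rule Cauchy_Schwarz_nn_integral) measurable
  also have "(\<integral>\<^sup>+x. (indicator A x)\<^sup>2 \<partial>lborel) = (\<integral>\<^sup>+x. indicator A x \<partial>lborel)"
    by (intro nn_integral_cong) (auto simp: indicator_def)
  also have "\<dots> = emeasure lborel A" using A by simp
  also have "(\<integral>\<^sup>+x. (f x * indicator A x)\<^sup>2 \<partial>lborel) = (\<integral>\<^sup>+x\<in>A. (f x)\<^sup>2 \<partial>lborel)"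
    by (intro nn_integral_cong) (auto simp: indicator_def)
  finally show ?thesis .
qed

lemma nn_integral_L2_tendsto_L1:
  fixes f :: "'b \<Rightarrow> 'a::euclidean_space \<Rightarrow> ennreal"
  assumes m: "\<And>n. f n \<in> borel_measurable borel" and A: "A \<in> sets borel" "emeasure lborel A < \<infinity>"
    and lim: "((\<lambda>n. \<integral>\<^sup>+x\<in>A. (f n x)\<^sup>2 \<partial>lborel) \<longlongrightarrow> 0) F"
  shows "((\<lambda>n. \<integral>\<^sup>+x\<in>A. f n x \<partial>lborel) \<longlongrightarrow> 0) F"
proof (rule ennreal_tendsto_0I)
  fix \<eta> :: real assume \<eta>: "\<eta> > 0"
  define a where "a = measure lborel A"
  have a: "a \<ge> 0" "emeasure lborel A = ennreal a" using A by (auto simp: a_def emeasure_eq_ennreal_measure)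
  have "\<eta>\<^sup>2 / (a + 1) > 0" using \<eta> a by simp
  from ennreal_tendsto_0D[OF lim this]
  show "\<forall>\<^sub>F n in F. (\<integral>\<^sup>+x\<in>A. f n x \<partial>lborel) \<le> ennreal \<eta>"
  proof eventually_elim
    fix n assume le: "(\<integral>\<^sup>+x\<in>A. (f n x)\<^sup>2 \<partial>lborel) \<le> ennreal (\<eta>\<^sup>2 / (a + 1))"
    have "(\<integral>\<^sup>+x\<in>A. f n x \<partial>lborel)\<^sup>2 \<le> ennreal a * ennreal (\<eta>\<^sup>2 / (a + 1))"
      using nn_integral_sq_bound[OF m A(1), of n] mult_left_mono[OF le, of "ennreal a"] unfolding a by (auto intro: order_trans)
    also have "\<dots> \<le> ennreal (\<eta>\<^sup>2)"
      using a(1) \<eta> by (auto simp: field_simps intro!: ennreal_leI simp flip: ennreal_mult)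
    finally show "(\<integral>\<^sup>+x\<in>A. f n x \<partial>lborel) \<le> ennreal \<eta>" by (rule ennreal_le_of_sq_le) (use \<eta> in simp)
  qed
qed

subsection \<open>Limits of approximate solutions\<close>

lemma approx_solution_borel:
  assumes "approx_solution \<delta> v g \<beta> r"
  shows "v \<in> borel_measurable borel" "g \<in> borel_measurable borel" "\<beta> \<in> borel_measurable borel"
    "has_grad v g" "continuous_on UNIV \<beta>"
  using assms unfolding approx_solution_def by (auto intro: has_grad_borel borel_measurable_continuous_onI)

text \<open>On the smaller ball the cutoff is at least \<open>s\<^sup>2 - t\<^sup>2\<close>, so the
  weighted energy controls the unweighted one.\<close>

lemma gradient_bound_from_cutoff:
  fixes g :: "'a::euclidean_space \<Rightarrow> 'a"
  assumes gc: "continuous_on UNIV g" and s: "0 \<le> t" "t < s" and A: "A \<subseteq> cball 0 t"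
    and E: "(\<integral>x. (cutoff s x)\<^sup>2 * (norm (g x))\<^sup>2 \<partial>lborel) \<le> E"
  shows "(\<integral>\<^sup>+x\<in>A. ennreal ((norm (g x))\<^sup>2) \<partial>lborel) \<le> ennreal (E / (s\<^sup>2 - t\<^sup>2)\<^sup>2)"
proof -
  define \<kappa> where "\<kappa> = (s\<^sup>2 - t\<^sup>2)\<^sup>2"
  have st: "s\<^sup>2 - t\<^sup>2 > 0" using power_strict_mono[of t s 2] s by simp
  have \<kappa>: "\<kappa> > 0" unfolding \<kappa>_def using st by simp
  have i: "integrable lborel (\<lambda>x. (cutoff s x)\<^sup>2 * (norm (g x))\<^sup>2)"
    by (rule integrable_continuous_bounded_support[where r=s])
       (use cutoff_zero[of s] s in \<open>auto intro!: continuous_intros gc continuous_on_cutoff\<close>)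
  have "(\<integral>\<^sup>+x\<in>A. ennreal ((norm (g x))\<^sup>2) \<partial>lborel) \<le> (\<integral>\<^sup>+x. ennreal ((1 / \<kappa>) * ((cutoff s x)\<^sup>2 * (norm (g x))\<^sup>2)) \<partial>lborel)"
  proof (rule nn_integral_mono)
    fix x
    show "ennreal ((norm (g x))\<^sup>2) * indicator A x \<le> ennreal ((1 / \<kappa>) * ((cutoff s x)\<^sup>2 * (norm (g x))\<^sup>2))"
    proof (cases "x \<in> A")
      case True
      then have "norm x \<le> t" using A by auto
      then have "(norm x)\<^sup>2 \<le> t\<^sup>2" by (intro power_mono) auto
      then have "s\<^sup>2 - t\<^sup>2 \<le> cutoff s x" by (simp add: cutoff_def)
      then have "\<kappa> \<le> (cutoff s x)\<^sup>2" unfolding \<kappa>_def using st by (intro power_mono) auto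
      then have "1 * (norm (g x))\<^sup>2 \<le> ((1 / \<kappa>) * (cutoff s x)\<^sup>2) * (norm (g x))\<^sup>2"
        using \<kappa> by (intro mult_right_mono) (auto simp: field_simps)
      then show ?thesis using True by (simp add: ennreal_leI mult.assoc)
    qed simp
  qed
  also have "\<dots> = ennreal (\<integral>x. (1 / \<kappa>) * ((cutoff s x)\<^sup>2 * (norm (g x))\<^sup>2) \<partial>lborel)"
    by (rule nn_integral_eq_integral) (use i \<kappa> in auto)
  also have "\<dots> \<le> ennreal (E / \<kappa>)"
    using E \<kappa> by (intro ennreal_leI) (simp add: divide_right_mono)
  finally show ?thesis unfolding \<kappa>_def .
qed

text \<open>The crude energy bound: \<open>v\<close> is estimated by \<open>M\<close> and the drift
  by the \<open>L1\<close> norm of its limit plus 1. The constant depends on the sequence, which is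
  good enough for compactness and for continuity of the limit.\<close>

lemma uniform_gradient_bound:
  fixes v :: "nat \<Rightarrow> 'a::euclidean_space \<Rightarrow> real"
  assumes ap: "\<And>m. approx_solution (\<delta> m) (v m) (g m) (\<beta> m) (r m)" and \<delta>: "\<And>m. 0 < \<delta> m" "\<delta> \<longlonglongrightarrow> 0"
    and vM: "\<And>m x. \<bar>v m x\<bar> \<le> M" and b: "integrable lborel b"
    and \<beta>b: "(\<lambda>m. \<integral>\<^sup>+x\<in>ball 0 1. ennreal (norm (\<beta> m x - b x)) \<partial>lborel) \<longlonglongrightarrow> 0"
    and t: "0 \<le> t" "t < 1"
  obtains K where "K > 0" "\<forall>\<^sub>F m in sequentially. (\<integral>\<^sup>+x\<in>cball 0 t. ennreal ((norm (g m x))\<^sup>2) \<partial>lborel) \<le> ennreal K"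
proof -
  define s where "s = (t + 1) / 2"
  have s: "0 < s" "t < s" "s < 1" using t by (auto simp: s_def)
  define V where "V = measure lborel (cball (0::'a) 1)"
  define Bn where "Bn = (\<integral>x. norm (b x) \<partial>lborel)"
  \<comment> \<open>\<open>Bn + 1\<close> eventually bounds the \<open>L1\<close> norms of the
    drifts; the summand 6 covers the term \<open>6 * \<delta> m\<close> once
    \<open>\<delta> m \<le> 1\<close>.\<close>
  define E where "E = 36 * (M\<^sup>2 * (V + (Bn + 1))) + 6"
  have bm[measurable]: "b \<in> borel_measurable borel" using b by auto
  have M0: "0 \<le> M" using vM[of 0 0] by linarith
  have V0: "V \<ge> 0" "Bn \<ge> 0" by (auto simp: V_def Bn_def)
  have Ep: "E > 0" unfolding E_def using V0 by (intro add_nonneg_pos mult_nonneg_nonneg) auto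
  define K where "K = E / (s\<^sup>2 - t\<^sup>2)\<^sup>2"
  have st: "s\<^sup>2 - t\<^sup>2 > 0" using power_strict_mono[of t s 2] s t by simp
  have "K > 0" unfolding K_def using Ep st by simp
  moreover have "\<forall>\<^sub>F m in sequentially. (\<integral>\<^sup>+x\<in>cball 0 t. ennreal ((norm (g m x))\<^sup>2) \<partial>lborel) \<le> ennreal K"
  proof -
    have "\<forall>\<^sub>F m in sequentially. \<delta> m < 1 - s" using order_tendstoD(2)[OF \<delta>(2)] s by simp
    moreover have "\<forall>\<^sub>F m in sequentially. (\<integral>\<^sup>+x\<in>ball 0 1. ennreal (norm (\<beta> m x - b x)) \<partial>lborel) \<le> ennreal 1"
      by (rule ennreal_tendsto_0D[OF \<beta>b]) simp
    ultimately show ?thesis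
    proof eventually_elim
      fix m assume d: "\<delta> m < 1 - s" and B: "(\<integral>\<^sup>+x\<in>ball 0 1. ennreal (norm (\<beta> m x - b x)) \<partial>lborel) \<le> ennreal 1"
      note meas[measurable] = approx_solution_borel(1-3)[OF ap[of m]]
      define I where "I = (\<integral>x. indicator (cball 0 s) x * ((v m x)\<^sup>2 * (1 + norm (\<beta> m x))) \<partial>lborel)"
      have "ennreal I = (\<integral>\<^sup>+x\<in>cball 0 s. ennreal ((v m x)\<^sup>2 * (1 + norm (\<beta> m x))) \<partial>lborel)"
        unfolding I_def by (rule nn_integral_indicator_eq_integral(2)[symmetric])
          (auto intro!: continuous_intros has_grad_continuous[OF approx_solution_borel(4)[OF ap]] approx_solution_borel(5)[OF ap])
      also have "\<dots> \<le> (\<integral>\<^sup>+x. ennreal (M\<^sup>2) * (indicator (cball 0 1) x + (ennreal (norm (b x)) + ennreal (norm (\<beta> m x - b x)) * indicator (ball 0 1) x)) \<partial>lborel)"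
      proof (rule nn_integral_mono)
        fix x
        show "ennreal ((v m x)\<^sup>2 * (1 + norm (\<beta> m x))) * indicator (cball 0 s) x \<le>
          ennreal (M\<^sup>2) * (indicator (cball 0 1) x + (ennreal (norm (b x)) + ennreal (norm (\<beta> m x - b x)) * indicator (ball 0 1) x))"
        proof (cases "norm x \<le> s")
          case True
          have "(v m x)\<^sup>2 \<le> M\<^sup>2" using vM[of m x] by (simp add: abs_le_square_iff[symmetric] M0)
          moreover have "1 + norm (\<beta> m x) \<le> 1 + (norm (b x) + norm (\<beta> m x - b x))"
            using norm_triangle_sub[of "\<beta> m x" "b x"] by simp
          ultimately have "(v m x)\<^sup>2 * (1 + norm (\<beta> m x)) \<le> M\<^sup>2 * (1 + (norm (b x) + norm (\<beta> m x - b x)))"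
            by (intro mult_mono) auto
          then have "ennreal ((v m x)\<^sup>2 * (1 + norm (\<beta> m x))) \<le> ennreal (M\<^sup>2 * (1 + (norm (b x) + norm (\<beta> m x - b x))))"
            by (rule ennreal_leI)
          also have "\<dots> = ennreal (M\<^sup>2) * (1 + (ennreal (norm (b x)) + ennreal (norm (\<beta> m x - b x))))"
            by (simp add: ennreal_mult)
          finally show ?thesis using True s by simp
        qed simp
      qed
      also have "\<dots> = ennreal (M\<^sup>2) * (\<integral>\<^sup>+x. indicator (cball 0 1) x + (ennreal (norm (b x)) + ennreal (norm (\<beta> m x - b x)) * indicator (ball 0 1) x) \<partial>lborel)"
        by (rule nn_integral_cmult) (intro borel_measurable_add borel_measurable_times_ennreal borel_measurable_indicator; simp)
      also have "(\<integral>\<^sup>+x. indicator (cball 0 1) x + (ennreal (norm (b x)) + ennreal (norm (\<beta> m x - b x)) * indicator (ball 0 1) x) \<partial>lborel)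
         = (\<integral>\<^sup>+x. indicator (cball (0::'a) 1) x \<partial>lborel) + ((\<integral>\<^sup>+x. ennreal (norm (b x)) \<partial>lborel) + (\<integral>\<^sup>+x\<in>ball 0 1. ennreal (norm (\<beta> m x - b x)) \<partial>lborel))"
        proof -
          have m1: "(\<lambda>x. ennreal (norm (\<beta> m x - b x)) * indicator (ball 0 1) x) \<in> borel_measurable lborel"
            by (rule borel_measurable_times_ennreal[OF _ borel_measurable_indicator]) simp_all
          have m2: "(\<lambda>x. ennreal (norm (b x))) \<in> borel_measurable lborel" by simp
          have m3: "indicator (cball (0::'a) 1) \<in> borel_measurable lborel" by (rule borel_measurable_indicator) simp
          show ?thesis
            by (simp only: nn_integral_add[OF m3 borel_measurable_add[OF m2 m1]] nn_integral_add[OF m2 m1])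
        qed
      also have "\<dots> = ennreal V + (ennreal Bn + (\<integral>\<^sup>+x\<in>ball 0 1. ennreal (norm (\<beta> m x - b x)) \<partial>lborel))"
        using emeasure_lborel_cball_finite[of "0::'a" 1] b
        by (simp add: V_def Bn_def emeasure_eq_ennreal_measure nn_integral_eq_integral less_top)
      also have "ennreal (M\<^sup>2) * \<dots> \<le> ennreal (M\<^sup>2) * (ennreal V + (ennreal Bn + ennreal 1))"
        using B by (intro mult_left_mono add_left_mono) auto
      also have "\<dots> = ennreal (M\<^sup>2 * (V + (Bn + 1)))" using V0 by (simp add: ennreal_mult)
      finally have "I \<le> M\<^sup>2 * (V + (Bn + 1))" using V0 by (simp add: ennreal_le_iff)
      moreover have "(\<integral>x. (cutoff s x)\<^sup>2 * (norm (g m x))\<^sup>2 \<partial>lborel) \<le> 36 * I + 6 * \<delta> m"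
        unfolding I_def by (rule energy_estimate[OF ap]) (use s d \<delta> in auto)
      moreover have "\<delta> m \<le> 1" using d s by simp
      ultimately have "(\<integral>x. (cutoff s x)\<^sup>2 * (norm (g m x))\<^sup>2 \<partial>lborel) \<le> E" unfolding E_def by linarith
      then show "(\<integral>\<^sup>+x\<in>cball 0 t. ennreal ((norm (g m x))\<^sup>2) \<partial>lborel) \<le> ennreal K"
        unfolding K_def
        by (rule gradient_bound_from_cutoff[OF has_grad_continuous_grad[OF approx_solution_borel(4)[OF ap]] t(1) s(2) order_refl])
    qed
  qed
  ultimately show thesis by (rule that)
qed

text \<open>Rellich's theorem for a sequence whose weak limit is known. Three comparisons at one
  fixed mollification scale: \<open>v m\<close> with its mollification by the gradient bound,
  uniformly in \<open>m\<close>; this mollification with that of \<open>u\<close>, where weak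
  convergence means pointwise convergence; the mollification of \<open>u\<close> with
  \<open>u\<close> by the \<open>L2\<close> oscillation.\<close>

lemma L1_convergence:
  fixes v :: "nat \<Rightarrow> 'a::euclidean_space \<Rightarrow> real"
  assumes ap: "\<And>m. has_grad (v m) (g m)"
    and vM: "\<And>m x. \<bar>v m x\<bar> \<le> M"
    and um: "u \<in> borel_measurable borel" and u0: "\<And>x. 1 < norm x \<Longrightarrow> u x = 0" and uM: "\<And>x. \<bar>u x\<bar> \<le> M"
    and weak: "\<And>\<phi> C. \<phi> \<in> borel_measurable borel \<Longrightarrow> (\<And>x. \<bar>\<phi> x\<bar> \<le> C) \<Longrightarrow>
       (\<lambda>m. \<integral>x. indicator (ball 0 1) x * (v m x * \<phi> x) \<partial>lborel) \<longlonglongrightarrow> (\<integral>x. u x * \<phi> x \<partial>lborel)"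
    and grad: "\<And>t. 0 \<le> t \<Longrightarrow> t < 1 \<Longrightarrow> \<exists>K>0. \<forall>\<^sub>F m in sequentially. (\<integral>\<^sup>+x\<in>cball 0 t. ennreal ((norm (g m x))\<^sup>2) \<partial>lborel) \<le> ennreal K"
    and s: "0 \<le> s" "s < 1"
  shows "(\<lambda>m. \<integral>\<^sup>+x\<in>cball 0 s. ennreal \<bar>v m x - u x\<bar> \<partial>lborel) \<longlonglongrightarrow> 0"
proof (rule ennreal_tendsto_0I)
  fix \<eta> :: real assume \<eta>: "\<eta> > 0"
  have um'[measurable]: "u \<in> borel_measurable borel" by (rule um)
  have vm[measurable]: "v m \<in> borel_measurable borel" for m using has_grad_borel[OF ap] by simp
  have M0: "0 \<le> M" using uM[of 0] by linarith
  define t where "t = (s + 1) / 2"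
  have t: "0 \<le> t" "s < t" "t < 1" using s by (auto simp: t_def)
  obtain K where K: "K > 0" "\<forall>\<^sub>F m in sequentially. (\<integral>\<^sup>+x\<in>cball 0 t. ennreal ((norm (g m x))\<^sup>2) \<partial>lborel) \<le> ennreal K"
    using grad[OF t(1,3)] by blast
  define a where "a = measure lborel (cball (0::'a) t)"
  have a: "a \<ge> 0" "emeasure lborel (cball (0::'a) t) = ennreal a"
    using emeasure_lborel_cball_finite[of "0::'a" t] by (auto simp: a_def emeasure_eq_ennreal_measure less_top)
  define K' where "K' = sqrt (a * K) + 1"
  have K': "K' > 0" "a * K \<le> K'\<^sup>2" unfolding K'_def using a K by (auto simp: add_nonneg_pos power2_sum)
  have u2: "(\<integral>\<^sup>+x. ennreal ((norm (u x))\<^sup>2) \<partial>lborel) < \<infinity>"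
    by (rule bounded_imp_L2_bounded_support[OF u0 uM])
  have ui: "integrable lborel u" by (rule L2_imp_integrable_bounded_support[OF um u0 u2])
  define \<eta>2 where "\<eta>2 = (\<eta> / 3)\<^sup>2 / (a + 1)"
  have \<eta>2: "\<eta>2 > 0" "a * \<eta>2 \<le> (\<eta> / 3)\<^sup>2" using \<eta> a by (auto simp: \<eta>2_def field_simps)
  have cb: "cball (0::'a) t \<in> sets borel" by simp
  obtain e0 where e0: "e0 > 0" "\<And>e p. bump e p \<Longrightarrow> e \<le> e0 \<Longrightarrow> (\<integral>\<^sup>+x\<in>cball 0 t. osc_fun p u x \<partial>lborel) \<le> ennreal \<eta>2"
    using osc_fun_tendsto[OF um cb u2 emeasure_lborel_cball_finite \<eta>2(1)] by blast
  \<comment> \<open>Three requirements: a small mollification error for \<open>u\<close>, the ball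
    of radius \<open>s + e\<close> inside that of radius \<open>t\<close>, and the rate
    \<open>e * K'\<close> below \<open>\<eta> / 3\<close>.\<close>
  define e where "e = min e0 (min (t - s) (\<eta> / (3 * K')))"
  have e: "e > 0" "e \<le> e0" "e \<le> t - s" "e * K' \<le> \<eta> / 3"
  proof -
    show "e > 0" "e \<le> e0" "e \<le> t - s" using e0 t \<eta> K' by (auto simp: e_def)
    have "e \<le> \<eta> / (3 * K')" by (simp add: e_def)
    then show "e * K' \<le> \<eta> / 3" using K' by (simp add: field_simps)
  qed
  obtain p :: "'a \<Rightarrow> real" where p: "bump e p" using ex_bump[OF e(1)] by blast
  have pm[measurable]: "p \<in> borel_measurable borel" using bumpD[OF p] by simp
  obtain B where B: "B \<ge> 0" "\<And>x. \<bar>p x\<bar> \<le> B" using bump_bounded[OF p] by blast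
  define w where "w m x = (\<integral>y. p (x - y) * v m y \<partial>lborel)" for m x
  have Icb: "(\<lambda>x. f x * indicator (cball (0::'a) s) x) \<in> borel_measurable borel" if "f \<in> borel_measurable borel" for f :: "'a \<Rightarrow> ennreal"
    by (rule borel_measurable_times_ennreal[OF that borel_measurable_indicator]) simp
  \<comment> \<open>Since \<open>s + e \<le> t < 1\<close>, a kernel centred in the smaller ball
    sees only points of the unit ball, where the weak convergence is assumed.\<close>
  have w_eq: "w m x = (\<integral>y. indicator (ball 0 1) y * (v m y * p (x - y)) \<partial>lborel)" if "norm x \<le> s" for m x
    unfolding w_def
  proof (rule Bochner_Integration.integral_cong[OF refl])
    fix y
    show "p (x - y) * v m y = indicator (ball 0 1) y * (v m y * p (x - y))"
    proof (cases "norm y < 1")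
      case False
      then have "e \<le> norm (x - y)" using norm_triangle_ineq2[of y x] that e(3) t by (simp add: norm_minus_commute)
      then show ?thesis using bumpD(3)[OF p] by simp
    qed (simp add: mult.commute)
  qed
  have wlim: "(\<lambda>m. w m x) \<longlonglongrightarrow> mollify p u x" if "norm x \<le> s" for x
    using weak[of "\<lambda>y. p (x - y)" B] B unfolding w_eq[OF that] by (simp add: mollify_def mult.commute)
  have wm[measurable]: "w m \<in> borel_measurable borel" for m unfolding w_def by measurable
  have pum[measurable]: "mollify p u \<in> borel_measurable borel" unfolding mollify_def by measurable
  have wM: "\<bar>w m x\<bar> \<le> M" if "norm x \<le> s" for m x
  proof -
    have i: "integrable lborel (\<lambda>y. p (x - y) * M)" using bump_integral_reflect(1)[OF p] by simp
    have i2: "integrable lborel (\<lambda>y. p (x - y) *\<^sub>R v m y)"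
      by (rule integrable_bounded_scaleR[OF bump_integral_reflect(1)[OF p]]) (use vM in auto)
    have "norm (w m x) \<le> (\<integral>y. p (x - y) * M \<partial>lborel)"
      unfolding w_def
    proof (rule Bochner_Integration.integral_norm_bound_integral[OF _ i])
      show "integrable lborel (\<lambda>y. p (x - y) * v m y)" using i2 by simp
      show "norm (p (x - y) * v m y) \<le> p (x - y) * M" for y
        using bumpD(2)[OF p] vM[of m y] by (simp add: abs_mult mult_left_mono)
    qed
    then show ?thesis using bump_integral_reflect(2)[OF p] by simp
  qed
  have "(\<lambda>m. \<integral>\<^sup>+x\<in>cball 0 s. ennreal \<bar>w m x - mollify p u x\<bar> \<partial>lborel) \<longlonglongrightarrow> (\<integral>\<^sup>+x. 0 \<partial>(lborel::'a measure))"
  proof (rule nn_integral_dominated_convergence[where w="\<lambda>x. ennreal (2 * M) * indicator (cball 0 s) x"])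
    show "(\<lambda>x. ennreal (2 * M) * indicator (cball 0 s) (x::'a)) \<in> borel_measurable lborel" using Icb by simp
    show "(\<lambda>x. ennreal \<bar>w m x - mollify p u x\<bar> * indicator (cball 0 s) x) \<in> borel_measurable lborel" for m using Icb by simp
    show "AE x in lborel. ennreal \<bar>w j x - mollify p u x\<bar> * indicator (cball 0 s) x \<le> ennreal (2 * M) * indicator (cball 0 s) x" for j
    proof (rule AE_I2)
      fix x
      show "ennreal \<bar>w j x - mollify p u x\<bar> * indicator (cball 0 s) x \<le> ennreal (2 * M) * indicator (cball 0 s) x"
      proof (cases "norm x \<le> s")
        case True
        have "\<bar>w j x - mollify p u x\<bar> \<le> 2 * M" using wM[OF True, of j] mollify_bound[OF p ui uM, of x] by linarith
        then show ?thesis using True by (simp add: ennreal_leI)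
      qed simp
    qed
    have "emeasure lborel (cball (0::'a) s) < \<infinity>" by (rule emeasure_lborel_cball_finite)
    then show "(\<integral>\<^sup>+x. ennreal (2 * M) * indicator (cball 0 s) (x::'a) \<partial>lborel) < \<infinity>"
      by (subst nn_integral_cmult_indicator) (auto simp: ennreal_mult_less_top)
    show "AE x in lborel. (\<lambda>i. ennreal \<bar>w i x - mollify p u x\<bar> * indicator (cball 0 s) x) \<longlonglongrightarrow> 0"
    proof (rule AE_I2)
      fix x
      show "(\<lambda>i. ennreal \<bar>w i x - mollify p u x\<bar> * indicator (cball 0 s) x) \<longlonglongrightarrow> 0"
      proof (cases "norm x \<le> s")
        case True
        have "(\<lambda>i. \<bar>w i x - mollify p u x\<bar>) \<longlonglongrightarrow> 0"
          using tendsto_rabs[OF tendsto_diff[OF wlim[OF True] tendsto_const[of "mollify p u x"]]] by simp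
        from tendsto_ennrealI[OF this] show ?thesis using True by simp
      qed simp
    qed
  qed simp
  then have "\<forall>\<^sub>F m in sequentially. (\<integral>\<^sup>+x\<in>cball 0 s. ennreal \<bar>w m x - mollify p u x\<bar> \<partial>lborel) \<le> ennreal (\<eta> / 3)"
    using \<eta> by (intro ennreal_tendsto_0D) auto
  with K(2) show "\<forall>\<^sub>F m in sequentially. (\<integral>\<^sup>+x\<in>cball 0 s. ennreal \<bar>v m x - u x\<bar> \<partial>lborel) \<le> ennreal \<eta>"
  proof eventually_elim
    fix m assume gK: "(\<integral>\<^sup>+x\<in>cball 0 t. ennreal ((norm (g m x))\<^sup>2) \<partial>lborel) \<le> ennreal K"
      and m2: "(\<integral>\<^sup>+x\<in>cball 0 s. ennreal \<bar>w m x - mollify p u x\<bar> \<partial>lborel) \<le> ennreal (\<eta> / 3)"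
    have gm[measurable]: "g m \<in> borel_measurable borel" using has_grad_borel[OF ap] by simp
    have "(\<integral>\<^sup>+x\<in>cball 0 t. ennreal (norm (g m x)) \<partial>lborel)\<^sup>2 \<le> ennreal a * (\<integral>\<^sup>+x\<in>cball 0 t. (ennreal (norm (g m x)))\<^sup>2 \<partial>lborel)"
      unfolding a(2)[symmetric] by (rule nn_integral_sq_bound) simp_all
    also have "\<dots> \<le> ennreal a * ennreal K" using gK by (intro mult_left_mono) (auto simp: ennreal_power)
    also have "\<dots> \<le> ennreal (K'\<^sup>2)" using a K K' by (simp add: ennreal_leI flip: ennreal_mult)
    finally have g1: "(\<integral>\<^sup>+x\<in>cball 0 t. ennreal (norm (g m x)) \<partial>lborel) \<le> ennreal K'"
      by (rule ennreal_le_of_sq_le) (use K' in simp)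
    have "(\<integral>\<^sup>+x\<in>cball 0 s. ennreal \<bar>w m x - v m x\<bar> \<partial>lborel) \<le> ennreal e * (\<integral>\<^sup>+x\<in>cball 0 (s + e). ennreal (norm (g m x)) \<partial>lborel)"
      unfolding w_def by (rule mollify_L1_rate[OF ap p])
    also have "\<dots> \<le> ennreal e * (\<integral>\<^sup>+x\<in>cball 0 t. ennreal (norm (g m x)) \<partial>lborel)"
      using e(3) by (intro mult_left_mono nn_integral_mono) (auto simp: indicator_def)
    also have "\<dots> \<le> ennreal e * ennreal K'" by (intro mult_left_mono g1) auto
    also have "\<dots> \<le> ennreal (\<eta> / 3)" using e K' by (simp add: ennreal_leI flip: ennreal_mult)
    finally have m1: "(\<integral>\<^sup>+x\<in>cball 0 s. ennreal \<bar>w m x - v m x\<bar> \<partial>lborel) \<le> ennreal (\<eta> / 3)" .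
    have "(\<integral>\<^sup>+x\<in>cball 0 t. ennreal \<bar>mollify p u x - u x\<bar> \<partial>lborel)\<^sup>2 \<le>
       ennreal a * (\<integral>\<^sup>+x\<in>cball 0 t. (ennreal \<bar>mollify p u x - u x\<bar>)\<^sup>2 \<partial>lborel)"
      unfolding a(2)[symmetric] by (rule nn_integral_sq_bound) simp_all
    also have "\<dots> \<le> ennreal a * (\<integral>\<^sup>+x\<in>cball 0 t. osc_fun p u x \<partial>lborel)"
      using mollify_diff_bound[OF p um ui] by (intro mult_left_mono nn_integral_mono mult_right_mono) (auto simp: ennreal_power)
    also have "\<dots> \<le> ennreal a * ennreal \<eta>2" by (intro mult_left_mono e0(2)[OF p e(2)]) auto
    also have "\<dots> \<le> ennreal ((\<eta> / 3)\<^sup>2)" using a \<eta>2 by (simp add: ennreal_leI flip: ennreal_mult)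
    finally have "(\<integral>\<^sup>+x\<in>cball 0 t. ennreal \<bar>mollify p u x - u x\<bar> \<partial>lborel) \<le> ennreal (\<eta> / 3)"
      by (rule ennreal_le_of_sq_le) (use \<eta> in simp)
    moreover have "(\<integral>\<^sup>+x\<in>cball 0 s. ennreal \<bar>mollify p u x - u x\<bar> \<partial>lborel) \<le> (\<integral>\<^sup>+x\<in>cball 0 t. ennreal \<bar>mollify p u x - u x\<bar> \<partial>lborel)"
      using t by (intro nn_integral_mono) (auto simp: indicator_def)
    ultimately have m3: "(\<integral>\<^sup>+x\<in>cball 0 s. ennreal \<bar>mollify p u x - u x\<bar> \<partial>lborel) \<le> ennreal (\<eta> / 3)" by (rule order_trans[rotated])
    have "(\<integral>\<^sup>+x\<in>cball 0 s. ennreal \<bar>v m x - u x\<bar> \<partial>lborel) \<le>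
       (\<integral>\<^sup>+x. (ennreal \<bar>w m x - v m x\<bar> * indicator (cball 0 s) x + ennreal \<bar>w m x - mollify p u x\<bar> * indicator (cball 0 s) x) +
          ennreal \<bar>mollify p u x - u x\<bar> * indicator (cball 0 s) x \<partial>lborel)"
    proof (rule nn_integral_mono)
      fix x
      have "\<bar>v m x - u x\<bar> \<le> (\<bar>w m x - v m x\<bar> + \<bar>w m x - mollify p u x\<bar>) + \<bar>mollify p u x - u x\<bar>" by linarith
      from ennreal_leI[OF this]
      show "ennreal \<bar>v m x - u x\<bar> * indicator (cball 0 s) x \<le> (ennreal \<bar>w m x - v m x\<bar> * indicator (cball 0 s) x + ennreal \<bar>w m x - mollify p u x\<bar> * indicator (cball 0 s) x) +
          ennreal \<bar>mollify p u x - u x\<bar> * indicator (cball 0 s) x"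
        by (auto simp: indicator_def)
    qed
    also have "\<dots> = ((\<integral>\<^sup>+x\<in>cball 0 s. ennreal \<bar>w m x - v m x\<bar> \<partial>lborel) + (\<integral>\<^sup>+x\<in>cball 0 s. ennreal \<bar>w m x - mollify p u x\<bar> \<partial>lborel)) +
        (\<integral>\<^sup>+x\<in>cball 0 s. ennreal \<bar>mollify p u x - u x\<bar> \<partial>lborel)"
      using Icb by (simp add: nn_integral_add)
    also have "\<dots> \<le> (ennreal (\<eta> / 3) + ennreal (\<eta> / 3)) + ennreal (\<eta> / 3)" by (intro add_mono m1 m2 m3)
    also have "\<dots> = ennreal \<eta>" using \<eta> by (simp flip: ennreal_plus)
    finally show "(\<integral>\<^sup>+x\<in>cball 0 s. ennreal \<bar>v m x - u x\<bar> \<partial>lborel) \<le> ennreal \<eta>" .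
  qed
qed

lemma frontier_square:
  assumes "x \<in> frontier {x. sq_norm (x - c) < \<rho>}"
  shows "sq_norm (x - c) = \<rho>"
proof -
  have o: "open {x. sq_norm (x - c) < \<rho>}" by (intro open_Collect_less continuous_intros)
  have "closed {x. sq_norm (x - c) \<le> \<rho>}" by (intro closed_Collect_le continuous_intros)
  then have "closure {x. sq_norm (x - c) < \<rho>} \<subseteq> {x. sq_norm (x - c) \<le> \<rho>}"
    by (intro closure_minimal) auto
  then show ?thesis using assms o by (auto simp: frontier_def interior_open not_less)
qed

lemma open_square: "open {x. sq_norm (x - c) < \<rho>}"
  by (intro open_Collect_less continuous_intros)

text \<open>For each \<open>m\<close> the boundary of some square of half-width between
  \<open>\<rho>\<close> and \<open>R\<close> carries oscillation at most \<open>q\<close>. The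
  maximum principle for \<open>v m\<close> and for \<open>- v m\<close> transports this inside, up
  to an excess that tends to zero. The squares vary with \<open>m\<close>, but all contain the one
  of half-width \<open>\<rho>\<close>, on which the limit is taken.\<close>

lemma oscillation_limit:
  fixes v :: "nat \<Rightarrow> real^2 \<Rightarrow> real"
  assumes ap: "\<And>m. approx_solution (\<delta> m) (v m) (g m) (\<beta> m) (r m)" and \<delta>: "\<And>m. 0 < \<delta> m" "\<delta> \<longlonglongrightarrow> 0"
    and vM: "\<And>m x. \<bar>v m x\<bar> \<le> M" and um: "u \<in> borel_measurable borel"
    and L1: "(\<lambda>m. \<integral>\<^sup>+x\<in>cball 0 s. ennreal \<bar>v m x - u x\<bar> \<partial>lborel) \<longlonglongrightarrow> 0" and s: "s < 1"
    and sub: "{x. sq_norm (x - c) \<le> R} \<subseteq> cball 0 s" and \<rho>: "0 < \<rho>" "\<rho> < R" and K: "0 < K"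
    and E: "\<And>m. (\<integral>\<^sup>+x\<in>{x. sq_norm (x - c) \<le> R}. ennreal ((norm (g m x))\<^sup>2) \<partial>lborel) \<le> ennreal K"
  obtains y where "AE x in lborel. sq_norm (x - c) < \<rho> \<longrightarrow> \<bar>u x - y\<bar> \<le> 16 * sqrt (K / ln (R / \<rho>))"
proof -
  define q where "q = 16 * sqrt (K / ln (R / \<rho>))"
  have M0: "0 \<le> M" using vM[of 0 0] by linarith
  have q0: "0 \<le> q" unfolding q_def using K \<rho> by simp
  have vg: "has_grad (v m) (g m)" for m by (rule approx_solution_borel(4)[OF ap])
  have [measurable]: "v m \<in> borel_measurable borel" for m by (rule approx_solution_borel(1)[OF ap])
  note um[measurable]
  have "\<exists>\<rho>' \<ge> \<rho>. \<rho>' \<le> R \<and> (\<forall>x y. sq_norm (x - c) = \<rho>' \<longrightarrow> sq_norm (y - c) = \<rho>' \<longrightarrow> \<bar>v m x - v m y\<bar> \<le> q)" for m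
    using courant_lebesgue[OF vg \<rho> K E, of m] unfolding q_def by metis
  then obtain R' where R': "\<And>m. \<rho> \<le> R' m" "\<And>m. R' m \<le> R"
    "\<And>m x y. sq_norm (x - c) = R' m \<Longrightarrow> sq_norm (y - c) = R' m \<Longrightarrow> \<bar>v m x - v m y\<bar> \<le> q" by metis
  define y where "y m = v m (c + R' m *\<^sub>R unit_e1)" for m
  have sqc: "sq_norm ((c + R' m *\<^sub>R unit_e1) - c) = R' m" for m
    using R'(1)[of m] \<rho> by (simp add: sq_norm_def)
  have yb: "\<bar>v m x - y m\<bar> \<le> q" if "sq_norm (x - c) = R' m" for m x
    unfolding y_def by (rule R'(3)[OF that sqc])
  \<comment> \<open>The maximum principle asks for a strict inequality on the frontier; this
    vanishing margin provides it.\<close>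
  define \<tau> where "\<tau> m = 1 / real (Suc m)" for m
  have \<tau>: "\<tau> m > 0" "\<tau> \<longlonglongrightarrow> 0" for m
    unfolding \<tau>_def using LIMSEQ_inverse_real_of_nat by (simp_all add: inverse_eq_divide)
  define A where "A = {x. sq_norm (x - c) < \<rho>}"
  have Ab: "A \<in> sets borel" unfolding A_def by (rule borel_open[OF open_square])
  have As: "A \<subseteq> cball 0 s" using sub \<rho> by (auto simp: A_def)
  have Af: "emeasure lborel A < \<infinity>"
    using emeasure_mono[OF As, of lborel] emeasure_lborel_cball_finite[of "0::real^2" s] by (simp add: le_less_trans)
  define W where "W m x = max 0 (\<bar>v m x - y m\<bar> - q - \<tau> m)" for m x
  have Wm[measurable]: "W m \<in> borel_measurable borel" for m unfolding W_def by measurable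
  define C where "C = 2 * M * (measure lborel (cball (0::real^2) 1) + 1)"
  have C0: "0 \<le> C" unfolding C_def using M0 by (intro mult_nonneg_nonneg) auto
  have "\<forall>\<^sub>F m in sequentially. \<delta> m < 1 - s" using order_tendstoD(2)[OF \<delta>(2)] s by simp
  then have W2: "\<forall>\<^sub>F m in sequentially. (\<integral>\<^sup>+x\<in>A. (ennreal (W m x))\<^sup>2 \<partial>lborel) \<le> ennreal (2 * C * sqrt (\<delta> m))"
  proof eventually_elim
    fix m assume d: "\<delta> m < 1 - s"
    define Q where "Q = {x. sq_norm (x - c) < R' m}"
    have Q: "open Q" unfolding Q_def by (rule open_square)
    have "Q \<subseteq> cball 0 s" using sub R'(2)[of m] by (force simp: Q_def)
    also have "\<dots> \<subseteq> cball 0 (1 - \<delta> m)" using d by auto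
    finally have Qs: "Q \<subseteq> cball 0 (1 - \<delta> m)" .
    have fr: "sq_norm (x - c) = R' m" if "x \<in> frontier Q" for x
      using frontier_square that unfolding Q_def by blast
    have yM: "\<bar>y m\<bar> \<le> M" unfolding y_def by (rule vM)
    have Qb: "Q \<in> sets borel" using Q by simp
    have 1: "(\<integral>\<^sup>+x\<in>Q. ennreal ((max 0 (v m x - (y m + q + \<tau> m)))\<^sup>2) \<partial>lborel) \<le> ennreal (2 * M * sqrt (\<delta> m) * (measure lborel (cball (0::real^2) 1) + 1))"
    proof (rule approx_maximum_principle[OF ap \<delta>(1) Q Qs])
      show "v m x < y m + q + \<tau> m" if "x \<in> frontier Q" for x using yb[OF fr[OF that]] \<tau>(1)[of m] by linarith
      show "v m x - (y m + q + \<tau> m) \<le> 2 * M" for x using vM[of m x] yM q0 \<tau>(1)[of m] by linarith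
    qed (use M0 in simp)
    have 2: "(\<integral>\<^sup>+x\<in>Q. ennreal ((max 0 (- v m x - (- y m + q + \<tau> m)))\<^sup>2) \<partial>lborel) \<le> ennreal (2 * M * sqrt (\<delta> m) * (measure lborel (cball (0::real^2) 1) + 1))"
    proof (rule approx_maximum_principle[OF approx_solution_uminus[OF ap] \<delta>(1) Q Qs])
      show "- v m x < - y m + q + \<tau> m" if "x \<in> frontier Q" for x using yb[OF fr[OF that]] \<tau>(1)[of m] by linarith
      show "- v m x - (- y m + q + \<tau> m) \<le> 2 * M" for x using vM[of m x] yM q0 \<tau>(1)[of m] by linarith
    qed (use M0 in simp)
    have "(\<integral>\<^sup>+x\<in>A. (ennreal (W m x))\<^sup>2 \<partial>lborel) \<le>
       (\<integral>\<^sup>+x. ennreal ((max 0 (v m x - (y m + q + \<tau> m)))\<^sup>2) * indicator Q x + ennreal ((max 0 (- v m x - (- y m + q + \<tau> m)))\<^sup>2) * indicator Q x \<partial>lborel)"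
    proof (rule nn_integral_mono)
      fix x
      show "(ennreal (W m x))\<^sup>2 * indicator A x \<le> ennreal ((max 0 (v m x - (y m + q + \<tau> m)))\<^sup>2) * indicator Q x + ennreal ((max 0 (- v m x - (- y m + q + \<tau> m)))\<^sup>2) * indicator Q x"
      proof (cases "x \<in> A")
        case True
        then have xQ: "x \<in> Q" using R'(1)[of m] by (auto simp: A_def Q_def)
        have "W m x = max 0 (v m x - (y m + q + \<tau> m)) \<or> W m x = max 0 (- v m x - (- y m + q + \<tau> m))"
          by (auto simp: W_def abs_if)
        then have "(W m x)\<^sup>2 \<le> (max 0 (v m x - (y m + q + \<tau> m)))\<^sup>2 + (max 0 (- v m x - (- y m + q + \<tau> m)))\<^sup>2"
          by (elim disjE) simp_all
        moreover have "0 \<le> W m x" by (simp add: W_def)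
        ultimately show ?thesis using True xQ by (simp add: ennreal_power ennreal_leI flip: ennreal_plus)
      qed simp
    qed
    also have "\<dots> = (\<integral>\<^sup>+x\<in>Q. ennreal ((max 0 (v m x - (y m + q + \<tau> m)))\<^sup>2) \<partial>lborel) + (\<integral>\<^sup>+x\<in>Q. ennreal ((max 0 (- v m x - (- y m + q + \<tau> m)))\<^sup>2) \<partial>lborel)"
      by (rule nn_integral_add; rule borel_measurable_times_ennreal[OF _ borel_measurable_indicator]) (use Qb in simp_all)
    also have "\<dots> \<le> ennreal (2 * M * sqrt (\<delta> m) * (measure lborel (cball (0::real^2) 1) + 1)) + ennreal (2 * M * sqrt (\<delta> m) * (measure lborel (cball (0::real^2) 1) + 1))"
      by (rule add_mono[OF 1 2])
    also have "\<dots> = ennreal (2 * C * sqrt (\<delta> m))"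
      using M0 \<delta>(1)[of m] by (subst ennreal_plus[symmetric]) (auto simp: C_def algebra_simps)
    finally show "(\<integral>\<^sup>+x\<in>A. (ennreal (W m x))\<^sup>2 \<partial>lborel) \<le> ennreal (2 * C * sqrt (\<delta> m))" .
  qed
  have "(\<lambda>m. 2 * C * sqrt (\<delta> m)) \<longlonglongrightarrow> 2 * C * sqrt 0" by (intro tendsto_intros \<delta>)
  then have lim0: "(\<lambda>m. ennreal (2 * C * sqrt (\<delta> m))) \<longlonglongrightarrow> 0" using tendsto_ennrealI by fastforce
  have W2lim: "(\<lambda>m. \<integral>\<^sup>+x\<in>A. (ennreal (W m x))\<^sup>2 \<partial>lborel) \<longlonglongrightarrow> 0"
    by (rule tendsto_sandwich[OF _ W2 tendsto_const lim0]) simp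
  have W1: "(\<lambda>m. \<integral>\<^sup>+x\<in>A. ennreal (W m x) \<partial>lborel) \<longlonglongrightarrow> 0"
    by (rule nn_integral_L2_tendsto_L1[OF _ Ab Af W2lim]) measurable
  have U1: "(\<lambda>m. \<integral>\<^sup>+x\<in>A. ennreal \<bar>v m x - u x\<bar> \<partial>lborel) \<longlonglongrightarrow> 0"
    by (rule tendsto_sandwich[OF _ _ tendsto_const L1])
       (use As in \<open>auto intro!: always_eventually nn_integral_mono simp: indicator_def\<close>)
  \<comment> \<open>The reference boundary values stay in a compact interval, so along a subsequence
    they settle at one centre \<open>y'\<close>.\<close>
  have "\<forall>n. y n \<in> {-M..M}" using vM unfolding y_def by (metis abs_le_iff atLeastAtMost_iff minus_le_iff)
  then obtain y' \<sigma> where \<sigma>: "strict_mono (\<sigma> :: nat \<Rightarrow> nat)" "(y \<circ> \<sigma>) \<longlonglongrightarrow> y'"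
    using compact_Icc[of "-M" M] unfolding compact_def by metis
  \<comment> \<open>What remains of the excess in the limit. Its integral over \<open>A\<close> is
    dominated by three terms that vanish along the subsequence, hence it is zero a.e. on
    \<open>A\<close>.\<close>
  define F where "F x = max 0 (\<bar>u x - y'\<bar> - q)" for x
  have Fm[measurable]: "F \<in> borel_measurable borel" unfolding F_def by measurable
  have IA: "(\<lambda>x. f x * indicator A x) \<in> borel_measurable lborel" if "f \<in> borel_measurable borel" for f :: "real^2 \<Rightarrow> ennreal"
    by (rule borel_measurable_times_ennreal[OF _ borel_measurable_indicator]) (use that Ab in simp_all)
  have Fle: "(\<integral>\<^sup>+x\<in>A. ennreal (F x) \<partial>lborel) \<le> (\<integral>\<^sup>+x\<in>A. ennreal \<bar>v m x - u x\<bar> \<partial>lborel) +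
     ((\<integral>\<^sup>+x\<in>A. ennreal (W m x) \<partial>lborel) + ennreal (\<bar>y m - y'\<bar> + \<tau> m) * emeasure lborel A)" for m
  proof -
    have "(\<integral>\<^sup>+x\<in>A. ennreal (F x) \<partial>lborel) \<le> (\<integral>\<^sup>+x. ennreal \<bar>v m x - u x\<bar> * indicator A x +
       (ennreal (W m x) * indicator A x + ennreal (\<bar>y m - y'\<bar> + \<tau> m) * indicator A x) \<partial>lborel)"
    proof (rule nn_integral_mono)
      fix x
      have "F x \<le> \<bar>v m x - u x\<bar> + (W m x + (\<bar>y m - y'\<bar> + \<tau> m))"
        unfolding F_def W_def using \<tau>(1)[of m] by linarith
      then have "ennreal (F x) \<le> ennreal (\<bar>v m x - u x\<bar> + (W m x + (\<bar>y m - y'\<bar> + \<tau> m)))" by (rule ennreal_leI)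
      also have "\<dots> = ennreal \<bar>v m x - u x\<bar> + (ennreal (W m x) + ennreal (\<bar>y m - y'\<bar> + \<tau> m))"
      proof -
        have "0 \<le> W m x" "0 \<le> \<tau> m" using \<tau>(1)[of m] by (auto simp: W_def)
        then show ?thesis by simp
      qed
      finally have "ennreal (F x) \<le> ennreal \<bar>v m x - u x\<bar> + (ennreal (W m x) + ennreal (\<bar>y m - y'\<bar> + \<tau> m))" .
      then show "ennreal (F x) * indicator A x \<le> ennreal \<bar>v m x - u x\<bar> * indicator A x + (ennreal (W m x) * indicator A x + ennreal (\<bar>y m - y'\<bar> + \<tau> m) * indicator A x)"
        by (auto simp: indicator_def)
    qed
    also have "\<dots> = (\<integral>\<^sup>+x\<in>A. ennreal \<bar>v m x - u x\<bar> \<partial>lborel) + ((\<integral>\<^sup>+x\<in>A. ennreal (W m x) \<partial>lborel) + (\<integral>\<^sup>+x\<in>A. ennreal (\<bar>y m - y'\<bar> + \<tau> m) \<partial>lborel))"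
    proof -
      have m1: "(\<lambda>x. ennreal \<bar>v m x - u x\<bar> * indicator A x) \<in> borel_measurable lborel" by (rule IA) measurable
      have m2: "(\<lambda>x. ennreal (W m x) * indicator A x) \<in> borel_measurable lborel" by (rule IA) measurable
      have m3: "(\<lambda>x. ennreal (\<bar>y m - y'\<bar> + \<tau> m) * indicator A x) \<in> borel_measurable lborel" by (rule IA) measurable
      show ?thesis by (simp only: nn_integral_add[OF m1 borel_measurable_add[OF m2 m3]] nn_integral_add[OF m2 m3])
    qed
    also have "(\<integral>\<^sup>+x\<in>A. ennreal (\<bar>y m - y'\<bar> + \<tau> m) \<partial>lborel) = ennreal (\<bar>y m - y'\<bar> + \<tau> m) * emeasure lborel A"
      by (rule nn_integral_cmult_indicator) (use Ab in simp)
    finally show ?thesis .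
  qed
  have "(\<lambda>n. \<bar>(y \<circ> \<sigma>) n - y'\<bar> + (\<tau> \<circ> \<sigma>) n) \<longlonglongrightarrow> \<bar>y' - y'\<bar> + 0"
    by (intro tendsto_intros \<sigma>(2) LIMSEQ_subseq_LIMSEQ[OF \<tau>(2) \<sigma>(1)])
  then have "(\<lambda>n. ennreal (\<bar>y (\<sigma> n) - y'\<bar> + \<tau> (\<sigma> n))) \<longlonglongrightarrow> ennreal 0" by (intro tendsto_ennrealI) simp
  then have l3: "(\<lambda>n. ennreal (\<bar>y (\<sigma> n) - y'\<bar> + \<tau> (\<sigma> n)) * emeasure lborel A) \<longlonglongrightarrow> ennreal 0 * emeasure lborel A"
    by (intro tendsto_mult_ennreal) (use Af in auto)
  have "(\<lambda>n. (\<integral>\<^sup>+x\<in>A. ennreal \<bar>v (\<sigma> n) x - u x\<bar> \<partial>lborel) +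
     ((\<integral>\<^sup>+x\<in>A. ennreal (W (\<sigma> n) x) \<partial>lborel) + ennreal (\<bar>y (\<sigma> n) - y'\<bar> + \<tau> (\<sigma> n)) * emeasure lborel A)) \<longlonglongrightarrow> 0 + (0 + ennreal 0 * emeasure lborel A)"
    by (intro tendsto_add l3 LIMSEQ_subseq_LIMSEQ[OF U1 \<sigma>(1), unfolded comp_def] LIMSEQ_subseq_LIMSEQ[OF W1 \<sigma>(1), unfolded comp_def])
  then have "(\<integral>\<^sup>+x\<in>A. ennreal (F x) \<partial>lborel) \<le> 0 + (0 + ennreal 0 * emeasure lborel A)"
    by (rule tendsto_lowerbound) (use Fle in auto)
  then have "(\<integral>\<^sup>+x\<in>A. ennreal (F x) \<partial>lborel) = 0" by simp
  moreover have "(\<lambda>x. ennreal (F x) * indicator A x) \<in> borel_measurable lborel" by (rule IA) measurable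
  ultimately have "AE x in lborel. ennreal (F x) * indicator A x = 0" by (simp add: nn_integral_0_iff_AE)
  then have "AE x in lborel. sq_norm (x - c) < \<rho> \<longrightarrow> \<bar>u x - y'\<bar> \<le> q"
    by eventually_elim (auto simp: A_def F_def ennreal_eq_0_iff)
  then show thesis using that unfolding q_def by blast
qed

text \<open>As \<open>b\<close> is merely integrable, the limit of the integrals of
  \<open>v\<^sup>2 * norm b\<close> is taken by dominated convergence: a.e. convergence of
  \<open>v\<close>, available along a subsequence, and the bound \<open>M\<^sup>2\<close>. The limit
  function is bounded by \<open>N\<close>, which replaces \<open>M\<close> up to
  \<open>\<eta>\<close>; exchanging \<open>\<beta>\<close> for \<open>b\<close> costs
  \<open>M\<^sup>2\<close> times their \<open>L1\<close> distance.\<close>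

lemma energy_integral_limit:
  fixes v :: "nat \<Rightarrow> 'a::euclidean_space \<Rightarrow> real" and \<beta> :: "nat \<Rightarrow> 'a \<Rightarrow> 'a"
  assumes vc: "\<And>m. continuous_on UNIV (v m)" and \<beta>c: "\<And>m. continuous_on UNIV (\<beta> m)"
    and vM: "\<And>m x. \<bar>v m x\<bar> \<le> M" and um: "u \<in> borel_measurable borel" and uN: "\<And>x. \<bar>u x\<bar> \<le> N"
    and L1: "(\<lambda>m. \<integral>\<^sup>+x\<in>cball 0 s. ennreal \<bar>v m x - u x\<bar> \<partial>lborel) \<longlonglongrightarrow> 0" and s: "s < 1"
    and b: "integrable lborel b" and \<beta>b: "(\<lambda>m. \<integral>\<^sup>+x\<in>ball 0 1. ennreal (norm (\<beta> m x - b x)) \<partial>lborel) \<longlonglongrightarrow> 0"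
    and \<eta>: "\<eta> > 0"
  obtains \<sigma> :: "nat \<Rightarrow> nat" where "strict_mono \<sigma>"
    "\<And>i. (\<integral>x. indicator (cball 0 s) x * ((v (\<sigma> i) x)\<^sup>2 * (1 + norm (\<beta> (\<sigma> i) x))) \<partial>lborel) \<le>
       N\<^sup>2 * (measure lborel (cball (0::'a) 1) + (\<integral>x. norm (b x) \<partial>lborel)) + \<eta>"
proof -
  note um[measurable]
  have vm[measurable]: "v m \<in> borel_measurable borel" for m by (rule borel_measurable_continuous_onI[OF vc])
  have bm[measurable]: "b \<in> borel_measurable borel" using b by auto
  have Im[measurable]: "indicator (cball (0::'a) s) \<in> borel_measurable (borel :: 'a measure)"
    by (rule borel_measurable_indicator) simp
  have M0: "0 \<le> M" using vM[of 0 0] by linarith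
  have cbi: "integrable lborel (indicator (cball (0::'a) t) :: 'a \<Rightarrow> real)" for t
    using emeasure_lborel_cball_finite[of "0::'a" t] by (simp add: integrable_indicator_iff)
  define f where "f m x = indicator (cball 0 s) x * (v m x - u x)" for m x
  have fi: "integrable lborel (f m)" for m
  proof (rule Bochner_Integration.integrable_bound)
    show "integrable lborel (\<lambda>x. (M + N) * indicator (cball (0::'a) s) x)" using cbi by simp
    show "f m \<in> borel_measurable lborel" unfolding f_def by measurable
    show "AE x in lborel. norm (f m x) \<le> norm ((M + N) * indicator (cball 0 s) x)"
    proof (rule AE_I2)
      fix x
      have "\<bar>v m x - u x\<bar> \<le> \<bar>M + N\<bar>" using vM[of m x] uN[of x] by linarith
      then show "norm (f m x) \<le> norm ((M + N) * indicator (cball 0 s) x)" by (simp add: f_def indicator_def)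
    qed
  qed
  have "(\<lambda>m. \<integral>x. norm (f m x) \<partial>lborel) \<longlonglongrightarrow> 0"
  proof -
    have "ennreal (\<integral>x. norm (f m x) \<partial>lborel) = (\<integral>\<^sup>+x\<in>cball 0 s. ennreal \<bar>v m x - u x\<bar> \<partial>lborel)" for m
    proof -
      have "ennreal (\<integral>x. norm (f m x) \<partial>lborel) = (\<integral>\<^sup>+x. ennreal (norm (f m x)) \<partial>lborel)"
        by (rule nn_integral_eq_integral[symmetric]) (use fi in auto)
      also have "\<dots> = (\<integral>\<^sup>+x\<in>cball 0 s. ennreal \<bar>v m x - u x\<bar> \<partial>lborel)"
        by (intro nn_integral_cong) (auto simp: f_def split: split_indicator)
      finally show ?thesis .
    qed
    then have "(\<lambda>m. ennreal (\<integral>x. norm (f m x) \<partial>lborel)) \<longlonglongrightarrow> ennreal 0" using L1 by simp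
    then show ?thesis by (rule tendsto_ennrealD) auto
  qed
  then obtain \<sigma> :: "nat \<Rightarrow> nat" where \<sigma>: "strict_mono \<sigma>" "AE x in lborel. (\<lambda>n. f (\<sigma> n) x) \<longlonglongrightarrow> 0"
    using tendsto_L1_AE_subseq[of lborel f, OF fi] by blast
  define I1 where "I1 n = (\<integral>x. indicator (cball 0 s) x * ((v (\<sigma> n) x)\<^sup>2 * (1 + norm (b x))) \<partial>lborel)" for n
  have di: "integrable lborel (\<lambda>x. M\<^sup>2 * (indicator (cball 0 s) x + norm (b x)))"
    using b by (intro integrable_mult_right Bochner_Integration.integrable_add cbi) auto
  have p1: "norm (indicator (cball 0 s) x * ((v (\<sigma> n) x)\<^sup>2 * (1 + norm (b x)))) \<le> M\<^sup>2 * (indicator (cball 0 s) x + norm (b x))" for n x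
  proof (cases "norm x \<le> s")
    case True
    have "(v (\<sigma> n) x)\<^sup>2 \<le> M\<^sup>2" using vM[of "\<sigma> n" x] by (simp add: abs_le_square_iff[symmetric] M0)
    then have "(v (\<sigma> n) x)\<^sup>2 * (1 + norm (b x)) \<le> M\<^sup>2 * (1 + norm (b x))" by (intro mult_right_mono) auto
    then show ?thesis using True by simp
  qed simp
  have ii1: "integrable lborel (\<lambda>x. indicator (cball 0 s) x * ((v (\<sigma> n) x)\<^sup>2 * (1 + norm (b x))))" for n
    by (rule Bochner_Integration.integrable_bound[OF di], measurable) (rule AE_I2, rule order_trans[OF p1], simp)
  have "I1 \<longlonglongrightarrow> (\<integral>x. indicator (cball 0 s) x * ((u x)\<^sup>2 * (1 + norm (b x))) \<partial>lborel)"
    unfolding I1_def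
  proof (rule integral_dominated_convergence[OF _ _ di])
    show "AE x in lborel. (\<lambda>n. indicator (cball 0 s) x * ((v (\<sigma> n) x)\<^sup>2 * (1 + norm (b x)))) \<longlonglongrightarrow> indicator (cball 0 s) x * ((u x)\<^sup>2 * (1 + norm (b x)))"
      using \<sigma>(2)
    proof eventually_elim
      fix x assume l: "(\<lambda>n. f (\<sigma> n) x) \<longlonglongrightarrow> 0"
      show "(\<lambda>n. indicator (cball 0 s) x * ((v (\<sigma> n) x)\<^sup>2 * (1 + norm (b x)))) \<longlonglongrightarrow> indicator (cball 0 s) x * ((u x)\<^sup>2 * (1 + norm (b x)))"
      proof (cases "norm x \<le> s")
        case True
        then have "(\<lambda>n. v (\<sigma> n) x - u x) \<longlonglongrightarrow> 0" using l by (simp add: f_def)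
        then have "(\<lambda>n. v (\<sigma> n) x) \<longlonglongrightarrow> u x" by (simp add: LIM_zero_iff)
        then show ?thesis by (intro tendsto_intros)
      qed simp
    qed
  qed (use p1 in \<open>auto intro!: AE_I2\<close>)
  moreover have "(\<integral>x. indicator (cball 0 s) x * ((u x)\<^sup>2 * (1 + norm (b x))) \<partial>lborel) \<le> N\<^sup>2 * (measure lborel (cball (0::'a) 1) + (\<integral>x. norm (b x) \<partial>lborel))"
  proof -
    have "(\<integral>x. indicator (cball 0 s) x * ((u x)\<^sup>2 * (1 + norm (b x))) \<partial>lborel) \<le> (\<integral>x. N\<^sup>2 * (indicator (cball (0::'a) 1) x + norm (b x)) \<partial>lborel)"
    proof (rule integral_mono')
      show "integrable lborel (\<lambda>x. N\<^sup>2 * (indicator (cball 0 1) x + norm (b x)))"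
    using b by (intro integrable_mult_right Bochner_Integration.integrable_add cbi) auto
      fix x
      show "indicator (cball 0 s) x * ((u x)\<^sup>2 * (1 + norm (b x))) \<le> N\<^sup>2 * (indicator (cball 0 1) x + norm (b x))"
      proof (cases "norm x \<le> s")
        case True
        have "(u x)\<^sup>2 \<le> N\<^sup>2" using uN[of x] by (intro power2_le_iff_abs_le[THEN iffD2]) auto
        then have "(u x)\<^sup>2 * (1 + norm (b x)) \<le> N\<^sup>2 * (1 + norm (b x))" by (intro mult_right_mono) auto
        then show ?thesis using True s by simp
      qed simp
      show "0 \<le> N\<^sup>2 * (indicator (cball 0 1) x + norm (b x))" by (simp add: indicator_def)
    qed
    also have "\<dots> = N\<^sup>2 * (measure lborel (cball (0::'a) 1) + (\<integral>x. norm (b x) \<partial>lborel))"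
      using Bochner_Integration.integral_add[OF cbi[of 1], of "\<lambda>x. norm (b x)"] b by simp
    finally show ?thesis .
  qed
  ultimately have e1: "\<forall>\<^sub>F n in sequentially. I1 n < N\<^sup>2 * (measure lborel (cball (0::'a) 1) + (\<integral>x. norm (b x) \<partial>lborel)) + \<eta> / 2"
    using \<eta> by (intro order_tendstoD(2)) auto
  define \<eta>' where "\<eta>' = (\<eta> / 2) / (M\<^sup>2 + 1)"
  have mp: "M\<^sup>2 + 1 > 0" by (simp add: add_nonneg_pos)
  have \<eta>': "\<eta>' > 0" "M\<^sup>2 * \<eta>' \<le> \<eta> / 2"
  proof -
    show p: "\<eta>' > 0" unfolding \<eta>'_def using \<eta> mp by (intro divide_pos_pos) auto
    have "\<eta>' * (M\<^sup>2 + 1) = \<eta> / 2" unfolding \<eta>'_def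
      by (rule nonzero_eq_divide_eq[THEN iffD1, OF _ refl]) (use mp in simp)
    then show "M\<^sup>2 * \<eta>' \<le> \<eta> / 2" using p by (simp add: distrib_left mult.commute)
  qed
  have e2: "\<forall>\<^sub>F n in sequentially. (\<integral>\<^sup>+x\<in>ball 0 1. ennreal (norm (\<beta> (\<sigma> n) x - b x)) \<partial>lborel) \<le> ennreal \<eta>'"
    by (rule ennreal_tendsto_0D[OF LIMSEQ_subseq_LIMSEQ[OF \<beta>b \<sigma>(1), unfolded comp_def] \<eta>'(1)])
  have "\<forall>\<^sub>F n in sequentially. (\<integral>x. indicator (cball 0 s) x * ((v (\<sigma> n) x)\<^sup>2 * (1 + norm (\<beta> (\<sigma> n) x))) \<partial>lborel) \<le>
       N\<^sup>2 * (measure lborel (cball (0::'a) 1) + (\<integral>x. norm (b x) \<partial>lborel)) + \<eta>"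
    using e1 e2
  proof eventually_elim
    fix n assume a1: "I1 n < N\<^sup>2 * (measure lborel (cball (0::'a) 1) + (\<integral>x. norm (b x) \<partial>lborel)) + \<eta> / 2"
      and a2: "(\<integral>\<^sup>+x\<in>ball 0 1. ennreal (norm (\<beta> (\<sigma> n) x - b x)) \<partial>lborel) \<le> ennreal \<eta>'"
    define D where "D x = indicator (cball 0 s) x * norm (\<beta> (\<sigma> n) x - b x)" for x
    have \<beta>m[measurable]: "\<beta> (\<sigma> n) \<in> borel_measurable borel" by (rule borel_measurable_continuous_onI[OF \<beta>c])
    have Dm[measurable]: "D \<in> borel_measurable borel" unfolding D_def by measurable
    have "(\<integral>\<^sup>+x. ennreal (D x) \<partial>lborel) \<le> (\<integral>\<^sup>+x\<in>ball 0 1. ennreal (norm (\<beta> (\<sigma> n) x - b x)) \<partial>lborel)"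
      using s by (intro nn_integral_mono) (auto simp: D_def indicator_def)
    also note a2
    finally have Dn: "(\<integral>\<^sup>+x. ennreal (D x) \<partial>lborel) \<le> ennreal \<eta>'" .
    have D0: "0 \<le> D x" for x by (simp add: D_def)
    have Di: "integrable lborel D"
      by (rule integrableI_bounded) (use Dn D0 in \<open>auto simp: less_top[symmetric] top_unique\<close>)
    have DI: "(\<integral>x. D x \<partial>lborel) \<le> \<eta>'"
      using Dn nn_integral_eq_integral[OF Di] D0 \<eta>'(1) by (simp add: ennreal_le_iff)
    have "(\<integral>x. indicator (cball 0 s) x * ((v (\<sigma> n) x)\<^sup>2 * (1 + norm (\<beta> (\<sigma> n) x))) \<partial>lborel) \<le>
       (\<integral>x. indicator (cball 0 s) x * ((v (\<sigma> n) x)\<^sup>2 * (1 + norm (b x))) + M\<^sup>2 * D x \<partial>lborel)"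
    proof (rule integral_mono')
      show "integrable lborel (\<lambda>x. indicator (cball 0 s) x * ((v (\<sigma> n) x)\<^sup>2 * (1 + norm (b x))) + M\<^sup>2 * D x)"
        using ii1 Di by simp
      fix x
      show "indicator (cball 0 s) x * ((v (\<sigma> n) x)\<^sup>2 * (1 + norm (\<beta> (\<sigma> n) x))) \<le> indicator (cball 0 s) x * ((v (\<sigma> n) x)\<^sup>2 * (1 + norm (b x))) + M\<^sup>2 * D x"
      proof (cases "norm x \<le> s")
        case True
        have "(v (\<sigma> n) x)\<^sup>2 \<le> M\<^sup>2" using vM[of "\<sigma> n" x] by (simp add: abs_le_square_iff[symmetric] M0)
        then have "(v (\<sigma> n) x)\<^sup>2 * norm (\<beta> (\<sigma> n) x - b x) \<le> M\<^sup>2 * norm (\<beta> (\<sigma> n) x - b x)" by (intro mult_right_mono) auto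
        moreover have "(v (\<sigma> n) x)\<^sup>2 * (1 + norm (\<beta> (\<sigma> n) x)) \<le> (v (\<sigma> n) x)\<^sup>2 * ((1 + norm (b x)) + norm (\<beta> (\<sigma> n) x - b x))"
          using norm_triangle_sub[of "\<beta> (\<sigma> n) x" "b x"] by (intro mult_left_mono) auto
        ultimately show ?thesis using True by (simp add: D_def distrib_left)
      qed (simp add: D_def)
      show "0 \<le> indicator (cball 0 s) x * ((v (\<sigma> n) x)\<^sup>2 * (1 + norm (b x))) + M\<^sup>2 * D x" using D0[of x] by simp
    qed
    also have "\<dots> = I1 n + M\<^sup>2 * (\<integral>x. D x \<partial>lborel)" unfolding I1_def using ii1 Di by simp
    also have "\<dots> \<le> I1 n + M\<^sup>2 * \<eta>'" by (intro add_left_mono mult_left_mono DI) simp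
    finally show "(\<integral>x. indicator (cball 0 s) x * ((v (\<sigma> n) x)\<^sup>2 * (1 + norm (\<beta> (\<sigma> n) x))) \<partial>lborel) \<le>
       N\<^sup>2 * (measure lborel (cball (0::'a) 1) + (\<integral>x. norm (b x) \<partial>lborel)) + \<eta>"
      using a1 \<eta>'(2) by linarith
  qed
  then obtain n0 where n0: "\<And>n. n \<ge> n0 \<Longrightarrow> (\<integral>x. indicator (cball 0 s) x * ((v (\<sigma> n) x)\<^sup>2 * (1 + norm (\<beta> (\<sigma> n) x))) \<partial>lborel) \<le>
       N\<^sup>2 * (measure lborel (cball (0::'a) 1) + (\<integral>x. norm (b x) \<partial>lborel)) + \<eta>"
    by (auto simp: eventually_sequentially)
  show thesis
  proof (rule that[of "\<lambda>i. \<sigma> (i + n0)"])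
    show "strict_mono (\<lambda>i. \<sigma> (i + n0))" using \<sigma>(1) by (simp add: strict_mono_def)
  qed (use n0 in auto)
qed

lemma AE_open_witness:
  fixes U :: "'a::euclidean_space set"
  assumes "AE z in lborel. z \<in> U \<longrightarrow> P z" "open U" "U \<noteq> {}"
  shows "\<exists>z\<in>U. P z"
proof (rule ccontr)
  assume "\<not> ?thesis"
  with assms(1) have "AE z in lborel. z \<notin> U" by (auto elim!: eventually_mono)
  then have "U \<in> null_sets lborel" using assms(2) by (subst (asm) AE_iff_null_sets[symmetric]) auto
  then show False
    using open_not_negligible[OF assms(2,3)] negligible_iff_null_sets null_sets_completionI by blast
qed

text \<open>Values are defined through local essential bounds, so that an a.e. bound on an open
  square becomes a bound at each of its points. This transfer is kept as the last conclusion for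
  arbitrary squares, because the estimate at the origin needs it again.\<close>

lemma continuous_representative_exists:
  fixes u :: "real^2 \<Rightarrow> real"
  assumes uN: "\<And>x. \<bar>u x\<bar> \<le> N"
    and osc: "\<And>c \<epsilon>. c \<in> ball 0 1 \<Longrightarrow> \<epsilon> > 0 \<Longrightarrow> \<exists>\<rho>>0. \<exists>y. AE x in lborel. sq_norm (x - c) < \<rho> \<longrightarrow> \<bar>u x - y\<bar> \<le> \<epsilon>"
  obtains w where "continuous_on (ball 0 1) w" "AE x in lborel. x \<in> ball 0 1 \<longrightarrow> w x = u x" "\<And>x. \<bar>w x\<bar> \<le> N"
    "\<And>c \<rho> y \<epsilon> x. AE x in lborel. sq_norm (x - c) < \<rho> \<longrightarrow> \<bar>u x - y\<bar> \<le> \<epsilon> \<Longrightarrow> sq_norm (x - c) < \<rho> \<Longrightarrow> \<bar>w x - y\<bar> \<le> \<epsilon>"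
proof -
  \<comment> \<open>The essential upper bounds of \<open>u\<close> near \<open>x\<close>; their
    infimum is the upper limit of \<open>u\<close> at \<open>x\<close> modulo null sets.\<close>
  define S where "S x = {k. \<exists>d>0. AE z in lborel. norm (z - x) < d \<longrightarrow> u z \<le> k}" for x
  define w where "w x = Inf (S x)" for x
  have w: "\<bar>w x - y\<bar> \<le> \<epsilon>" if ae: "AE x in lborel. sq_norm (x - c) < \<rho> \<longrightarrow> \<bar>u x - y\<bar> \<le> \<epsilon>" and x: "sq_norm (x - c) < \<rho>"
    for c \<rho> y \<epsilon> x
  proof -
    obtain d where d: "d > 0" "ball x d \<subseteq> {x. sq_norm (x - c) < \<rho>}"
      using open_square[of c \<rho>] x unfolding open_contains_ball by blast
    have ae': "AE z in lborel. norm (z - x) < d \<longrightarrow> \<bar>u z - y\<bar> \<le> \<epsilon>"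
      using ae by eventually_elim (use d(2) in \<open>force simp: dist_norm norm_minus_commute\<close>)
    have up: "y + \<epsilon> \<in> S x"
      unfolding S_def using d(1) ae' by (auto intro!: exI[of _ d] elim!: eventually_mono)
    have lo: "y - \<epsilon> \<le> k" if k: "k \<in> S x" for k
    proof -
      obtain d' where d': "d' > 0" "AE z in lborel. norm (z - x) < d' \<longrightarrow> u z \<le> k" using k by (auto simp: S_def)
      have "AE z in lborel. z \<in> ball x (min d d') \<longrightarrow> (u z \<le> k \<and> \<bar>u z - y\<bar> \<le> \<epsilon>)"
        using ae' d'(2) by eventually_elim (auto simp: dist_norm norm_minus_commute)
      then obtain z where "u z \<le> k" "\<bar>u z - y\<bar> \<le> \<epsilon>"
        using AE_open_witness[of "ball x (min d d')"] d(1) d'(1) by fastforce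
      then show ?thesis by linarith
    qed
    have "w x \<le> y + \<epsilon>" unfolding w_def by (rule cInf_lower[OF up], rule bdd_belowI, rule lo)
    moreover have "y - \<epsilon> \<le> w x" unfolding w_def by (rule cInf_greatest) (use up lo in auto)
    ultimately show ?thesis by linarith
  qed
  have wN: "\<bar>w x\<bar> \<le> N" for x
  proof -
    have "\<bar>w x - 0\<bar> \<le> N" by (rule w[of x 1]) (use uN in \<open>auto simp: sq_norm_def\<close>)
    then show ?thesis by simp
  qed
  have cont: "continuous_on (ball 0 1) w"
    unfolding continuous_on_iff
  proof (intro ballI allI impI)
    fix c :: "real^2" and e :: real assume c: "c \<in> ball 0 1" and e: "0 < e"
    obtain \<rho> y where \<rho>: "\<rho> > 0" "AE x in lborel. sq_norm (x - c) < \<rho> \<longrightarrow> \<bar>u x - y\<bar> \<le> e / 3"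
      using osc[OF c, of "e / 3"] e by auto
    have "dist (w x) (w c) < e" if "dist x c < \<rho>" for x
    proof -
      have "sq_norm (x - c) < \<rho>" using that sq_norm_le_norm[of "x - c"] by (simp add: dist_norm)
      moreover have "sq_norm (c - c) < \<rho>" using \<rho>(1) by (simp add: sq_norm_def)
      ultimately have "\<bar>w x - y\<bar> \<le> e / 3" "\<bar>w c - y\<bar> \<le> e / 3" using w[OF \<rho>(2)] by blast+
      then show ?thesis using e unfolding dist_real_def by linarith
    qed
    then show "\<exists>d>0. \<forall>x'\<in>ball 0 1. dist x' c < d \<longrightarrow> dist (w x') (w c) < e" using \<rho>(1) by blast
  qed
  have ae: "AE x in lborel. x \<in> ball 0 1 \<longrightarrow> \<bar>w x - u x\<bar> \<le> 1 / real (Suc n)" for n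
  proof -
    define e where "e = (1 / real (Suc n)) / 2"
    have e: "e > 0" by (simp add: e_def)
    \<comment> \<open>The ball is covered by uncountably many such squares, each with its own null
      set; Lindelof's theorem leaves countably many.\<close>
    define F where "F = {{x. sq_norm (x - c) < \<rho>} | c \<rho>. \<exists>y. AE x in lborel. sq_norm (x - c) < \<rho> \<longrightarrow> \<bar>u x - y\<bar> \<le> e}"
    have "\<And>U. U \<in> F \<Longrightarrow> open U" unfolding F_def using open_square by blast
    then obtain F' where F': "F' \<subseteq> F" "countable F'" "\<Union>F' = \<Union>F" using Lindelof by metis
    have "AE x in lborel. x \<in> U \<longrightarrow> \<bar>w x - u x\<bar> \<le> 1 / real (Suc n)" if UF: "U \<in> F" for U
    proof -
      obtain c \<rho> y where U: "U = {x. sq_norm (x - c) < \<rho>}" and a: "AE x in lborel. sq_norm (x - c) < \<rho> \<longrightarrow> \<bar>u x - y\<bar> \<le> e"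
        using UF unfolding F_def by blast
      from a show ?thesis
      proof eventually_elim
        fix x assume h: "sq_norm (x - c) < \<rho> \<longrightarrow> \<bar>u x - y\<bar> \<le> e"
        show "x \<in> U \<longrightarrow> \<bar>w x - u x\<bar> \<le> 1 / real (Suc n)"
        proof
          assume "x \<in> U"
          then have "\<bar>w x - y\<bar> \<le> e" "\<bar>u x - y\<bar> \<le> e" using w[OF a] h U by auto
          moreover have "e + e = 1 / real (Suc n)" unfolding e_def by (rule field_sum_of_halves)
          ultimately show "\<bar>w x - u x\<bar> \<le> 1 / real (Suc n)" by linarith
        qed
      qed
    qed
    then have "AE x in lborel. \<forall>U\<in>F'. x \<in> U \<longrightarrow> \<bar>w x - u x\<bar> \<le> 1 / real (Suc n)"
      using F'(1,2) by (subst AE_ball_countable) auto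
    moreover have "ball 0 1 \<subseteq> \<Union>F"
    proof
      fix c :: "real^2" assume "c \<in> ball 0 1"
      then obtain \<rho> y where "\<rho> > 0" "AE x in lborel. sq_norm (x - c) < \<rho> \<longrightarrow> \<bar>u x - y\<bar> \<le> e" using osc[of c e] e by blast
      then have "{x. sq_norm (x - c) < \<rho>} \<in> F" "c \<in> {x. sq_norm (x - c) < \<rho>}" unfolding F_def by (auto simp: sq_norm_def)
      then show "c \<in> \<Union>F" by blast
    qed
    ultimately show ?thesis
    proof (elim eventually_mono, intro impI)
      fix x assume "ball 0 1 \<subseteq> \<Union>F" "\<forall>U\<in>F'. x \<in> U \<longrightarrow> \<bar>w x - u x\<bar> \<le> 1 / real (Suc n)" "x \<in> ball 0 1"
      then show "\<bar>w x - u x\<bar> \<le> 1 / real (Suc n)" using F'(3) by blast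
    qed
  qed
  have "AE x in lborel. \<forall>n. x \<in> ball 0 1 \<longrightarrow> \<bar>w x - u x\<bar> \<le> 1 / real (Suc n)" using ae by (subst AE_all_countable) blast
  then have "AE x in lborel. x \<in> ball 0 1 \<longrightarrow> w x = u x"
  proof eventually_elim
    fix x assume h: "\<forall>n. x \<in> ball 0 1 \<longrightarrow> \<bar>w x - u x\<bar> \<le> 1 / real (Suc n)"
    show "x \<in> ball 0 1 \<longrightarrow> w x = u x"
    proof
      assume "x \<in> ball 0 1"
      then have "\<bar>w x - u x\<bar> \<le> 1 / real (Suc n)" for n using h by blast
      then have "\<bar>w x - u x\<bar> \<le> 0"
        using LIMSEQ_le_const[OF LIMSEQ_inverse_real_of_nat, of "\<bar>w x - u x\<bar>"] by (auto simp: inverse_eq_divide)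
      then show "w x = u x" by simp
    qed
  qed
  then show thesis using that[of w] cont wN w by blast
qed

text \<open>37 collects the factor 36 of the energy estimate and one unit for the error
  \<open>6 * \<delta> m\<close>, eventually below the square of the sup bound; 17 is the price of
  removing the cutoff. Adding 1 to the measure allows \<open>1 + norm b\<close> to be factored
  out.\<close>

definition energy_const :: real where
  "energy_const = 17 * (37 * (measure lborel (cball (0::real^2) 1) + 1))"

lemma energy_const_pos: "energy_const > 0"
  by (simp add: energy_const_def add_nonneg_pos)

text \<open>The first summand serves radii below 1/4, where a square of half-width 1/2 leaves room
  for the logarithm; the summand 3 serves the remaining radii, where the trivial bound by twice the
  sup norm is enough.\<close>

definition modulus_const :: real where
  "modulus_const = 32 * sqrt (2 * energy_const) + 3"

text \<open>\<open>M\<close> bounds the sequence and \<open>N\<close> the limit: compactness is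
  proved with \<open>M\<close>, while the modulus of continuity has to come out with
  \<open>N\<close>. The indicator in \<open>weak\<close> is there because \<open>v m\<close>, unlike
  \<open>u\<close>, may be nonzero outside the ball.\<close>

locale approximation =
  fixes v :: "nat \<Rightarrow> real^2 \<Rightarrow> real" and g \<beta> r :: "nat \<Rightarrow> real^2 \<Rightarrow> real^2" and \<delta> :: "nat \<Rightarrow> real"
    and u :: "real^2 \<Rightarrow> real" and b :: "real^2 \<Rightarrow> real^2" and M N :: real
  assumes ap: "\<And>m. approx_solution (\<delta> m) (v m) (g m) (\<beta> m) (r m)"
    and \<delta>0: "\<And>m. 0 < \<delta> m" and \<delta>_lim: "\<delta> \<longlonglongrightarrow> 0"
    and vM: "\<And>m x. \<bar>v m x\<bar> \<le> M"
    and bi: "integrable lborel b"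
    and \<beta>b: "(\<lambda>m. \<integral>\<^sup>+x\<in>ball 0 1. ennreal (norm (\<beta> m x - b x)) \<partial>lborel) \<longlonglongrightarrow> 0"
    and um: "u \<in> borel_measurable borel" and u0: "\<And>x. 1 < norm x \<Longrightarrow> u x = 0"
    and uN: "\<And>x. \<bar>u x\<bar> \<le> N" and NM: "N \<le> M"
    and weak: "\<And>\<phi> C. \<phi> \<in> borel_measurable borel \<Longrightarrow> (\<And>x. \<bar>\<phi> x\<bar> \<le> C) \<Longrightarrow>
       (\<lambda>m. \<integral>x. indicator (ball 0 1) x * (v m x * \<phi> x) \<partial>lborel) \<longlonglongrightarrow> (\<integral>x. u x * \<phi> x \<partial>lborel)"
begin

lemma vg: "has_grad (v m) (g m)"
  by (rule approx_solution_borel(4)[OF ap])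

lemma N_nonneg: "0 \<le> N"
  using uN[of 0] by linarith

lemma gradient_bound:
  assumes "0 \<le> t" "t < 1"
  obtains K m0 where "K > 0" "\<And>m. m \<ge> m0 \<Longrightarrow> (\<integral>\<^sup>+x\<in>cball 0 t. ennreal ((norm (g m x))\<^sup>2) \<partial>lborel) \<le> ennreal K"
proof -
  obtain K where K: "K > 0" "\<forall>\<^sub>F m in sequentially. (\<integral>\<^sup>+x\<in>cball 0 t. ennreal ((norm (g m x))\<^sup>2) \<partial>lborel) \<le> ennreal K"
    by (rule uniform_gradient_bound[OF ap \<delta>0 \<delta>_lim vM bi \<beta>b assms])
  from K(2) obtain m0 where "\<And>m. m \<ge> m0 \<Longrightarrow> (\<integral>\<^sup>+x\<in>cball 0 t. ennreal ((norm (g m x))\<^sup>2) \<partial>lborel) \<le> ennreal K"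
    by (auto simp: eventually_sequentially)
  then show thesis by (rule that[OF K(1)])
qed

lemma L1_lim:
  assumes "0 \<le> s" "s < 1"
  shows "(\<lambda>m. \<integral>\<^sup>+x\<in>cball 0 s. ennreal \<bar>v m x - u x\<bar> \<partial>lborel) \<longlonglongrightarrow> 0"
proof (rule L1_convergence[OF vg vM um u0 _ weak _ assms])
  show "\<bar>u x\<bar> \<le> M" for x using uN[of x] NM by linarith
  fix t :: real assume t: "0 \<le> t" "t < 1"
  obtain K where "K > 0" "\<forall>\<^sub>F m in sequentially. (\<integral>\<^sup>+x\<in>cball 0 t. ennreal ((norm (g m x))\<^sup>2) \<partial>lborel) \<le> ennreal K"
    by (rule uniform_gradient_bound[OF ap \<delta>0 \<delta>_lim vM bi \<beta>b t])
  then show "\<exists>K>0. \<forall>\<^sub>F m in sequentially. (\<integral>\<^sup>+x\<in>cball 0 t. ennreal ((norm (g m x))\<^sup>2) \<partial>lborel) \<le> ennreal K"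
    by blast
qed

lemma local_oscillation:
  assumes c: "c \<in> ball 0 1" and e: "\<epsilon> > 0"
  shows "\<exists>\<rho>>0. \<exists>y. AE x in lborel. sq_norm (x - c) < \<rho> \<longrightarrow> \<bar>u x - y\<bar> \<le> \<epsilon>"
proof -
  define s where "s = (norm c + 1) / 2"
  have s: "0 \<le> s" "norm c < s" "s < 1" using c by (auto simp: s_def)
  \<comment> \<open>Passing from \<open>sq_norm\<close> to \<open>norm\<close> costs a factor 2,
    hence the half.\<close>
  define R where "R = (s - norm c) / 2"
  have R: "R > 0" using s by (simp add: R_def)
  have sub: "{x. sq_norm (x - c) \<le> R} \<subseteq> cball 0 s"
  proof
    fix x assume "x \<in> {x. sq_norm (x - c) \<le> R}"
    then have "norm (x - c) \<le> s - norm c" using norm_le_sq_norm[of "x - c"] by (simp add: R_def)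
    then show "x \<in> cball 0 s" using norm_triangle_sub[of x c] by simp
  qed
  obtain K m0 where K: "K > 0" "\<And>m. m \<ge> m0 \<Longrightarrow> (\<integral>\<^sup>+x\<in>cball 0 s. ennreal ((norm (g m x))\<^sup>2) \<partial>lborel) \<le> ennreal K"
    using gradient_bound[OF s(1,3)] by blast
  \<comment> \<open>Solves \<open>16 * sqrt (K / ln (R / \<rho>)) = \<epsilon>\<close>; 256 is the
    square of 16.\<close>
  define \<rho> where "\<rho> = R * exp (- (256 * K / \<epsilon>\<^sup>2))"
  have \<rho>: "0 < \<rho>" "\<rho> < R" using R K e by (auto simp: \<rho>_def)
  have "R / \<rho> = exp (256 * K / \<epsilon>\<^sup>2)" using R by (simp add: \<rho>_def exp_minus field_simps)
  then have "ln (R / \<rho>) = 256 * K / \<epsilon>\<^sup>2" by simp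
  then have "K / ln (R / \<rho>) = (\<epsilon> / 16)\<^sup>2" using K e by (simp add: power_divide)
  then have q: "16 * sqrt (K / ln (R / \<rho>)) = \<epsilon>" using e by simp
  have sh: "(\<lambda>m. \<delta> (m + m0)) \<longlonglongrightarrow> 0" "(\<lambda>m. \<integral>\<^sup>+x\<in>cball 0 s. ennreal \<bar>v (m + m0) x - u x\<bar> \<partial>lborel) \<longlonglongrightarrow> 0"
    using LIMSEQ_ignore_initial_segment[OF \<delta>_lim] LIMSEQ_ignore_initial_segment[OF L1_lim[OF s(1,3)]] by auto
  have E: "(\<integral>\<^sup>+x\<in>{x. sq_norm (x - c) \<le> R}. ennreal ((norm (g (m + m0) x))\<^sup>2) \<partial>lborel) \<le> ennreal K" for m
  proof -
    have "(\<integral>\<^sup>+x\<in>{x. sq_norm (x - c) \<le> R}. ennreal ((norm (g (m + m0) x))\<^sup>2) \<partial>lborel) \<le> (\<integral>\<^sup>+x\<in>cball 0 s. ennreal ((norm (g (m + m0) x))\<^sup>2) \<partial>lborel)"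
      using sub by (intro nn_integral_mono mult_left_mono) (auto split: split_indicator)
    also have "\<dots> \<le> ennreal K" by (rule K(2)) simp
    finally show ?thesis .
  qed
  obtain y where "AE x in lborel. sq_norm (x - c) < \<rho> \<longrightarrow> \<bar>u x - y\<bar> \<le> 16 * sqrt (K / ln (R / \<rho>))"
    by (rule oscillation_limit[of "\<lambda>m. \<delta> (m + m0)" "\<lambda>m. v (m + m0)" "\<lambda>m. g (m + m0)" "\<lambda>m. \<beta> (m + m0)" "\<lambda>m. r (m + m0)",
          OF ap \<delta>0 sh(1) vM um sh(2) s(3) sub \<rho> K(1) E])
  then show ?thesis using \<rho>(1) unfolding q by blast
qed

text \<open>The factor \<open>17\<close> bounds \<open>1 / (s\<^sup>2 - t\<^sup>2)\<^sup>2\<close> for \<open>s = 9/10\<close> and \<open>t = 3/4\<close>; the square of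
  half-width \<open>1/2\<close> lies in the disc of radius \<open>t\<close>.\<close>

lemma oscillation_at_origin:
  assumes N: "N > 0" and \<rho>: "0 < \<rho>" "\<rho> < 1/2"
  shows "\<exists>y. AE x in lborel. sq_norm (x - 0) < \<rho> \<longrightarrow>
     \<bar>u x - y\<bar> \<le> 16 * sqrt (energy_const * N\<^sup>2 * (1 + (\<integral>x. norm (b x) \<partial>lborel)) / ln ((1/2) / \<rho>))"
proof -
  define Bn where "Bn = (\<integral>x. norm (b x) \<partial>lborel)"
  define V where "V = measure lborel (cball (0::real^2) 1)"
  have BV: "Bn \<ge> 0" "V \<ge> 0" by (auto simp: Bn_def V_def)
  define K where "K = energy_const * N\<^sup>2 * (1 + Bn)"
  have K0: "K > 0" unfolding K_def using energy_const_pos N BV by (intro mult_pos_pos) auto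
  have s: "(0::real) \<le> 9/10" "9/10 < (1::real)" by auto
  have N2: "N\<^sup>2 > 0" using N by simp
  \<comment> \<open>The tolerance is taken as \<open>N\<^sup>2\<close> so that it merges with the
    main term; positivity of \<open>N\<close> enters here.\<close>
  obtain \<sigma> :: "nat \<Rightarrow> nat" where \<sigma>: "strict_mono \<sigma>"
    "\<And>i. (\<integral>x. indicator (cball 0 (9/10)) x * ((v (\<sigma> i) x)\<^sup>2 * (1 + norm (\<beta> (\<sigma> i) x))) \<partial>lborel) \<le> N\<^sup>2 * (V + Bn) + N\<^sup>2"
    using energy_integral_limit[of v \<beta> M u N "9/10" b "N\<^sup>2", OF has_grad_continuous[OF vg] approx_solution_borel(5)[OF ap] vM um uN
        L1_lim[OF s] s(2) bi \<beta>b N2] unfolding V_def Bn_def by blast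
  \<comment> \<open>\<open>1/10\<close> keeps the cutoff radius \<open>9/10\<close> inside the
    region where the equation holds, and \<open>N\<^sup>2 / 6\<close> makes the remainder term at
    most \<open>N\<^sup>2\<close>.\<close>
  have "\<forall>\<^sub>F m in sequentially. \<delta> m < min (1/10) (N\<^sup>2 / 6)"
    by (rule order_tendstoD(2)[OF \<delta>_lim]) (use N2 in simp)
  then obtain n0 where n0: "\<And>m. m \<ge> n0 \<Longrightarrow> \<delta> m < min (1/10) (N\<^sup>2 / 6)" by (auto simp: eventually_sequentially)
  define \<sigma>' where "\<sigma>' i = \<sigma> (i + n0)" for i
  have \<sigma>': "strict_mono \<sigma>'" using \<sigma>(1) by (simp add: strict_mono_def \<sigma>'_def)
  have \<sigma>n: "n0 \<le> \<sigma>' i" for i using seq_suble[OF \<sigma>(1), of "i + n0"] by (simp add: \<sigma>'_def)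
  have sub: "{x::real^2. sq_norm (x - 0) \<le> 1/2} \<subseteq> cball 0 (3/4)"
  proof
    fix x :: "real^2" assume "x \<in> {x. sq_norm (x - 0) \<le> 1/2}"
    then have "sq_norm x \<le> 1/2" by simp
    moreover have "0 \<le> sq_norm x" by (simp add: sq_norm_def)
    ultimately have "(sq_norm x)\<^sup>2 \<le> (1/2)\<^sup>2" by (intro power_mono) auto
    then have "(norm x)\<^sup>2 \<le> (3/4)\<^sup>2" using norm_sq_le_sq_norm[of x] by (simp add: power2_eq_square)
    then have "norm x \<le> 3/4" by (rule power2_le_imp_le) simp
    then show "x \<in> cball 0 (3/4)" by simp
  qed
  have E: "(\<integral>\<^sup>+x\<in>{x. sq_norm (x - 0) \<le> 1/2}. ennreal ((norm (g (\<sigma>' i) x))\<^sup>2) \<partial>lborel) \<le> ennreal K" for i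
  proof -
    have d: "\<delta> (\<sigma>' i) < 1/10" "6 * \<delta> (\<sigma>' i) < N\<^sup>2" using n0[OF \<sigma>n[of i]] by auto
    define I where "I = (\<integral>x. indicator (cball 0 (9/10)) x * ((v (\<sigma>' i) x)\<^sup>2 * (1 + norm (\<beta> (\<sigma>' i) x))) \<partial>lborel)"
    have "I \<le> N\<^sup>2 * (V + Bn) + N\<^sup>2" unfolding I_def \<sigma>'_def by (rule \<sigma>(2))
    moreover have "(\<integral>x. (cutoff (9/10) x)\<^sup>2 * (norm (g (\<sigma>' i) x))\<^sup>2 \<partial>lborel) \<le> 36 * I + 6 * \<delta> (\<sigma>' i)"
      unfolding I_def by (rule energy_estimate[OF ap]) (use d \<delta>0[of "\<sigma>' i"] in auto)
    ultimately have "(\<integral>x. (cutoff (9/10) x)\<^sup>2 * (norm (g (\<sigma>' i) x))\<^sup>2 \<partial>lborel) \<le> 36 * (N\<^sup>2 * (V + Bn) + N\<^sup>2) + N\<^sup>2"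
    proof -
      assume I: "I \<le> N\<^sup>2 * (V + Bn) + N\<^sup>2"
        and le: "(\<integral>x. (cutoff (9/10) x)\<^sup>2 * (norm (g (\<sigma>' i) x))\<^sup>2 \<partial>lborel) \<le> 36 * I + 6 * \<delta> (\<sigma>' i)"
      have "36 * I + 6 * \<delta> (\<sigma>' i) \<le> 36 * (N\<^sup>2 * (V + Bn) + N\<^sup>2) + N\<^sup>2"
        by (intro add_mono mult_left_mono I less_imp_le[OF d(2)]) simp
      with le show ?thesis by (rule order_trans)
    qed
    also have "\<dots> \<le> 37 * (N\<^sup>2 * ((V + 1) * (1 + Bn)))"
    proof -
      have "V + Bn + 1 \<le> (V + 1) * (1 + Bn)" using BV by (simp add: algebra_simps)
      then have P: "N\<^sup>2 * (V + Bn + 1) \<le> N\<^sup>2 * ((V + 1) * (1 + Bn))" by (intro mult_left_mono) auto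
      have "N\<^sup>2 \<le> N\<^sup>2 * (V + Bn + 1)" using BV by (simp add: mult_le_cancel_left1)
      then have P': "N\<^sup>2 \<le> N\<^sup>2 * ((V + 1) * (1 + Bn))" using P by (rule order_trans)
      have "36 * (N\<^sup>2 * (V + Bn + 1)) + N\<^sup>2 \<le> 36 * (N\<^sup>2 * ((V + 1) * (1 + Bn))) + N\<^sup>2 * ((V + 1) * (1 + Bn))"
        by (rule add_mono[OF mult_left_mono[OF P] P']) simp
      also have "\<dots> = 37 * (N\<^sup>2 * ((V + 1) * (1 + Bn)))" by simp
      finally show ?thesis by (simp add: distrib_left)
    qed
    finally have "(\<integral>\<^sup>+x\<in>{x. sq_norm (x - 0) \<le> 1/2}. ennreal ((norm (g (\<sigma>' i) x))\<^sup>2) \<partial>lborel) \<le>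
        ennreal (37 * (N\<^sup>2 * ((V + 1) * (1 + Bn))) / ((9/10)\<^sup>2 - (3/4)\<^sup>2)\<^sup>2)"
      by (intro gradient_bound_from_cutoff[OF has_grad_continuous_grad[OF vg] _ _ sub]) auto
    also have "\<dots> \<le> ennreal K"
    proof (rule ennreal_leI)
      have "0 \<le> 37 * (N\<^sup>2 * ((V + 1) * (1 + Bn)))" using BV by (intro mult_nonneg_nonneg) auto
      then have "37 * (N\<^sup>2 * ((V + 1) * (1 + Bn))) / ((9/10)\<^sup>2 - (3/4)\<^sup>2)\<^sup>2 \<le> 17 * (37 * (N\<^sup>2 * ((V + 1) * (1 + Bn))))"
        by (simp add: power2_eq_square field_simps)
      also have "\<dots> = K" by (simp add: K_def energy_const_def V_def)
      finally show "37 * (N\<^sup>2 * ((V + 1) * (1 + Bn))) / ((9/10)\<^sup>2 - (3/4)\<^sup>2)\<^sup>2 \<le> K" .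
    qed
    finally show ?thesis .
  qed
  have sh: "(\<lambda>m. \<delta> (\<sigma>' m)) \<longlonglongrightarrow> 0" "(\<lambda>m. \<integral>\<^sup>+x\<in>cball 0 (3/4). ennreal \<bar>v (\<sigma>' m) x - u x\<bar> \<partial>lborel) \<longlonglongrightarrow> 0"
    using LIMSEQ_subseq_LIMSEQ[OF \<delta>_lim \<sigma>'] LIMSEQ_subseq_LIMSEQ[OF L1_lim[of "3/4"] \<sigma>'] by (auto simp: comp_def)
  have s34: "(3/4::real) < 1" by simp
  obtain y where "AE x in lborel. sq_norm (x - 0) < \<rho> \<longrightarrow> \<bar>u x - y\<bar> \<le> 16 * sqrt (K / ln ((1/2) / \<rho>))"
    by (rule oscillation_limit[of "\<lambda>m. \<delta> (\<sigma>' m)" "\<lambda>m. v (\<sigma>' m)" "\<lambda>m. g (\<sigma>' m)" "\<lambda>m. \<beta> (\<sigma>' m)" "\<lambda>m. r (\<sigma>' m)",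
          OF ap \<delta>0 sh(1) vM um sh(2) s34 sub \<rho> K0 E])
  then show ?thesis unfolding K_def Bn_def by blast
qed

lemma continuous_representative_modulus:
  obtains w where "continuous_on (ball 0 1) w" "AE x in lborel. x \<in> ball 0 1 \<longrightarrow> w x = u x"
    "\<And>\<rho> x. 0 < \<rho> \<Longrightarrow> \<rho> < 1 \<Longrightarrow> norm x < \<rho> \<Longrightarrow>
       \<bar>w x - w 0\<bar> \<le> modulus_const * sqrt (1 + (\<integral>x. norm (b x) \<partial>lborel)) / sqrt (- ln \<rho>) * N"
proof -
  obtain w where w: "continuous_on (ball 0 1) w" "AE x in lborel. x \<in> ball 0 1 \<longrightarrow> w x = u x" "\<And>x. \<bar>w x\<bar> \<le> N"
    "\<And>c \<rho> y \<epsilon> x. AE x in lborel. sq_norm (x - c) < \<rho> \<longrightarrow> \<bar>u x - y\<bar> \<le> \<epsilon> \<Longrightarrow> sq_norm (x - c) < \<rho> \<Longrightarrow> \<bar>w x - y\<bar> \<le> \<epsilon>"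
    using continuous_representative_exists[of u N, OF uN local_oscillation] by blast
  define B where "B = 1 + (\<integral>x. norm (b x) \<partial>lborel)"
  have B1: "B \<ge> 1" by (simp add: B_def)
  have ec: "energy_const > 0" by (rule energy_const_pos)
  have "\<bar>w x - w 0\<bar> \<le> modulus_const * sqrt B / sqrt (- ln \<rho>) * N" if \<rho>: "0 < \<rho>" "\<rho> < 1" and x: "norm x < \<rho>" for \<rho> x
  \<comment> \<open>The estimate at the origin needs a positive \<open>N\<close>; for
    \<open>N = 0\<close> the representative is zero.\<close>
  proof (cases "N = 0")
    case True then show ?thesis using w(3)[of x] w(3)[of 0] by simp
  next
    case False
    then have N: "N > 0" using N_nonneg by simp
    have l: "- ln \<rho> > 0" using \<rho> by simp
    show ?thesis
    \<comment> \<open>Below 1/4 one has \<open>ln ((1/2) / \<rho>) \<ge> - ln \<rho> / 2\<close>, so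
      the outer half-width 1/2 can be replaced by 1 at the cost of a factor 2 under the
      root.\<close>
    proof (cases "\<rho> < 1/4")
      case True
      define q where "q = 16 * sqrt (energy_const * N\<^sup>2 * B / ln ((1/2) / \<rho>))"
      obtain y where y: "AE x in lborel. sq_norm (x - 0) < \<rho> \<longrightarrow> \<bar>u x - y\<bar> \<le> q"
        using oscillation_at_origin[OF N \<rho>(1)] True unfolding q_def B_def by auto
      have "sq_norm (x - 0) < \<rho>" using x sq_norm_le_norm[of x] by simp
      moreover have "sq_norm (0 - 0) < \<rho>" using \<rho> by (simp add: sq_norm_def)
      ultimately have "\<bar>w x - y\<bar> \<le> q" "\<bar>w 0 - y\<bar> \<le> q" using w(4)[OF y] by blast+
      then have "\<bar>w x - w 0\<bar> \<le> 2 * q" by linarith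
      also have "2 * q \<le> 2 * (16 * sqrt (energy_const * N\<^sup>2 * B / (- ln \<rho> / 2)))"
      proof -
        have "2 * ln (1/4) \<ge> 2 * ln \<rho>" using True \<rho> by simp
        moreover have "ln (1/4) = - 2 * ln (2::real)"
        proof -
          have "ln (4::real) = ln (2 ^ 2)" by simp
          also have "\<dots> = 2 * ln 2" by (subst ln_realpow) auto
          finally show ?thesis by (simp add: ln_div)
        qed
        moreover have "ln ((1/2) / \<rho>) = - ln 2 - ln \<rho>" using \<rho> by (simp add: ln_div ln_mult)
        ultimately have ll: "- ln \<rho> / 2 \<le> ln ((1/2) / \<rho>)" by linarith
        show ?thesis unfolding q_def
          using ll l ec B1 by (intro mult_left_mono real_sqrt_le_mono divide_left_mono mult_pos_pos) auto
      qed
      also have "\<dots> = 32 * sqrt (2 * energy_const) * sqrt B / sqrt (- ln \<rho>) * N"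
      proof -
        have "energy_const * N\<^sup>2 * B / (- ln \<rho> / 2) = (2 * energy_const) * B / (- ln \<rho>) * N\<^sup>2" by simp
        then have "sqrt (energy_const * N\<^sup>2 * B / (- ln \<rho> / 2)) = sqrt (2 * energy_const) * sqrt B / sqrt (- ln \<rho>) * N"
          using N by (simp only: real_sqrt_mult real_sqrt_divide real_sqrt_abs abs_of_pos)
        then show ?thesis by simp
      qed
      also have "\<dots> \<le> modulus_const * sqrt B / sqrt (- ln \<rho>) * N"
        unfolding modulus_const_def using B1 l N by (intro mult_right_mono divide_right_mono) auto
      finally show ?thesis .
    next
      case False
      \<comment> \<open>Here \<open>- ln \<rho> \<le> ln 4 \<le> 2 \<le> (3/2)\<^sup>2\<close>, so
        the constant 3 over the root of \<open>- ln \<rho>\<close> is at least 2.\<close>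
      have "\<bar>w x - w 0\<bar> \<le> 2 * N" using w(3)[of x] w(3)[of 0] by linarith
      also have "\<dots> \<le> 3 * sqrt B / sqrt (- ln \<rho>) * N"
      proof -
        have "ln (1/4) \<le> ln \<rho>" using False \<rho> by simp
        moreover have "ln (1/4) = - ln (4::real)" by (simp add: ln_div)
        moreover have "ln (4::real) \<le> 2"
        proof -
          have "ln (4::real) = ln (2 ^ 2)" by simp
          also have "\<dots> = 2 * ln 2" by (subst ln_realpow) auto
          also have "\<dots> \<le> 2" using ln_2_less_1 by simp
          finally show ?thesis .
        qed
        ultimately have "- ln \<rho> \<le> (3/2)\<^sup>2" by (simp add: power2_eq_square)
        then have "sqrt (- ln \<rho>) \<le> 3/2" by (rule real_le_lsqrt[rotated]) simp
        then have "2 * sqrt (- ln \<rho>) \<le> 3 * sqrt B" using B1 real_sqrt_ge_one[of B] by linarith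
        then have "2 \<le> 3 * sqrt B / sqrt (- ln \<rho>)" using l by (simp add: pos_le_divide_eq)
        then show ?thesis using N by (intro mult_right_mono) auto
      qed
      also have "\<dots> \<le> modulus_const * sqrt B / sqrt (- ln \<rho>) * N"
        unfolding modulus_const_def using B1 l N ec by (intro mult_right_mono divide_right_mono) auto
      finally show ?thesis .
    qed
  qed
  then show thesis using that[OF w(1,2)] unfolding B_def by blast
qed

text \<open>The weak limit of the gradients on \<open>D\<close>. Against a test field
  \<open>\<phi> x *\<^sub>R i\<close> the integrals converge, because integration by parts moves the
  derivative onto \<open>\<phi>\<close>, where weak convergence of \<open>v m\<close> applies; the
  resulting identity characterizes the weak gradient of \<open>u\<close>.\<close>

lemma weak_gradient:
  assumes D: "open D" "compact (closure D)" "closure D \<subseteq> ball 0 1"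
  obtains H :: "real^2 \<Rightarrow> real^2" where "H \<in> L2_space D"
    "\<And>\<phi> i. \<phi> \<in> test_functions D \<Longrightarrow> i \<in> Basis \<Longrightarrow>
       (\<integral>x. u x * partial_deriv i \<phi> x \<partial>lborel) = - (LINT x|lebesgue_on D. (H x \<bullet> i) * \<phi> x)"
proof -
  \<comment> \<open>The norm attains its maximum on the compact closure, so \<open>D\<close> lies in
    a ball of radius below 1, on which the energies are uniformly bounded. The empty set is treated
    apart.\<close>
  obtain t where t: "0 \<le> t" "t < 1" "D \<subseteq> cball 0 t"
  proof (cases "D = {}")
    case True then show thesis using that[of 0] by simp
  next
    case False
    then have "closure D \<noteq> {}" by simp
    then obtain x where x: "x \<in> closure D" "\<And>y. y \<in> closure D \<Longrightarrow> norm y \<le> norm x"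
      using continuous_attains_sup[OF D(2), of norm] continuous_on_norm_id by blast
    show thesis using that[of "norm x"] x D(3) closure_subset[of D] by (auto simp: subset_iff)
  qed
  have DL: "D \<inter> space lebesgue \<in> sets lebesgue" "D \<in> sets borel" using D(1) by auto
  obtain K m0 where K: "K > 0" "\<And>m. m \<ge> m0 \<Longrightarrow> (\<integral>\<^sup>+x\<in>cball 0 t. ennreal ((norm (g m x))\<^sup>2) \<partial>lborel) \<le> ennreal K"
    using gradient_bound[OF t(1,2)] by blast
  have gm[measurable]: "g m \<in> borel_measurable borel" for m by (rule approx_solution_borel(2)[OF ap])
  have restr: "f \<in> borel_measurable (lebesgue_on D)" if "f \<in> borel_measurable borel" for f :: "real^2 \<Rightarrow> 'z::topological_space"
    using that by (intro measurable_restrict_space1 measurable_completion) simp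
  have fin: "finite_measure (lebesgue_on D)"
  proof
    have "emeasure lborel D \<le> emeasure lborel (cball (0::real^2) t)" by (rule emeasure_mono[OF t(3)]) simp
    then show "emeasure (lebesgue_on D) (space (lebesgue_on D)) \<noteq> \<infinity>"
      using emeasure_lborel_cball_finite[of "0::real^2" t] DL
      by (simp add: emeasure_restrict_space space_restrict_space emeasure_completion top_unique less_top)
  qed
  have GK: "(\<integral>\<^sup>+x. ennreal ((norm (g (n + m0) x))\<^sup>2) \<partial>lebesgue_on D) \<le> ennreal K" for n
  proof -
    have "(\<integral>\<^sup>+x. ennreal ((norm (g (n + m0) x))\<^sup>2) \<partial>lebesgue_on D) = (\<integral>\<^sup>+x\<in>D. ennreal ((norm (g (n + m0) x))\<^sup>2) \<partial>lborel)"
      by (subst nn_integral_restrict_space[OF DL(1)]) (rule nn_integral_completion)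
    also have "\<dots> \<le> (\<integral>\<^sup>+x\<in>cball 0 t. ennreal ((norm (g (n + m0) x))\<^sup>2) \<partial>lborel)"
      using t(3) by (intro nn_integral_mono mult_left_mono) (auto split: split_indicator)
    also have "\<dots> \<le> ennreal K" by (rule K(2)) simp
    finally show ?thesis .
  qed
  obtain H where H: "H \<in> borel_measurable (lebesgue_on D)" "(\<integral>\<^sup>+x. ennreal ((norm (H x))\<^sup>2) \<partial>lebesgue_on D) \<le> ennreal K"
    "\<And>\<phi> C l. \<phi> \<in> borel_measurable (lebesgue_on D) \<Longrightarrow> (\<And>x. norm (\<phi> x) \<le> C) \<Longrightarrow>
       (\<lambda>n. \<integral>x. g (n + m0) x \<bullet> \<phi> x \<partial>lebesgue_on D) \<longlonglongrightarrow> l \<Longrightarrow> (\<integral>x. H x \<bullet> \<phi> x \<partial>lebesgue_on D) = l"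
    by (rule L2_bounded_weak_limit[of "lebesgue_on D" "\<lambda>n. g (n + m0)" K, OF fin restr[OF gm] less_imp_le[OF K(1)] GK]) blast
  have "integrable (lebesgue_on D) (\<lambda>x. (norm (H x))\<^sup>2)"
    by (rule integrableI_bounded) (use H(1,2) in \<open>auto simp: less_top[symmetric] top_unique\<close>)
  then have HL: "H \<in> L2_space D" using H(1) by (simp add: L2_space_def)
  show thesis
  proof (rule that[OF HL])
    fix \<phi> :: "real^2 \<Rightarrow> real" and i :: "real^2" assume \<phi>: "\<phi> \<in> test_functions D" and i: "i \<in> Basis"
    have \<phi>g: "has_grad \<phi> (grad \<phi>)" using \<phi> by (intro has_grad_C_k[of 0]) (auto simp: test_functions_def)
    have \<phi>D: "\<phi> x = 0" if "x \<notin> D" for x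
      using \<phi> that closure_subset[of "{x. \<phi> x \<noteq> 0}"] by (auto simp: test_functions_def)
    have \<phi>t: "\<phi> x = 0" if "t < norm x" for x
    proof (rule \<phi>D)
      show "x \<notin> D" using t(3) that by auto
    qed
    have \<phi>c: "continuous_on UNIV \<phi>" by (rule has_grad_continuous[OF \<phi>g])
    have gt: "grad \<phi> x = 0" if "t < norm x" for x by (rule has_grad_zero_outside[OF \<phi>g \<phi>t that])
    obtain B where B: "B \<ge> 0" "\<And>x. norm (\<phi> x) \<le> B" using bounded_continuous_bounded_support[OF \<phi>c \<phi>t] by blast
    obtain B' where B': "B' \<ge> 0" "\<And>x. norm (grad \<phi> x) \<le> B'"
      using bounded_continuous_bounded_support[OF has_grad_continuous_grad[OF \<phi>g] gt] by blast
    have gb[measurable]: "grad \<phi> \<in> borel_measurable borel" "\<phi> \<in> borel_measurable borel" using has_grad_borel[OF \<phi>g] by auto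
    have step: "(\<integral>x. g m x \<bullet> (\<phi> x *\<^sub>R i) \<partial>lebesgue_on D) = - (\<integral>x. indicator (ball 0 1) x * (v m x * (grad \<phi> x \<bullet> i)) \<partial>lborel)" for m
    proof -
      have "(\<integral>x. g m x \<bullet> (\<phi> x *\<^sub>R i) \<partial>lebesgue_on D) = (\<integral>x. indicator D x *\<^sub>R (g m x \<bullet> (\<phi> x *\<^sub>R i)) \<partial>lebesgue)"
        by (rule integral_restrict_space[OF DL(1)])
      also have "\<dots> = (\<integral>x. indicator D x *\<^sub>R (g m x \<bullet> (\<phi> x *\<^sub>R i)) \<partial>lborel)"
        by (rule integral_completion) (use DL(2) in measurable)
      also have "\<dots> = (\<integral>x. (g m x \<bullet> i) * \<phi> x \<partial>lborel)"
        by (rule Bochner_Integration.integral_cong) (use \<phi>D in \<open>auto split: split_indicator\<close>)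
      also have "\<dots> = - (\<integral>x. v m x * (grad \<phi> x \<bullet> i) \<partial>lborel)"
        by (rule grad_integral_by_parts[OF vg \<phi>g]) (rule \<phi>t)
      also have "(\<integral>x. v m x * (grad \<phi> x \<bullet> i) \<partial>lborel) = (\<integral>x. indicator (ball 0 1) x * (v m x * (grad \<phi> x \<bullet> i)) \<partial>lborel)"
        by (rule Bochner_Integration.integral_cong) (use gt t(2) in \<open>auto split: split_indicator\<close>)
      finally show ?thesis .
    qed
    have gi: "\<bar>grad \<phi> x \<bullet> i\<bar> \<le> B'" for x
      using Basis_le_norm[OF i, of "grad \<phi> x"] B'(2)[of x] by linarith
    have "(\<lambda>m. \<integral>x. indicator (ball 0 1) x * (v m x * (grad \<phi> x \<bullet> i)) \<partial>lborel) \<longlonglongrightarrow> (\<integral>x. u x * (grad \<phi> x \<bullet> i) \<partial>lborel)"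
      by (rule weak[OF _ gi]) measurable
    then have "(\<lambda>n. - (\<integral>x. indicator (ball 0 1) x * (v (n + m0) x * (grad \<phi> x \<bullet> i)) \<partial>lborel)) \<longlonglongrightarrow> - (\<integral>x. u x * (grad \<phi> x \<bullet> i) \<partial>lborel)"
      by (intro tendsto_minus) (rule LIMSEQ_ignore_initial_segment)
    then have "(\<integral>x. H x \<bullet> (\<phi> x *\<^sub>R i) \<partial>lebesgue_on D) = - (\<integral>x. u x * (grad \<phi> x \<bullet> i) \<partial>lborel)"
      unfolding step[symmetric]
    proof (rule H(3)[rotated 2])
      show "(\<lambda>x. \<phi> x *\<^sub>R i) \<in> borel_measurable (lebesgue_on D)" by (rule restr) measurable
      show "norm (\<phi> x *\<^sub>R i) \<le> B" for x using B(2)[of x] i by simp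
    qed
    then show "(\<integral>x. u x * partial_deriv i \<phi> x \<partial>lborel) = - (LINT x|lebesgue_on D. (H x \<bullet> i) * \<phi> x)"
      by (simp add: partial_deriv_has_grad[OF \<phi>g] mult.commute)
  qed
qed

end

subsection \<open>Borel representatives and the theorem\<close>

text \<open>A function measurable for the completed measure agrees a.e. with a Borel one, component
  by component. Extension by zero turns integrals over \<open>S\<close> into integrals over the
  whole space, where translation and Tonelli are at hand.\<close>

lemma borel_representative:
  fixes f :: "'a::euclidean_space \<Rightarrow> 'b::euclidean_space"
  assumes f: "f \<in> borel_measurable (lebesgue_on S)" and S: "S \<in> sets borel"
  shows "\<exists>f'\<in>borel_measurable borel. (\<forall>x. x \<notin> S \<longrightarrow> f' x = 0) \<and> (AE x in lebesgue_on S. f x = f' x)"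
proof -
  have SL: "S \<inter> space lebesgue \<in> sets lebesgue" using S by simp
  have fm: "(\<lambda>x. indicator S x *\<^sub>R f x) \<in> borel_measurable lebesgue"
    using f borel_measurable_restrict_space_iff[OF SL] by blast
  have "\<exists>h\<in>borel_measurable lborel. AE x in lborel. (indicator S x *\<^sub>R f x) \<bullet> i = h x" for i
    by (rule completion_ex_borel_measurable_real) (use fm in measurable)
  then obtain h where h: "\<And>i. h i \<in> borel_measurable lborel" "\<And>i. AE x in lborel. (indicator S x *\<^sub>R f x) \<bullet> i = h i x"
    by metis
  have hm[measurable]: "h i \<in> borel_measurable borel" for i using h(1)[of i] by simp
  define f' where "f' x = indicator S x *\<^sub>R (\<Sum>i\<in>Basis. h i x *\<^sub>R i)" for x
  have "f' \<in> borel_measurable borel" unfolding f'_def using S by measurable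
  moreover have "\<forall>x. x \<notin> S \<longrightarrow> f' x = 0" by (simp add: f'_def)
  moreover have "AE x in lebesgue_on S. f x = f' x"
  proof -
    have "AE x in lborel. \<forall>i\<in>Basis. (indicator S x *\<^sub>R f x) \<bullet> i = h i x"
      using h(2) by (subst AE_finite_all) auto
    then have "AE x in lborel. x \<in> S \<longrightarrow> f x = f' x"
    proof eventually_elim
      fix x assume a: "\<forall>i\<in>Basis. (indicator S x *\<^sub>R f x) \<bullet> i = h i x"
      show "x \<in> S \<longrightarrow> f x = f' x"
      proof
        assume "x \<in> S"
        then have "f' x = (\<Sum>i\<in>Basis. (f x \<bullet> i) *\<^sub>R i)" unfolding f'_def using a by simp
        then show "f x = f' x" by (simp add: euclidean_representation)
      qed
    qed
    then show ?thesis by (simp add: AE_restrict_space_iff[OF SL] AE_completion_iff)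
  qed
  ultimately show ?thesis by blast
qed

text \<open>Dictionary between the integrals of the given functions and the \<open>lborel\<close>
  integrals of their representatives: restriction and completion disappear because \<open>h\<close>
  is Borel and vanishes outside \<open>S\<close>.\<close>

lemma integral_lebesgue_on_borel:
  fixes h k :: "'a::euclidean_space \<Rightarrow> 'b::euclidean_space"
  assumes S: "S \<in> sets borel" and h: "h \<in> borel_measurable borel" "\<And>x. x \<notin> S \<Longrightarrow> h x = 0"
    and k: "k \<in> borel_measurable (lebesgue_on S)" "AE x in lebesgue_on S. k x = h x"
  shows "(LINT x|lebesgue_on S. k x) = (\<integral>x. h x \<partial>lborel)"
    and "integrable (lebesgue_on S) k \<longleftrightarrow> integrable lborel h"
proof -
  have SL: "S \<inter> space lebesgue \<in> sets lebesgue" using S by simp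
  have hL: "h \<in> borel_measurable (lebesgue_on S)"
    using h(1) by (intro measurable_restrict_space1 measurable_completion) simp
  have e: "(\<lambda>x. indicator S x *\<^sub>R h x) = h" using h(2) by (auto split: split_indicator)
  have "(LINT x|lebesgue_on S. k x) = (LINT x|lebesgue_on S. h x)" by (rule integral_cong_AE[OF k(1) hL k(2)])
  also have "\<dots> = (\<integral>x. h x \<partial>lebesgue)" by (subst integral_restrict_space[OF SL]) (simp add: e)
  also have "\<dots> = (\<integral>x. h x \<partial>lborel)" by (rule integral_completion) (use h(1) in simp)
  finally show "(LINT x|lebesgue_on S. k x) = (\<integral>x. h x \<partial>lborel)" .
  have "integrable (lebesgue_on S) k \<longleftrightarrow> integrable (lebesgue_on S) h" by (rule integrable_cong_AE[OF k(1) hL k(2)])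
  also have "\<dots> \<longleftrightarrow> integrable lebesgue h" by (subst integrable_restrict_space[OF SL]) (simp add: e)
  also have "\<dots> \<longleftrightarrow> integrable lborel h" by (rule integrable_completion) (use h(1) in simp)
  finally show "integrable (lebesgue_on S) k \<longleftrightarrow> integrable lborel h" .
qed

lemma Linf_space_AE_bound:
  assumes "u \<in> Linf_space S"
  shows "AE x in lebesgue_on S. \<bar>u x\<bar> \<le> Linf_norm S u"
proof -
  define e where "e = esssup (lebesgue_on S) (\<lambda>x. ereal \<bar>u x\<bar>)"
  have "e < \<infinity>" using assms by (simp add: Linf_space_def e_def)
  have "AE x in lebesgue_on S. ereal \<bar>u x\<bar> \<le> e" unfolding e_def by (rule esssup_AE)
  then show ?thesis
  proof eventually_elim
    fix x assume "ereal \<bar>u x\<bar> \<le> e"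
    then show "\<bar>u x\<bar> \<le> Linf_norm S u"
      using \<open>e < \<infinity>\<close> unfolding Linf_norm_def e_def[symmetric] by (cases e) auto
  qed
qed

text \<open>A nonempty open set is not null, so the a.e. bound on the absolute value holds at some
  point.\<close>

lemma Linf_norm_nonneg:
  fixes u :: "'a::euclidean_space \<Rightarrow> real"
  assumes "u \<in> Linf_space S" "open S" "S \<noteq> {}"
  shows "0 \<le> Linf_norm S u"
proof -
  have "S \<inter> space lebesgue \<in> sets lebesgue" using assms(2) by simp
  then have "AE x in lborel. x \<in> S \<longrightarrow> \<bar>u x\<bar> \<le> Linf_norm S u"
    using Linf_space_AE_bound[OF assms(1)] by (simp add: AE_restrict_space_iff AE_completion_iff)
  from AE_open_witness[OF this assms(2,3)] show ?thesis by (metis abs_ge_zero order_trans)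
qed

text \<open>Clamping to the interval from \<open>- M\<close> to \<open>M\<close> changes nothing
  a.e. and turns the a.e. bound into one at every point, as the convolution estimates
  require.\<close>

lemma bounded_borel_representative:
  fixes u :: "'a::euclidean_space \<Rightarrow> real"
  assumes u: "u \<in> Linf_space S" and S: "S \<in> sets borel" and M: "Linf_norm S u \<le> M" "0 \<le> M"
  shows "\<exists>u'\<in>borel_measurable borel. (\<forall>x. x \<notin> S \<longrightarrow> u' x = 0) \<and> (\<forall>x. \<bar>u' x\<bar> \<le> M) \<and> (AE x in lebesgue_on S. u x = u' x)"
proof -
  have "u \<in> borel_measurable (lebesgue_on S)" using u by (simp add: Linf_space_def)
  then obtain u' where u': "u' \<in> borel_measurable borel" "\<forall>x. x \<notin> S \<longrightarrow> u' x = 0" "AE x in lebesgue_on S. u x = u' x"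
    using borel_representative[OF _ S] by blast
  have [measurable]: "u' \<in> borel_measurable borel" by (rule u'(1))
  have "(\<lambda>x. max (- M) (min M (u' x))) \<in> borel_measurable borel" by measurable
  moreover have "\<forall>x. x \<notin> S \<longrightarrow> max (- M) (min M (u' x)) = 0" using u'(2) M(2) by simp
  moreover have "\<forall>x. \<bar>max (- M) (min M (u' x))\<bar> \<le> M" using M(2) by (auto simp: max_def min_def)
  moreover have "AE x in lebesgue_on S. u x = max (- M) (min M (u' x))"
    using u'(3) Linf_space_AE_bound[OF u] by eventually_elim (use M in auto)
  ultimately show ?thesis by (intro bexI[of _ "\<lambda>x. max (- M) (min M (u' x))"] conjI)
qed

lemma test_function_facts:
  fixes w :: "'a::euclidean_space \<Rightarrow> real"
  assumes w: "w \<in> test_functions S" and S: "bounded S"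
  shows "has_grad w (grad w)" "continuous_on UNIV (laplacian w)"
    "x \<notin> S \<Longrightarrow> w x = 0" "x \<notin> S \<Longrightarrow> grad w x = 0" "x \<notin> S \<Longrightarrow> laplacian w x = 0"
    "\<exists>C\<ge>0. \<forall>x. norm (grad w x) \<le> C \<and> \<bar>laplacian w x\<bar> \<le> C"
proof -
  have Ck: "C_k k w" for k using w by (simp add: test_functions_def)
  show wg: "has_grad w (grad w)" by (rule has_grad_C_k[of 0]) (rule Ck)
  have pg: "has_grad (partial_deriv i w) (grad (partial_deriv i w))" if "i \<in> Basis" for i
    by (rule has_grad_C_k[of 0]) (use Ck[of "Suc (Suc 0)"] that in simp)
  have l_eq: "laplacian w x = (\<Sum>i\<in>Basis. grad (partial_deriv i w) x \<bullet> i)" for x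
    unfolding laplacian_def by (intro sum.cong refl partial_deriv_has_grad pg)
  show lc: "continuous_on UNIV (laplacian w)"
    unfolding l_eq[abs_def] by (intro continuous_intros has_grad_continuous_grad[OF pg])
  \<comment> \<open>Derivatives vanish on open sets of zeros, and this open set contains every point
    outside \<open>S\<close>, boundary points of \<open>S\<close> included.\<close>
  define U where "U = - closure {x. w x \<noteq> 0}"
  have U: "open U" unfolding U_def by (intro open_Compl closed_closure)
  have SU: "x \<in> U" if "x \<notin> S" for x using w that by (auto simp: U_def test_functions_def)
  have w0: "w x = 0" if "x \<in> U" for x using that closure_subset[of "{x. w x \<noteq> 0}"] by (auto simp: U_def)
  have g0: "grad w x = 0" if "x \<in> U" for x by (rule has_grad_eq_zero[OF wg U w0 that])
  have p0: "partial_deriv i w x = 0" if "x \<in> U" for i x using g0[OF that] partial_deriv_has_grad[OF wg] by simp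
  have l0: "laplacian w x = 0" if "x \<in> U" for x
    unfolding l_eq using has_grad_eq_zero[OF pg U p0 that] by simp
  show "x \<notin> S \<Longrightarrow> w x = 0" "x \<notin> S \<Longrightarrow> grad w x = 0" "x \<notin> S \<Longrightarrow> laplacian w x = 0"
    using w0 g0 l0 SU by auto
  obtain R where R: "\<And>x. x \<in> S \<Longrightarrow> norm x \<le> R" using S bounded_iff by blast
  have out: "x \<in> U" if "R < norm x" for x using R[of x] SU[of x] that by fastforce
  obtain B where B: "B \<ge> 0" "\<And>x. norm (grad w x) \<le> B"
    using bounded_continuous_bounded_support[OF has_grad_continuous_grad[OF wg], of R] g0 out by blast
  obtain B' where B': "B' \<ge> 0" "\<And>x. norm (laplacian w x) \<le> B'"
    using bounded_continuous_bounded_support[OF lc, of R] l0 out by blast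
  show "\<exists>C\<ge>0. \<forall>x. norm (grad w x) \<le> C \<and> \<bar>laplacian w x\<bar> \<le> C"
    using B B' by (intro exI[of _ "max B B'"]) (auto simp: le_max_iff_disj)
qed

lemma lebesgue_on_borelI:
  fixes f :: "'a::euclidean_space \<Rightarrow> 'b::topological_space"
  assumes "f \<in> borel_measurable borel"
  shows "f \<in> borel_measurable (lebesgue_on S)"
proof (rule measurable_restrict_space1, rule measurable_completion)
  show "f \<in> borel_measurable lborel" using assms by simp
qed

lemma modulus_const_pos: "modulus_const > 0"
  using energy_const_pos by (simp add: modulus_const_def add_nonneg_pos)

text \<open>The equation passes to the limit by pairing weak-star convergence of the solutions with
  strong \<open>L1\<close> convergence of the drifts; both regularity claims come from the locale.
  The constant is a closed term, so its independence of the data is evident.\<close>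

lemma limit_of_solutions:
  fixes bs :: "nat \<Rightarrow> real^2 \<Rightarrow> real^2" and us :: "nat \<Rightarrow> real^2 \<Rightarrow> real"
    and b :: "real^2 \<Rightarrow> real^2" and u :: "real^2 \<Rightarrow> real"
  assumes b2: "\<And>m. bs m \<in> L2_space (ball 0 1)" and uinf: "\<And>m. us m \<in> Linf_space (ball 0 1)"
    and div: "\<And>m. divergence_free (ball 0 1) (bs m)"
    and sol: "\<And>m. distributional_solution (ball 0 1) (bs m) (us m)"
    and bd: "\<And>m. Linf_norm (ball 0 1) (us m) \<le> M0"
    and bconv: "L1_converges (ball 0 1) bs b"
    and uconv: "Linf_weak_star_converges (ball 0 1) us u"
  shows "distributional_solution (ball 0 1) b u" (is ?sol)
    and "u \<in> H1_loc (ball 0 1)" (is ?H1)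
    and "\<exists>w. continuous_representative (ball 0 1) u w \<and>
        (\<forall>r::real. 0 < r \<and> r < 1 \<longrightarrow>
          (SUP x\<in>ball 0 r. \<bar>w x - w 0\<bar>) \<le>
            modulus_const * sqrt (1 + L1_norm (ball 0 1) b) / sqrt (- ln r) * Linf_norm (ball 0 1) u)" (is ?mod)
proof -

  \<comment> \<open>Borel representatives of the data\<close>
  define S :: "(real^2) set" where "S = ball 0 1"
  have S: "S \<in> sets borel" "open S" "S \<noteq> {}" "bounded S" by (auto simp: S_def)
  have SL: "S \<inter> space lebesgue \<in> sets lebesgue" using S(1) by simp
  have Sf: "emeasure lborel S < \<infinity>" unfolding S_def by (rule emeasure_lborel_ball_finite)
  have outS: "x \<notin> S" if "1 < norm x" for x using that by (simp add: S_def)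
  have ui: "u \<in> Linf_space S" using uconv by (simp add: Linf_weak_star_converges_def S_def)
  define N where "N = Linf_norm S u"
  have N0: "0 \<le> N" unfolding N_def by (rule Linf_norm_nonneg[OF ui S(2,3)])
  \<comment> \<open>The maximum also dominates the bound of the limit, as \<open>NM\<close>
    demands.\<close>
  define M where "M = max M0 N"
  have M: "0 \<le> M" "N \<le> M" "Linf_norm S (us m) \<le> M" for m using N0 bd[of m] by (auto simp: M_def S_def)
  have usL: "us m \<in> Linf_space S" for m using uinf by (simp add: S_def)
  have bsL2: "bs m \<in> L2_space S" for m using b2 by (simp add: S_def)
  have bL1: "b \<in> L1_space S" using bconv by (simp add: L1_converges_def S_def)
  have usm: "us m \<in> borel_measurable (lebesgue_on S)" for m using usL[of m] by (simp add: Linf_space_def)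
  have umL: "u \<in> borel_measurable (lebesgue_on S)" using ui by (simp add: Linf_space_def)
  have bsm: "bs m \<in> borel_measurable (lebesgue_on S)" for m using bsL2[of m] by (simp add: L2_space_def)
  have bm: "b \<in> borel_measurable (lebesgue_on S)" using bL1 by (auto simp: L1_space_def)
  have "\<exists>u'\<in>borel_measurable borel. (\<forall>x. x \<notin> S \<longrightarrow> u' x = 0) \<and> (\<forall>x. \<bar>u' x\<bar> \<le> M) \<and> (AE x in lebesgue_on S. us m x = u' x)" for m
    by (rule bounded_borel_representative[OF usL S(1) M(3,1)])
  then obtain us' where us': "\<And>m. us' m \<in> borel_measurable borel" "\<And>m x. x \<notin> S \<Longrightarrow> us' m x = 0"
      "\<And>m x. \<bar>us' m x\<bar> \<le> M" "\<And>m. AE x in lebesgue_on S. us m x = us' m x"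
    by metis
  obtain u' where u': "u' \<in> borel_measurable borel" "\<And>x. x \<notin> S \<Longrightarrow> u' x = 0"
      "\<And>x. \<bar>u' x\<bar> \<le> N" "AE x in lebesgue_on S. u x = u' x"
    using bounded_borel_representative[OF ui S(1) _ N0] unfolding N_def by auto
  have "\<exists>f'\<in>borel_measurable borel. (\<forall>x. x \<notin> S \<longrightarrow> f' x = 0) \<and> (AE x in lebesgue_on S. bs m x = f' x)" for m
    by (rule borel_representative[OF bsm S(1)])
  then obtain bs' where bs': "\<And>m. bs' m \<in> borel_measurable borel" "\<And>m x. x \<notin> S \<Longrightarrow> bs' m x = 0"
      "\<And>m. AE x in lebesgue_on S. bs m x = bs' m x"
    by metis
  obtain b' where b': "b' \<in> borel_measurable borel" "\<And>x. x \<notin> S \<Longrightarrow> b' x = 0" "AE x in lebesgue_on S. b x = b' x"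
    using borel_representative[OF bm S(1)] by auto
  note [measurable] = us'(1) u'(1) bs'(1) b'(1) usm umL bsm bm
  have bs2: "(\<integral>\<^sup>+x. ennreal ((norm (bs' m x))\<^sup>2) \<partial>lborel) < \<infinity>" for m
  proof -
    have "AE x in lebesgue_on S. (norm (bs m x))\<^sup>2 = (norm (bs' m x))\<^sup>2" using bs'(3)[of m] by eventually_elim simp
    then have "integrable lborel (\<lambda>x. (norm (bs' m x))\<^sup>2)"
      using integral_lebesgue_on_borel(2)[OF S(1), of "\<lambda>x. (norm (bs' m x))\<^sup>2" "\<lambda>x. (norm (bs m x))\<^sup>2"] bsL2[of m] bs'(2)
      by (simp add: L2_space_def)
    then show ?thesis by (simp add: integrable_iff_bounded)
  qed
  have bi: "integrable lborel b'"
    using integral_lebesgue_on_borel(2)[OF S(1) b'(1,2) bm b'(3)] bL1 by (simp add: L1_space_def)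
  have bsi: "integrable lborel (bs' m)" for m
    by (rule L2_imp_integrable_bounded_support[OF bs'(1) _ bs2, of 1]) (use bs'(2) outS in auto)
  have bnorm: "L1_norm S b = (\<integral>x. norm (b' x) \<partial>lborel)"
  proof -
    have "AE x in lebesgue_on S. norm (b x) = norm (b' x)" using b'(3) by eventually_elim simp
    then show ?thesis unfolding L1_norm_def by (intro integral_lebesgue_on_borel(1)[OF S(1)]) (use b'(2) in auto)
  qed
  have bsb: "(\<lambda>m. \<integral>x. norm (bs' m x - b' x) \<partial>lborel) \<longlonglongrightarrow> 0"
  proof -
    have "L1_norm S (\<lambda>x. bs m x - b x) = (\<integral>x. norm (bs' m x - b' x) \<partial>lborel)" for m
    proof -
      have "AE x in lebesgue_on S. norm (bs m x - b x) = norm (bs' m x - b' x)" using b'(3) bs'(3)[of m] by eventually_elim simp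
      then show ?thesis unfolding L1_norm_def
        by (intro integral_lebesgue_on_borel(1)[OF S(1)]) (use b'(2) bs'(2) in auto)
    qed
    then show ?thesis using bconv by (simp add: L1_converges_def S_def)
  qed

  \<comment> \<open>Weak formulations and weak-star convergence for the representatives\<close>
  have testdiv: "(\<integral>x. bs' m x \<bullet> grad w x \<partial>lborel) = 0" if w: "w \<in> test_functions S" for m w
  proof -
    note wf = test_function_facts[OF w S(4)]
    have gm[measurable]: "grad w \<in> borel_measurable borel" using has_grad_borel[OF wf(1)] by simp
    have gL[measurable]: "grad w \<in> borel_measurable (lebesgue_on S)" by (rule lebesgue_on_borelI[OF gm])
    have "AE x in lebesgue_on S. bs m x \<bullet> grad w x = bs' m x \<bullet> grad w x" using bs'(3)[of m] by eventually_elim simp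
    then have "(LINT x|lebesgue_on S. bs m x \<bullet> grad w x) = (\<integral>x. bs' m x \<bullet> grad w x \<partial>lborel)"
      by (intro integral_lebesgue_on_borel(1)[OF S(1)]) (use bs'(2) in auto)
    then show ?thesis using div[of m] w by (simp add: divergence_free_def S_def)
  qed
  have testeq: "(\<integral>x. us' m x * laplacian w x + us' m x * (bs' m x \<bullet> grad w x) \<partial>lborel) = 0" if w: "w \<in> test_functions S" for m w
  proof -
    note wf = test_function_facts[OF w S(4)]
    have gm[measurable]: "grad w \<in> borel_measurable borel" using has_grad_borel[OF wf(1)] by simp
    have lm[measurable]: "laplacian w \<in> borel_measurable borel" by (rule borel_measurable_continuous_onI[OF wf(2)])
    have [measurable]: "grad w \<in> borel_measurable (lebesgue_on S)" "laplacian w \<in> borel_measurable (lebesgue_on S)"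
      by (rule lebesgue_on_borelI[OF gm], rule lebesgue_on_borelI[OF lm])
    have "AE x in lebesgue_on S. us m x * laplacian w x + us m x * (bs m x \<bullet> grad w x) = us' m x * laplacian w x + us' m x * (bs' m x \<bullet> grad w x)"
      using bs'(3)[of m] us'(4)[of m] by eventually_elim simp
    then have "(LINT x|lebesgue_on S. us m x * laplacian w x + us m x * (bs m x \<bullet> grad w x)) =
       (\<integral>x. us' m x * laplacian w x + us' m x * (bs' m x \<bullet> grad w x) \<partial>lborel)"
      by (intro integral_lebesgue_on_borel(1)[OF S(1)]) (use us'(2) in auto)
    then show ?thesis using sol[of m] w by (simp add: distributional_solution_def S_def)
  qed
  have weak_star: "(\<lambda>m. \<integral>x. us' m x * \<phi> x \<partial>lborel) \<longlonglongrightarrow> (\<integral>x. u' x * \<phi> x \<partial>lborel)"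
    if \<phi>[measurable]: "\<phi> \<in> borel_measurable borel" and \<phi>i: "integrable (lebesgue_on S) \<phi>" for \<phi>
  proof -
    have \<phi>L[measurable]: "\<phi> \<in> borel_measurable (lebesgue_on S)" by (rule lebesgue_on_borelI[OF \<phi>])
    have 1: "(LINT x|lebesgue_on S. us m x * \<phi> x) = (\<integral>x. us' m x * \<phi> x \<partial>lborel)" for m
    proof -
      have "AE x in lebesgue_on S. us m x * \<phi> x = us' m x * \<phi> x" using us'(4)[of m] by eventually_elim simp
      then show ?thesis by (intro integral_lebesgue_on_borel(1)[OF S(1)]) (use us'(2) in auto)
    qed
    have 2: "(LINT x|lebesgue_on S. u x * \<phi> x) = (\<integral>x. u' x * \<phi> x \<partial>lborel)"
    proof -
      have "AE x in lebesgue_on S. u x * \<phi> x = u' x * \<phi> x" using u'(4) by eventually_elim simp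
      then show ?thesis by (intro integral_lebesgue_on_borel(1)[OF S(1)]) (use u'(2) in auto)
    qed
    show ?thesis
      using uconv \<phi>i unfolding Linf_weak_star_converges_def S_def[symmetric] L1_space_def 1[symmetric] 2[symmetric] by blast
  qed

  \<comment> \<open>The diagonal sequence of approximate solutions\<close>
  define \<delta> where "\<delta> m = 1 / real (Suc m)" for m
  have \<delta>: "\<delta> m > 0" "\<delta> \<longlonglongrightarrow> 0" for m
    unfolding \<delta>_def using LIMSEQ_inverse_real_of_nat by (simp_all add: inverse_eq_divide)
  define P where "P m v g \<beta> r \<longleftrightarrow> approx_solution (\<delta> m) v g \<beta> r \<and> (\<forall>x. \<bar>v x\<bar> \<le> M) \<and>
      (\<integral>\<^sup>+x\<in>ball 0 1. ennreal ((norm (\<beta> x - bs' m x))\<^sup>2) \<partial>lborel) \<le> ennreal (\<delta> m) \<and>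
      (\<integral>\<^sup>+x\<in>ball 0 1. ennreal ((norm (v x - us' m x))\<^sup>2) \<partial>lborel) \<le> ennreal (\<delta> m)" for m v g \<beta> r
  have "\<exists>v g \<beta> r. P m v g \<beta> r" for m
  proof -
    have o1: "us' m x = 0" "bs' m x = 0" if "1 < norm x" for x using us'(2) bs'(2) outS[OF that] by auto
    have td: "(\<integral>x. bs' m x \<bullet> grad w x \<partial>lborel) = 0" if "w \<in> test_functions (ball 0 1)" for w
      by (rule testdiv) (use that in \<open>simp only: S_def\<close>)
    have te: "(\<integral>x. us' m x * laplacian w x + us' m x * (bs' m x \<bullet> grad w x) \<partial>lborel) = 0" if "w \<in> test_functions (ball 0 1)" for w
      by (rule testeq) (use that in \<open>simp only: S_def\<close>)
    obtain v g \<beta> r where "approx_solution (\<delta> m) v g \<beta> r" "\<And>x. \<bar>v x\<bar> \<le> M"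
      "(\<integral>\<^sup>+x\<in>ball 0 1. ennreal ((norm (\<beta> x - bs' m x))\<^sup>2) \<partial>lborel) \<le> ennreal (\<delta> m)"
      "(\<integral>\<^sup>+x\<in>ball 0 1. ennreal ((norm (v x - us' m x))\<^sup>2) \<partial>lborel) \<le> ennreal (\<delta> m)"
      by (rule ex_approx_solution[OF us'(1)[of m] bs'(1)[of m] o1(1) us'(3)[of m] o1(2) bs2[of m] td te \<delta>(1)[of m]]) blast+
    then show ?thesis unfolding P_def by blast
  qed
  \<comment> \<open>The four components are chosen one after the other. The scale is tied to the
    index, so all mollification errors vanish along the sequence.\<close>
  then have "\<forall>m. \<exists>v g \<beta> r. P m v g \<beta> r" ..
  then obtain v where "\<forall>m. \<exists>g \<beta> r. P m (v m) g \<beta> r" by (rule choice[THEN exE])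
  then obtain g where "\<forall>m. \<exists>\<beta> r. P m (v m) (g m) \<beta> r" by (rule choice[THEN exE])
  then obtain \<beta> where "\<forall>m. \<exists>r. P m (v m) (g m) (\<beta> m) r" by (rule choice[THEN exE])
  then obtain r where "\<forall>m. P m (v m) (g m) (\<beta> m) (r m)" by (rule choice[THEN exE])
  then have ap: "\<And>m. approx_solution (\<delta> m) (v m) (g m) (\<beta> m) (r m)" and vM: "\<And>m x. \<bar>v m x\<bar> \<le> M"
    and \<beta>2: "\<And>m. (\<integral>\<^sup>+x\<in>ball 0 1. ennreal ((norm (\<beta> m x - bs' m x))\<^sup>2) \<partial>lborel) \<le> ennreal (\<delta> m)"
    and v2: "\<And>m. (\<integral>\<^sup>+x\<in>ball 0 1. ennreal ((norm (v m x - us' m x))\<^sup>2) \<partial>lborel) \<le> ennreal (\<delta> m)"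
    by (auto simp: P_def)

  \<comment> \<open>Convergence of the approximations\<close>
  have vm[measurable]: "v m \<in> borel_measurable borel" and \<beta>m[measurable]: "\<beta> m \<in> borel_measurable borel" for m
    using approx_solution_borel[OF ap] by auto
  have \<delta>e: "(\<lambda>m. ennreal (\<delta> m)) \<longlonglongrightarrow> 0" using tendsto_ennrealI[OF \<delta>(2)] by simp
  have bb: "ball (0::real^2) 1 \<in> sets borel" by simp
  have Sf': "emeasure lborel (ball (0::real^2) 1) < \<infinity>" by (rule emeasure_lborel_ball_finite)
  have \<beta>1: "(\<lambda>m. \<integral>\<^sup>+x\<in>ball 0 1. ennreal (norm (\<beta> m x - bs' m x)) \<partial>lborel) \<longlonglongrightarrow> 0"
  proof (rule nn_integral_L2_tendsto_L1[OF _ bb Sf'])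
    show "(\<lambda>m. \<integral>\<^sup>+x\<in>ball 0 1. (ennreal (norm (\<beta> m x - bs' m x)))\<^sup>2 \<partial>lborel) \<longlonglongrightarrow> 0"
      by (rule tendsto_sandwich[OF _ _ tendsto_const \<delta>e]) (use \<beta>2 in \<open>auto simp: ennreal_power\<close>)
  qed measurable
  have v1: "(\<lambda>m. \<integral>\<^sup>+x\<in>ball 0 1. ennreal (norm (v m x - us' m x)) \<partial>lborel) \<longlonglongrightarrow> 0"
  proof (rule nn_integral_L2_tendsto_L1[OF _ bb Sf'])
    show "(\<lambda>m. \<integral>\<^sup>+x\<in>ball 0 1. (ennreal (norm (v m x - us' m x)))\<^sup>2 \<partial>lborel) \<longlonglongrightarrow> 0"
      by (rule tendsto_sandwich[OF _ _ tendsto_const \<delta>e]) (use v2 in \<open>auto simp: ennreal_power\<close>)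
  qed measurable
  have \<beta>b: "(\<lambda>m. \<integral>\<^sup>+x\<in>ball 0 1. ennreal (norm (\<beta> m x - b' x)) \<partial>lborel) \<longlonglongrightarrow> 0"
  proof (rule tendsto_sandwich[OF _ _ tendsto_const])
    have "(\<lambda>m. ennreal (\<integral>x. norm (bs' m x - b' x) \<partial>lborel)) \<longlonglongrightarrow> 0" using tendsto_ennrealI[OF bsb] by simp
    from tendsto_add[OF \<beta>1 this]
    show "(\<lambda>m. (\<integral>\<^sup>+x\<in>ball 0 1. ennreal (norm (\<beta> m x - bs' m x)) \<partial>lborel) + ennreal (\<integral>x. norm (bs' m x - b' x) \<partial>lborel)) \<longlonglongrightarrow> 0" by simp
    have "(\<integral>\<^sup>+x\<in>ball 0 1. ennreal (norm (\<beta> m x - b' x)) \<partial>lborel) \<le>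
       (\<integral>\<^sup>+x\<in>ball 0 1. ennreal (norm (\<beta> m x - bs' m x)) \<partial>lborel) + ennreal (\<integral>x. norm (bs' m x - b' x) \<partial>lborel)" for m
    proof -
      have "(\<integral>\<^sup>+x\<in>ball 0 1. ennreal (norm (\<beta> m x - b' x)) \<partial>lborel) \<le>
        (\<integral>\<^sup>+x. ennreal (norm (\<beta> m x - bs' m x)) * indicator (ball 0 1) x + ennreal (norm (bs' m x - b' x)) \<partial>lborel)"
      proof (rule nn_integral_mono)
        fix x
        have "norm (\<beta> m x - b' x) \<le> norm (\<beta> m x - bs' m x) + norm (bs' m x - b' x)"
          using norm_triangle_ineq[of "\<beta> m x - bs' m x" "bs' m x - b' x"] by simp
        from ennreal_leI[OF this]
        show "ennreal (norm (\<beta> m x - b' x)) * indicator (ball 0 1) x \<le> ennreal (norm (\<beta> m x - bs' m x)) * indicator (ball 0 1) x + ennreal (norm (bs' m x - b' x))"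
          by (auto split: split_indicator)
      qed
      also have "\<dots> = (\<integral>\<^sup>+x\<in>ball 0 1. ennreal (norm (\<beta> m x - bs' m x)) \<partial>lborel) + (\<integral>\<^sup>+x. ennreal (norm (bs' m x - b' x)) \<partial>lborel)"
      proof (rule nn_integral_add)
        show "(\<lambda>x. ennreal (norm (\<beta> m x - bs' m x)) * indicator (ball 0 1) x) \<in> borel_measurable lborel"
          by (rule borel_measurable_times_ennreal[OF _ borel_measurable_indicator]) simp_all
      qed measurable
      also have "(\<integral>\<^sup>+x. ennreal (norm (bs' m x - b' x)) \<partial>lborel) = ennreal (\<integral>x. norm (bs' m x - b' x) \<partial>lborel)"
        by (rule nn_integral_eq_integral) (use bi bsi in auto)
      finally show ?thesis .
    qed
    then show "\<forall>\<^sub>F m in sequentially. (\<integral>\<^sup>+x\<in>ball 0 1. ennreal (norm (\<beta> m x - b' x)) \<partial>lborel) \<le>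
       (\<integral>\<^sup>+x\<in>ball 0 1. ennreal (norm (\<beta> m x - bs' m x)) \<partial>lborel) + ennreal (\<integral>x. norm (bs' m x - b' x) \<partial>lborel)" by simp
  qed simp
  have weak: "(\<lambda>m. \<integral>x. indicator (ball 0 1) x * (v m x * \<phi> x) \<partial>lborel) \<longlonglongrightarrow> (\<integral>x. u' x * \<phi> x \<partial>lborel)"
    if \<phi>m[measurable]: "\<phi> \<in> borel_measurable borel" and \<phi>C: "\<And>x. \<bar>\<phi> x\<bar> \<le> C" for \<phi> C
  proof -
    have C0: "0 \<le> C" using \<phi>C[of 0] by linarith
    have Im[measurable]: "(indicator (ball 0 1) :: real^2 \<Rightarrow> real) \<in> borel_measurable borel" by (rule borel_measurable_indicator) simp
    have Ii: "integrable lborel (indicator (ball 0 1) :: real^2 \<Rightarrow> real)" using Sf' by (simp add: integrable_indicator_iff)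
    have bdd: "integrable lborel (\<lambda>x. indicator (ball 0 1) x *\<^sub>R h x)" if "h \<in> borel_measurable borel" "\<And>x. norm (h x) \<le> c" for h :: "real^2 \<Rightarrow> real" and c
      by (rule integrable_bounded_scaleR[OF Ii]) (use that in auto)
    have "integrable lborel (\<lambda>x. indicator (ball 0 1) x *\<^sub>R \<phi> x)" by (rule bdd[of _ C]) (use \<phi>C in auto)
    then have "integrable (lebesgue_on S) \<phi>"
      by (subst integral_lebesgue_on_borel(2)[OF S(1), of "\<lambda>x. indicator (ball 0 1) x *\<^sub>R \<phi> x"])
         (auto simp: S_def intro!: lebesgue_on_borelI AE_I2 split: split_indicator)
    from weak_star[OF \<phi>m this] have ws: "(\<lambda>m. \<integral>x. us' m x * \<phi> x \<partial>lborel) \<longlonglongrightarrow> (\<integral>x. u' x * \<phi> x \<partial>lborel)" .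
    have i1: "integrable lborel (\<lambda>x. indicator (ball 0 1) x *\<^sub>R (v m x * \<phi> x))" for m
      by (rule bdd[of _ "M * C"]) (use vM \<phi>C M(1) in \<open>auto simp: abs_mult intro!: mult_mono\<close>)
    have i2: "integrable lborel (\<lambda>x. indicator (ball 0 1) x *\<^sub>R (us' m x * \<phi> x))" for m
      by (rule bdd[of _ "M * C"]) (use us'(3) \<phi>C M(1) in \<open>auto simp: abs_mult intro!: mult_mono\<close>)
    have i3: "integrable lborel (\<lambda>x. indicator (ball 0 1) x *\<^sub>R \<bar>v m x - us' m x\<bar>)" for m
    proof (rule bdd[of _ "2 * M"])
      show "norm \<bar>v m x - us' m x\<bar> \<le> 2 * M" for x using vM[of m x] us'(3)[of m x] by simp
    qed measurable
    have r1: "(\<lambda>m. \<integral>x. indicator (ball 0 1) x *\<^sub>R \<bar>v m x - us' m x\<bar> \<partial>lborel) \<longlonglongrightarrow> 0"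
    proof -
      have "ennreal (\<integral>x. indicator (ball 0 1) x *\<^sub>R \<bar>v m x - us' m x\<bar> \<partial>lborel) = (\<integral>\<^sup>+x\<in>ball 0 1. ennreal (norm (v m x - us' m x)) \<partial>lborel)" for m
      proof -
        have "ennreal (\<integral>x. indicator (ball 0 1) x *\<^sub>R \<bar>v m x - us' m x\<bar> \<partial>lborel) = (\<integral>\<^sup>+x. ennreal (indicator (ball 0 1) x *\<^sub>R \<bar>v m x - us' m x\<bar>) \<partial>lborel)"
          by (rule nn_integral_eq_integral[OF i3, symmetric]) auto
        also have "\<dots> = (\<integral>\<^sup>+x\<in>ball 0 1. ennreal (norm (v m x - us' m x)) \<partial>lborel)"
          by (intro nn_integral_cong) (auto split: split_indicator)
        finally show ?thesis .
      qed
      then have "(\<lambda>m. ennreal (\<integral>x. indicator (ball 0 1) x *\<^sub>R \<bar>v m x - us' m x\<bar> \<partial>lborel)) \<longlonglongrightarrow> ennreal 0" using v1 by simp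
      then show ?thesis by (rule tendsto_ennrealD) auto
    qed
    \<comment> \<open>The pairings of \<open>v m\<close> and \<open>us' m\<close> with
      \<open>\<phi>\<close> differ by at most \<open>C\<close> times the \<open>L1\<close> distance
      of the two functions, so both have the same limit.\<close>
    have "(\<lambda>m. (\<integral>x. indicator (ball 0 1) x * (v m x * \<phi> x) \<partial>lborel) - (\<integral>x. us' m x * \<phi> x \<partial>lborel)) \<longlonglongrightarrow> 0"
    proof (rule Lim_null_comparison)
      show "\<forall>\<^sub>F m in sequentially. norm ((\<integral>x. indicator (ball 0 1) x * (v m x * \<phi> x) \<partial>lborel) - (\<integral>x. us' m x * \<phi> x \<partial>lborel)) \<le>
         C * (\<integral>x. indicator (ball 0 1) x *\<^sub>R \<bar>v m x - us' m x\<bar> \<partial>lborel)"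
      proof (intro always_eventually allI)
        fix m
        have "(\<integral>x. us' m x * \<phi> x \<partial>lborel) = (\<integral>x. indicator (ball 0 1) x *\<^sub>R (us' m x * \<phi> x) \<partial>lborel)"
        proof (rule Bochner_Integration.integral_cong[OF refl])
          fix x show "us' m x * \<phi> x = indicator (ball 0 1) x *\<^sub>R (us' m x * \<phi> x)"
            using us'(2)[of x m] by (auto simp: S_def split: split_indicator)
        qed
        then have "(\<integral>x. indicator (ball 0 1) x * (v m x * \<phi> x) \<partial>lborel) - (\<integral>x. us' m x * \<phi> x \<partial>lborel) =
           (\<integral>x. indicator (ball 0 1) x *\<^sub>R (v m x * \<phi> x) - indicator (ball 0 1) x *\<^sub>R (us' m x * \<phi> x) \<partial>lborel)"
          using Bochner_Integration.integral_diff[OF i1[of m] i2[of m]] by simp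
        then have "norm ((\<integral>x. indicator (ball 0 1) x * (v m x * \<phi> x) \<partial>lborel) - (\<integral>x. us' m x * \<phi> x \<partial>lborel)) =
           norm (\<integral>x. indicator (ball 0 1) x *\<^sub>R (v m x * \<phi> x) - indicator (ball 0 1) x *\<^sub>R (us' m x * \<phi> x) \<partial>lborel)"
          by (rule arg_cong)
        also have "\<dots> \<le> (\<integral>x. C * (indicator (ball 0 1) x *\<^sub>R \<bar>v m x - us' m x\<bar>) \<partial>lborel)"
        proof (rule Bochner_Integration.integral_norm_bound_integral)
          show "integrable lborel (\<lambda>x. indicator (ball 0 1) x *\<^sub>R (v m x * \<phi> x) - indicator (ball 0 1) x *\<^sub>R (us' m x * \<phi> x))"
            by (rule Bochner_Integration.integrable_diff[OF i1[of m] i2[of m]])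
          show "integrable lborel (\<lambda>x. C * (indicator (ball 0 1) x *\<^sub>R \<bar>v m x - us' m x\<bar>))" by (rule integrable_mult_right) (rule i3)
          fix x
          have "\<bar>(v m x - us' m x) * \<phi> x\<bar> \<le> \<bar>v m x - us' m x\<bar> * C" unfolding abs_mult by (intro mult_left_mono \<phi>C) auto
          then show "norm (indicator (ball 0 1) x *\<^sub>R (v m x * \<phi> x) - indicator (ball 0 1) x *\<^sub>R (us' m x * \<phi> x)) \<le> C * (indicator (ball 0 1) x *\<^sub>R \<bar>v m x - us' m x\<bar>)"
            by (auto simp: left_diff_distrib[symmetric] mult.commute[of C] split: split_indicator simp del: abs_mult)
        qed
        finally show "norm ((\<integral>x. indicator (ball 0 1) x * (v m x * \<phi> x) \<partial>lborel) - (\<integral>x. us' m x * \<phi> x \<partial>lborel)) \<le>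
           C * (\<integral>x. indicator (ball 0 1) x *\<^sub>R \<bar>v m x - us' m x\<bar> \<partial>lborel)" by simp
      qed
      show "(\<lambda>m. C * (\<integral>x. indicator (ball 0 1) x *\<^sub>R \<bar>v m x - us' m x\<bar> \<partial>lborel)) \<longlonglongrightarrow> 0"
        using tendsto_mult[OF tendsto_const[of C] r1] by simp
    qed
    from tendsto_add[OF this ws] show ?thesis by simp
  qed
  have u0': "u' x = 0" if "1 < norm x" for x by (rule u'(2)[OF outS[OF that]])
  interpret approximation v g \<beta> r \<delta> u' b' M N
    by unfold_locales (fact ap \<delta>(1) \<delta>(2) vM bi \<beta>b u'(1) u0' u'(3) M(2) weak)+

  \<comment> \<open>The limit equation\<close>
  show ?sol
    unfolding distributional_solution_def S_def[symmetric]
  proof (intro conjI ballI)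
    show "b \<in> L1_space S" by (rule bL1)
    show "u \<in> Linf_space S" by (rule ui)
    fix w assume w: "w \<in> test_functions S"
    note wf = test_function_facts[OF w S(4)]
    have gm[measurable]: "grad w \<in> borel_measurable borel" using has_grad_borel[OF wf(1)] by simp
    have lm[measurable]: "laplacian w \<in> borel_measurable borel" by (rule borel_measurable_continuous_onI[OF wf(2)])
    have [measurable]: "grad w \<in> borel_measurable (lebesgue_on S)" "laplacian w \<in> borel_measurable (lebesgue_on S)"
      by (rule lebesgue_on_borelI[OF gm], rule lebesgue_on_borelI[OF lm])
    obtain C where C: "C \<ge> 0" "\<And>x. norm (grad w x) \<le> C" "\<And>x. \<bar>laplacian w x\<bar> \<le> C" using wf(6) by blast
    have ig: "integrable lborel (\<lambda>x. f x \<bullet> grad w x)" if "integrable lborel f" for f :: "real^2 \<Rightarrow> real^2"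
    proof (rule Bochner_Integration.integrable_bound)
      show "integrable lborel (\<lambda>x. C * norm (f x))" using that by simp
      show "(\<lambda>x. f x \<bullet> grad w x) \<in> borel_measurable lborel" using that by measurable
      show "AE x in lborel. norm (f x \<bullet> grad w x) \<le> norm (C * norm (f x))"
      proof (rule AE_I2)
        fix x
        have "\<bar>f x \<bullet> grad w x\<bar> \<le> norm (f x) * norm (grad w x)" by (rule Cauchy_Schwarz_ineq2)
        also have "\<dots> \<le> norm (f x) * C" by (intro mult_left_mono C) auto
        finally show "norm (f x \<bullet> grad w x) \<le> norm (C * norm (f x))" using C(1) by (simp add: mult.commute)
      qed
    qed
    have il: "integrable lborel (laplacian w)"
      by (rule integrable_continuous_bounded_support[OF wf(2), of 1]) (use wf(5) outS in auto)
    \<comment> \<open>The limit drift is made part of the test function, which is thereby fixed and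
      integrable, so that weak-star convergence applies to it.\<close>
    define \<phi> where "\<phi> x = laplacian w x + b' x \<bullet> grad w x" for x
    have \<phi>m[measurable]: "\<phi> \<in> borel_measurable borel" unfolding \<phi>_def by measurable
    have \<phi>i: "integrable lborel \<phi>" unfolding \<phi>_def by (intro Bochner_Integration.integrable_add il ig bi)
    have \<phi>0: "\<phi> x = 0" if "x \<notin> S" for x using wf(4,5)[OF that] by (simp add: \<phi>_def)
    have "integrable (lebesgue_on S) \<phi>"
      by (rule integral_lebesgue_on_borel(2)[OF S(1) \<phi>m \<phi>0 lebesgue_on_borelI[OF \<phi>m] AE_I2[OF refl], THEN iffD2, OF _ \<phi>i])
    then have ws: "(\<lambda>m. \<integral>x. us' m x * \<phi> x \<partial>lborel) \<longlonglongrightarrow> (\<integral>x. u' x * \<phi> x \<partial>lborel)" by (rule weak_star[OF \<phi>m])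
    \<comment> \<open>Subtracting the equation for \<open>us' m\<close> leaves its product with
      \<open>(bs' m x - b' x) \<bullet> grad w x\<close>, at most \<open>M * C\<close> times the
      \<open>L1\<close> distance of the drifts.\<close>
    have "(\<lambda>m. \<integral>x. us' m x * \<phi> x \<partial>lborel) \<longlonglongrightarrow> 0"
    proof (rule Lim_null_comparison)
      show "\<forall>\<^sub>F m in sequentially. norm (\<integral>x. us' m x * \<phi> x \<partial>lborel) \<le> M * C * (\<integral>x. norm (bs' m x - b' x) \<partial>lborel)"
      proof (intro always_eventually allI)
        fix m
        have um1: "integrable lborel (\<lambda>x. us' m x * f x)" if "integrable lborel f" for f :: "real^2 \<Rightarrow> real"
        proof -
          have "integrable lborel (\<lambda>x. us' m x *\<^sub>R f x)"
            by (rule integrable_scaleR_bounded[OF that _ us'(3)]) measurable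
          then show ?thesis by simp
        qed
        have i1: "integrable lborel (\<lambda>x. us' m x * \<phi> x)" by (rule um1[OF \<phi>i])
        have i2: "integrable lborel (\<lambda>x. us' m x * laplacian w x + us' m x * (bs' m x \<bullet> grad w x))"
          by (intro Bochner_Integration.integrable_add um1 il ig bsi)
        have "(\<integral>x. us' m x * \<phi> x \<partial>lborel) = (\<integral>x. us' m x * \<phi> x \<partial>lborel) - (\<integral>x. us' m x * laplacian w x + us' m x * (bs' m x \<bullet> grad w x) \<partial>lborel)"
          using testeq[OF w] by simp
        also have "\<dots> = (\<integral>x. us' m x * \<phi> x - (us' m x * laplacian w x + us' m x * (bs' m x \<bullet> grad w x)) \<partial>lborel)"
          by (rule Bochner_Integration.integral_diff[OF i1 i2, symmetric])
        finally have "norm (\<integral>x. us' m x * \<phi> x \<partial>lborel) = norm (\<integral>x. us' m x * \<phi> x - (us' m x * laplacian w x + us' m x * (bs' m x \<bullet> grad w x)) \<partial>lborel)"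
          by (rule arg_cong)
        also have "\<dots> \<le> (\<integral>x. M * C * norm (bs' m x - b' x) \<partial>lborel)"
        proof (rule Bochner_Integration.integral_norm_bound_integral)
          show "integrable lborel (\<lambda>x. us' m x * \<phi> x - (us' m x * laplacian w x + us' m x * (bs' m x \<bullet> grad w x)))"
            by (rule Bochner_Integration.integrable_diff[OF i1 i2])
          show "integrable lborel (\<lambda>x. M * C * norm (bs' m x - b' x))" using bi bsi by simp
          fix x
          have e: "us' m x * \<phi> x - (us' m x * laplacian w x + us' m x * (bs' m x \<bullet> grad w x)) = - (us' m x * ((bs' m x - b' x) \<bullet> grad w x))"
            by (simp add: \<phi>_def inner_diff_left algebra_simps)
          have "\<bar>(bs' m x - b' x) \<bullet> grad w x\<bar> \<le> norm (bs' m x - b' x) * norm (grad w x)" by (rule Cauchy_Schwarz_ineq2)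
          also have "\<dots> \<le> norm (bs' m x - b' x) * C" by (intro mult_left_mono C) auto
          finally have "\<bar>us' m x\<bar> * \<bar>(bs' m x - b' x) \<bullet> grad w x\<bar> \<le> M * (norm (bs' m x - b' x) * C)"
            by (intro mult_mono us'(3)) (use M(1) in auto)
          then show "norm (us' m x * \<phi> x - (us' m x * laplacian w x + us' m x * (bs' m x \<bullet> grad w x))) \<le> M * C * norm (bs' m x - b' x)"
            unfolding e by (simp add: abs_mult ac_simps)
        qed
        finally show "norm (\<integral>x. us' m x * \<phi> x \<partial>lborel) \<le> M * C * (\<integral>x. norm (bs' m x - b' x) \<partial>lborel)" by simp
      qed
      show "(\<lambda>m. M * C * (\<integral>x. norm (bs' m x - b' x) \<partial>lborel)) \<longlonglongrightarrow> 0"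
        using tendsto_mult[OF tendsto_const[of "M * C"] bsb] by simp
    qed
    with ws have z: "(\<integral>x. u' x * \<phi> x \<partial>lborel) = 0" using LIMSEQ_unique by blast
    have "AE x in lebesgue_on S. u x * laplacian w x + u x * (b x \<bullet> grad w x) = u' x * \<phi> x"
      using u'(4) b'(3) by eventually_elim (simp add: \<phi>_def distrib_left)
    then have "(LINT x|lebesgue_on S. u x * laplacian w x + u x * (b x \<bullet> grad w x)) = (\<integral>x. u' x * \<phi> x \<partial>lborel)"
      by (intro integral_lebesgue_on_borel(1)[OF S(1)]) (use u'(2) in auto)
    then show "(LINT x|lebesgue_on S. u x * laplacian w x + u x * (b x \<bullet> grad w x)) = 0" using z by simp
  qed

  \<comment> \<open>Local Sobolev regularity\<close>
  show ?H1
    unfolding H1_loc_def mem_Collect_eq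
  proof (intro allI impI)
    fix D :: "(real^2) set" assume D: "open D \<and> compact (closure D) \<and> closure D \<subseteq> ball 0 1"
    have DS: "D \<subseteq> S" using D closure_subset[of D] by (auto simp: S_def)
    have Db: "D \<in> sets borel" using D by simp
    have DL: "D \<inter> space lebesgue \<in> sets lebesgue" using Db by simp
    have Dbd: "bounded D" using D compact_imp_bounded bounded_subset closure_subset by blast
    have uD[measurable]: "u \<in> borel_measurable (lebesgue_on D)" using umL DS by (rule measurable_restrict_mono)
    have aeD: "AE x in lebesgue_on D. u x = u' x"
      using u'(4) unfolding AE_restrict_space_iff[OF DL] AE_restrict_space_iff[OF SL]
      by (rule eventually_mono) (use DS in blast)
    have ID[measurable]: "(indicator D :: real^2 \<Rightarrow> real) \<in> borel_measurable borel" by (rule borel_measurable_indicator[OF Db])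
    have uL2: "u \<in> L2_space D"
    proof -
      have "(\<integral>\<^sup>+x. ennreal ((norm (u' x))\<^sup>2) \<partial>lborel) < \<infinity>"
        by (rule bounded_imp_L2_bounded_support[of 1, OF _ u'(3)]) (use u'(2) outS in auto)
      then have "integrable lborel (\<lambda>x. (norm (u' x))\<^sup>2)" by (simp add: integrable_iff_bounded)
      then have "integrable lborel (\<lambda>x. indicator D x *\<^sub>R (norm (u' x))\<^sup>2)"
        by (rule integrable_scaleR_bounded[of _ _ _ 1]) (auto split: split_indicator)
      moreover have "AE x in lebesgue_on D. (norm (u x))\<^sup>2 = indicator D x *\<^sub>R (norm (u' x))\<^sup>2"
        using aeD unfolding AE_restrict_space_iff[OF DL] by (rule eventually_mono) simp
      ultimately have "integrable (lebesgue_on D) (\<lambda>x. (norm (u x))\<^sup>2)"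
        by (subst integral_lebesgue_on_borel(2)[OF Db, of "\<lambda>x. indicator D x *\<^sub>R (norm (u' x))\<^sup>2"]) auto
      then show ?thesis by (simp add: L2_space_def)
    qed
    obtain H :: "real^2 \<Rightarrow> real^2" where H: "H \<in> L2_space D"
      "\<And>\<phi> i. \<phi> \<in> test_functions D \<Longrightarrow> i \<in> Basis \<Longrightarrow>
         (\<integral>x. u' x * partial_deriv i \<phi> x \<partial>lborel) = - (LINT x|lebesgue_on D. (H x \<bullet> i) * \<phi> x)"
      using weak_gradient[of D] D by blast
    have uu:  "(LINT x|lebesgue_on D. u x * partial_deriv i \<phi> x) = (\<integral>x. u' x * partial_deriv i \<phi> x \<partial>lborel)"
      if \<phi>: "\<phi> \<in> test_functions D" for \<phi> i
    proof -
      note pf = test_function_facts[OF \<phi> Dbd]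
      have pe: "partial_deriv i \<phi> = (\<lambda>x. grad \<phi> x \<bullet> i)" by (simp add: fun_eq_iff partial_deriv_has_grad[OF pf(1)])
      have pz: "partial_deriv i \<phi> x = 0" if "x \<notin> D" for x using pf(4)[OF that] by (simp add: pe)
      have [measurable]: "grad \<phi> \<in> borel_measurable borel" using has_grad_borel[OF pf(1)] by simp
      then have pm[measurable]: "partial_deriv i \<phi> \<in> borel_measurable borel" unfolding pe by measurable
      have [measurable]: "partial_deriv i \<phi> \<in> borel_measurable (lebesgue_on D)" by (rule lebesgue_on_borelI[OF pm])
      have "AE x in lebesgue_on D. u x * partial_deriv i \<phi> x = u' x * partial_deriv i \<phi> x" using aeD by eventually_elim simp
      then show ?thesis
        by (intro integral_lebesgue_on_borel(1)[OF Db]) (use pz in auto)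
    qed
    have "\<forall>\<phi>\<in>test_functions D. \<forall>i\<in>Basis. (LINT x|lebesgue_on D. u x * partial_deriv i \<phi> x) = - (LINT x|lebesgue_on D. (H x \<bullet> i) * \<phi> x)"
      by (simp add: uu H(2))
    then show "u \<in> H1_space D" unfolding H1_space_def using uL2 H(1) by blast
  qed

  \<comment> \<open>Continuous representative and modulus of continuity at the origin\<close>
  obtain w where w: "continuous_on (ball 0 1) w" "AE x in lborel. x \<in> ball 0 1 \<longrightarrow> w x = u' x"
    "\<And>\<rho> x. 0 < \<rho> \<Longrightarrow> \<rho> < 1 \<Longrightarrow> norm x < \<rho> \<Longrightarrow>
       \<bar>w x - w 0\<bar> \<le> modulus_const * sqrt (1 + (\<integral>x. norm (b' x) \<partial>lborel)) / sqrt (- ln \<rho>) * N"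
    using continuous_representative_modulus by blast
  show ?mod
  proof (intro exI[of _ w] conjI allI impI)
    have "AE x in lebesgue_on S. w x = u' x"
      using w(2) unfolding AE_restrict_space_iff[OF SL] AE_completion_iff by (simp add: S_def)
    then have "AE x in lebesgue_on S. w x = u x" using u'(4) by eventually_elim simp
    then show "continuous_representative (ball 0 1) u w" using w(1)
      unfolding continuous_representative_def S_def[symmetric] by blast
    fix \<rho> :: real assume \<rho>: "0 < \<rho> \<and> \<rho> < 1"
    show "(SUP x\<in>ball 0 \<rho>. \<bar>w x - w 0\<bar>) \<le> modulus_const * sqrt (1 + L1_norm (ball 0 1) b) / sqrt (- ln \<rho>) * Linf_norm (ball 0 1) u"
    proof (rule cSUP_least)
      show "ball (0::real^2) \<rho> \<noteq> {}" using \<rho> by simp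
      show "\<bar>w x - w 0\<bar> \<le> modulus_const * sqrt (1 + L1_norm (ball 0 1) b) / sqrt (- ln \<rho>) * Linf_norm (ball 0 1) u" if "x \<in> ball 0 \<rho>" for x
        unfolding S_def[symmetric] bnorm N_def[symmetric] by (rule w(3)) (use \<rho> that in auto)
    qed
  qed
qed

theorem theorem1p4:
  shows "\<exists>C::real. C > 0 \<and>
    (\<forall>(bs :: nat \<Rightarrow> real^2 \<Rightarrow> real^2) (us :: nat \<Rightarrow> real^2 \<Rightarrow> real)
       (b :: real^2 \<Rightarrow> real^2) (u :: real^2 \<Rightarrow> real).
      (\<forall>m. bs m \<in> L2_space (ball 0 1) \<and> us m \<in> Linf_space (ball 0 1)) \<and>
      (\<forall>m. divergence_free (ball 0 1) (bs m)) \<and>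
      (\<forall>m. distributional_solution (ball 0 1) (bs m) (us m)) \<and>
      (\<exists>M. \<forall>m. Linf_norm (ball 0 1) (us m) \<le> M) \<and>
      L1_converges (ball 0 1) bs b \<and>
      Linf_weak_star_converges (ball 0 1) us u
      \<longrightarrow>
      distributional_solution (ball 0 1) b u \<and>
      u \<in> H1_loc (ball 0 1) \<and>
      (\<exists>w. continuous_representative (ball 0 1) u w \<and>
        (\<forall>r::real. 0 < r \<and> r < 1 \<longrightarrow>
          (SUP x\<in>ball 0 r. \<bar>w x - w 0\<bar>) \<le>
            C * sqrt (1 + L1_norm (ball 0 1) b) / sqrt (- ln r) * Linf_norm (ball 0 1) u)))"
proof (intro exI[of _ modulus_const] conjI[OF modulus_const_pos] allI impI)
  fix bs :: "nat \<Rightarrow> real^2 \<Rightarrow> real^2" and us :: "nat \<Rightarrow> real^2 \<Rightarrow> real"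
    and b :: "real^2 \<Rightarrow> real^2" and u :: "real^2 \<Rightarrow> real"
  assume H: "(\<forall>m. bs m \<in> L2_space (ball 0 1) \<and> us m \<in> Linf_space (ball 0 1)) \<and>
      (\<forall>m. divergence_free (ball 0 1) (bs m)) \<and>
      (\<forall>m. distributional_solution (ball 0 1) (bs m) (us m)) \<and>
      (\<exists>M. \<forall>m. Linf_norm (ball 0 1) (us m) \<le> M) \<and>
      L1_converges (ball 0 1) bs b \<and>
      Linf_weak_star_converges (ball 0 1) us u"
  then obtain M where M: "\<And>m. Linf_norm (ball 0 1) (us m) \<le> M" by blast
  have A: "bs m \<in> L2_space (ball 0 1)" "us m \<in> Linf_space (ball 0 1)"
    "divergence_free (ball 0 1) (bs m)" "distributional_solution (ball 0 1) (bs m) (us m)"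
    "L1_converges (ball 0 1) bs b" "Linf_weak_star_converges (ball 0 1) us u" for m
    using H by blast+
  note L = limit_of_solutions[OF A(1-4) M A(5,6)]
  show "distributional_solution (ball 0 1) b u \<and> u \<in> H1_loc (ball 0 1) \<and>
      (\<exists>w. continuous_representative (ball 0 1) u w \<and>
        (\<forall>r::real. 0 < r \<and> r < 1 \<longrightarrow>
          (SUP x\<in>ball 0 r. \<bar>w x - w 0\<bar>) \<le>
            modulus_const * sqrt (1 + L1_norm (ball 0 1) b) / sqrt (- ln r) * Linf_norm (ball 0 1) u))"
    by (intro conjI L)
qed

end
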